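(* For every quantum spin network $(\Gamma,\gamma)$ there exists a $\mathbb{Z}/4\mathbb{Z}$-valued quadratic form $Q(\gamma)$ (in the labels $\gamma$, the form depending on $\Gamma$) such that, identifying $\mathbb{Z}/4\mathbb{Z}$ with $\{0,1,2,3\}$, $$\langle \Gamma,\gamma\rangle(q)=q^{\frac14 Q(\gamma)}\,\langle\!\langle \Gamma,\gamma\rangle\!\rangle(q),\qquad \langle\!\langle \Gamma,\gamma\rangle\!\rangle(q)\in\mathbb{Z}[q^{\pm1}],$$ where $\langle \Gamma,\gamma\rangle(q)$ is the standard evaluation of $(\Gamma,\gamma)$.
   Context: Quantum spin networks. A knotted ribbon graph is a framed graph $\Gamma$ embedded in $S^3$, with vertices of arbitrary valency, together with a cyclic ordering of the edges around each vertex; only integer framings are allowed, so that thickening $\Gamma$ (vertices to disks, edges to bands) gives an orientable surface. Multiple edges and loops are allowed, $\Gamma$ may be disconnected, and knots and links (graphs without vertices) are included. A local projector at a vertex $v$ whose incident half-edges, in cyclic order, are colored $(c_1,\dots,c_d)$ is a planar way to connect, by disjoint arcs in a disk, the $c_1+\dots+c_d$ points placed on the boundary of the disk ($c_i$ consecutive points for the $i$-th half-edge), with no U-turns (no arc joins two points of the same half-edge). A quantum spin network is a pair $(\Gamma,\gamma)$, where $\Gamma$ is a knotted ribbon graph and $\gamma=(\gamma_E,\gamma_V)$ consists of a coloring $\gamma_E$ of the edges of $\Gamma$ by natural numbers and a choice $\gamma_V$ of a local projector at each vertex. It is admissible if at every vertex the projector $\gamma_V(v)$ matches the labels given by $\gamma_E$.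 (At a trivalent vertex the projector is determined by the three colors $a,b,c$, and it exists iff $a+b+c$ is even and the triangle inequalities hold.) Evaluation. Let $A^4=q$, $[n]=\frac{A^{2n}-A^{-2n}}{A^2-A^{-2}}$, $[n]!=\prod_{k=1}^n[k]$. The Kauffman bracket of framed links is given by: a crossing equals $A$ times its $A$-smoothing plus $A^{-1}$ times its other smoothing (standard convention), and a disjoint unknotted circle contributes the factor $-[2]$. The Penrose evaluation $\langle\Gamma,\gamma\rangle^P$ is $0$ if $(\Gamma,\gamma)$ is not admissible. Otherwise thicken vertices to disks and edges to untwisted bands following the ribbon structure, replace each vertex $v$ by the arcs of $\gamma_V(v)$, replace each edge colored $b$ by $A^{b(b-1)}\sum_{\sigma\in S_b}A^{-3\ell(\sigma)}\beta_\sigma$ (where $\ell(\sigma)$ is the length of $\sigma$ and $\beta_\sigma$ is the negative permutation braid of $\sigma$, strands oriented downwards; this is $[b]!$ times the Jones-Wenzl idempotent), and evaluate the resulting linear combination of framed links by the Kauffman bracket. The standard evaluation is $\langle\Gamma,\gamma\rangle=\frac{1}{[\mathcal I]!}\langle\Gamma,\gamma\rangle^P$, with $[\mathcal I]!=\prod_v[\gamma_V(v)]!$, where for a projector $p$, $[p]!$ is the product, over pairs of edges (half-edges) at the vertex, of $[m]!$, $m$ being the number of arcs of $p$ connecting the pair. A knot component colored $a$ is interpreted by first subdividing it with a vertex (whose third edge is colored $0$), so that the $0$-framed unknot colored $a$ has value $(-1)^a[a+1]$. The standard evaluation is a function of $q^{1/4}=A$. *)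

theory Defs
  imports
    "HOL-Library.FuncSet"
    "HOL-Library.Numeral_Type"
    "HOL-Combinatorics.Permutations"
    "HOL-Computational_Algebra.Polynomial"
    "HOL-Computational_Algebra.Fraction_Field"
begin

section \<open>Rational functions in \<open>A = q^(1/4)\<close>\<close>

type_synonym ratfun = "int poly fract"

definition A :: ratfun where
  "A = Fract [:0, 1:] 1"

definition q :: ratfun where
  "q = A ^ 4"

definition qint :: "nat \<Rightarrow> ratfun" where
  "qint n = (A powi (2 * int n) - A powi (- 2 * int n)) / (A powi 2 - A powi (- 2))"

definition qfact :: "nat \<Rightarrow> ratfun" where
  "qfact n = (\<Prod>k = 1..n. qint k)"

text \<open>The subring \<open>\<int>[x, 1/x]\<close>.\<close>

definition laurent_polys :: "ratfun \<Rightarrow> ratfun set" where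
  "laurent_polys x = {\<Sum>k\<in>K. of_int (c k) * x powi k | (K :: int set) (c :: int \<Rightarrow> int). finite K}"


section \<open>The Kauffman bracket\<close>

text \<open>
  A framed link is read off a planar diagram with blackboard framing that is sliced by
  horizontal lines and read from bottom to top. A slice changes the row of strands, whose
  positions are numbered from the left starting with 0:
  \<^item> \<open>Arcs i ls\<close> inserts \<open>length ls\<close> strands from position \<open>i\<close> on, the lower ends of two of them
    being connected by an arc iff they have the same label in \<open>ls\<close>. It is used with every label
    occurring exactly twice, all labels smaller than \<open>length ls\<close>, and the arcs not crossing;
  \<^item> \<open>Join i\<close> connects the strands \<open>i\<close> and \<open>i + 1\<close> by a local maximum;
  \<^item> \<open>CrossPos i\<close> and \<open>CrossNeg i\<close> cross the strands \<open>i\<close> and \<open>i + 1\<close>; the over-strand goes from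
    bottom left to top right in \<open>CrossPos\<close>, and from bottom right to top left in \<open>CrossNeg\<close>. So
    the crossing is positive, resp. negative, if both strands are oriented downwards
    (or both upwards).
\<close>

datatype slice = Arcs nat "nat list" | Join nat | CrossPos nat | CrossNeg nat

fun slice_weight :: "slice \<Rightarrow> nat" where
  "slice_weight (CrossPos i) = 3"
| "slice_weight (CrossNeg i) = 3"
| "slice_weight (Arcs i ls) = 1"
| "slice_weight (Join i) = 1"

text \<open>
  In \<open>bracket n xs w\<close>, the list \<open>xs\<close> names for each strand of the current row the connected
  piece (of the part of the diagram read so far) it belongs to, \<open>n\<close> is larger than all names in
  use, and \<open>w\<close> is the rest of the diagram. A crossing is replaced by its two smoothings: the
  vertical one, which is the \<open>A\<close>-smoothing of \<open>CrossPos\<close>, and the one consisting of a maximum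
  below a minimum, which is the \<open>A\<close>-smoothing of \<open>CrossNeg\<close>. A maximum joining a piece to itself
  closes a circle.
\<close>

function (sequential) bracket :: "nat \<Rightarrow> nat list \<Rightarrow> slice list \<Rightarrow> ratfun" where
  "bracket n xs [] = 1"
| "bracket n xs (Arcs i ls # w) =
     bracket (n + length ls) (take i xs @ map (\<lambda>l. n + l) ls @ drop i xs) w"
| "bracket n xs (Join i # w) =
     (let x = xs ! i; y = xs ! (i + 1); ys = take i xs @ drop (i + 2) xs in
      if x = y then - qint 2 * bracket n ys w
      else bracket n (map (\<lambda>z. if z = y then x else z) ys) w)"
| "bracket n xs (CrossPos i # w) =
     A * bracket n xs w + inverse A * bracket n xs (Join i # Arcs i [0, 0] # w)"
| "bracket n xs (CrossNeg i # w) =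
     A * bracket n xs (Join i # Arcs i [0, 0] # w) + inverse A * bracket n xs w"
  by pat_completeness auto
termination
  by (relation "measure (\<lambda>(n, xs, w). sum_list (map slice_weight w))") auto

definition kauffman_bracket :: "slice list \<Rightarrow> ratfun" where
  "kauffman_bracket w = bracket 0 [] w"


section \<open>Knotted ribbon graphs\<close>

text \<open>
  A knotted ribbon graph is presented by a planar diagram with blackboard framing, sliced as
  above: \<open>Cup i\<close> inserts a local minimum whose two strands get the positions \<open>i\<close>, \<open>i + 1\<close>,
  \<open>Cap i\<close> is a local maximum joining the strands \<open>i\<close> and \<open>i + 1\<close>, \<open>Pos i\<close> and \<open>Neg i\<close> are the
  crossings of \<open>CrossPos i\<close> and \<open>CrossNeg i\<close>, and \<open>Vertex i d\<close> is a vertex of valency \<open>d\<close>, turned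
  so that all its half-edges leave upwards, at the positions \<open>i, \<dots>, i + d - 1\<close>; their cyclic
  order is the one from left to right. Integer framings other than the blackboard framing are
  obtained by adding curls.
\<close>

datatype piece = Cup nat | Cap nat | Pos nat | Neg nat | Vertex nat nat

type_synonym diagram = "piece list"

text \<open>
  Strands are cut into segments, numbered in the order of creation: each \<open>Cup\<close> creates one
  segment (both of its strands belong to it), and \<open>Vertex i d\<close> creates \<open>d\<close> segments, its
  half-edges. A state consists of the number of segments created so far and the current row of
  segments.
\<close>

fun step :: "piece \<Rightarrow> nat \<times> nat list \<Rightarrow> nat \<times> nat list" where
  "step (Cup i) (n, xs) = (n + 1, take i xs @ [n, n] @ drop i xs)"
| "step (Cap i) (n, xs) = (n, take i xs @ drop (i + 2) xs)"
| "step (Pos i) (n, xs) = (n, take i xs @ [xs ! (i + 1), xs ! i] @ drop (i + 2) xs)"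
| "step (Neg i) (n, xs) = (n, take i xs @ [xs ! (i + 1), xs ! i] @ drop (i + 2) xs)"
| "step (Vertex i d) (n, xs) = (n + d, take i xs @ [n..<n + d] @ drop i xs)"

fun fits :: "piece \<Rightarrow> nat list \<Rightarrow> bool" where
  "fits (Cup i) xs \<longleftrightarrow> i \<le> length xs"
| "fits (Cap i) xs \<longleftrightarrow> i + 2 \<le> length xs"
| "fits (Pos i) xs \<longleftrightarrow> i + 2 \<le> length xs"
| "fits (Neg i) xs \<longleftrightarrow> i + 2 \<le> length xs"
| "fits (Vertex i d) xs \<longleftrightarrow> i \<le> length xs"

definition state :: "diagram \<Rightarrow> nat \<Rightarrow> nat \<times> nat list" where
  "state D p = fold step (take p D) (0, [])"

definition row :: "diagram \<Rightarrow> nat \<Rightarrow> nat list" where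
  "row D p = snd (state D p)"

definition knotted_ribbon_graph :: "diagram \<Rightarrow> bool" where
  "knotted_ribbon_graph D \<longleftrightarrow>
     (\<forall>p < length D. fits (D ! p) (row D p)) \<and> row D (length D) = []"

definition segments :: "diagram \<Rightarrow> nat set" where
  "segments D = {..<fst (state D (length D))}"

definition joins :: "diagram \<Rightarrow> (nat \<times> nat) set" where
  "joins D = {(row D p ! i, row D p ! (i + 1)) | p i. p < length D \<and> D ! p = Cap i}"

text \<open>
  An edge, or a knot component, is a class of segments that are connected through local maxima.
\<close>

definition edge :: "diagram \<Rightarrow> nat \<Rightarrow> nat set" where
  "edge D s = {t. (s, t) \<in> (joins D \<union> (joins D)\<inverse>)\<^sup>*}"

definition edges :: "diagram \<Rightarrow> nat set set" where
  "edges D = edge D ` segments D"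

text \<open>A vertex is identified with its place in the diagram.\<close>

definition vertices :: "diagram \<Rightarrow> nat set" where
  "vertices D = {p. p < length D \<and> (\<exists>i d. D ! p = Vertex i d)}"

definition half_edges :: "diagram \<Rightarrow> nat \<Rightarrow> nat list" where
  "half_edges D v =
     (case D ! v of Vertex i d \<Rightarrow> [fst (state D v)..<fst (state D v) + d] | _ \<Rightarrow> [])"

definition valency :: "diagram \<Rightarrow> nat \<Rightarrow> nat" where
  "valency D v = length (half_edges D v)"

definition knot_components :: "diagram \<Rightarrow> nat set set" where
  "knot_components D = {e \<in> edges D. \<forall>v \<in> vertices D. e \<inter> set (half_edges D v) = {}}"


section \<open>Local projectors and quantum spin networks\<close>

text \<open>
  \<open>legs\<close> are the colors \<open>c\<^sub>0, \<dots>, c\<^sub>d\<^sub>-\<^sub>1\<close> of the half-edges; \<open>partner ! j\<close> is the point connected to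
  the \<open>j\<close>-th of the \<open>c\<^sub>0 + \<dots> + c\<^sub>d\<^sub>-\<^sub>1\<close> points.
\<close>

record projector =
  legs :: "nat list"
  partner :: "nat list"

definition leg_of :: "nat list \<Rightarrow> nat \<Rightarrow> nat" where
  "leg_of c j = (LEAST i. j < sum_list (take (i + 1) c))"

definition local_projector :: "projector \<Rightarrow> bool" where
  "local_projector \<pi> \<longleftrightarrow>
     (let c = legs \<pi>; p = partner \<pi>; n = sum_list c in
      length p = n \<and>
      (\<forall>j < n. p ! j < n \<and> p ! j \<noteq> j \<and> p ! (p ! j) = j) \<and>
      (\<forall>j < n. \<forall>k < n. \<not> (j < k \<and> k < p ! j \<and> p ! j < p ! k)) \<and>
      (\<forall>j < n. leg_of c (p ! j) \<noteq> leg_of c j))"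

definition arc_number :: "projector \<Rightarrow> nat \<Rightarrow> nat \<Rightarrow> nat" where
  "arc_number \<pi> i k =
     card {j. j < sum_list (legs \<pi>) \<and> leg_of (legs \<pi>) j = i \<and>
              leg_of (legs \<pi>) (partner \<pi> ! j) = k}"

definition projector_fact :: "projector \<Rightarrow> ratfun" where
  "projector_fact \<pi> =
     (\<Prod>(i, k) \<in> {(i, k). i < k \<and> k < length (legs \<pi>)}. qfact (arc_number \<pi> i k))"

record labels =
  ecol :: "nat set \<Rightarrow> nat"
  vproj :: "nat \<Rightarrow> projector"

definition spin_network :: "diagram \<Rightarrow> labels \<Rightarrow> bool" where
  "spin_network D \<gamma> \<longleftrightarrow> knotted_ribbon_graph D \<and>
     (\<forall>v \<in> vertices D. local_projector (vproj \<gamma> v) \<and> length (legs (vproj \<gamma> v)) = valency D v)"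

definition admissible :: "diagram \<Rightarrow> labels \<Rightarrow> bool" where
  "admissible D \<gamma> \<longleftrightarrow>
     (\<forall>v \<in> vertices D. legs (vproj \<gamma> v) = map (\<lambda>h. ecol \<gamma> (edge D h)) (half_edges D v))"


section \<open>Evaluation\<close>

definition inversions :: "nat \<Rightarrow> (nat \<Rightarrow> nat) \<Rightarrow> nat" where
  "inversions b \<sigma> = card {(j, k). j < k \<and> k < b \<and> \<sigma> j > \<sigma> k}"

text \<open>
  Positions of the crossings in a reduced word of \<open>\<sigma>\<close>, by insertion sort: when the strands
  starting at \<open>0, \<dots>, k - 1\<close> have been sorted by their values under \<open>\<sigma>\<close>, the strand starting
  at \<open>k\<close> moves to the left across those with a larger value.
\<close>

definition reduced_word :: "nat \<Rightarrow> (nat \<Rightarrow> nat) \<Rightarrow> nat list" where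
  "reduced_word b \<sigma> = concat (map (\<lambda>k. rev [k - card {j. j < k \<and> \<sigma> j > \<sigma> k}..<k]) [0..<b])"

text \<open>The negative permutation braid on \<open>b\<close> strands, starting at position \<open>i\<close>.\<close>

definition perm_braid :: "nat \<Rightarrow> nat \<Rightarrow> (nat \<Rightarrow> nat) \<Rightarrow> slice list" where
  "perm_braid i b \<sigma> = map (\<lambda>j. CrossNeg (i + j)) (reduced_word b \<sigma>)"

definition width :: "diagram \<Rightarrow> labels \<Rightarrow> nat list \<Rightarrow> nat" where
  "width D \<gamma> ss = sum_list (map (\<lambda>s. ecol \<gamma> (edge D s)) ss)"

text \<open>
  Each edge receives exactly one permutation braid, at the start of the first of its segments
  (the place on the edge is immaterial).
\<close>

definition edge_braid ::
  "diagram \<Rightarrow> labels \<Rightarrow> (nat set \<Rightarrow> nat \<Rightarrow> nat) \<Rightarrow> nat \<Rightarrow> nat \<Rightarrow> slice list" where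
  "edge_braid D \<gamma> \<sigma> s i =
     (let e = edge D s in if s = Min e then perm_braid i (ecol \<gamma> e) (\<sigma> e) else [])"

text \<open>
  The link obtained by replacing every segment of an edge of color \<open>b\<close> by \<open>b\<close> parallel strands,
  the vertex \<open>v\<close> by the arcs of its projector, and inserting the permutation braid of \<open>\<sigma> e\<close>
  into each edge \<open>e\<close>.
\<close>

definition cable_slice ::
  "diagram \<Rightarrow> labels \<Rightarrow> (nat set \<Rightarrow> nat \<Rightarrow> nat) \<Rightarrow> nat \<Rightarrow> slice list" where
  "cable_slice D \<gamma> \<sigma> p =
     (let n = fst (state D p); xs = row D p;
          col = (\<lambda>s. ecol \<gamma> (edge D s));
          off = (\<lambda>i. width D \<gamma> (take i xs))
      in case D ! p of
        Cup i \<Rightarrow>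
          Arcs (off i) ([0..<col n] @ rev [0..<col n]) # edge_braid D \<gamma> \<sigma> n (off i)
      | Cap i \<Rightarrow>
          map (\<lambda>j. Join (off i + j)) (rev [0..<col (xs ! i)])
      | Pos i \<Rightarrow>
          concat (map (\<lambda>j. map (\<lambda>k. CrossPos (off i + j + k)) [0..<col (xs ! (i + 1))])
                      (rev [0..<col (xs ! i)]))
      | Neg i \<Rightarrow>
          concat (map (\<lambda>j. map (\<lambda>k. CrossNeg (off i + j + k)) [0..<col (xs ! (i + 1))])
                      (rev [0..<col (xs ! i)]))
      | Vertex i d \<Rightarrow>
          (let pt = partner (vproj \<gamma> p) in
           Arcs (off i) (map (\<lambda>j. min j (pt ! j)) [0..<length pt])
           # concat (map (\<lambda>h. edge_braid D \<gamma> \<sigma> h (off i + width D \<gamma> [n..<h])) [n..<n + d])))"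

definition cable ::
  "diagram \<Rightarrow> labels \<Rightarrow> (nat set \<Rightarrow> nat \<Rightarrow> nat) \<Rightarrow> slice list" where
  "cable D \<gamma> \<sigma> = concat (map (cable_slice D \<gamma> \<sigma>) [0..<length D])"

definition penrose_eval :: "diagram \<Rightarrow> labels \<Rightarrow> ratfun" where
  "penrose_eval D \<gamma> =
     (if admissible D \<gamma> then
        (\<Sum>\<sigma> \<in> (\<Pi>\<^sub>E e \<in> edges D. {\<tau>. \<tau> permutes {..<ecol \<gamma> e}}).
           (\<Prod>e \<in> edges D.
              A ^ (ecol \<gamma> e * (ecol \<gamma> e - 1)) * A powi (- 3 * int (inversions (ecol \<gamma> e) (\<sigma> e))))
           * kauffman_bracket (cable D \<gamma> \<sigma>))
      else 0)"

text \<open>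
  A knot component of color \<open>a\<close> contributes \<open>[a]!\<close> to the denominator: the projector at the
  subdividing vertex, with legs \<open>a, a, 0\<close>, consists of \<open>a\<close> arcs connecting the first two legs.
\<close>

definition total_fact :: "diagram \<Rightarrow> labels \<Rightarrow> ratfun" where
  "total_fact D \<gamma> =
     (\<Prod>v \<in> vertices D. projector_fact (vproj \<gamma> v)) * (\<Prod>e \<in> knot_components D. qfact (ecol \<gamma> e))"

definition standard_eval :: "diagram \<Rightarrow> labels \<Rightarrow> ratfun" where
  "standard_eval D \<gamma> = penrose_eval D \<gamma> / total_fact D \<gamma>"


section \<open>Quadratic forms in the labels\<close>

definition quadratic_form :: "'i set \<Rightarrow> (('i \<Rightarrow> int) \<Rightarrow> 'r :: comm_ring_1) \<Rightarrow> bool" where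
  "quadratic_form I Q \<longleftrightarrow>
     (\<exists>c. \<forall>x. Q x = (\<Sum>i \<in> I. \<Sum>j \<in> I. c i j * of_int (x i) * of_int (x j)))"

text \<open>
  The numerical labels in \<open>\<gamma>\<close> are the colors of the edges and the numbers of arcs of the local
  projector at \<open>v\<close> between its \<open>i\<close>-th and \<open>k\<close>-th half-edge. The colors alone do not
  suffice: a 4-valent vertex with legs \<open>1, 1, 1, 1\<close> has two non-crossing local projectors, and
  exchanging them changes the powers of \<open>A\<close> that occur in the evaluation by 2 modulo 4.
\<close>

datatype label = Edge_color "nat set" | Arc_number nat nat nat

definition label_set :: "diagram \<Rightarrow> label set" where
  "label_set D =
     Edge_color ` edges D \<union> {Arc_number v i k | v i k. v \<in> vertices D \<and> i < k \<and> k < valency D v}"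

fun label_value :: "labels \<Rightarrow> label \<Rightarrow> int" where
  "label_value \<gamma> (Edge_color e) = int (ecol \<gamma> e)"
| "label_value \<gamma> (Arc_number v i k) = int (arc_number (vproj \<gamma> v) i k)"

text \<open>
  The type \<open>4\<close> of the library is \<open>\<int>/4\<int>\<close>; its representation function takes values in \<open>{0..<4}\<close>.
\<close>

definition residue :: "4 \<Rightarrow> int" where
  "residue z = Rep_bit0 z"

end

theory Submission
 imports Defs "HOL-Library.Sublist"
begin

text \<open>The Kauffman bracket is a state sum: put a sign on every strand of a row, and let every slice act
on functions of words of signs (\<open>kauffman_bracket_state_sum\<close>). Replacing each edge
by a sum over permutation braids then inserts, up to a factor \<open>[b]!\<close>, the projection
\<open>Pop\<close> onto the symmetric functions (\<open>perm_braid_sum\<close>). From this the theorem follows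
in two independent steps.

\<^bold>\<open>Integrality\<close> (\<open>standard_eval_integral\<close>). The projections are idempotent and slide through
crossings, maxima and minima, so the single projection on an edge may be repeated on each of its
segments (\<open>V_reps\<close>). Then every row carries a function symmetric in each cable. Take
as basis of these the functions \<open>[k]! A^(2 inv)\<close>, where \<open>k\<close> is the number of positive signs and \<open>inv\<close>
the number of inversions of the word. Coefficients in \<open>\<int>[A, 1/A]\<close> stay there under a
crossing, under a maximum divided by \<open>[b]!\<close>, under a minimum multiplied by \<open>[b]!\<close>, and under a
vertex multiplied by the product of the factorials of its legs and divided by the factorial
of its projector (\<open>integral_vec_cross\<close>, \<open>integral_vec_cap\<close>, \<open>integral_vec_cup\<close>,
\<open>integral_vec_vertex\<close>). An edge with two ends at vertices meets one more of the multiplied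
factorials than of the divided ones, a knot component equally many; hence these factors turn the
Penrose evaluation exactly into the standard one (\<open>factor_total\<close>).

\<^bold>\<open>Degrees\<close> (\<open>standard_eval_hom\<close>). Give the sign at position \<open>j\<close> the degree \<open>2 j\<close> if it is positive and
0 otherwise. Every slice is homogeneous modulo 4 for the sum of this degree and the exponent of \<open>A\<close>
(\<open>homog_act\<close>), and so is every permutation braid with its coefficient, the degree \<open>b (b - 1)\<close> being the
same for all permutations. So the Penrose evaluation lies in \<open>A^e \<int>[q, 1/q]\<close> with an explicit \<open>e\<close>, and
an integral quotient by the homogeneous denominator is homogeneous too (\<open>hom_divide\<close>).
The resulting degree consists of quadratic terms, such as products of two colors at crossings and doubled products of arc
numbers of nested bundles at vertices, and of two kinds of linear terms: the number of arcs at
each vertex, and \<open>-b\<close> for each edge that is not a knot component. They cancel because such an edge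
has exactly two half-edges (\<open>sum_vlin\<close>).\<close>

section \<open>Laurent polynomials and their grading modulo 4\<close>

lemma A_nonzero [simp]: "A \<noteq> 0"
 by (simp add: A_def eq_fract Zero_fract_def)

lemma A_power_eq_Fract: "A ^ n = Fract (monom 1 n) 1"
 by (induction n) (auto simp: A_def One_fract_def monom_Suc monom_0 one_pCons)

lemma A_power_neq_1: "n > 0 ==> A ^ n \<noteq> 1"
 by (simp add: A_power_eq_Fract One_fract_def eq_fract monom_eq_1_iff)

lemma q_nonzero [simp]: "q \<noteq> 0"
 by (simp add: q_def)

lemma q_powi: "q powi k = A powi (4 * k)"
 by (simp add: q_def power_int_mult)

lemma laurent_polysI: "finite K ==> (\<Sum>k\<in>K. of_int (c k) * x powi k) \<in> laurent_polys x"
 by (auto simp: laurent_polys_def)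

lemma laurent_monom: "of_int a * x powi k \<in> laurent_polys x"
 using laurent_polysI[of "{k}" "\<lambda>_. a" x] by simp

lemma laurent_powi [simp]: "x powi k \<in> laurent_polys x"
 using laurent_monom[of 1 x k] by simp

lemma laurent_of_int [simp]: "of_int a \<in> laurent_polys x"
 using laurent_monom[of a x 0] by simp

lemma laurent_0 [simp]: "0 \<in> laurent_polys x"
 using laurent_of_int[of 0 x] by simp

lemma laurent_1 [simp]: "1 \<in> laurent_polys x"
 using laurent_of_int[of 1 x] by simp

lemma laurent_add [simp]:
 assumes "P \<in> laurent_polys x" "R \<in> laurent_polys x"
 shows "P + R \<in> laurent_polys x"
proof -
 obtain K c where K: "finite K" "P = (\<Sum>k\<in>K. of_int (c k) * x powi k)"
  using assms(1) by (auto simp: laurent_polys_def)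
 obtain L d where L: "finite L" "R = (\<Sum>k\<in>L. of_int (d k) * x powi k)"
  using assms(2) by (auto simp: laurent_polys_def)
 have "P = (\<Sum>k\<in>K \<union> L. of_int (if k \<in> K then c k else 0) * x powi k)"
  unfolding K by (rule sum.mono_neutral_cong_left) (use K L in auto)
 moreover have "R = (\<Sum>k\<in>K \<union> L. of_int (if k \<in> L then d k else 0) * x powi k)"
  unfolding L by (rule sum.mono_neutral_cong_left) (use K L in auto)
 ultimately have "P + R = (\<Sum>k\<in>K \<union> L. of_int ((if k \<in> K then c k else 0) +
   (if k \<in> L then d k else 0)) * x powi k)"
  by (simp only: sum.distrib of_int_add distrib_right)
 also have "\<dots> \<in> laurent_polys x"
  using K(1) L(1) by (intro laurent_polysI) simp
 finally show ?thesis .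
qed

lemma laurent_sum:
 "(\<And>i. i \<in> I ==> f i \<in> laurent_polys x) ==> sum f I \<in> laurent_polys x"
 by (induction I rule: infinite_finite_induct) auto

lemma laurent_mult [simp]:
 assumes "x \<noteq> 0" "P \<in> laurent_polys x" "R \<in> laurent_polys x"
 shows "P * R \<in> laurent_polys x"
proof -
 obtain K c where K: "finite K" "P = (\<Sum>k\<in>K. of_int (c k) * x powi k)"
  using assms(2) by (auto simp: laurent_polys_def)
 obtain L d where L: "finite L" "R = (\<Sum>k\<in>L. of_int (d k) * x powi k)"
  using assms(3) by (auto simp: laurent_polys_def)
 have "P * R = (\<Sum>k\<in>K. \<Sum>l\<in>L. of_int (c k * d l) * x powi (k + l))"
  unfolding K L by (simp add: sum_product power_int_add assms mult_ac)
 also have "\<dots> \<in> laurent_polys x"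
  by (intro laurent_sum laurent_monom)
 finally show ?thesis .
qed

lemma laurent_minus [simp]:
 "P \<in> laurent_polys x ==> - P \<in> laurent_polys x"
proof -
 assume "P \<in> laurent_polys x"
 then obtain K c where K: "finite K" "P = (\<Sum>k\<in>K. of_int (c k) * x powi k)"
  by (auto simp: laurent_polys_def)
 then have "- P = (\<Sum>k\<in>K. of_int (- c k) * x powi k)"
  by (simp add: sum_negf)
 then show ?thesis using laurent_polysI[OF K(1), of "\<lambda>k. - c k" x] by simp
qed

lemma laurent_diff [simp]:
 "P \<in> laurent_polys x ==> R \<in> laurent_polys x ==> P - R \<in> laurent_polys x"
 using laurent_add[of P x "- R"] by simp

lemma laurent_prod:
 "x \<noteq> 0 ==> (\<And>i. i \<in> I ==> f i \<in> laurent_polys x) ==> prod f I \<in> laurent_polys x"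
 by (induction I rule: infinite_finite_induct) auto

lemma laurent_power [simp]:
 "x \<noteq> 0 ==> P \<in> laurent_polys x ==> P ^ n \<in> laurent_polys x"
 by (induction n) auto

abbreviation LA :: "ratfun set" where "LA \<equiv> laurent_polys A"

lemma laurent_A_inverse [simp]: "inverse A \<in> LA"
 using laurent_powi[of A "-1"] by (simp del: laurent_powi)

lemma laurent_A [simp]: "A \<in> LA"
 using laurent_powi[of A "1"] by (simp del: laurent_powi)

text \<open>The homogeneous part of degree \<open>r\<close> modulo 4 of \<open>\<int>[A, 1/A]\<close>, as \<open>q = A^4\<close>.\<close>

definition hom :: "int => ratfun set" where
 "hom r = {A powi r * P | P. P \<in> laurent_polys q}"

lemma hom_0 [simp]: "0 \<in> hom r"
 by (auto simp: hom_def intro!: exI[of _ 0])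

lemma hom_powi: "A powi r \<in> hom r"
 by (auto simp: hom_def intro!: exI[of _ 1])

lemma hom_of_int: "of_int a \<in> hom 0"
 by (auto simp: hom_def intro!: exI[of _ "of_int a"])

lemma hom_1: "1 \<in> hom 0"
 using hom_of_int[of 1] by simp

lemma hom_add: "X \<in> hom r ==> Y \<in> hom r ==> X + Y \<in> hom r"
 unfolding hom_def
proof clarify
 fix P R assume "P \<in> laurent_polys q" "R \<in> laurent_polys q"
 then show "\<exists>S. A powi r * P + A powi r * R = A powi r * S \<and> S \<in> laurent_polys q"
  by (intro exI[of _ "P + R"]) (simp add: distrib_left)
qed

lemma hom_minus: "X \<in> hom r ==> - X \<in> hom r"
 unfolding hom_def
proof clarify
 fix P assume "P \<in> laurent_polys q"
 then show "\<exists>R. - (A powi r * P) = A powi r * R \<and> R \<in> laurent_polys q"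
  by (intro exI[of _ "- P"]) simp
qed

lemma hom_sum: "(\<And>i. i \<in> I ==> f i \<in> hom r) ==> sum f I \<in> hom r"
 by (induction I rule: infinite_finite_induct) (auto intro: hom_add)

lemma hom_mult: "X \<in> hom r ==> Y \<in> hom s ==> X * Y \<in> hom (r + s)"
 unfolding hom_def
proof clarify
 fix P R assume "P \<in> laurent_polys q" "R \<in> laurent_polys q"
 then show "\<exists>S. A powi r * P * (A powi s * R) = A powi (r + s) * S \<and> S \<in> laurent_polys q"
  by (intro exI[of _ "P * R"]) (auto simp: power_int_add)
qed

lemma hom_prod: "(\<And>i. i \<in> I ==> f i \<in> hom (r i)) ==> prod f I \<in> hom (sum r I)"
 by (induction I rule: infinite_finite_induct) (auto intro: hom_mult hom_1)

lemma hom_shift: "hom (r + 4 * k) \<subseteq> hom r"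
proof
 fix X assume "X \<in> hom (r + 4 * k)"
 then obtain P where P: "P \<in> laurent_polys q" "X = A powi (r + 4 * k) * P"
  by (auto simp: hom_def)
 then have "X = A powi r * (q powi k * P)"
  by (simp add: q_powi power_int_add)
 then show "X \<in> hom r" using P(1) by (auto simp: hom_def)
qed

lemma hom_cong:
 assumes "X \<in> hom r" "r mod 4 = s mod 4" shows "X \<in> hom s"
proof -
 obtain k where "s = r + 4 * k"
  using assms(2) by (rule mod_eqE)
 then have "r = s + 4 * (- k)" by simp
 then show ?thesis using hom_shift[of s "- k"] assms(1) by auto
qed

lemma hom_in_LA: "X \<in> hom r ==> X \<in> LA"
proof -
 assume "X \<in> hom r"
 then obtain P where P: "P \<in> laurent_polys q" "X = A powi r * P"
  by (auto simp: hom_def)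
 then obtain K c where K: "finite K" "P = (\<Sum>k\<in>K. of_int (c k) * q powi k)"
  by (auto simp: laurent_polys_def)
 have "P \<in> LA"
  unfolding K(2) q_powi by (intro laurent_sum laurent_monom)
 then show ?thesis unfolding P(2) by (rule laurent_mult[OF A_nonzero laurent_powi])
qed

text \<open>Every Laurent polynomial in \<open>A\<close> is \<open>A^(-N) p(A)\<close> with a polynomial \<open>p\<close>; this makes
coefficients available for elements of the fraction field.\<close>

definition emb :: "nat => int poly => ratfun" where
 "emb N p = A powi (- int N) * Fract p 1"

lemma emb_add_shift: "emb (N + M) (monom 1 M * p) = emb N p"
proof -
 have "Fract (monom 1 M * p) 1 = A ^ M * Fract p 1"
  by (simp add: A_power_eq_Fract)
 moreover have "A powi (- int (N + M)) * A ^ M = A powi (- int N)"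
 proof -
  have "A powi (- int N) = A powi (- int (N + M) + int M)" by simp
  also have "\<dots> = A powi (- int (N + M)) * A powi int M" by (rule power_int_add) simp
  finally show ?thesis by simp
 qed
 ultimately show ?thesis by (simp add: emb_def mult.assoc[symmetric])
qed

lemma emb_eq_iff: "emb N p = emb N r \<longleftrightarrow> p = r"
 by (auto simp: emb_def eq_fract)

lemma emb_plus: "emb N p + emb N r = emb N (p + r)"
 by (simp add: emb_def ring_distribs[symmetric])

lemma emb_mult: "emb N p * emb M r = emb (N + M) (p * r)"
proof -
 have "A powi (- int (N + M)) = A powi (- int N) * A powi (- int M)"
  by (simp flip: power_int_add)
 moreover have "Fract (p * r) 1 = Fract p 1 * Fract r 1" by simp
 ultimately show ?thesis unfolding emb_def by (simp only: mult_ac)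
qed

lemma Fract_of_int: "Fract [:a:] 1 = of_int a"
proof (induction a rule: int_induct[of _ 0])
 case base then show ?case by (simp add: Zero_fract_def)
next
 case (step1 i)
 have "Fract [:i + 1:] 1 = Fract [:i:] 1 + Fract 1 1" by (simp add: one_pCons)
 then show ?case using step1 by (simp add: One_fract_def)
next
 case (step2 i)
 have "Fract [:i - 1:] 1 = Fract [:i:] 1 - Fract 1 1" by (simp add: one_pCons)
 then show ?case using step2 by (simp add: One_fract_def)
qed

lemma Fract_monom: "Fract (monom c i) 1 = of_int c * A powi int i"
proof -
 have "Fract (monom c i) 1 = Fract ([:c:] * monom 1 i) 1" by (simp add: smult_monom)
 also have "\<dots> = Fract [:c:] 1 * Fract (monom 1 i) 1" by simp
 also have "\<dots> = of_int c * A powi int i" by (simp only: Fract_of_int A_power_eq_Fract power_int_of_nat)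
 finally show ?thesis .
qed

lemma Fract_sum: "Fract (sum f I) 1 = (\<Sum>i\<in>I. Fract (f i :: int poly) 1)"
proof (induction I rule: infinite_finite_induct)
 case (insert i I)
 have "Fract (f i + sum f I) 1 = Fract (f i) 1 + Fract (sum f I) 1" by simp
 then show ?case by (simp only: sum.insert[OF insert.hyps] insert.IH)
qed (simp_all add: Zero_fract_def[symmetric])

text \<open>The condition on \<open>p\<close> for \<open>emb N p\<close> to lie in \<open>hom r\<close>.\<close>

definition hpoly :: "int => nat => int poly => bool" where
 "hpoly r N p \<longleftrightarrow> (\<forall>j. coeff p j \<noteq> 0 \<longrightarrow> (int j - int N) mod 4 = r mod 4)"

lemma hpoly_shift: "hpoly r N p ==> hpoly r (N + M) (monom 1 M * p)"
 unfolding hpoly_def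
proof (intro allI impI)
 fix j
 assume h: "\<forall>j. coeff p j \<noteq> 0 \<longrightarrow> (int j - int N) mod 4 = r mod 4"
  and "coeff (monom 1 M * p) j \<noteq> 0"
 then have "M \<le> j" "coeff p (j - M) \<noteq> 0" by (auto simp: coeff_monom_mult split: if_splits)
 moreover from this h have "(int (j - M) - int N) mod 4 = r mod 4" by blast
 ultimately show "(int j - int (N + M)) mod 4 = r mod 4" by (simp add: of_nat_diff algebra_simps)
qed

lemma hpoly_add: "hpoly r N p ==> hpoly r N p' ==> hpoly r N (p + p')"
 unfolding hpoly_def by (metis add.right_neutral coeff_add)

lemma emb_sum_ex:
 assumes "finite K"
 shows "\<exists>N p. (\<Sum>k\<in>K. of_int (c k) * A powi (r + m * k)) = emb N p \<and> (4 dvd m \<longrightarrow> hpoly r N p)"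
 using assms
proof (induction K)
 case empty
 show ?case by (rule exI[of _ 0], rule exI[of _ 0]) (simp add: emb_def hpoly_def Zero_fract_def)
next
 case (insert k K)
 obtain N p where Np: "(\<Sum>k\<in>K. of_int (c k) * A powi (r + m * k)) = emb N p" "4 dvd m \<longrightarrow> hpoly r N p"
  using insert.IH by auto
 define e where "e = r + m * k"
 define M where "M = nat (- e)"
 define d where "d = nat (e + int M)"
 have "A powi e = A powi (- int M) * A ^ d"
 proof -
  have "e = - int M + int d" by (simp add: M_def d_def)
  then have "A powi e = A powi (- int M) * A powi int d" by (simp only: power_int_add[OF disjI1[OF A_nonzero]])
  then show ?thesis by simp
 qed
 then have 1: "of_int (c k) * A powi e = emb M (monom (c k) d)"
  unfolding emb_def Fract_monom by (simp add: mult_ac)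
 have 2: "4 dvd m \<longrightarrow> hpoly r M (monom (c k) d)"
  unfolding hpoly_def coeff_monom
 proof (intro impI allI)
  fix j assume "4 dvd m" and "(if d = j then c k else 0) \<noteq> 0"
  then have "int j - int M = r + 4 * (m div 4 * k)"
   by (auto simp: d_def M_def e_def split: if_splits elim!: dvdE)
  then show "(int j - int M) mod 4 = r mod 4" by (simp only: mod_mult_self2)
 qed
 have "(\<Sum>k\<in>insert k K. of_int (c k) * A powi (r + m * k)) = emb (M + N) (monom 1 N * monom (c k) d) + emb (N + M) (monom 1 M * p)"
  using insert.hyps 1 Np(1) unfolding emb_add_shift by (simp add: e_def)
 also have "\<dots> = emb (M + N) (monom 1 N * monom (c k) d + monom 1 M * p)"
  by (simp add: emb_plus add.commute)
 finally show ?case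
  using 2 Np(2) hpoly_shift[of r M "monom (c k) d" N] hpoly_shift[of r N p M]
  by (metis hpoly_add add.commute)
qed

lemma LA_emb: "X \<in> LA ==> \<exists>N p. X = emb N p"
 using emb_sum_ex[of _ _ 0 1] by (auto simp: laurent_polys_def)

lemma hom_emb: "X \<in> hom r ==> \<exists>N p. X = emb N p \<and> hpoly r N p"
proof -
 assume "X \<in> hom r"
 then obtain K c where K: "finite K" "X = A powi r * (\<Sum>k\<in>K. of_int (c k) * q powi k)"
  by (auto simp: hom_def laurent_polys_def)
 then have "X = (\<Sum>k\<in>K. of_int (c k) * A powi (r + 4 * k))"
  by (simp add: q_powi power_int_add sum_distrib_left mult_ac)
 then show ?thesis using emb_sum_ex[OF K(1), of c r 4] by auto
qed

lemma emb_hom: "hpoly r N p ==> emb N p \<in> hom r"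
proof -
 assume h: "hpoly r N p"
 have "Fract p 1 = Fract (\<Sum>i\<le>degree p. monom (coeff p i) i) 1"
  by (simp only: poly_as_sum_of_monoms)
 also have "\<dots> = (\<Sum>i\<le>degree p. Fract (monom (coeff p i) i) 1)"
  by (rule Fract_sum)
 also have "\<dots> = (\<Sum>i\<le>degree p. of_int (coeff p i) * A powi int i)"
  by (intro sum.cong refl Fract_monom)
 finally have "emb N p = (\<Sum>i\<le>degree p. A powi (- int N) * (of_int (coeff p i) * A powi int i))"
  unfolding emb_def by (simp only: sum_distrib_left)
 also have "\<dots> = (\<Sum>i\<le>degree p. of_int (coeff p i) * A powi (int i - int N))"
  by (intro sum.cong refl) (simp add: power_int_diff power_int_minus divide_inverse mult_ac)
 also have "\<dots> \<in> hom r"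
 proof (rule hom_sum)
  fix i
  show "of_int (coeff p i) * A powi (int i - int N) \<in> hom r"
  proof (cases "coeff p i = 0")
   case False
   then have "(int i - int N) mod 4 = r mod 4" using h by (auto simp: hpoly_def)
   moreover have "of_int (coeff p i) * A powi (int i - int N) \<in> hom (int i - int N)"
    using hom_mult[OF hom_of_int hom_powi] by simp
   ultimately show ?thesis by (rule hom_cong[rotated])
  qed simp
 qed
 finally show ?thesis .
qed

text \<open>Multiplication by the homogeneous \<open>D\<close> shifts the classes of exponents modulo 4. So the part of
\<open>X\<close> in the wrong classes is annihilated by \<open>D\<close> and vanishes. Integrality of \<open>X\<close> is essential: a
quotient of homogeneous elements need not be a Laurent polynomial.\<close>

lemma hom_divide:
 assumes X: "X \<in> LA" and D: "D \<in> hom f" "D \<noteq> 0" and XD: "X * D \<in> hom e"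
 shows "X \<in> hom (e - f)"
proof -
 obtain N p where Np: "X = emb N p" using LA_emb[OF X] by auto
 obtain M d where Md: "D = emb M d" "hpoly f M d" using hom_emb[OF D(1)] by auto
 obtain K n where Kn: "X * D = emb K n" "hpoly e K n" using hom_emb[OF XD] by auto
 have "emb (N + M + K) (monom 1 K * (p * d)) = emb (K + (N + M)) (monom 1 (N + M) * n)"
 proof -
  have "emb (N + M) (p * d) = emb K n" using Kn(1) unfolding Np Md(1) emb_mult .
  then show ?thesis unfolding emb_add_shift .
 qed
 then have eq: "monom 1 K * (p * d) = monom 1 (N + M) * n"
  unfolding add.commute[of K "N + M"] emb_eq_iff .
 have hpd: "hpoly e (N + M) (p * d)"
  unfolding hpoly_def
 proof (intro allI impI)
  fix j assume "coeff (p * d) j \<noteq> 0"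
  then have "coeff (monom 1 K * (p * d)) (j + K) \<noteq> 0"
   by (simp add: coeff_monom_mult)
  then have "N + M \<le> j + K" "coeff n (j + K - (N + M)) \<noteq> 0"
   unfolding eq by (auto simp: coeff_monom_mult split: if_splits)
  then have "(int (j + K - (N + M)) - int K) mod 4 = e mod 4"
   using Kn(2) by (auto simp: hpoly_def)
  moreover have "int (j + K - (N + M)) - int K = int j - int (N + M)"
   using \<open>N + M \<le> j + K\<close> by linarith
  ultimately show "(int j - int (N + M)) mod 4 = e mod 4" by (simp only:)
 qed
 define good where "good j \<longleftrightarrow> (int j - int N) mod 4 = (e - f) mod 4" for j
 \<comment> \<open>the part of \<open>p\<close> in the expected classes of exponents\<close>
 define p1 where "p1 = (\<Sum>i\<le>degree p. if good i then monom (coeff p i) i else 0)"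
 define p2 where "p2 = p - p1"
 have c1: "coeff p1 j = (if good j then coeff p j else 0)" for j
 proof -
  have "coeff p1 j = (\<Sum>i\<le>degree p. if i = j then (if good j then coeff p j else 0) else 0)"
   unfolding p1_def coeff_sum by (rule sum.cong) auto
  then show ?thesis by (auto simp: coeff_eq_0)
 qed
 have c2: "coeff p2 j = (if good j then 0 else coeff p j)" for j
  by (simp add: p2_def c1)
 have "p2 * d = 0"
 proof (rule poly_eqI, rule ccontr)
  fix j assume nz: "coeff (p2 * d) j \<noteq> coeff 0 j"
  then have "(\<Sum>i\<le>j. coeff p2 i * coeff d (j - i)) \<noteq> 0" by (simp add: coeff_mult)
  then have "\<exists>i\<in>{..j}. coeff p2 i * coeff d (j - i) \<noteq> 0"
   by (metis (no_types, lifting) sum.neutral)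
  then obtain i where i: "i \<le> j" "coeff p2 i \<noteq> 0" "coeff d (j - i) \<noteq> 0" by auto
  have bad: "(int j - int (N + M)) mod 4 \<noteq> e mod 4"
  proof
   assume e: "(int j - int (N + M)) mod 4 = e mod 4"
   have "(int (j - i) - int M) mod 4 = f mod 4" using Md(2) i(3) by (auto simp: hpoly_def)
   then have "((int j - int (N + M)) - (int (j - i) - int M)) mod 4 = (e - f) mod 4"
    using e by (intro mod_diff_cong)
   moreover have "(int j - int (N + M)) - (int (j - i) - int M) = int i - int N"
    using i(1) by (simp add: of_nat_diff)
   ultimately have "good i" by (simp add: good_def)
   then show False using i(2) c2 by simp
  qed
  have "coeff (p1 * d) j = 0"
  proof -
   have "coeff p1 i * coeff d (j - i) = 0" if "i \<le> j" for i
   proof (rule ccontr)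
    assume "coeff p1 i * coeff d (j - i) \<noteq> 0"
    then have g: "good i" and dd: "coeff d (j - i) \<noteq> 0" by (auto simp: c1 split: if_splits)
    have "(int (j - i) - int M) mod 4 = f mod 4" using Md(2) dd by (auto simp: hpoly_def)
    then have "((int i - int N) + (int (j - i) - int M)) mod 4 = ((e - f) + f) mod 4"
     using g unfolding good_def by (rule mod_add_cong[rotated])
    moreover have "(int i - int N) + (int (j - i) - int M) = int j - int (N + M)"
     using that by (simp add: of_nat_diff)
    ultimately show False using bad by (simp only: diff_add_cancel)
   qed
   then show ?thesis unfolding coeff_mult by (intro sum.neutral) auto
  qed
  moreover have "coeff (p * d) j = 0" using bad hpd by (auto simp: hpoly_def)
  moreover have "coeff (p * d) j = coeff (p1 * d) j + coeff (p2 * d) j"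
  proof -
   have "p = p1 + p2" unfolding p2_def by simp
   then have "p * d = (p1 + p2) * d" by (rule arg_cong)
   also have "\<dots> = p1 * d + p2 * d" by (rule distrib_right)
   finally have "p * d = p1 * d + p2 * d" .
   then show ?thesis by (simp only: coeff_add)
  qed
  ultimately show False using nz by auto
 qed
 moreover have "d \<noteq> 0" using D(2) Md(1) by (auto simp: emb_def fract_collapse)
 ultimately have "p2 = 0" by simp
 then have "p = p1" by (simp add: p2_def)
 have "hpoly (e - f) N p"
  unfolding hpoly_def
 proof (intro allI impI)
  fix j assume "coeff p j \<noteq> 0"
  then have "coeff p1 j \<noteq> 0" using \<open>p = p1\<close> by (rule subst[rotated])
  then have "good j" unfolding c1 by (rule contrapos_np) simp
  then show "(int j - int N) mod 4 = (e - f) mod 4" by (simp only: good_def)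
 qed
 then show ?thesis unfolding Np by (rule emb_hom)
qed

section \<open>Quantum integers and Gaussian binomials\<close>

text \<open>Positive and negative crossings are mirror images under \<open>A \<mapsto> 1/A\<close>; most formulas below
are proved for both at once.\<close>

abbreviation unit_A :: "ratfun => bool" where
 "unit_A z \<equiv> z = A \<or> z = inverse A"

lemma unit_A_nonzero: "unit_A z ==> z \<noteq> 0"
 by auto

lemma inverse_A_powi: "inverse A powi k = A powi (- k)"
 by (simp add: power_int_inverse power_int_minus)

lemma unit_A_powi_LA: "unit_A z ==> z powi k \<in> LA"
 by (auto simp: inverse_A_powi)

lemma A2_diff_nonzero: "A powi 2 - A powi (- 2) \<noteq> 0"
proof
 assume "A powi 2 - A powi (- 2) = 0"
 then have "A powi 2 * A powi 2 = A powi (- 2) * A powi 2" by simp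
 then have "A ^ 4 = 1" by (simp add: power_int_minus)
 then show False using A_power_neq_1[of 4] by simp
qed

lemma unit_A2_diff_nonzero: "unit_A z ==> z powi 2 - z powi (- 2) \<noteq> 0"
proof (elim disjE)
 assume "z = inverse A"
 then have "z powi 2 - z powi (- 2) = - (A powi 2 - A powi (- 2))"
  by (simp only: inverse_A_powi) simp
 then show ?thesis using A2_diff_nonzero by simp
qed (use A2_diff_nonzero in simp)

lemma qint_diff:
 assumes "unit_A z"
 shows "(z powi 2 - z powi (- 2)) * qint n = z powi (2 * int n) - z powi (- 2 * int n)"
proof -
 have 1: "(A powi 2 - A powi (- 2)) * qint n = A powi (2 * int n) - A powi (- 2 * int n)"
  using A2_diff_nonzero by (simp add: qint_def)
 show ?thesis
  using assms
 proof
  assume z: "z = inverse A"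
  have "(z powi 2 - z powi (- 2)) * qint n = - ((A powi 2 - A powi (- 2)) * qint n)"
   unfolding z inverse_A_powi by (simp add: algebra_simps)
  also have "\<dots> = z powi (2 * int n) - z powi (- 2 * int n)"
   unfolding 1 z inverse_A_powi by simp
  finally show ?thesis .
 qed (use 1 in simp)
qed

lemma qint_0 [simp]: "qint 0 = 0"
 by (simp add: qint_def)

lemma qint_1 [simp]: "qint (Suc 0) = 1"
 using A2_diff_nonzero by (simp add: qint_def)

lemma qint_add:
 assumes z: "unit_A z"
 shows "qint (m + n) = z powi (2 * int n) * qint m + z powi (- 2 * int m) * qint n"
proof -
 have z0: "z \<noteq> 0" using z by (rule unit_A_nonzero)
 let ?d = "z powi 2 - z powi (- 2)"
 have "?d * (z powi (2 * int n) * qint m + z powi (- 2 * int m) * qint n)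
   = z powi (2 * int n) * (?d * qint m) + z powi (- 2 * int m) * (?d * qint n)"
  by (simp add: algebra_simps)
 also have "\<dots> = z powi (2 * int n) * (z powi (2 * int m) - z powi (- 2 * int m))
   + z powi (- 2 * int m) * (z powi (2 * int n) - z powi (- 2 * int n))"
  by (simp only: qint_diff[OF z])
 also have "\<dots> = z powi (2 * int n) * z powi (2 * int m) - z powi (- 2 * int m) * z powi (- 2 * int n)"
  by (simp add: algebra_simps)
 also have "\<dots> = z powi (2 * int (m + n)) - z powi (- 2 * int (m + n))"
  using z0 by (simp add: power_int_add[symmetric] algebra_simps)
 also have "\<dots> = ?d * qint (m + n)"
  by (simp only: qint_diff[OF z])
 finally show ?thesis using unit_A2_diff_nonzero[OF z] by simp
qed

lemma qint_Suc: "unit_A z ==> qint (Suc n) = z powi (2 * int n) + z powi (- 2) * qint n"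
 using qint_add[of z 1 n] by simp

lemma qint_Suc': "unit_A z ==> qint (Suc n) = z powi 2 * qint n + z powi (- 2 * int n)"
 using qint_add[of z n 1] by simp

text \<open>The exponents of \<open>[n]\<close> are \<open>2 n - 2, 2 n - 6, \<dots>\<close>\<close>

lemma qint_hom: "qint n \<in> hom (2 * int n - 2)"
proof (induction n)
 case (Suc n)
 have "A powi (- 2) * qint n \<in> hom (2 * int n)"
  by (rule hom_cong[OF hom_mult[OF hom_powi Suc]]) presburger
 then show ?case
  using hom_add[OF hom_powi[of "2 * int n"]] by (simp add: qint_Suc[of A])
qed simp

lemma qint_nonzero: "n > 0 ==> qint n \<noteq> 0"
proof
 assume n: "n > 0" and "qint n = 0"
 then have "A powi (2 * int n) = A powi (- 2 * int n)"
  using qint_diff[of A n] by simp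
 then have "A powi (2 * int n) * A powi (2 * int n) = A powi (- 2 * int n) * A powi (2 * int n)"
  by (rule arg_cong)
 then have "A powi (2 * int n) * A powi (2 * int n) = 1"
  by (simp add: power_int_minus)
 then have "A powi int (4 * n) = 1" by (simp only: power_int_add[OF disjI1[OF A_nonzero], symmetric]) simp
 then have "A ^ (4 * n) = 1" by (simp only: power_int_of_nat)
 then show False using A_power_neq_1[of "4 * n"] n by simp
qed

lemma qfact_0 [simp]: "qfact 0 = 1"
 by (simp add: qfact_def)

lemma qfact_Suc: "qfact (Suc n) = qint (Suc n) * qfact n"
 by (simp add: qfact_def)

lemma qfact_nonzero [simp]: "qfact n \<noteq> 0"
 by (induction n) (auto simp: qfact_Suc qint_nonzero)

lemma qfact_hom: "qfact n \<in> hom (int n * (int n - 1))"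
proof (induction n)
 case (Suc n)
 have "qfact (Suc n) \<in> hom ((2 * int (Suc n) - 2) + int n * (int n - 1))"
  unfolding qfact_Suc by (rule hom_mult[OF qint_hom Suc])
 then show ?case by (simp add: algebra_simps)
qed (use hom_1 in simp)

lemma qfact_LA [simp]: "qfact n \<in> LA"
 using qfact_hom by (rule hom_in_LA)

definition qbin :: "nat => nat => ratfun" where
 "qbin n k = (if k \<le> n then qfact n / (qfact k * qfact (n - k)) else 0)"

lemma qbin_0 [simp]: "qbin n 0 = 1"
 by (simp add: qbin_def)

lemma qbin_self [simp]: "qbin n n = 1"
 by (simp add: qbin_def)

lemma qbin_gt [simp]: "n < k ==> qbin n k = 0"
 by (simp add: qbin_def)

lemma qbin_Pascal:
 assumes z: "unit_A z"
 shows "qbin (Suc n) (Suc k) =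
  z powi (- 2 * int (Suc k)) * qbin n (Suc k) + z powi (2 * (int n - int k)) * qbin n k"
proof -
 consider "n < k" | "n = k" | "k < n" by linarith
 then show ?thesis
 proof cases
  case 3
  define m where "m = n - Suc k"
  have n: "n = Suc (k + m)" using 3 by (simp add: m_def)
  have q: "qint (Suc n) = z powi (2 * int (Suc m)) * qint (Suc k) + z powi (- 2 * int (Suc k)) * qint (Suc m)"
   using qint_add[OF z, of "Suc k" "Suc m"] by (simp add: n)
  have e: "int n - int k = int (Suc m)" by (simp add: n)
  have "qbin (Suc n) (Suc k) = qint (Suc n) * qfact n / (qfact (Suc k) * qfact (Suc m))"
   by (simp add: qbin_def n qfact_Suc)
  moreover have "qbin n (Suc k) = qfact n * qint (Suc m) / (qfact (Suc k) * qfact (Suc m))"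
   using qint_nonzero[of "Suc m"] by (simp add: qbin_def n qfact_Suc)
  moreover have "qbin n k = qfact n * qint (Suc k) / (qfact (Suc k) * qfact (Suc m))"
   using qint_nonzero[of "Suc k"] by (simp add: qbin_def n qfact_Suc)
  ultimately show ?thesis
   unfolding q e by (simp add: add_divide_distrib ring_distribs mult_ac)
 qed simp_all
qed

text \<open>By the Pascal rule, as for ordinary binomial coefficients.\<close>

lemma qbin_LA [simp]: "qbin n k \<in> LA"
proof (induction n arbitrary: k)
 case 0
 then show ?case by (cases k) auto
next
 case IH: (Suc n)
 show ?case
 proof (cases k)
  case (Suc j)
  show ?thesis
   unfolding Suc qbin_Pascal[OF disjI1[OF refl]]
   by (intro laurent_add laurent_mult laurent_powi IH A_nonzero)
 qed simp
qed

lemma qmultinomial_LA: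
 "finite J ==> qfact (\<Sum>j\<in>J. n j) / (\<Prod>j\<in>J. qfact (n j)) \<in> LA"
proof (induction J rule: finite_induct)
 case (insert i J)
 have "qfact (n i + sum n J) / (qfact (n i) * (\<Prod>j\<in>J. qfact (n j)))
   = qbin (n i + sum n J) (n i) * (qfact (sum n J) / (\<Prod>j\<in>J. qfact (n j)))"
  by (simp add: qbin_def)
 also have "\<dots> \<in> LA" by (rule laurent_mult[OF A_nonzero qbin_LA insert.IH])
 finally show ?case using insert.hyps by simp
qed simp

section \<open>The Kauffman bracket as a state sum\<close>

text \<open>\<open>True\<close> stands for the positive sign. For a row of \<open>N\<close> strands only the values on words of
length \<open>N\<close> matter; \<open>eqv N\<close> below is equality on these.\<close>

type_synonym vec = "bool list => ratfun"

text \<open>The weights of a minimum, and below of a maximum, in the two-dimensional representation of the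
Temperley-Lieb category: a circle gives \<open>-[2]\<close> (\<open>capsum_cupM\<close>), and a zigzag can be straightened
(\<open>capsum_zigzag1\<close>, \<open>capsum_zigzag2\<close>).\<close>

definition cupM :: "bool => bool => ratfun" where
 "cupM a b = (if a = b then 0 else if a then A else - inverse A)"

definition capsum :: "(bool => bool => ratfun) => ratfun" where
 "capsum f = - A * f True False + inverse A * f False True"

definition cap_at :: "nat => vec => vec" where
 "cap_at i v = (\<lambda>es. capsum (\<lambda>a b. v (take i es @ [a, b] @ drop i es)))"

definition cup_at :: "nat => vec => vec" where
 "cup_at i v = (\<lambda>es. cupM (es ! i) (es ! (i + 1)) * v (take i es @ drop (i + 2) es))"

fun pair_w :: "bool list => ratfun" where
 "pair_w [a, b] = cupM a b"
| "pair_w _ = 1"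

text \<open>The weight of a system of arcs, each arc being a label that occurs at its two ends.\<close>

definition arcw :: "nat list => vec" where
 "arcw ls ds = (\<Prod>x\<in>set ls. pair_w (map snd (filter (\<lambda>p. fst p = x) (zip ls ds))))"

text \<open>Non-crossing systems of arcs, built by inserting innermost arcs; so proofs by induction need only
deal with an arc whose ends are adjacent.\<close>

inductive planar :: "nat list => bool" where
 planar_Nil: "planar []"
| planar_insert: "planar (as @ bs) ==> x \<notin> set (as @ bs) ==> planar (as @ [x, x] @ bs)"

lemma filter_zip_neq:
 "x \<notin> set ls ==> filter (\<lambda>p. fst p = x) (zip ls ds) = []"
 by (auto simp: filter_empty_conv dest: set_zip_leftD)

lemma arcw_Nil [simp]: "arcw [] ds = 1"
 by (simp add: arcw_def)

lemma arcw_pair [simp]: "arcw [x, x] [a, b] = cupM a b"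
 by (simp add: arcw_def)

lemma arcw_append_mid:
 assumes "set ls \<inter> set (us @ vs) = {}" "length pre = length us" "length ds = length ls" "length suf = length vs"
 shows "arcw (us @ ls @ vs) (pre @ ds @ suf) = arcw ls ds * arcw (us @ vs) (pre @ suf)"
proof -
 let ?f = "\<lambda>x. pair_w (map snd (filter (\<lambda>p. fst p = x) (zip (us @ ls @ vs) (pre @ ds @ suf))))"
 have "arcw (us @ ls @ vs) (pre @ ds @ suf) = prod ?f (set ls \<union> set (us @ vs))"
  by (auto simp: arcw_def intro!: prod.cong)
 also have "\<dots> = prod ?f (set ls) * prod ?f (set (us @ vs))"
  using assms(1) by (intro prod.union_disjoint) auto
 also have "prod ?f (set ls) = arcw ls ds"
  unfolding arcw_def
 proof (rule prod.cong[OF refl])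
  fix x assume "x \<in> set ls"
  then have "x \<notin> set us" "x \<notin> set vs" using assms(1) by auto
  then show "?f x = pair_w (map snd (filter (\<lambda>p. fst p = x) (zip ls ds)))"
   using assms by (simp add: filter_zip_neq)
 qed
 also have "prod ?f (set (us @ vs)) = arcw (us @ vs) (pre @ suf)"
  unfolding arcw_def
 proof (rule prod.cong[OF refl])
  fix x assume "x \<in> set (us @ vs)"
  then have "x \<notin> set ls" using assms(1) by blast
  then show "?f x = pair_w (map snd (filter (\<lambda>p. fst p = x) (zip (us @ vs) (pre @ suf))))"
   using assms by (simp add: filter_zip_neq)
 qed
 finally show ?thesis .
qed

lemma arcw_insert:
 assumes "x \<notin> set (as @ bs)" "length pre = length as" "length suf = length bs"
 shows "arcw (as @ x # x # bs) (pre @ a # b # suf) = cupM a b * arcw (as @ bs) (pre @ suf)"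
 using arcw_append_mid[of "[x, x]" as bs pre "[a, b]" suf] assms by simp

lemma arcw_rename:
 assumes "inj_on f (set ls)"
 shows "arcw (map f ls) ds = arcw ls ds"
proof -
 have "filter (\<lambda>p. fst p = f x) (zip (map f ls) ds) =
   map (apfst f) (filter (\<lambda>p. fst p = x) (zip ls ds))" if "x \<in> set ls" for x
 proof -
  have "zip (map f ls) ds = map (apfst f) (zip ls ds)"
   by (simp add: zip_map1 apfst_def map_prod_def)
  moreover have "filter (\<lambda>p. f (fst p) = f x) (zip ls ds) = filter (\<lambda>p. fst p = x) (zip ls ds)"
   using that assms by (intro filter_cong) (auto dest: set_zip_leftD simp: inj_on_eq_iff)
  ultimately show ?thesis by (simp add: filter_map o_def)
 qed
 then show ?thesis
  unfolding arcw_def using assms by (simp add: prod.reindex o_def)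
qed

lemma planar_rename: "planar ls ==> inj_on f (set ls) ==> planar (map f ls)"
proof (induction rule: planar.induct)
 case (planar_insert as bs x)
 have "planar (map f as @ map f bs)"
  using planar_insert.IH planar_insert.prems by (auto simp: inj_on_def)
 moreover have "f x \<notin> set (map f as @ map f bs)"
  using planar_insert.hyps(2) planar_insert.prems by (auto simp: inj_on_def)
 ultimately show ?case using planar.planar_insert[of "map f as" "map f bs" "f x"] by simp
qed (simp add: planar_Nil)

lemma planar_append_mid:
 "planar ls ==> planar (us @ vs) ==> set ls \<inter> set (us @ vs) = {} ==> planar (us @ ls @ vs)"
proof (induction rule: planar.induct)
 case (planar_insert as bs x)
 then have "planar ((us @ as) @ (bs @ vs))" by auto
 then show ?case
  using planar.planar_insert[of "us @ as" "bs @ vs" x] planar_insert by auto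
qed simp

lemma qint_2: "qint 2 = A ^ 2 + inverse A ^ 2"
 using qint_Suc[of A 1] by (simp add: numeral_2_eq_2 power_int_minus power_inverse)

lemma capsum_cupM: "capsum cupM = - qint 2"
 by (simp add: capsum_def cupM_def qint_2 power2_eq_square)

lemma capsum_zigzag1: "capsum (\<lambda>a b. cupM b c * f a) = f c"
 by (cases c) (simp_all add: capsum_def cupM_def)

lemma capsum_zigzag2: "capsum (\<lambda>a b. cupM c a * f b) = f c"
 by (cases c) (simp_all add: capsum_def cupM_def)

lemma capsum_mult: "capsum (\<lambda>a b. c * f a b) = c * capsum f"
 by (simp add: capsum_def algebra_simps)

lemma capsum_mult': "capsum (\<lambda>a b. f a b * c) = capsum f * c"
 by (simp add: capsum_def algebra_simps)

abbreviation (input) relabel :: "nat => nat => nat => nat" where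
 "relabel x y \<equiv> (\<lambda>z. if z = y then x else z)"

lemma split_pair:
 assumes "length xs = k + Suc (Suc m)"
 shows "\<exists>us p r vs. xs = us @ p # r # vs \<and> length us = k \<and> length vs = m"
proof -
 have "xs = take k xs @ xs ! k # xs ! Suc k # drop (Suc (Suc k)) xs" using assms by (simp add: Cons_nth_drop_Suc)
 then show ?thesis using assms by (intro exI[of _ "take k xs"] exI) (auto intro: exI)
qed

lemma split_far:
 assumes "as @ n # n' # bs = us @ x # y # vs" "Suc (Suc (length as)) \<le> length us"
 shows "\<exists>ws. us = as @ n # n' # ws \<and> bs = ws @ x # y # vs"
proof -
 consider (1) ws where "us = as @ ws" "n # n' # bs = ws @ x # y # vs" | (2) ws where "as = us @ ws"
  using assms(1) by (auto simp: append_eq_append_conv2)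
 then show ?thesis
 proof cases
  case 1
  then have "Suc (Suc 0) \<le> length ws" using assms(2) by simp
  then show ?thesis using 1 by (cases ws; cases "tl ws") auto
 qed (use assms(2) in simp)
qed

text \<open>Joining two neighbouring ends either closes a circle or merges two arcs. In the induction over
innermost arcs, an innermost arc with exactly one of the two ends gives a zigzag, one with both
ends gives a circle, and all others factor out.\<close>

lemma planar_join:
 assumes "planar xs" "xs = us @ x # y # vs"
 shows "(x = y \<longrightarrow> planar (us @ vs) \<and> (\<forall>pre suf. length pre = length us \<longrightarrow> length suf = length vs \<longrightarrow>
      capsum (\<lambda>a b. arcw xs (pre @ a # b # suf)) = - qint 2 * arcw (us @ vs) (pre @ suf)))
    \<and> (x \<noteq> y \<longrightarrow> planar (map (relabel x y) (us @ vs)) \<and>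
      (\<forall>pre suf. length pre = length us \<longrightarrow> length suf = length vs \<longrightarrow>
      capsum (\<lambda>a b. arcw xs (pre @ a # b # suf)) = arcw (map (relabel x y) (us @ vs)) (pre @ suf)))"
 using assms
proof (induction arbitrary: us vs rule: planar.induct)
 case planar_Nil
 then show ?case by simp
next
 case (planar_insert as bs n)
 let ?r = "relabel x y"
 have eq: "as @ n # n # bs = us @ x # y # vs" using planar_insert.prems by simp
 consider (same) "length as = length us" | (right) "length as = Suc (length us)"
  | (left) "length us = Suc (length as)" | (far_left) "Suc (Suc (length as)) \<le> length us"
  | (far_right) "Suc (Suc (length us)) \<le> length as"
  by linarith
 then show ?case
 proof cases
  case same
  then have "as = us" "x = n" "y = n" "bs = vs" using eq by auto
  then show ?thesis
   using planar_insert.hyps by (auto simp: arcw_insert capsum_mult' capsum_cupM)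
 next
  case right
  then have "length as = length (us @ [x])" by simp
  moreover have "as @ (n # n # bs) = (us @ [x]) @ (y # vs)" using eq by simp
  ultimately have as: "as = us @ [x]" and y: "y = n" and vs: "vs = n # bs"
   using append_eq_append_conv[of as "us @ [x]" "n # n # bs" "y # vs"] by auto
  have neq: "x \<noteq> y" "n \<notin> set us" "n \<notin> set bs" using planar_insert.hyps(2) by (auto simp: as y)
  then have m: "map ?r (us @ vs) = as @ bs"
   by (auto simp: as vs y intro!: map_idI)
  have "capsum (\<lambda>a b. arcw (as @ [n, n] @ bs) (pre @ a # b # suf)) = arcw (as @ bs) (pre @ suf)"
   if l: "length pre = length us" "length suf = length vs" for pre suf
  proof -
   obtain c suf' where suf: "suf = c # suf'" "length suf' = length bs" using l(2) vs by (cases suf) auto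
   have "arcw (as @ [n, n] @ bs) (pre @ a # b # suf) = cupM b c * arcw (as @ bs) ((pre @ [a]) @ suf')" for a b
    using arcw_insert[of n as bs "pre @ [a]" suf' b c] planar_insert.hyps(2) l suf as by simp
   then show ?thesis by (simp add: capsum_zigzag1 suf)
  qed
  then show ?thesis using neq planar_insert.hyps(1) unfolding m by simp
 next
  case left
  then have "length us = length (as @ [n])" by simp
  moreover have "us @ x # y # vs = (as @ [n]) @ n # bs" using eq by simp
  ultimately have us: "us = as @ [n]" and x: "x = n" and bs: "bs = y # vs"
   using append_eq_append_conv[of us "as @ [n]" "x # y # vs" "n # bs"] by auto
  have neq: "x \<noteq> y" "n \<notin> set as" "n \<notin> set vs" "n \<noteq> y" using planar_insert.hyps(2) by (auto simp: bs x)
  have m: "map ?r (us @ vs) = map ?r (as @ bs)"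
   using neq by (simp add: us bs x)
  have inj: "inj_on ?r (set (as @ bs))"
   using planar_insert.hyps(2) by (auto simp: inj_on_def x)
  have "capsum (\<lambda>a b. arcw (as @ [n, n] @ bs) (pre @ a # b # suf)) = arcw (as @ bs) (pre @ suf)"
   if l: "length pre = length us" "length suf = length vs" for pre suf
  proof -
   obtain c pre' where pre: "pre = pre' @ [c]" "length pre' = length as" using l(1) us by (cases pre rule: rev_cases) auto
   have "arcw (as @ [n, n] @ bs) (pre @ a # b # suf) = cupM c a * arcw (as @ bs) (pre' @ b # suf)" for a b
    using arcw_insert[of n as bs pre' "b # suf" c a] planar_insert.hyps(2) l pre bs by simp
   then show ?thesis by (simp add: capsum_zigzag2 pre)
  qed
  then show ?thesis using neq planar_rename[OF planar_insert.hyps(1) inj] unfolding m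
   by (simp only: arcw_rename[OF inj]) simp
 next
  case far_left
  obtain us' where us: "us = as @ n # n # us'" and bs: "bs = us' @ x # y # vs"
   using split_far[OF eq far_left] by blast
  have n: "n \<notin> set as" "n \<notin> set us'" "n \<notin> set vs" "n \<noteq> x" "n \<noteq> y" using planar_insert.hyps(2) by (auto simp: bs)
  note IH = planar_insert.IH[of "as @ us'" vs]
  have eqIH: "as @ bs = (as @ us') @ x # y # vs" by (simp add: bs)
  have step: "arcw (as @ [n, n] @ bs) (pre @ a # b # suf) =
    cupM p r * arcw (as @ bs) ((pre1 @ pre2) @ a # b # suf)"
   if "pre = pre1 @ p # r # pre2" "length pre1 = length as" "length pre2 = length us'" "length suf = length vs"
   for pre suf pre1 pre2 p r a b
   using arcw_insert[of n as bs pre1 "pre2 @ a # b # suf" p r] planar_insert.hyps(2) that by (simp add: bs)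
  have split: "\<exists>pre1 p r pre2. pre = pre1 @ p # r # pre2 \<and> length pre1 = length as \<and> length pre2 = length us'"
   if "length pre = length us" for pre :: "bool list"
   using split_pair[of pre "length as" "length us'"] that us by simp
  show ?thesis
  proof (cases "x = y")
   case True
   have ncs: "planar (as @ us' @ vs)" using IH True by (simp add: bs)
   have "planar (us @ vs)" using planar.planar_insert[of as "us' @ vs" n] ncs n by (simp add: us)
   moreover have "capsum (\<lambda>a b. arcw (as @ [n, n] @ bs) (pre @ a # b # suf)) = - qint 2 * arcw (us @ vs) (pre @ suf)"
    if l: "length pre = length us" "length suf = length vs" for pre suf
   proof -
    obtain pre1 p r pre2 where pre: "pre = pre1 @ p # r # pre2" "length pre1 = length as" "length pre2 = length us'"
     using split[OF l(1)] by auto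
    have "length (pre1 @ pre2) = length (as @ us')" using pre(2,3) by simp
    then have "capsum (\<lambda>a b. arcw (as @ bs) ((pre1 @ pre2) @ a # b # suf)) = - qint 2 * arcw ((as @ us') @ vs) ((pre1 @ pre2) @ suf)"
     using IH[OF eqIH] True l(2) by blast
    moreover have "arcw (us @ vs) (pre @ suf) = cupM p r * arcw ((as @ us') @ vs) ((pre1 @ pre2) @ suf)"
     using arcw_insert[of n as "us' @ vs" pre1 "pre2 @ suf" p r] n pre l by (simp add: us)
    ultimately show ?thesis
     unfolding step[OF pre l(2)] capsum_mult by (simp only:) (simp add: mult_ac)
   qed
   ultimately show ?thesis using True by simp
  next
   case False
   have ncs: "planar (map ?r as @ map ?r (us' @ vs))" using IH False by (simp add: bs)
   have nr: "n \<notin> set (map ?r as @ map ?r (us' @ vs))" using n by (auto split: if_splits)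
   have m: "map ?r (us @ vs) = map ?r as @ n # n # map ?r (us' @ vs)" using n by (simp add: us)
   have "planar (map ?r (us @ vs))" using planar.planar_insert[OF ncs nr] unfolding m by simp
   moreover have "capsum (\<lambda>a b. arcw (as @ [n, n] @ bs) (pre @ a # b # suf)) = arcw (map ?r (us @ vs)) (pre @ suf)"
    if l: "length pre = length us" "length suf = length vs" for pre suf
   proof -
    obtain pre1 p r pre2 where pre: "pre = pre1 @ p # r # pre2" "length pre1 = length as" "length pre2 = length us'"
     using split[OF l(1)] by auto
    have "length (pre1 @ pre2) = length (as @ us')" using pre(2,3) by simp
    then have "capsum (\<lambda>a b. arcw (as @ bs) ((pre1 @ pre2) @ a # b # suf)) = arcw (map ?r ((as @ us') @ vs)) ((pre1 @ pre2) @ suf)"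
     using IH[OF eqIH] False l(2) by blast
    moreover have "arcw (map ?r (us @ vs)) (pre @ suf) = cupM p r * arcw (map ?r ((as @ us') @ vs)) ((pre1 @ pre2) @ suf)"
     unfolding m using arcw_insert[OF nr, of pre1 "pre2 @ suf" p r] pre l by simp
    ultimately show ?thesis
     unfolding step[OF pre l(2)] capsum_mult by (simp only:)
   qed
   ultimately show ?thesis using False by simp
  qed
 next
  case far_right
  obtain as' where as: "as = us @ x # y # as'" and vs: "vs = as' @ n # n # bs"
   using split_far[OF eq[symmetric] far_right] by blast
  have n: "n \<notin> set us" "n \<notin> set as'" "n \<notin> set bs" "n \<noteq> x" "n \<noteq> y" using planar_insert.hyps(2) by (auto simp: as)
  note IH = planar_insert.IH[of us "as' @ bs"]
  have eqIH: "as @ bs = us @ x # y # (as' @ bs)" by (simp add: as)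
  have step: "arcw (as @ [n, n] @ bs) (pre @ a # b # suf) =
    cupM p r * arcw (as @ bs) (pre @ a # b # (suf1 @ suf2))"
   if "suf = suf1 @ p # r # suf2" "length suf1 = length as'" "length suf2 = length bs" "length pre = length us"
   for pre suf suf1 suf2 p r a b
   using arcw_insert[of n as bs "pre @ a # b # suf1" suf2 p r] planar_insert.hyps(2) that by (simp add: as)
  have split: "\<exists>suf1 p r suf2. suf = suf1 @ p # r # suf2 \<and> length suf1 = length as' \<and> length suf2 = length bs"
   if "length suf = length vs" for suf :: "bool list"
   using split_pair[of suf "length as'" "length bs"] that vs by simp
  show ?thesis
  proof (cases "x = y")
   case True
   have ncs: "planar ((us @ as') @ bs)" using IH True by (simp add: as)
   have "planar (us @ vs)" using planar.planar_insert[of "us @ as'" bs n] ncs n by (simp add: vs)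
   moreover have "capsum (\<lambda>a b. arcw (as @ [n, n] @ bs) (pre @ a # b # suf)) = - qint 2 * arcw (us @ vs) (pre @ suf)"
    if l: "length pre = length us" "length suf = length vs" for pre suf
   proof -
    obtain suf1 p r suf2 where suf: "suf = suf1 @ p # r # suf2" "length suf1 = length as'" "length suf2 = length bs"
     using split[OF l(2)] by auto
    have "length (suf1 @ suf2) = length (as' @ bs)" using suf(2,3) by simp
    then have "capsum (\<lambda>a b. arcw (as @ bs) (pre @ a # b # (suf1 @ suf2))) = - qint 2 * arcw (us @ as' @ bs) (pre @ suf1 @ suf2)"
     using IH[OF eqIH] True l(1) by blast
    moreover have "arcw (us @ vs) (pre @ suf) = cupM p r * arcw (us @ as' @ bs) (pre @ suf1 @ suf2)"
     using arcw_insert[of n "us @ as'" bs "pre @ suf1" suf2 p r] n suf l by (simp add: vs)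
    ultimately show ?thesis
     unfolding step[OF suf l(1)] capsum_mult by (simp only:) (simp add: mult_ac)
   qed
   ultimately show ?thesis using True by simp
  next
   case False
   have ncs: "planar (map ?r (us @ as') @ map ?r bs)" using IH False by (simp add: as)
   have nr: "n \<notin> set (map ?r (us @ as') @ map ?r bs)" using n by (auto split: if_splits)
   have m: "map ?r (us @ vs) = map ?r (us @ as') @ n # n # map ?r bs" using n by (simp add: vs)
   have "planar (map ?r (us @ vs))" using planar.planar_insert[OF ncs nr] unfolding m by simp
   moreover have "capsum (\<lambda>a b. arcw (as @ [n, n] @ bs) (pre @ a # b # suf)) = arcw (map ?r (us @ vs)) (pre @ suf)"
    if l: "length pre = length us" "length suf = length vs" for pre suf
   proof -
    obtain suf1 p r suf2 where suf: "suf = suf1 @ p # r # suf2" "length suf1 = length as'" "length suf2 = length bs"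
     using split[OF l(2)] by auto
    have "length (suf1 @ suf2) = length (as' @ bs)" using suf(2,3) by simp
    then have "capsum (\<lambda>a b. arcw (as @ bs) (pre @ a # b # (suf1 @ suf2))) = arcw (map ?r (us @ as' @ bs)) (pre @ suf1 @ suf2)"
     using IH[OF eqIH] False l(1) by blast
    moreover have "arcw (map ?r (us @ vs)) (pre @ suf) = cupM p r * arcw (map ?r (us @ as' @ bs)) (pre @ suf1 @ suf2)"
     unfolding m using arcw_insert[OF nr, of "pre @ suf1" suf2 p r] suf l by simp
    ultimately show ?thesis
     unfolding step[OF suf l(1)] capsum_mult by (simp only:)
   qed
   ultimately show ?thesis using False by simp
  qed
 qed
qed

text \<open>The state sum one slice at a time. A crossing acts by its two smoothings.\<close>

fun act :: "slice => vec => vec" where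
 "act (Arcs i ls) v = (\<lambda>es. arcw ls (take (length ls) (drop i es)) * v (take i es @ drop (i + length ls) es))"
| "act (Join i) v = cap_at i v"
| "act (CrossPos i) v = (\<lambda>es. A * v es + inverse A * cup_at i (cap_at i v) es)"
| "act (CrossNeg i) v = (\<lambda>es. A * cup_at i (cap_at i v) es + inverse A * v es)"

abbreviation runs :: "slice list => vec => vec" where
 "runs \<equiv> fold act"

fun sfit :: "slice => nat => bool" where
 "sfit (Arcs i ls) N \<longleftrightarrow> i \<le> N \<and> planar ls \<and> (\<forall>l\<in>set ls. l < length ls)"
| "sfit (Join i) N \<longleftrightarrow> i + 2 \<le> N"
| "sfit (CrossPos i) N \<longleftrightarrow> i + 2 \<le> N"
| "sfit (CrossNeg i) N \<longleftrightarrow> i + 2 \<le> N"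

fun swd :: "slice => nat => nat" where
 "swd (Arcs i ls) N = N + length ls"
| "swd (Join i) N = N - 2"
| "swd (CrossPos i) N = N"
| "swd (CrossNeg i) N = N"

fun vword :: "nat => slice list => nat => bool" where
 "vword N [] N' \<longleftrightarrow> N = N'"
| "vword N (s # w) N' \<longleftrightarrow> sfit s N \<and> vword (swd s N) w N'"

lemma vword_append: "vword N (w1 @ w2) N' \<longleftrightarrow> (\<exists>M. vword N w1 M \<and> vword M w2 N')"
 by (induction w1 arbitrary: N) auto

definition eqv :: "nat => vec => vec => bool" where
 "eqv N v u \<longleftrightarrow> (\<forall>es. length es = N \<longrightarrow> v es = u es)"

lemma eqv_refl [simp]: "eqv N v v"
 by (simp add: eqv_def)

lemma eqv_sym: "eqv N v u ==> eqv N u v"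
 by (simp add: eqv_def)

lemma eqv_trans [trans]: "eqv N v u ==> eqv N u w ==> eqv N v w"
 by (simp add: eqv_def)

lemma cap_at_cong: "eqv N v u ==> i + 2 \<le> N ==> eqv (N - 2) (cap_at i v) (cap_at i u)"
 unfolding eqv_def cap_at_def
 by (intro allI impI arg_cong[of _ _ capsum] ext) auto

lemma cup_at_cong: "eqv (N - 2) v u ==> i + 2 \<le> N ==> eqv N (cup_at i v) (cup_at i u)"
 unfolding eqv_def cup_at_def by auto

lemma act_cong: "eqv N v u ==> sfit s N ==> eqv (swd s N) (act s v) (act s u)"
proof (cases s)
 case (CrossPos i)
 assume h: "eqv N v u" "sfit s N"
 then have "eqv N (cup_at i (cap_at i v)) (cup_at i (cap_at i u))"
  using CrossPos by (intro cup_at_cong cap_at_cong) auto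
 then show ?thesis using h CrossPos by (simp add: eqv_def)
next
 case (CrossNeg i)
 assume h: "eqv N v u" "sfit s N"
 then have "eqv N (cup_at i (cap_at i v)) (cup_at i (cap_at i u))"
  using CrossNeg by (intro cup_at_cong cap_at_cong) auto
 then show ?thesis using h CrossNeg by (simp add: eqv_def)
next
 case (Join i)
 assume h: "eqv N v u" "sfit s N"
 then show ?thesis using Join cap_at_cong[of N v u i] by simp
qed (auto simp: eqv_def)

lemma runs_cong: "eqv N v u ==> vword N w N' ==> eqv N' (runs w v) (runs w u)"
 by (induction w arbitrary: N v u) (auto intro: act_cong)

lemma act_lin:
 "act s (\<lambda>es. a * v es + b * u es) = (\<lambda>es. a * act s v es + b * act s u es)"
 by (cases s) (auto simp: cap_at_def cup_at_def capsum_def algebra_simps)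

lemma runs_lin:
 "runs w (\<lambda>es. a * v es + b * u es) = (\<lambda>es. a * runs w v es + b * runs w u es)"
 by (induction w arbitrary: v u) (auto simp: act_lin)

lemma cap_at_split: "length pre = i ==> cap_at i v (pre @ suf) = capsum (\<lambda>a b. v (pre @ a # b # suf))"
 by (simp add: cap_at_def)

lemma planar_pair [simp]: "planar [x, x]"
 using planar_insert[of "[]" "[]" x] planar_Nil by simp

lemma eqv_act_Arcs_pair: "i + 2 \<le> N ==> eqv N (act (Arcs i [0, 0]) v) (cup_at i v)"
 unfolding eqv_def
proof (intro allI impI)
 fix es :: "bool list" assume "i + 2 \<le> N" "length es = N"
 then have "take 2 (drop i es) = [es ! i, es ! (i + 1)]"
  by (simp add: numeral_2_eq_2 take_Suc_conv_app_nth)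
 moreover have "act (Arcs i [0, 0]) v es = arcw [0, 0] (take 2 (drop i es)) * v (take i es @ drop (i + 2) es)"
  by (simp add: numeral_2_eq_2)
 ultimately show "act (Arcs i [0, 0]) v es = cup_at i v es"
  by (simp only: cup_at_def arcw_pair)
qed

lemma nth_split2: "i + 2 \<le> length xs ==> xs = take i xs @ xs ! i # xs ! (i + 1) # drop (i + 2) xs"
 by (simp add: Cons_nth_drop_Suc)

text \<open>The part of the diagram already read has been resolved into arcs, described by the
names in the current row. So the remaining slices act on the weight of these arcs.\<close>

lemma bracket_state_sum:
 "planar xs ==> set xs \<subseteq> {..<n} ==> vword (length xs) w 0 ==> bracket n xs w = runs w (arcw xs) []"
proof (induction n xs w rule: bracket.induct)
 case (1 n xs)
 then show ?case by simp
next
 case (2 n xs i ls w)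
 let ?ls = "map (\<lambda>l. n + l) ls" and ?us = "take i xs" and ?vs = "drop i xs"
 have i: "i \<le> length xs" and ls: "planar ls" "\<forall>l\<in>set ls. l < length ls" using 2 by auto
 have disj: "set ?ls \<inter> set (?us @ ?vs) = {}" using "2.prems"(2) by auto
 have inj: "inj_on (\<lambda>l. n + l) (set ls)" by (auto simp: inj_on_def)
 have "planar (?us @ ?ls @ ?vs)"
  using planar_append_mid[OF planar_rename[OF ls(1) inj] _ disj] 2 by simp
 moreover have "set (?us @ ?ls @ ?vs) \<subseteq> {..<n + length ls}"
  using "2.prems"(2) ls(2) by (auto dest: in_set_takeD in_set_dropD)
 moreover have v: "vword (length (?us @ ?ls @ ?vs)) w 0" using "2.prems"(3) i by (simp add: add.commute)
 ultimately have "bracket n xs (Arcs i ls # w) = runs w (arcw (?us @ ?ls @ ?vs)) []"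
  using "2.IH" by simp
 also have "eqv (length (?us @ ?ls @ ?vs)) (arcw (?us @ ?ls @ ?vs)) (act (Arcs i ls) (arcw xs))"
  unfolding eqv_def
 proof (intro allI impI)
  fix es :: "bool list" assume l: "length es = length (?us @ ?ls @ ?vs)"
  let ?pre = "take i es" and ?ds = "take (length ls) (drop i es)" and ?suf = "drop (i + length ls) es"
  have e: "es = ?pre @ ?ds @ ?suf" by (metis append_take_drop_id drop_drop add.commute)
  have "arcw (?us @ ?ls @ ?vs) (?pre @ ?ds @ ?suf) = arcw ?ls ?ds * arcw (?us @ ?vs) (?pre @ ?suf)"
   by (rule arcw_append_mid[OF disj]) (use l i in auto)
  then show "arcw (?us @ ?ls @ ?vs) es = act (Arcs i ls) (arcw xs) es"
   using e arcw_rename[OF inj] by simp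
 qed
 from runs_cong[OF this v] have "runs w (arcw (?us @ ?ls @ ?vs)) [] = runs w (act (Arcs i ls) (arcw xs)) []"
  by (simp add: eqv_def)
 finally show ?case by simp
next
 case (3 n xs i w)
 define x y us vs where "x = xs ! i" "y = xs ! (i + 1)" "us = take i xs" "vs = drop (i + 2) xs"
 note defs = this
 have i: "i + 2 \<le> length xs" using "3.prems" by simp
 have xs: "xs = us @ x # y # vs" unfolding defs using i by (rule nth_split2)
 have l: "length us = i" "length xs = i + 2 + length vs" using i by (auto simp: defs)
 have v: "vword (length (us @ vs)) w 0" using "3.prems"(3) l by (simp add: add.commute)
 note J = planar_join[OF "3.prems"(1) xs]
 have ysd: "us @ vs = take i xs @ drop (i + 2) xs" by (simp only: defs)
 have sub: "set (us @ vs) \<subseteq> {..<n}" "x < n" using "3.prems"(2) unfolding xs by auto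
 have unfold: "bracket n xs (Join i # w) = (if x = y then - qint 2 * bracket n (us @ vs) w
   else bracket n (map (relabel x y) (us @ vs)) w)"
  by (simp only: bracket.simps Let_def defs)
 have c: "cap_at i (arcw xs) (take i es @ drop i es) = capsum (\<lambda>a b. arcw xs (take i es @ a # b # drop i es))"
  if "length es = length (us @ vs)" for es
  using that l by (intro cap_at_split) auto
 show ?case
 proof (cases "x = y")
  case True
  have "bracket n xs (Join i # w) = - qint 2 * bracket n (us @ vs) w"
   using True unfold by simp
  also have "bracket n (us @ vs) w = runs w (arcw (us @ vs)) []"
   using 3(1)[OF defs(1,2) ysd True] True J v sub by blast
  also have "- qint 2 * \<dots> = runs w (\<lambda>es. - qint 2 * arcw (us @ vs) es) []"
   using runs_lin[of w "- qint 2" "arcw (us @ vs)" 0 "arcw (us @ vs)"] by simp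
  also have "\<dots> = runs w (cap_at i (arcw xs)) []"
  proof -
   have "eqv (length (us @ vs)) (\<lambda>es. - qint 2 * arcw (us @ vs) es) (cap_at i (arcw xs))"
    unfolding eqv_def
   proof (intro allI impI)
    fix es :: "bool list" assume e: "length es = length (us @ vs)"
    have "capsum (\<lambda>a b. arcw xs (take i es @ a # b # drop i es)) = - qint 2 * arcw (us @ vs) (take i es @ drop i es)"
     using J True e l by auto
    then show "- qint 2 * arcw (us @ vs) es = cap_at i (arcw xs) es" using c[OF e] by simp
   qed
   from runs_cong[OF this v] show ?thesis by (simp add: eqv_def)
  qed
  finally show ?thesis by simp
 next
  case False
  let ?ys = "map (relabel x y) (us @ vs)"
  have "bracket n xs (Join i # w) = bracket n ?ys w"
   using False unfold by simp
  also have "\<dots> = runs w (arcw ?ys) []"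
  proof -
   have "set ?ys \<subseteq> {..<n}" using sub by auto
   moreover have "vword (length ?ys) w 0" using v by simp
   ultimately show ?thesis
    using 3(2)[OF defs(1,2) ysd False] False J by blast
  qed
  also have "\<dots> = runs w (cap_at i (arcw xs)) []"
  proof -
   have "eqv (length (us @ vs)) (arcw ?ys) (cap_at i (arcw xs))"
    unfolding eqv_def
   proof (intro allI impI)
    fix es :: "bool list" assume e: "length es = length (us @ vs)"
    have "capsum (\<lambda>a b. arcw xs (take i es @ a # b # drop i es)) = arcw ?ys (take i es @ drop i es)"
     using J False e l by auto
    then show "arcw ?ys es = cap_at i (arcw xs) es" using c[OF e] by simp
   qed
   from runs_cong[OF this v] show ?thesis by (simp add: eqv_def)
  qed
  finally show ?thesis by simp
 qed
next
 case (4 n xs i w)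
 have i: "i + 2 \<le> length xs" and v: "vword (length xs) w 0" using "4.prems" by auto
 obtain m where "length xs = i + 2 + m" using i le_Suc_ex by blast
 then have v2: "vword (length xs) (Join i # Arcs i [0, 0] # w) 0" using v by simp
 have "runs (Join i # Arcs i [0, 0] # w) (arcw xs) [] = runs w (cup_at i (cap_at i (arcw xs))) []"
  using runs_cong[OF eqv_act_Arcs_pair[OF i, of "cap_at i (arcw xs)"] v] by (simp add: eqv_def)
 then show ?case
  using "4.IH"(1)[OF "4.prems"(1,2) v] "4.IH"(2)[OF "4.prems"(1,2) v2]
  by (simp add: runs_lin)
next
 case (5 n xs i w)
 have i: "i + 2 \<le> length xs" and v: "vword (length xs) w 0" using "5.prems" by auto
 obtain m where "length xs = i + 2 + m" using i le_Suc_ex by blast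
 then have v2: "vword (length xs) (Join i # Arcs i [0, 0] # w) 0" using v by simp
 have "runs (Join i # Arcs i [0, 0] # w) (arcw xs) [] = runs w (cup_at i (cap_at i (arcw xs))) []"
  using runs_cong[OF eqv_act_Arcs_pair[OF i, of "cap_at i (arcw xs)"] v] by (simp add: eqv_def)
 then show ?case
  using "5.IH"(1)[OF "5.prems"(1,2) v2] "5.IH"(2)[OF "5.prems"(1,2) v]
  by (simp add: runs_lin)
qed

lemma kauffman_bracket_state_sum:
 "vword 0 w 0 ==> kauffman_bracket w = runs w (\<lambda>es. 1) []"
proof -
 have "arcw [] = (\<lambda>es. 1)" by auto
 then show "vword 0 w 0 ==> kauffman_bracket w = runs w (\<lambda>es. 1) []"
  unfolding kauffman_bracket_def by (subst bracket_state_sum) (auto simp: planar_Nil)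
qed

section \<open>The symmetrizer\<close>

abbreviation cnt :: "bool => bool list => nat" where
 "cnt s es \<equiv> count_list es s"

text \<open>The number of inversions: pairs of places, the left one not \<open>s\<close>, the right one \<open>s\<close>.\<close>

fun ninv :: "bool => bool list => nat" where
 "ninv s [] = 0"
| "ninv s (a # es) = (if a = s then 0 else cnt s es) + ninv s es"

lemma cnt_le_length: "cnt s es \<le> length es"
 by (rule count_le_length)

lemma cnt_Not: "cnt (\<not> s) es = length es - cnt s es"
proof (induction es)
 case (Cons a es)
 then show ?case using cnt_le_length[of es s] by auto
qed simp

lemma ninv_append: "ninv s (pre @ suf) = ninv s pre + ninv s suf + (length pre - cnt s pre) * cnt s suf"
proof (induction pre)
 case (Cons a pre)
 have "Suc (length pre) - cnt s pre = Suc (length pre - cnt s pre)"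
  using cnt_le_length[of pre s] by auto
 then show ?case using Cons by auto
qed simp

lemma ninv_Not: "ninv s es + ninv (\<not> s) es = cnt s es * (length es - cnt s es)"
proof (induction es)
 case (Cons a es)
 have "Suc (length es) - cnt s es = Suc (length es - cnt s es)"
  using cnt_le_length[of es s] by auto
 then show ?case
  using Cons cnt_Not[where s = s and es = es] cnt_le_length[of es s] by (cases "a = s") auto
qed simp

lemma ninv_rev: "ninv s (rev es) = ninv (\<not> s) es"
proof (induction es)
 case (Cons a es)
 then show ?case using cnt_Not[where s = s and es = es] cnt_le_length[of es s]
  by (cases "a = s") (auto simp: ninv_append)
qed simp

lemma cnt_map_Not: "cnt s (map Not es) = cnt (\<not> s) es"
 by (induction es) auto

lemma ninv_map_Not: "ninv s (map Not es) = ninv (\<not> s) es"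
 by (induction es) (auto simp: cnt_map_Not)

text \<open>The symmetric function: interchanging different neighbouring signs multiplies it by \<open>z^2\<close> or
\<open>z^(-2)\<close>. On words with a fixed number of positive signs it spans the symmetric functions.\<close>

definition xw :: "ratfun => bool => bool list => ratfun" where
 "xw z s es = z powi (2 * int (ninv s es))"

definition words :: "nat => bool list set" where
 "words b = {es. length es = b}"

lemma words_0 [simp]: "words 0 = {[]}"
 by (auto simp: words_def)

lemma finite_words [simp]: "finite (words b)"
 using finite_lists_length_eq[of "UNIV :: bool set" b] by (simp add: words_def)

lemma words_Suc: "words (Suc b) = (#) True ` words b \<union> (#) False ` words b"
 by (auto simp: words_def length_Suc_conv image_iff)

lemma sum_words_Suc: "(\<Sum>es\<in>words (Suc b). f es) = (\<Sum>es\<in>words b. f (s # es)) + (\<Sum>es\<in>words b. f ((\<not> s) # es))"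
proof -
 have "(\<Sum>es\<in>words (Suc b). f es) = (\<Sum>es\<in>words b. f (True # es)) + (\<Sum>es\<in>words b. f (False # es))"
  unfolding words_Suc by (subst sum.union_disjoint) (auto simp: sum.reindex)
 then show ?thesis by (cases s) (auto simp: add.commute)
qed

lemma sum_words_rev: "(\<Sum>es\<in>words b. f (rev es)) = (\<Sum>es\<in>words b. f es)"
 by (rule sum.reindex_bij_witness[of _ rev rev]) (auto simp: words_def)

lemma sum_words_snoc:
 "(\<Sum>es\<in>words (Suc b). f es) = (\<Sum>es\<in>words b. f (es @ [s])) + (\<Sum>es\<in>words b. f (es @ [\<not> s]))"
proof -
 have "(\<Sum>es\<in>words (Suc b). f es) = (\<Sum>es\<in>words (Suc b). f (rev es))"
  by (rule sum_words_rev[symmetric])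
 also have "\<dots> = (\<Sum>es\<in>words b. f (rev es @ [s])) + (\<Sum>es\<in>words b. f (rev es @ [\<not> s]))"
  by (simp add: sum_words_Suc[of _ _ s])
 also have "\<dots> = (\<Sum>es\<in>words b. f (es @ [s])) + (\<Sum>es\<in>words b. f (es @ [\<not> s]))"
  using sum_words_rev[of "\<lambda>es. f (es @ [s])" b] sum_words_rev[of "\<lambda>es. f (es @ [\<not> s])" b] by simp
 finally show ?thesis .
qed

text \<open>The pairing with the symmetric function on words with \<open>k\<close> signs \<open>s\<close>.\<close>

definition phi :: "ratfun => bool => nat => int => vec => ratfun" where
 "phi z s b k u = (\<Sum>es\<in>words b. if int (cnt s es) = k then xw z s es * u es else 0)"

lemma phi_0: "phi z s 0 k u = (if k = 0 then u [] else 0)"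
 by (auto simp: phi_def xw_def)

lemma xw_Cons: "z \<noteq> 0 ==> xw z s (a # es) = (if a = s then 1 else z powi (2 * int (cnt s es))) * xw z s es"
 by (simp add: xw_def power_int_add distrib_left)

lemma xw_snoc: "z \<noteq> 0 ==> xw z s (es @ [a]) =
  (if a = s then z powi (2 * (int (length es) - int (cnt s es))) else 1) * xw z s es"
 using cnt_le_length[of es s] by (simp add: xw_def ninv_append distrib_left power_int_add of_nat_diff)

lemma phi_Cons:
 assumes z: "z \<noteq> 0"
 shows "phi z s (Suc b) k u = phi z s b (k - 1) (\<lambda>es. u (s # es))
   + z powi (2 * k) * phi z s b k (\<lambda>es. u ((\<not> s) # es))"
proof -
 have "(\<Sum>es\<in>words b. if int (cnt s (s # es)) = k then xw z s (s # es) * u (s # es) else 0)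
   = phi z s b (k - 1) (\<lambda>es. u (s # es))"
  unfolding phi_def by (rule sum.cong) (auto simp: xw_Cons[OF z])
 moreover have "(\<Sum>es\<in>words b. if int (cnt s ((\<not> s) # es)) = k then xw z s ((\<not> s) # es) * u ((\<not> s) # es) else 0)
   = z powi (2 * k) * phi z s b k (\<lambda>es. u ((\<not> s) # es))"
  unfolding phi_def sum_distrib_left by (rule sum.cong) (auto simp: xw_Cons[OF z])
 ultimately show ?thesis
  unfolding phi_def[of z s "Suc b"] sum_words_Suc[of _ b s] by simp
qed

lemma phi_snoc:
 assumes z: "z \<noteq> 0"
 shows "phi z s (Suc b) k u = z powi (2 * (int (Suc b) - k)) * phi z s b (k - 1) (\<lambda>es. u (es @ [s]))
   + phi z s b k (\<lambda>es. u (es @ [\<not> s]))"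
proof -
 have "(\<Sum>es\<in>words b. if int (cnt s (es @ [s])) = k then xw z s (es @ [s]) * u (es @ [s]) else 0)
   = z powi (2 * (int (Suc b) - k)) * phi z s b (k - 1) (\<lambda>es. u (es @ [s]))"
  unfolding phi_def sum_distrib_left by (rule sum.cong) (auto simp: xw_snoc[OF z] words_def)
 moreover have "(\<Sum>es\<in>words b. if int (cnt s (es @ [\<not> s])) = k then xw z s (es @ [\<not> s]) * u (es @ [\<not> s]) else 0)
   = phi z s b k (\<lambda>es. u (es @ [\<not> s]))"
  unfolding phi_def by (rule sum.cong) (auto simp: xw_snoc[OF z])
 ultimately show ?thesis
  unfolding phi_def[of z s "Suc b"] sum_words_snoc[of _ b s] by simp
qed

text \<open>The R-matrix of the vector representation of quantum \<open>sl(2)\<close>; \<open>act_CrossPos\<close> and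
\<open>act_CrossNeg\<close> identify it with the crossings.\<close>

definition cz :: "ratfun => bool => nat => vec => vec" where
 "cz z s i v es =
  (if es ! i = es ! (i + 1) then z * v es
   else inverse z * v (take i es @ [es ! (i + 1), es ! i] @ drop (i + 2) es)
    + (if es ! i = s then 0 else (z - inverse z ^ 3) * v es))"

lemma cz_split:
 assumes "length pre = i"
 shows "cz z s i v (pre @ p # r # suf) =
  (if p = r then z * v (pre @ p # r # suf)
   else inverse z * v (pre @ r # p # suf) + (if p = s then 0 else (z - inverse z ^ 3) * v (pre @ p # r # suf)))"
 using assms by (auto simp: cz_def nth_append)

lemma cup_cap_split:
 assumes "length pre = i"
 shows "cup_at i (cap_at i v) (pre @ p # r # suf) = cupM p r * capsum (\<lambda>a b. v (pre @ a # b # suf))"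
proof -
 have "cup_at i (cap_at i v) (pre @ p # r # suf) = cupM p r * cap_at i v (pre @ suf)"
  using assms by (simp add: cup_at_def nth_append)
 then show ?thesis using assms by (simp add: cap_at_split)
qed

lemma act_CrossPos: "i + 2 \<le> length es ==> act (CrossPos i) v es = cz A True i v es"
proof -
 assume i: "i + 2 \<le> length es"
 define pre p r suf where "pre = take i es" "p = es ! i" "r = es ! (i + 1)" "suf = drop (i + 2) es"
 then have e: "es = pre @ p # r # suf" and l: "length pre = i" using nth_split2[OF i] i by auto
 show ?thesis unfolding e act.simps cup_cap_split[OF l] cz_split[OF l]
  by (cases p; cases r) (auto simp: cupM_def capsum_def field_simps power3_eq_cube)
qed

lemma act_CrossNeg: "i + 2 \<le> length es ==> act (CrossNeg i) v es = cz (inverse A) False i v es"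
proof -
 assume i: "i + 2 \<le> length es"
 define pre p r suf where "pre = take i es" "p = es ! i" "r = es ! (i + 1)" "suf = drop (i + 2) es"
 then have e: "es = pre @ p # r # suf" and l: "length pre = i" using nth_split2[OF i] i by auto
 show ?thesis unfolding e act.simps cup_cap_split[OF l] cz_split[OF l]
  by (cases p; cases r) (auto simp: cupM_def capsum_def field_simps power3_eq_cube)
qed

abbreviation run :: "ratfun => bool => nat list => vec => vec" where
 "run z s \<equiv> fold (cz z s)"

lemma cz_cong: "eqv N v u ==> i + 2 \<le> N ==> eqv N (cz z s i v) (cz z s i u)"
 unfolding eqv_def cz_def by auto

lemma run_cong: "eqv N v u ==> \<forall>i\<in>set w. i + 2 \<le> N ==> eqv N (run z s w v) (run z s w u)"
proof (induction w arbitrary: v u)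
 case (Cons i w)
 show ?case using Cons.IH[OF cz_cong[OF Cons.prems(1)]] Cons.prems(2) by simp
qed simp

lemma cz_lin: "cz z s i (\<lambda>es. a * v es + b * u es) = (\<lambda>es. a * cz z s i v es + b * cz z s i u es)"
 by (auto simp: cz_def algebra_simps)

lemma run_lin: "run z s w (\<lambda>es. a * v es + b * u es) = (\<lambda>es. a * run z s w v es + b * run z s w u es)"
 by (induction w arbitrary: v u) (auto simp: cz_lin)

lemma cz_shift:
 assumes "length pre = o'" "i + 2 \<le> length es"
 shows "cz z s (o' + i) v (pre @ es @ suf) = cz z s i (\<lambda>ds. v (pre @ ds @ suf)) es"
 using assms by (auto simp: cz_def nth_append)

lemma run_shift:
 "length pre = o' ==> \<forall>i\<in>set w. i + 2 \<le> length es ==>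
  run z s (map ((+) o') w) v (pre @ es @ suf) = run z s w (\<lambda>ds. v (pre @ ds @ suf)) es"
proof (induction w arbitrary: v)
 case (Cons i w)
 have "run z s (map ((+) o') (i # w)) v (pre @ es @ suf) = run z s w (\<lambda>ds. cz z s (o' + i) v (pre @ ds @ suf)) es"
  using Cons by simp
 also have "\<dots> = run z s w (cz z s i (\<lambda>ds. v (pre @ ds @ suf))) es"
 proof -
  have "eqv (length es) (\<lambda>ds. cz z s (o' + i) v (pre @ ds @ suf)) (cz z s i (\<lambda>ds. v (pre @ ds @ suf)))"
   unfolding eqv_def using cz_shift Cons.prems by auto
  from run_cong[OF this, of w] show ?thesis using Cons.prems by (simp add: eqv_def)
 qed
 finally show ?case by simp
qed simp

lemma runs_CrossNeg:
 "\<forall>i\<in>set w. i + 2 \<le> N ==> eqv N v u ==> eqv N (runs (map CrossNeg w) v) (run (inverse A) False w u)"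
proof (induction w arbitrary: v u)
 case (Cons i w)
 have "eqv N (act (CrossNeg i) v) (cz (inverse A) False i v)"
  using Cons.prems by (auto simp: eqv_def act_CrossNeg simp del: act.simps)
 also have "eqv N \<dots> (cz (inverse A) False i u)"
  using Cons.prems by (auto intro: cz_cong)
 finally show ?case using Cons by (simp del: act.simps)
qed simp

lemma runs_CrossPos:
 "\<forall>i\<in>set w. i + 2 \<le> N ==> eqv N v u ==> eqv N (runs (map CrossPos w) v) (run A True w u)"
proof (induction w arbitrary: v u)
 case (Cons i w)
 have "eqv N (act (CrossPos i) v) (cz A True i v)"
  using Cons.prems by (auto simp: eqv_def act_CrossPos simp del: act.simps)
 also have "eqv N \<dots> (cz A True i u)"
  using Cons.prems by (auto intro: cz_cong)
 finally show ?case using Cons by (simp del: act.simps)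
qed simp

text \<open>The sum over all ways to let the strand \<open>m\<close> move left across \<open>c \<le> m\<close> others, with the
coefficients \<open>A^(-3 c)\<close>; inserting the strands one after the other gives all permutation braids.\<close>

fun Xop :: "nat => nat => vec => vec" where
 "Xop i 0 v = v"
| "Xop i (Suc m) v = (\<lambda>es. v es + A powi (- 3) * Xop i m (cz (inverse A) False (i + m) v) es)"

fun Sop :: "nat => nat => vec => vec" where
 "Sop i 0 v = v"
| "Sop i (Suc m) v = Xop i m (Sop i m v)"

abbreviation xA :: "bool list => ratfun" where "xA \<equiv> xw A True"

text \<open>The induction over \<open>m\<close> lets the last strand cross its left neighbour first; the result is again
symmetric in the remaining strands, with the new coefficients \<open>g'\<close>.\<close>

lemma Xop_sym:
 assumes "length pre = i"
  and "\<And>ts a. length ts = m ==> u (pre @ ts @ a # suf) = xA ts * g (cnt True ts) a"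
  and "length ts = Suc m"
 shows "Xop i m u (pre @ ts @ suf) = xA ts *
  (A powi (- 2 * int m) * qint (cnt True ts) * g (cnt True ts - 1) True
   + A powi (- 2 * int m - 2 * int (cnt True ts)) * qint (Suc m - cnt True ts) * g (cnt True ts) False)"
 using assms
proof (induction m arbitrary: u g ts suf)
 case 0
 obtain a where "ts = [a]" using "0.prems"(3) by (auto simp: length_Suc_conv)
 then show ?case using "0.prems"(2)[of "[]" a] by (cases a) (simp_all add: xw_def)
next
 case (Suc m)
 obtain \<zeta> a where ts: "ts = \<zeta> @ [a]" and l\<zeta>: "length \<zeta> = Suc m"
  using Suc.prems(3) by (cases ts rule: rev_cases) auto
 let ?k = "cnt True \<zeta>"
 have kle: "?k \<le> Suc m" using cnt_le_length[of \<zeta> True] l\<zeta> by simp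
 define n where "n = Suc m - ?k"
 have mk: "int m = int n + int ?k - 1" using kle by (simp add: n_def)
 define u' where "u' = cz (inverse A) False (i + m) u"
 \<comment> \<open>the coefficients after the last two strands have crossed, the last sign being \<open>a\<close>\<close>
 define g' where "g' j c =
   (if a then (if c then inverse A * A powi (2 * (int m - int j)) * g (Suc j) True
         else A * A powi (2 * (int m - int j)) * g (Suc j) False)
   else (if c then (inverse A - A ^ 3) * A powi (2 * (int m - int j)) * g (Suc j) False + A * g j True
         else inverse A * g j False))" for j c
 have u': "u' (pre @ \<xi> @ c # a # suf) = xA \<xi> * g' (cnt True \<xi>) c" if "length \<xi> = m" for \<xi> c
 proof -
  have u1: "u (pre @ \<xi> @ True # b # suf) = xA \<xi> * A powi (2 * (int m - int (cnt True \<xi>))) * g (Suc (cnt True \<xi>)) b" for b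
   using Suc.prems(2)[of "\<xi> @ [True]" b] that by (simp add: xw_snoc mult_ac)
  have u2: "u (pre @ \<xi> @ False # b # suf) = xA \<xi> * g (cnt True \<xi>) b" for b
   using Suc.prems(2)[of "\<xi> @ [False]" b] that by (simp add: xw_snoc mult_ac)
  have "u' (pre @ \<xi> @ c # a # suf) = u' ((pre @ \<xi>) @ c # a # suf)" by simp
  also have "\<dots> = (if c = a then inverse A * u (pre @ \<xi> @ c # a # suf)
    else A * u (pre @ \<xi> @ a # c # suf) + (if c = False then 0 else (inverse A - A ^ 3) * u (pre @ \<xi> @ c # a # suf)))"
   unfolding u'_def using Suc.prems(1) that by (subst cz_split) auto
  finally show ?thesis
   by (cases a; cases c) (simp_all add: u1 u2 g'_def algebra_simps)
 qed
 have IH: "Xop i m u' (pre @ \<zeta> @ a # suf) = xA \<zeta> *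
   (A powi (- 2 * int m) * qint ?k * g' (?k - 1) True
    + A powi (- 2 * int m - 2 * int ?k) * qint n * g' ?k False)"
  unfolding n_def by (rule Suc.IH[OF Suc.prems(1) u' l\<zeta>])
 have val: "Xop i (Suc m) u (pre @ ts @ suf) = xA \<zeta> * g ?k a + A powi (- 3) * Xop i m u' (pre @ \<zeta> @ a # suf)"
  using Suc.prems(2)[OF l\<zeta>, of a] by (simp add: ts u'_def)
 \<comment> \<open>From here on the claim is an identity between rational functions of \<open>A\<close>, \<open>p\<close>, \<open>r\<close> and quantum integers.\<close>
 define p where "p = A powi (2 * int ?k)"
 define r where "r = A powi (2 * int n)"
 have nz: "p \<noteq> 0" "r \<noteq> 0" by (simp_all add: p_def r_def)
 have Am: "A powi (- 2 * int m) = A ^ 2 / (p * r)"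
 proof -
  have "A powi (- 2 * int m) = A powi (2 - 2 * int ?k - 2 * int n)" by (rule arg_cong) (simp add: mk)
  then show ?thesis by (simp add: power_int_diff p_def r_def)
 qed
 have Amk: "A powi (- 2 * int m - 2 * int ?k) = A ^ 2 / (p * p * r)"
  by (simp only: power_int_diff[OF disjI1[OF A_nonzero]] Am p_def[symmetric]) simp
 have A3: "A powi (- 3) = inverse A ^ 3" by (simp add: power_int_minus power_inverse)
 have qn: "qint (Suc n) = r + inverse A ^ 2 * qint n"
  using qint_Suc[of A n] by (simp add: r_def power_int_minus power_inverse)
 have qk: "qint (Suc ?k) = p + inverse A ^ 2 * qint ?k"
  using qint_Suc[of A ?k] by (simp add: p_def power_int_minus power_inverse)
 have qd: "(A ^ 2 - inverse A ^ 2) * qint ?k = p - inverse p"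
  using qint_diff[of A ?k] by (simp add: p_def power_int_minus power_inverse)
 show ?case
 proof (cases a)
  case True
  have x: "xA ts = r * xA \<zeta>" using kle by (simp add: ts True xw_snoc l\<zeta> r_def n_def of_nat_diff)
  have c: "cnt True ts = Suc ?k" by (simp add: ts True)
  have e1: "qint ?k * g' (?k - 1) True = qint ?k * (inverse A * (r * g ?k True))"
  proof (cases "?k = 0")
   case False
   then have "2 * (int m - int (?k - 1)) = 2 * int n" by (simp add: mk of_nat_diff)
   then show ?thesis using False True by (simp add: g'_def r_def)
  qed simp
  have e2: "g' ?k False = A * (r / A ^ 2) * g (Suc ?k) False"
  proof -
   have "2 * (int m - int ?k) = 2 * int n - 2" by (simp add: mk)
   then show ?thesis using True by (simp add: g'_def r_def power_int_diff)
  qed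
  have f1: "A powi (- 2 * int (Suc m)) = 1 / (p * r)"
  proof -
   have "A powi (- 2 * int (Suc m)) = A powi (- 2 * int m - 2)" by (rule arg_cong) simp
   then show ?thesis by (simp only: power_int_diff[OF disjI1[OF A_nonzero]] Am) simp
  qed
  have f2: "A powi (- 2 * int (Suc m) - 2 * int (Suc ?k)) = 1 / (p * p * r * A ^ 2)"
  proof -
   have "A powi (- 2 * int (Suc m) - 2 * int (Suc ?k)) = A powi (- 2 * int m - 2 * int ?k - 4)" by (rule arg_cong) simp
   then show ?thesis by (simp only: power_int_diff[OF disjI1[OF A_nonzero]] Am p_def[symmetric]) (simp add: field_simps eval_nat_numeral)
  qed
  have n': "Suc (Suc m) - Suc ?k = n" by (simp add: n_def)
  show ?thesis
   unfolding val IH x c f1 f2 n' qk mult.assoc e1[unfolded mult.assoc] e2 Am Amk A3 using nz True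
   by (simp add: field_simps eval_nat_numeral)
 next
  case False
  have x: "xA ts = xA \<zeta>" by (simp add: ts False xw_snoc)
  have c: "cnt True ts = ?k" by (simp add: ts False)
  have e1: "qint ?k * g' (?k - 1) True = qint ?k * ((inverse A - A ^ 3) * (r * g ?k False) + A * g (?k - 1) True)"
  proof (cases "?k = 0")
   case k: False
   then have "2 * (int m - int (?k - 1)) = 2 * int n" by (simp add: mk of_nat_diff)
   then show ?thesis using k False by (simp add: g'_def r_def)
  qed simp
  have e2: "g' ?k False = inverse A * g ?k False" using False by (simp add: g'_def)
  have f1: "A powi (- 2 * int (Suc m)) = 1 / (p * r)"
  proof -
   have "A powi (- 2 * int (Suc m)) = A powi (- 2 * int m - 2)" by (rule arg_cong) simp
   then show ?thesis by (simp only: power_int_diff[OF disjI1[OF A_nonzero]] Am) simp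
  qed
  have f2: "A powi (- 2 * int (Suc m) - 2 * int ?k) = 1 / (p * p * r)"
   by (simp only: power_int_diff[OF disjI1[OF A_nonzero]] f1 p_def[symmetric]) simp
  have n': "Suc (Suc m) - ?k = Suc n" using kle by (simp add: n_def)
  have qd': "qint ?k * A ^ 4 = qint ?k + A ^ 2 * (p - inverse p)"
   unfolding qd[symmetric] by (simp add: field_simps eval_nat_numeral)
  have "xA \<zeta> * g ?k a + A powi (- 3) * (xA \<zeta> * (A ^ 2 / (p * r) * (qint ?k * ((inverse A - A ^ 3) * (r * g ?k False) + A * g (?k - 1) True))
     + A ^ 2 / (p * p * r) * (qint n * (inverse A * g ?k False))))
    = xA \<zeta> * (g ?k False * (1 + inverse A ^ 2 / p * (qint ?k - qint ?k * A ^ 4) + inverse A ^ 2 * qint n / (p * p * r))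
      + qint ?k * g (?k - 1) True / (p * r))"
   unfolding A3 using nz False by (simp add: field_simps eval_nat_numeral)
  also have "\<dots> = xA \<zeta> * (1 / (p * r) * (qint ?k * g (?k - 1) True) + 1 / (p * p * r) * (qint (Suc n) * g ?k False))"
   unfolding qd' qn using nz by (simp add: field_simps eval_nat_numeral)
  finally show ?thesis
   unfolding val IH x c f1 f2 n' mult.assoc e1[unfolded mult.assoc] e2 Am Amk by simp
 qed
qed

text \<open>The symmetrizer is the projection to symmetric functions, explicitly. The closed form is found from
the Pascal rule for \<open>phi\<close>: the last insertion distinguishes the sign of the last strand.\<close>

lemma Sop_formula:
 assumes "length pre = i" "length ts = b"
 shows "Sop i b v (pre @ ts @ suf) = xA ts *
  (A powi (- (int b * (int b - 1)) - 2 * (int (cnt True ts) * (int b - int (cnt True ts))))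
   * qfact (cnt True ts) * qfact (b - cnt True ts) * phi A True b (int (cnt True ts)) (\<lambda>es. v (pre @ es @ suf)))"
 using assms
proof (induction b arbitrary: ts suf)
 case 0
 then show ?case by (simp add: xw_def phi_0)
next
 case (Suc m)
 define C where "C b k = A powi (- (int b * (int b - 1)) - 2 * (int k * (int b - int k))) * qfact k * qfact (b - k)" for b k
 define g where "g k a = C m k * phi A True m (int k) (\<lambda>es. v (pre @ es @ a # suf))" for k a
 have IH: "Sop i m v (pre @ \<zeta> @ a # suf) = xA \<zeta> * g (cnt True \<zeta>) a" if "length \<zeta> = m" for \<zeta> a
  using Suc.IH[OF Suc.prems(1) that, of "a # suf"] by (simp add: g_def C_def mult_ac)
 let ?k = "cnt True ts"
 have kle: "?k \<le> Suc m" using cnt_le_length[of ts True] Suc.prems by simp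
 have X: "Sop i (Suc m) v (pre @ ts @ suf) = xA ts *
  (A powi (- 2 * int m) * qint ?k * g (?k - 1) True
   + A powi (- 2 * int m - 2 * int ?k) * qint (Suc m - ?k) * g ?k False)"
  using Xop_sym[OF Suc.prems(1) IH Suc.prems(2)] by simp
 have 1: "A powi (- 2 * int m) * qint ?k * g (?k - 1) True
   = C (Suc m) ?k * (A powi (2 * (int (Suc m) - int ?k)) * phi A True m (int ?k - 1) (\<lambda>es. v (pre @ es @ True # suf)))"
 proof (cases ?k)
  case 0
  have "phi A True m (- 1) (\<lambda>es. v (pre @ es @ True # suf)) = 0"
   by (simp add: phi_def)
  then show ?thesis using 0 by simp
 next
  case (Suc j)
  have "A powi (- 2 * int m) * A powi (- (int m * (int m - 1)) - 2 * (int j * (int m - int j)))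
    = A powi (- (int (Suc m) * (int (Suc m) - 1)) - 2 * (int (Suc j) * (int (Suc m) - int (Suc j)))) * A powi (2 * (int (Suc m) - int (Suc j)))"
   unfolding power_int_add[OF disjI1[OF A_nonzero], symmetric]
   by (rule arg_cong) (simp add: algebra_simps)
  then show ?thesis
   unfolding g_def C_def Suc by (simp add: qfact_Suc mult_ac)
 qed
 have 2: "A powi (- 2 * int m - 2 * int ?k) * qint (Suc m - ?k) * g ?k False
   = C (Suc m) ?k * phi A True m (int ?k) (\<lambda>es. v (pre @ es @ False # suf))"
 proof (cases "?k = Suc m")
  case True
  have "phi A True m (int (Suc m)) (\<lambda>es. v (pre @ es @ False # suf)) = 0"
   unfolding phi_def
  proof (rule sum.neutral, intro ballI)
   fix es assume "es \<in> words m"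
   then have "cnt True es \<noteq> Suc m" using cnt_le_length[of es True] by (auto simp: words_def)
   then show "(if int (cnt True es) = int (Suc m) then xA es * v (pre @ es @ False # suf) else 0) = 0"
    by (simp only: of_nat_eq_iff if_False)
  qed
  then show ?thesis using True by simp
 next
  case False
  then obtain n where n: "m = ?k + n" using kle by (metis le_SucE le_iff_add)
  have "A powi (- 2 * int m - 2 * int ?k) * A powi (- (int m * (int m - 1)) - 2 * (int ?k * (int m - int ?k)))
    = A powi (- (int (Suc m) * (int (Suc m) - 1)) - 2 * (int ?k * (int (Suc m) - int ?k)))"
   unfolding power_int_add[OF disjI1[OF A_nonzero], symmetric]
   by (rule arg_cong) (simp add: algebra_simps)
  moreover have "Suc m - ?k = Suc (m - ?k)" using n by simp
  ultimately show ?thesis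
   unfolding g_def C_def by (simp add: qfact_Suc mult_ac)
 qed
 show ?case
  unfolding X 1 2 phi_snoc[OF A_nonzero, of True m] by (simp add: C_def algebra_simps)
qed

text \<open>The projection onto the symmetric functions that annihilates the functions orthogonal to them; the
factor normalizes by the squared length of \<open>xw\<close>, essentially a Gaussian binomial (\<open>phi_xw\<close>).\<close>

definition sp :: "ratfun => bool => nat => vec => vec" where
 "sp z s b u ts = xw z s ts * (z powi (- 2 * (int (cnt s ts) * (int b - int (cnt s ts)))) / qbin b (cnt s ts)
   * phi z s b (int (cnt s ts)) u)"

text \<open>The Jones-Wenzl idempotent on the \<open>b\<close> strands starting at position \<open>i\<close>.\<close>

definition Pop :: "nat => nat => vec => vec" where
 "Pop i b v es = sp A True b (\<lambda>ds. v (take i es @ ds @ drop (i + b) es)) (take b (drop i es))"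

lemma Pop_split:
 "length pre = i ==> length ts = b ==> Pop i b v (pre @ ts @ suf) = sp A True b (\<lambda>ds. v (pre @ ds @ suf)) ts"
 by (simp add: Pop_def)

lemma list_window:
 assumes "i + b \<le> length es"
 obtains pre ts suf where "es = pre @ ts @ suf" "length pre = i" "length ts = b"
proof
 show "es = take i es @ take b (drop i es) @ drop b (drop i es)"
  by (simp only: append_take_drop_id)
qed (use assms in auto)

lemma Sop_Pop:
 assumes "i + b \<le> length es"
 shows "A ^ (b * (b - 1)) * Sop i b v es = qfact b * Pop i b v es"
proof -
 obtain pre ts suf where e: "es = pre @ ts @ suf" "length pre = i" "length ts = b"
  using list_window[OF assms] by metis
 have le: "cnt True ts \<le> b" using cnt_le_length[of ts True] e by simp
 have "int (b * (b - 1)) = int b * (int b - 1)"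
  by (cases b) (auto simp: algebra_simps)
 then have "A ^ (b * (b - 1)) = A powi (int b * (int b - 1))"
  by (metis power_int_of_nat)
 then have "A ^ (b * (b - 1)) * A powi (- (int b * (int b - 1)) - 2 * (int (cnt True ts) * (int b - int (cnt True ts))))
   = A powi (- 2 * (int (cnt True ts) * (int b - int (cnt True ts))))"
  by (simp add: power_int_add[OF disjI1[OF A_nonzero], symmetric])
 then show ?thesis
  unfolding e(1) Sop_formula[OF e(2,3)] Pop_split[OF e(2,3)] sp_def
  using le by (simp add: qbin_def mult.assoc[symmetric])
qed

text \<open>Inversion tables: the insertion sort behind \<open>reduced_word\<close> reads nothing else of the permutation.\<close>

definition itab :: "nat => (nat => nat) => nat => nat" where
 "itab b \<sigma> = restrict (\<lambda>k. card {j. j < k \<and> \<sigma> j > \<sigma> k}) {..<b}"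

definition tabs :: "nat => (nat => nat) set" where
 "tabs b = PiE {..<b} (\<lambda>k. {..k})"

definition tword :: "nat => (nat => nat) => nat list" where
 "tword b c = concat (map (\<lambda>k. rev [k - c k..<k]) [0..<b])"

lemma reduced_word_itab: "reduced_word b \<sigma> = tword b (itab b \<sigma>)"
 unfolding reduced_word_def tword_def by (intro arg_cong[of _ _ concat] map_cong) (auto simp: itab_def)

lemma inversions_itab: "inversions b \<sigma> = (\<Sum>k<b. itab b \<sigma> k)"
proof -
 have "{(j, k). j < k \<and> k < b \<and> \<sigma> j > \<sigma> k} = prod.swap ` (SIGMA k:{..<b}. {j. j < k \<and> \<sigma> j > \<sigma> k})"
  by (auto simp: image_iff)
 then have "inversions b \<sigma> = card (SIGMA k:{..<b}. {j. j < k \<and> \<sigma> j > \<sigma> k})"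
  unfolding inversions_def by (simp add: card_image)
 also have "\<dots> = (\<Sum>k<b. card {j. j < k \<and> \<sigma> j > \<sigma> k})"
  by (rule card_SigmaI) auto
 finally show ?thesis by (simp add: itab_def)
qed

text \<open>The last value is determined by the number of larger ones before it; remove it and proceed
by induction.\<close>

lemma itab_eqD:
 fixes \<sigma> \<tau> :: "nat => nat"
 assumes "inj_on \<sigma> {..<n}" "inj_on \<tau> {..<n}" "\<sigma> ` {..<n} = \<tau> ` {..<n}"
  "\<forall>k<n. card {j. j < k \<and> \<sigma> j > \<sigma> k} = card {j. j < k \<and> \<tau> j > \<tau> k}"
 shows "\<forall>k<n. \<sigma> k = \<tau> k"
 using assms
proof (induction n)
 case (Suc n)
 define S where "S = \<sigma> ` {..<Suc n}"
 have fin: "finite S" by (simp add: S_def)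
 have c: "card {j. j < n \<and> \<rho> j > \<rho> n} = card {s\<in>S. s > \<rho> n}"
  if "inj_on \<rho> {..<Suc n}" "\<rho> ` {..<Suc n} = S" for \<rho> :: "nat => nat"
 proof -
  have "{s\<in>S. s > \<rho> n} = \<rho> ` {j. j < n \<and> \<rho> j > \<rho> n}"
   using that(2) by (auto simp: less_Suc_eq)
  moreover have "inj_on \<rho> {j. j < n \<and> \<rho> j > \<rho> n}"
   using that(1) by (rule inj_on_subset) auto
  ultimately show ?thesis by (simp add: card_image)
 qed
 have eq: "card {s\<in>S. s > \<sigma> n} = card {s\<in>S. s > \<tau> n}"
  using c[of \<sigma>] c[of \<tau>] Suc.prems S_def by simp
 have mem: "\<sigma> n \<in> S" "\<tau> n \<in> S" using Suc.prems(3) by (auto simp: S_def)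
 have less: False if "x < y" "y \<in> S" "card {s\<in>S. s > x} = card {s\<in>S. s > y}" for x y
 proof -
  have "{s\<in>S. s > y} \<subset> {s\<in>S. s > x}" using that by auto
  then have "card {s\<in>S. s > y} < card {s\<in>S. s > x}" using fin by (intro psubset_card_mono) auto
  then show False using that by simp
 qed
 have last: "\<sigma> n = \<tau> n"
  using less[of "\<sigma> n" "\<tau> n"] less[of "\<tau> n" "\<sigma> n"] mem eq by (metis linorder_neqE_nat)
 have "\<sigma> ` {..<n} = S - {\<sigma> n}" "\<tau> ` {..<n} = S - {\<tau> n}"
  using Suc.prems(1-3) by (auto simp: S_def lessThan_Suc inj_on_def)
 then have "\<forall>k<n. \<sigma> k = \<tau> k"
  using Suc.prems last by (intro Suc.IH) (auto simp: inj_on_def)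
 then show ?case using last by (auto simp: less_Suc_eq)
qed simp

lemma bij_itab: "bij_betw (itab b) {\<sigma>. \<sigma> permutes {..<b}} (tabs b)"
proof -
 have inj: "inj_on (itab b) {\<sigma>. \<sigma> permutes {..<b}}"
 proof (rule inj_onI)
  fix \<sigma> \<tau> assume st: "\<sigma> \<in> {\<sigma>. \<sigma> permutes {..<b}}" "\<tau> \<in> {\<sigma>. \<sigma> permutes {..<b}}" and eq: "itab b \<sigma> = itab b \<tau>"
  have "itab b \<rho> k = card {j. j < k \<and> \<rho> j > \<rho> k}" if "k < b" for \<rho> k
   using that by (simp add: itab_def)
  then have "\<forall>k<b. card {j. j < k \<and> \<sigma> j > \<sigma> k} = card {j. j < k \<and> \<tau> j > \<tau> k}"
   using eq by metis
  moreover have "inj_on \<sigma> {..<b}" "inj_on \<tau> {..<b}" "\<sigma> ` {..<b} = \<tau> ` {..<b}"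
   using st by (simp_all add: permutes_inj_on permutes_image)
  ultimately have "\<forall>k<b. \<sigma> k = \<tau> k"
   using itab_eqD[of \<sigma> b \<tau>] by blast
  moreover have "\<sigma> k = k" "\<tau> k = k" if "\<not> k < b" for k
   using st that permutes_not_in[of _ "{..<b}" k] by auto
  ultimately show "\<sigma> = \<tau>" by (metis ext)
 qed
 have sub: "itab b ` {\<sigma>. \<sigma> permutes {..<b}} \<subseteq> tabs b"
 proof -
  have "card {j. j < k \<and> \<sigma> j > \<sigma> k} \<le> k" for \<sigma> :: "nat => nat" and k
   using card_mono[of "{..<k}" "{j. j < k \<and> \<sigma> j > \<sigma> k}"] by auto
  then have "itab b \<sigma> \<in> tabs b" for \<sigma>
   unfolding itab_def tabs_def restrict_PiE_iff by simp
  then show ?thesis by blast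
 qed
 have "card (tabs b) = (\<Prod>k<b. Suc k)"
  unfolding tabs_def by (subst card_PiE) auto
 then have "card (tabs b) = fact b" by (simp add: fact_prod_Suc lessThan_atLeast0)
 moreover have "card {\<sigma>. \<sigma> permutes {..<b}} = fact b" by (rule card_permutations) auto
 moreover have "finite (tabs b)" unfolding tabs_def by (rule finite_PiE) auto
 ultimately have "itab b ` {\<sigma>. \<sigma> permutes {..<b}} = tabs b"
  using sub inj by (intro card_subset_eq) (auto simp: card_image)
 then show ?thesis using inj by (simp add: bij_betw_def)
qed

lemma Xop_sum:
 "Xop i m v es = (\<Sum>c\<le>m. A powi (- 3 * int c) * run (inverse A) False (map ((+) i) (rev [m - c..<m])) v es)"
proof (induction m arbitrary: v)
 case (Suc m)
 have "(\<Sum>c\<le>Suc m. A powi (- 3 * int c) * run (inverse A) False (map ((+) i) (rev [Suc m - c..<Suc m])) v es)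
  = v es + (\<Sum>c\<le>m. A powi (- 3 * int (Suc c)) * run (inverse A) False (map ((+) i) (rev [m - c..<Suc m])) v es)"
  by (subst sum.atMost_Suc_shift) simp
 also have "(\<Sum>c\<le>m. A powi (- 3 * int (Suc c)) * run (inverse A) False (map ((+) i) (rev [m - c..<Suc m])) v es)
   = A powi (- 3) * Xop i m (cz (inverse A) False (i + m) v) es"
  unfolding Suc.IH sum_distrib_left
 proof (rule sum.cong[OF refl])
  fix c assume "c \<in> {..m}"
  have "A powi (- 3 * int (Suc c)) = A powi (- 3) * A powi (- 3 * int c)"
   unfolding power_int_add[OF disjI1[OF A_nonzero], symmetric] by (rule arg_cong) simp
  moreover have "rev [m - c..<Suc m] = m # rev [m - c..<m]" by simp
  ultimately show "A powi (- 3 * int (Suc c)) * run (inverse A) False (map ((+) i) (rev [m - c..<Suc m])) v es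
   = A powi (- 3) * (A powi (- 3 * int c) * run (inverse A) False (map ((+) i) (rev [m - c..<m])) (cz (inverse A) False (i + m) v) es)"
   by (simp only: list.map fold.simps o_apply mult.assoc)
 qed
 finally show ?case by simp
qed simp

lemma run_sum:
 "finite I ==> run z s w (\<lambda>es. \<Sum>j\<in>I. f j * v j es) es = (\<Sum>j\<in>I. f j * run z s w (v j) es)"
proof (induction I rule: finite_induct)
 case empty
 then show ?case using run_lin[of z s w 0 "\<lambda>_. 0" 0 "\<lambda>_. 0"] by simp
next
 case (insert j I)
 then show ?case using run_lin[of z s w "f j" "v j" 1 "\<lambda>es. \<Sum>j\<in>I. f j * v j es"] by simp
qed

lemma tabs_sum:
 "(\<Sum>c\<in>tabs b. A powi (- 3 * int (\<Sum>k<b. c k)) * run (inverse A) False (map ((+) i) (tword b c)) v es) = Sop i b v es"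
proof (induction b arbitrary: es)
 case 0
 then show ?case by (simp add: tabs_def tword_def)
next
 case (Suc b)
 have fin: "finite (tabs b)" unfolding tabs_def by (rule finite_PiE) auto
 let ?h = "\<lambda>(y, g). g(b := y) :: nat => nat"
 have T: "tabs (Suc b) = ?h ` ({..b} \<times> tabs b)"
  unfolding tabs_def lessThan_Suc by (rule PiE_insert_eq)
 have inj: "inj_on ?h ({..b} \<times> tabs b)"
  unfolding tabs_def by (rule inj_combinator) simp
 define F where "F c = A powi (- 3 * int (\<Sum>k<b. c k))" for c :: "nat => nat"
 define R where "R c = run (inverse A) False (map ((+) i) (tword b c)) v" for c
 have "(\<Sum>c\<in>tabs (Suc b). A powi (- 3 * int (\<Sum>k<Suc b. c k)) * run (inverse A) False (map ((+) i) (tword (Suc b) c)) v es)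
  = (\<Sum>(y, g)\<in>{..b} \<times> tabs b. A powi (- 3 * int y) * (F g * run (inverse A) False (map ((+) i) (rev [b - y..<b])) (R g) es))"
  unfolding T
 proof (subst sum.reindex[OF inj], rule sum.cong[OF refl], clarify)
  fix y :: nat and g :: "nat => nat"
  have s: "(\<Sum>k<b. (g(b := y)) k) = (\<Sum>k<b. g k)" by (rule sum.cong) auto
  have w: "tword b (g(b := y)) = tword b g" unfolding tword_def by (intro arg_cong[of _ _ concat] map_cong) auto
  then have w': "tword (Suc b) (g(b := y)) = tword b g @ rev [b - y..<b]" by (simp add: tword_def)
  have p: "A powi (- 3 * int (\<Sum>k<Suc b. (g(b := y)) k)) = A powi (- 3 * int y) * F g"
   unfolding F_def power_int_add[OF disjI1[OF A_nonzero], symmetric] by (rule arg_cong) (simp add: s)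
  show "((\<lambda>c. A powi (- 3 * int (\<Sum>k<Suc b. c k)) * run (inverse A) False (map ((+) i) (tword (Suc b) c)) v es) \<circ> (\<lambda>(y, g). g(b := y))) (y, g)
   = A powi (- 3 * int y) * (F g * run (inverse A) False (map ((+) i) (rev [b - y..<b])) (R g) es)"
   using p w' by (simp add: R_def)
 qed
 also have "\<dots> = (\<Sum>y\<le>b. A powi (- 3 * int y) * (\<Sum>g\<in>tabs b. F g * run (inverse A) False (map ((+) i) (rev [b - y..<b])) (R g) es))"
  by (simp add: sum.cartesian_product[symmetric] sum_distrib_left)
 also have "\<dots> = (\<Sum>y\<le>b. A powi (- 3 * int y) * run (inverse A) False (map ((+) i) (rev [b - y..<b])) (\<lambda>es. \<Sum>g\<in>tabs b. F g * R g es) es)"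
  by (simp only: run_sum[OF fin])
 also have "(\<lambda>es. \<Sum>g\<in>tabs b. F g * R g es) = Sop i b v"
  by (rule ext) (simp only: F_def R_def Suc.IH)
 also have "(\<Sum>y\<le>b. A powi (- 3 * int y) * run (inverse A) False (map ((+) i) (rev [b - y..<b])) (Sop i b v) es) = Sop i (Suc b) v es"
  by (simp only: Xop_sum[symmetric] Sop.simps)
 finally show ?case .
qed

lemma tword_bound: "j \<in> set (tword b c) ==> j + 2 \<le> b"
proof -
 assume "j \<in> set (tword b c)"
 then obtain k where "k < b" "j < k" by (auto simp: tword_def)
 then show ?thesis by simp
qed

lemma perm_braid_word: "vword N (perm_braid i b \<sigma>) N \<longleftrightarrow> True" if "i + b \<le> N"
proof -
 have "\<forall>j\<in>set w. j + 2 \<le> b ==> vword N (map (\<lambda>j. CrossNeg (i + j)) w) N" for w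
  using that by (induction w) auto
 then show ?thesis using tword_bound by (auto simp: perm_braid_def reduced_word_itab)
qed

text \<open>Permutations correspond to inversion tables, whose entries are independent of each other; so the
sum over all braids factors into the insertions \<open>Xop\<close>.\<close>

lemma perm_braid_sum:
 assumes "i + b \<le> length es"
 shows "(\<Sum>\<sigma> | \<sigma> permutes {..<b}. A ^ (b * (b - 1)) * A powi (- 3 * int (inversions b \<sigma>)) * runs (perm_braid i b \<sigma>) v es)
  = qfact b * Pop i b v es"
proof -
 have "(\<Sum>\<sigma> | \<sigma> permutes {..<b}. A ^ (b * (b - 1)) * A powi (- 3 * int (inversions b \<sigma>)) * runs (perm_braid i b \<sigma>) v es)
  = (\<Sum>\<sigma> | \<sigma> permutes {..<b}. A ^ (b * (b - 1)) * (A powi (- 3 * int (\<Sum>k<b. itab b \<sigma> k)) * run (inverse A) False (map ((+) i) (tword b (itab b \<sigma>))) v es))"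
 proof (rule sum.cong[OF refl])
  fix \<sigma> :: "nat => nat"
  have "perm_braid i b \<sigma> = map CrossNeg (map ((+) i) (tword b (itab b \<sigma>)))"
   by (simp add: perm_braid_def reduced_word_itab)
  moreover have "\<forall>j\<in>set (map ((+) i) (tword b (itab b \<sigma>))). j + 2 \<le> length es"
   using tword_bound[of _ b "itab b \<sigma>"] assms by fastforce
  ultimately have "runs (perm_braid i b \<sigma>) v es = run (inverse A) False (map ((+) i) (tword b (itab b \<sigma>))) v es"
   using runs_CrossNeg[of "map ((+) i) (tword b (itab b \<sigma>))" "length es" v v] by (simp add: eqv_def)
  then show "A ^ (b * (b - 1)) * A powi (- 3 * int (inversions b \<sigma>)) * runs (perm_braid i b \<sigma>) v es
   = A ^ (b * (b - 1)) * (A powi (- 3 * int (\<Sum>k<b. itab b \<sigma> k)) * run (inverse A) False (map ((+) i) (tword b (itab b \<sigma>))) v es)"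
   by (simp add: inversions_itab)
 qed
 also have "\<dots> = (\<Sum>c\<in>tabs b. A ^ (b * (b - 1)) * (A powi (- 3 * int (\<Sum>k<b. c k)) * run (inverse A) False (map ((+) i) (tword b c)) v es))"
  by (rule sum.reindex_bij_betw[OF bij_itab, of "\<lambda>c. A ^ (b * (b - 1)) * (A powi (- 3 * int (\<Sum>k<b. c k)) * run (inverse A) False (map ((+) i) (tword b c)) v es)"])
 also have "\<dots> = A ^ (b * (b - 1)) * Sop i b v es"
  by (simp only: sum_distrib_left[symmetric] tabs_sum)
 also have "\<dots> = qfact b * Pop i b v es" by (rule Sop_Pop[OF assms])
 finally show ?thesis .
qed

section \<open>Symmetric cables and crossings\<close>

lemma power_unit_add: "unit_A z ==> z powi (m + n) = z powi m * z powi n"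
 by (rule power_int_add) (auto dest: unit_A_nonzero)

lemma power_unit_diff: "unit_A z ==> z powi (m - n) = z powi m / z powi n"
 by (rule power_int_diff) (auto dest: unit_A_nonzero)

lemma phi_lin: "phi z s b k (\<lambda>es. c * f es + d * g es) = c * phi z s b k f + d * phi z s b k g"
 by (auto simp: phi_def sum_distrib_left sum.distrib[symmetric] algebra_simps intro!: sum.cong)

lemma phi_scale: "phi z s b k (\<lambda>es. c * f es) = c * phi z s b k f"
 using phi_lin[of z s b k c f 0 f] by simp

lemma phi_cong: "(\<And>es. length es = b ==> int (cnt s es) = k ==> f es = g es) ==> phi z s b k f = phi z s b k g"
 unfolding phi_def by (rule sum.cong) (auto simp: words_def)

lemma phi_neg: "k < 0 ==> phi z s b k f = 0"
 by (auto simp: phi_def intro!: sum.neutral)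

lemma phi_large: "int b < k ==> phi z s b k f = 0"
 unfolding phi_def
proof (intro sum.neutral ballI)
 fix es assume "int b < k" "es \<in> words b"
 then have "int (cnt s es) \<noteq> k" using cnt_le_length[of es s] by (auto simp: words_def)
 then show "(if int (cnt s es) = k then xw z s es * f es else 0) = 0" by simp
qed

lemma upt_shift_Suc: "[i..<i + Suc b] = i # [Suc i..<Suc i + b]"
 by (simp add: upt_conv_Cons)

text \<open>A strand that crosses a symmetric cable keeps it symmetric; induction over the strands of
the cable.\<close>

lemma strand_right_sym:
 assumes z: "unit_A z"
 assumes "length pre = i"
  and "\<And>ts a. length ts = b ==> u (pre @ a # ts @ suf) = xw z s ts * g a (cnt s ts)"
  and "length ts = b"
 shows "run z s [i..<i + b] u (pre @ ts @ a # suf) = xw z s ts *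
  (if a = s then z powi (2 * int (cnt s ts) - int b) * g s (cnt s ts)
    + (z - inverse z ^ 3) * z powi (int b - 2 * int (cnt s ts) - 1) * qint (b - cnt s ts) * g (\<not> s) (Suc (cnt s ts))
   else z powi (int b - 2 * int (cnt s ts)) * g (\<not> s) (cnt s ts))"
 using assms(2-)
proof (induction b arbitrary: i pre u g ts)
 case 0
 then show ?case using "0.prems"(2)[of "[]" a] by (simp add: xw_def)
next
 case (Suc b)
 have z0: "z \<noteq> 0" using z by (rule unit_A_nonzero)
 obtain h ts' where ts: "ts = h # ts'" and lts: "length ts' = b"
  using Suc.prems(3) by (cases ts) auto
 define l where "l = cnt s ts'"
 have le: "l \<le> b" using cnt_le_length[of ts' s] lts by (simp add: l_def)
 define u' where "u' = cz z s i u"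
 define g' where "g' c k = (if h = s then (if c = s then z * g s (Suc k) else inverse z * g (\<not> s) (Suc k))
   else (if c = s then inverse z * (z powi (2 * int k) * g s k) + (z - inverse z ^ 3) * g (\<not> s) (Suc k)
      else z * (z powi (2 * int k) * g (\<not> s) k)))" for c k
 have u': "u' ((pre @ [h]) @ c # \<xi> @ suf) = xw z s \<xi> * g' c (cnt s \<xi>)" if "length \<xi> = b" for \<xi> c
 proof -
  have u: "u (pre @ d # e # \<xi> @ suf) = (if e = s then xw z s \<xi> * g d (Suc (cnt s \<xi>))
    else xw z s \<xi> * (z powi (2 * int (cnt s \<xi>)) * g d (cnt s \<xi>)))" for d e
   using Suc.prems(2)[of "e # \<xi>" d] that by (simp add: xw_Cons[OF z0])
  have "u' ((pre @ [h]) @ c # \<xi> @ suf) = u' (pre @ h # c # (\<xi> @ suf))" by simp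
  also have "\<dots> = (if h = c then z * u (pre @ h # c # \<xi> @ suf)
    else inverse z * u (pre @ c # h # \<xi> @ suf) + (if h = s then 0 else (z - inverse z ^ 3) * u (pre @ h # c # \<xi> @ suf)))"
   unfolding u'_def by (rule cz_split[OF Suc.prems(1)])
  finally show ?thesis
   unfolding u g'_def by (cases s; cases h; cases c) (simp_all add: algebra_simps)
 qed
 have "run z s [i..<i + Suc b] u (pre @ ts @ a # suf) = run z s [Suc i..<Suc i + b] u' ((pre @ [h]) @ ts' @ a # suf)"
  unfolding upt_shift_Suc by (simp add: u'_def ts)
 also have "\<dots> = xw z s ts' *
  (if a = s then z powi (2 * int l - int b) * g' s l
    + (z - inverse z ^ 3) * z powi (int b - 2 * int l - 1) * qint (b - l) * g' (\<not> s) (Suc l)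
   else z powi (int b - 2 * int l) * g' (\<not> s) l)"
  unfolding l_def by (rule Suc.IH[OF _ u' lts]) (simp add: Suc.prems(1))
 finally have val: "run z s [i..<i + Suc b] u (pre @ ts @ a # suf) = \<dots>" .
 define p where "p = z powi int l"
 define r where "r = z powi int b"
 have nz: "p \<noteq> 0" "r \<noteq> 0" using z0 by (simp_all add: p_def r_def)
 have P: "z powi (2 * k) = (z powi k) ^ 2" for k
  by (metis mult.commute power_int_mult power_int_numeral)
 then have P': "z powi (k * 2) = (z powi k) ^ 2" for k
  by (simp add: mult.commute[of _ "2 :: int"])
 note S = power_unit_add[OF z] power_unit_diff[OF z] P P' p_def[symmetric] r_def[symmetric]
  p_def[unfolded power_int_of_nat, symmetric] r_def[unfolded power_int_of_nat, symmetric]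
 have e: "int (Suc b) = int b + 1" "int (Suc l) = int l + 1" by simp_all
 have z1: "z powi 1 = z" "z powi 2 = z ^ 2" by simp_all
 show ?case
 proof (cases "h = s")
  case True
  have c: "cnt s ts = Suc l" by (simp add: ts True l_def)
  have x: "xw z s ts = xw z s ts'" by (simp add: ts True xw_Cons[OF z0])
  have d: "Suc b - Suc l = b - l" by simp
  show ?thesis unfolding val c x d e
   using True nz z0 by (simp add: g'_def S distrib_left z1 field_simps power2_eq_square)
 next
  case False
  have c: "cnt s ts = l" using False by (simp add: ts l_def)
  have x: "xw z s ts = z powi (2 * int l) * xw z s ts'" using False by (simp add: ts xw_Cons[OF z0] l_def)
  have d: "Suc b - l = Suc (b - l)" using le by simp
  have bl: "z powi (- 2 * int (b - l)) = p ^ 2 / r ^ 2"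
  proof -
   have "z powi (- 2 * int (b - l)) = z powi (2 * int l - 2 * int b)" using le by (intro arg_cong[of _ _ "(powi) z"]) (simp add: of_nat_diff)
   then show ?thesis by (simp only: S)
  qed
  have q: "qint (Suc (b - l)) = z ^ 2 * qint (b - l) + p ^ 2 / r ^ 2"
   using qint_Suc'[OF z, of "b - l"] bl by simp
  show ?thesis
  proof (cases "a = s")
   case True
   have g1: "g' s l = inverse z * (p ^ 2 * g s l) + (z - inverse z ^ 3) * g (\<not> s) (Suc l)"
    using False by (simp add: g'_def P p_def)
   have g2: "g' (\<not> s) (Suc l) = z * (z powi (2 * int l + 2) * g (\<not> s) (Suc l))"
    using False by (simp add: g'_def algebra_simps)
   define w where "w = z - inverse z ^ 3"
   show ?thesis unfolding val c x d e q if_P[OF True] g1 g2 w_def[symmetric]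
    using nz z0 by (simp add: S z1 field_simps power2_eq_square)
  next
   case a: False
   have g3: "g' (\<not> s) l = z * (p ^ 2 * g (\<not> s) l)"
    using False by (simp add: g'_def P p_def)
   show ?thesis unfolding val c x d e if_not_P[OF a] g3
    using nz z0 by (simp add: S z1 field_simps power2_eq_square)
  qed
 qed
qed

text \<open>The dual statement: the pairing with a symmetric cable after a strand has crossed it.\<close>

lemma strand_right_phi:
 assumes z: "unit_A z"
 assumes "length pre = i"
 shows "phi z s b l (\<lambda>ts. run z s [i..<i + b] u (pre @ ts @ a # suf)) =
  (if a = s then z powi (2 * l - int b) * phi z s b l (\<lambda>ts. u (pre @ s # ts @ suf))
    + (z - inverse z ^ 3) * z powi (2 * l - int b + 1) * qint (nat (l + 1)) * phi z s b (l + 1) (\<lambda>ts. u (pre @ (\<not> s) # ts @ suf))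
   else z powi (int b - 2 * l) * phi z s b l (\<lambda>ts. u (pre @ (\<not> s) # ts @ suf)))"
 using assms(2)
proof (induction b arbitrary: i pre u l)
 case 0
 show ?case
  by (cases "a = s"; cases "l = -1"; cases "l = 0") (auto simp: phi_0)
next
 case (Suc b)
 have z0: "z \<noteq> 0" using z by (rule unit_A_nonzero)
 define u' where "u' = cz z s i u"
 define V where "V d h k = phi z s b k (\<lambda>ts. u (pre @ d # h # ts @ suf))" for d h k
 have U': "phi z s b k (\<lambda>ts. u' ((pre @ [h]) @ c # ts @ suf)) = (if h = c then z * V h c k
    else inverse z * V c h k + (if h = s then 0 else (z - inverse z ^ 3) * V h c k))" for h c k
 proof -
  have "u' ((pre @ [h]) @ c # ts @ suf) = (if h = c then z * u (pre @ h # c # ts @ suf)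
    else inverse z * u (pre @ c # h # ts @ suf) + (if h = s then 0 else z - inverse z ^ 3) * u (pre @ h # c # ts @ suf))" for ts
   using cz_split[OF Suc.prems, of z s u h c "ts @ suf"] by (simp add: u'_def)
  then show ?thesis by (simp add: V_def phi_scale phi_lin)
 qed
 have U: "phi z s (Suc b) k (\<lambda>ts. u (pre @ d # ts @ suf)) = V d s (k - 1) + z powi (2 * k) * V d (\<not> s) k" for d k
  unfolding phi_Cons[OF z0] V_def by simp
 have L: "phi z s (Suc b) l (\<lambda>ts. run z s [i..<i + Suc b] u (pre @ ts @ a # suf))
   = phi z s b (l - 1) (\<lambda>ts. run z s [Suc i..<Suc i + b] u' ((pre @ [s]) @ ts @ a # suf))
   + z powi (2 * l) * phi z s b l (\<lambda>ts. run z s [Suc i..<Suc i + b] u' ((pre @ [\<not> s]) @ ts @ a # suf))"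
  unfolding phi_Cons[OF z0] upt_shift_Suc by (simp add: u'_def)
 have len: "length (pre @ [h]) = Suc i" for h using Suc.prems by simp
 define p where "p = z powi l"
 define r where "r = z powi int b"
 have nz: "p \<noteq> 0" "r \<noteq> 0" using z0 by (simp_all add: p_def r_def)
 have P: "z powi (2 * k) = (z powi k) ^ 2" for k
  by (metis mult.commute power_int_mult power_int_numeral)
 then have P': "z powi (k * 2) = (z powi k) ^ 2" for k
  by (simp add: mult.commute[of _ "2 :: int"])
 note S = power_unit_add[OF z] power_unit_diff[OF z] P P' p_def[symmetric] r_def[symmetric]
 have e: "int (Suc b) = int b + 1" by simp
 have z1: "z powi 1 = z" "z powi 2 = z ^ 2" by simp_all
 have ss: "(\<not> s) \<noteq> s" "s \<noteq> (\<not> s)" by auto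
 show ?case
 proof (cases "l < 0")
  case True
  then show ?thesis
   by (cases "l = -1") (simp_all add: phi_neg)
 next
  case False
  have qs: "qint (nat (l + 1)) = p ^ 2 + inverse z ^ 2 * qint (nat l)"
  proof -
   have "nat (l + 1) = Suc (nat l)" using False by simp
   then show ?thesis using qint_Suc[OF z, of "nat l"] False
    by (simp add: P p_def power_int_minus power_inverse)
  qed
  define w where "w = z - inverse z ^ 3"
  have l1: "l - 1 + 1 = l" by simp
  show ?thesis
  proof (cases "a = s")
   case True
   show ?thesis
    unfolding L Suc.IH[OF len] U U' if_P[OF True] if_P[OF refl] if_not_P[OF ss(1)] if_not_P[OF ss(2)] l1 e qs w_def[symmetric]
    using nz z0 by (simp add: S z1 right_diff_distrib distrib_left field_simps power2_eq_square)
  next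
   case a: False
   show ?thesis
    unfolding L Suc.IH[OF len] U U' if_not_P[OF a] if_P[OF refl] if_not_P[OF ss(1)] if_not_P[OF ss(2)] e
    using nz z0 by (simp add: S z1 right_diff_distrib distrib_left field_simps power2_eq_square)
  qed
 qed
qed

definition spop :: "ratfun => bool => nat => nat => vec => vec" where
 "spop z s i b v es = sp z s b (\<lambda>ds. v (take i es @ ds @ drop (i + b) es)) (take b (drop i es))"

lemma spop_split:
 "length pre = i ==> length ts = b ==> spop z s i b v (pre @ ts @ suf) = sp z s b (\<lambda>ds. v (pre @ ds @ suf)) ts"
 by (simp add: spop_def)

lemma sp_cong: "(\<And>es. length es = b ==> f es = g es) ==> sp z s b f ts = sp z s b g ts"
 unfolding sp_def by (simp cong: phi_cong)

lemma spop_cong: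
 assumes "eqv N v u" "i + b \<le> N"
 shows "eqv N (spop z s i b v) (spop z s i b u)"
 unfolding eqv_def
proof (intro allI impI)
 fix es :: "bool list" assume l: "length es = N"
 obtain pre ts suf where e: "es = pre @ ts @ suf" "length pre = i" "length ts = b"
  using list_window[of i b es] assms(2) l by metis
 show "spop z s i b v es = spop z s i b u es"
  unfolding e(1) spop_split[OF e(2,3)]
  by (rule sp_cong) (use assms(1) l e in \<open>auto simp: eqv_def\<close>)
qed

text \<open>Both sides involve \<open>v\<close> only through its pairings with the symmetric function, the left one
by \<open>strand_right_sym\<close>, the right one by \<open>strand_right_phi\<close>.\<close>

lemma strand_right_spop:
 assumes z: "unit_A z" and N: "i + b + 1 \<le> N"
 shows "eqv N (run z s [i..<i + b] (spop z s (Suc i) b v)) (spop z s i b (run z s [i..<i + b] v))"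
 unfolding eqv_def
proof (intro allI impI)
 fix es :: "bool list" assume l: "length es = N"
 obtain pre ts suf' where e: "es = pre @ ts @ suf'" "length pre = i" "length ts = b"
  using list_window[of i b es] N l by auto
 then obtain a suf where suf': "suf' = a # suf" using N l by (cases suf') auto
 have z0: "z \<noteq> 0" using z by (rule unit_A_nonzero)
 define k where "k = cnt s ts"
 have le: "k \<le> b" using cnt_le_length[of ts s] e by (simp add: k_def)
 define c where "c l = z powi (- 2 * (int l * (int b - int l))) / qbin b l" for l
 define g where "g d l = c l * phi z s b (int l) (\<lambda>ds. v (pre @ d # ds @ suf))" for d l
 have sp: "sp z s b f \<xi> = xw z s \<xi> * (c (cnt s \<xi>) * phi z s b (int (cnt s \<xi>)) f)" for f \<xi>
  by (simp add: sp_def c_def)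
 have u: "spop z s (Suc i) b v (pre @ d # \<xi> @ suf) = xw z s \<xi> * g d (cnt s \<xi>)" if "length \<xi> = b" for \<xi> d
  using spop_split[of "pre @ [d]" "Suc i" \<xi> b z s v suf] that e by (simp add: sp g_def)
 have ratio: "c (Suc k) * (z powi (int b - 2 * int k - 1) * qint (b - k)) * X = c k * (z powi (2 * int k - int b + 1) * qint (Suc k)) * X"
  if "k = b ==> X = 0" for X
 proof (cases "k = b")
  case True
  then show ?thesis using that by simp
 next
  case False
  then obtain m where b: "b = Suc (k + m)" using le by (metis le_neq_implies_less less_iff_Suc_add)
  have qb: "qbin b k * qint (Suc m) = qbin b (Suc k) * qint (Suc k)"
   using qint_nonzero[of "Suc m"] qint_nonzero[of "Suc k"]
   by (simp add: qbin_def b qfact_Suc)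
  have nz: "qbin b k \<noteq> 0" "qbin b (Suc k) \<noteq> 0" by (simp_all add: qbin_def b)
  have ex: "z powi (- 2 * (int (Suc k) * (int b - int (Suc k)))) * z powi (int b - 2 * int k - 1)
    = z powi (- 2 * (int k * (int b - int k))) * z powi (2 * int k - int b + 1)"
   unfolding power_unit_add[OF z, symmetric] by (rule arg_cong) (simp add: b algebra_simps)
  have bk: "b - k = Suc m" by (simp add: b)
  have "c (Suc k) * (z powi (int b - 2 * int k - 1) * qint (b - k)) * qbin b (Suc k) * qbin b k
    = (z powi (- 2 * (int (Suc k) * (int b - int (Suc k)))) * z powi (int b - 2 * int k - 1)) * (qbin b k * qint (Suc m))"
   unfolding c_def bk using nz by (simp add: field_simps)
  also have "\<dots> = c k * (z powi (2 * int k - int b + 1) * qint (Suc k)) * qbin b (Suc k) * qbin b k"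
   unfolding c_def ex qb using nz by (simp add: field_simps)
  finally show ?thesis using nz by simp
 qed
 have "run z s [i..<i + b] (spop z s (Suc i) b v) es = xw z s ts *
  (if a = s then z powi (2 * int k - int b) * g s k
    + (z - inverse z ^ 3) * z powi (int b - 2 * int k - 1) * qint (b - k) * g (\<not> s) (Suc k)
   else z powi (int b - 2 * int k) * g (\<not> s) k)"
  unfolding e(1) suf' k_def by (rule strand_right_sym[OF z e(2) u e(3)])
 moreover have "spop z s i b (run z s [i..<i + b] v) es = xw z s ts * (c k *
  (if a = s then z powi (2 * int k - int b) * phi z s b (int k) (\<lambda>ts. v (pre @ s # ts @ suf))
    + (z - inverse z ^ 3) * z powi (2 * int k - int b + 1) * qint (nat (int k + 1)) * phi z s b (int k + 1) (\<lambda>ts. v (pre @ (\<not> s) # ts @ suf))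
   else z powi (int b - 2 * int k) * phi z s b (int k) (\<lambda>ts. v (pre @ (\<not> s) # ts @ suf))))"
  unfolding e(1) suf' spop_split[OF e(2,3)] sp strand_right_phi[OF z e(2)] k_def ..
 moreover have "nat (int k + 1) = Suc k" "int k + 1 = int (Suc k)" by simp_all
 moreover have "c (Suc k) * (z powi (int b - 2 * int k - 1) * qint (b - k)) * phi z s b (int (Suc k)) (\<lambda>ts. v (pre @ (\<not> s) # ts @ suf))
   = c k * (z powi (2 * int k - int b + 1) * qint (Suc k)) * phi z s b (int (Suc k)) (\<lambda>ts. v (pre @ (\<not> s) # ts @ suf))"
  by (rule ratio) (rule phi_large, simp)
 moreover have "w * zb * qb * (cS * PH) = ck * (w * zc * qk * PH)" if "cS * (zb * qb) * PH = ck * (zc * qk) * PH"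
  for w zb qb cS PH ck zc qk :: ratfun
 proof -
  have "w * zb * qb * (cS * PH) = w * (cS * (zb * qb) * PH)" by (simp only: mult_ac)
  also have "\<dots> = ck * (w * zc * qk * PH)" unfolding that by (simp only: mult_ac)
  finally show ?thesis .
 qed
 moreover have "z powi e * g d k = c k * (z powi e * phi z s b (int k) (\<lambda>ds. v (pre @ d # ds @ suf)))" for d e
  by (simp add: g_def mult_ac)
 ultimately show "run z s [i..<i + b] (spop z s (Suc i) b v) es = spop z s i b (run z s [i..<i + b] v) es"
  by (cases "a = s") (simp_all only: if_True if_False refl distrib_left g_def[of _ "Suc k"])
qed

lemma qbin_sym: "k \<le> n ==> qbin n (n - k) = qbin n k"
 by (simp add: qbin_def mult.commute)

lemma xw_rev: "xw z s (rev es) = xw z (\<not> s) es"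
 by (simp add: xw_def ninv_rev)

lemma cnt_Not': "length es = b ==> cnt (\<not> s) es = b - cnt s es"
 using cnt_Not[where s = s and es = es] by simp

text \<open>Reversing words turns the symmetric function for the sign \<open>s\<close> into the one for the other sign.\<close>

lemma sp_mirror:
 assumes "length ts = b"
 shows "sp z s b (\<lambda>ds. f (rev ds)) ts = sp z (\<not> s) b f (rev ts)"
proof -
 let ?k = "cnt s ts"
 have le: "?k \<le> b" using cnt_le_length[of ts s] assms by simp
 have "phi z s b (int ?k) (\<lambda>ds. f (rev ds)) = (\<Sum>es\<in>words b. if cnt s (rev es) = ?k then xw z s (rev es) * f es else 0)"
  unfolding phi_def using sum_words_rev[of "\<lambda>es. if cnt s es = ?k then xw z s es * f (rev es) else 0" b]
  by (simp only: rev_rev_ident of_nat_eq_iff)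
 also have "\<dots> = phi z (\<not> s) b (int (b - ?k)) f"
  unfolding phi_def
 proof (rule sum.cong[OF refl])
  fix es assume "es \<in> words b"
  then have l: "length es = b" by (simp add: words_def)
  have "cnt s (rev es) = ?k \<longleftrightarrow> int (cnt (\<not> s) es) = int (b - ?k)"
   using cnt_Not'[OF l, of s] cnt_le_length[of es s] l le by auto
  then show "(if cnt s (rev es) = ?k then xw z s (rev es) * f es else 0)
    = (if int (cnt (\<not> s) es) = int (b - ?k) then xw z (\<not> s) es * f es else 0)"
   by (simp add: xw_rev)
 qed
 finally have ph: "phi z s b (int ?k) (\<lambda>ds. f (rev ds)) = phi z (\<not> s) b (int (b - ?k)) f" .
 have c: "cnt (\<not> s) (rev ts) = b - ?k" using cnt_Not'[OF assms, of s] by simp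
 have x: "xw z (\<not> s) (rev ts) = xw z s ts" by (simp add: xw_rev)
 show ?thesis
  unfolding sp_def ph c x qbin_sym[OF le] using le by (simp add: of_nat_diff mult.commute)
qed

lemma spop_mirror:
 assumes "length es = N" "i + b \<le> N"
 shows "spop z s i b (\<lambda>ds. v (rev ds)) es = spop z (\<not> s) (N - i - b) b v (rev es)"
proof -
 obtain pre ts suf where e: "es = pre @ ts @ suf" "length pre = i" "length ts = b"
  using list_window[of i b es] assms by metis
 have l: "length (rev suf) = N - i - b" "length (rev ts) = b" using e assms by auto
 have r: "rev es = rev suf @ rev ts @ rev pre" by (simp add: e)
 show ?thesis
  unfolding r spop_split[OF l] unfolding e(1) spop_split[OF e(2,3)]
  using sp_mirror[OF e(3), of z s "\<lambda>ds. v (rev suf @ ds @ rev pre)"] by simp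
qed

lemma cz_mirror:
 assumes "length es = N" "i + 2 \<le> N"
 shows "cz z s i (\<lambda>ds. v (rev ds)) es = cz z (\<not> s) (N - 2 - i) v (rev es)"
proof -
 define pre p r suf where "pre = take i es" "p = es ! i" "r = es ! (i + 1)" "suf = drop (i + 2) es"
 then have e: "es = pre @ p # r # suf" and l: "length pre = i" "length (rev suf) = N - 2 - i"
  using nth_split2[of i es] assms by auto
 have r: "rev es = rev suf @ r # p # rev pre" by (simp add: e)
 show ?thesis unfolding r cz_split[OF l(2)] unfolding e cz_split[OF l(1)] by auto
qed

lemma run_mirror:
 assumes "\<forall>i\<in>set w. i + 2 \<le> N" "length es = N"
 shows "run z s w (\<lambda>ds. v (rev ds)) es = run z (\<not> s) (map (\<lambda>i. N - 2 - i) w) v (rev es)"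
 using assms
proof (induction w arbitrary: v)
 case (Cons i w)
 have "eqv N (cz z s i (\<lambda>ds. v (rev ds))) (\<lambda>ds. cz z (\<not> s) (N - 2 - i) v (rev ds))"
  unfolding eqv_def using cz_mirror Cons.prems by simp
 from run_cong[OF this, of w] show ?case
  using Cons by (simp add: eqv_def)
qed simp

lemma map_mirror_upt: "i + b + 1 \<le> N ==> map (\<lambda>j. N - 2 - j) (rev [i..<i + b]) = [N - 1 - i - b..<N - 1 - i - b + b]"
 by (rule nth_equalityI) (auto simp: rev_nth)

lemma strand_left_spop:
 assumes z: "unit_A z" and N: "i + b + 1 \<le> N"
 shows "eqv N (run z s (rev [i..<i + b]) (spop z s i b v)) (spop z s (Suc i) b (run z s (rev [i..<i + b]) v))"
 unfolding eqv_def
proof (intro allI impI)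
 fix es :: "bool list" assume l: "length es = N"
 define j where "j = N - 1 - i - b"
 have j: "Suc j = N - i - b" "N - Suc i - b = j" "j + b + 1 \<le> N" using N by (auto simp: j_def)
 define v' where "v' = (\<lambda>ds. v (rev ds))"
 have v: "v = (\<lambda>ds. v' (rev ds))" by (simp add: v'_def)
 have w: "\<forall>k\<in>set (rev [i..<i + b]). k + 2 \<le> N" using N by auto
 have eq: "eqv N (spop z s i b v) (\<lambda>ds. spop z (\<not> s) (Suc j) b v' (rev ds))"
  unfolding eqv_def using spop_mirror[of _ N i b z s v'] N by (simp add: j(1) v)
 have "run z s (rev [i..<i + b]) (spop z s i b v) es = run z s (rev [i..<i + b]) (\<lambda>ds. spop z (\<not> s) (Suc j) b v' (rev ds)) es"
  using run_cong[OF eq w] l by (simp add: eqv_def)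
 also have "\<dots> = run z (\<not> s) [j..<j + b] (spop z (\<not> s) (Suc j) b v') (rev es)"
  unfolding run_mirror[OF w l] map_mirror_upt[OF N] j_def ..
 also have "\<dots> = spop z (\<not> s) j b (run z (\<not> s) [j..<j + b] v') (rev es)"
  using strand_right_spop[OF z j(3), of "\<not> s" v'] l by (simp add: eqv_def)
 also have "\<dots> = spop z s (Suc i) b (\<lambda>ds. run z (\<not> s) [j..<j + b] v' (rev ds)) es"
  using spop_mirror[OF l, of "Suc i" b z s "run z (\<not> s) [j..<j + b] v'"] N j(2) by simp
 also have "\<dots> = spop z s (Suc i) b (run z s (rev [i..<i + b]) v) es"
 proof -
  have "eqv N (\<lambda>ds. run z (\<not> s) [j..<j + b] v' (rev ds)) (run z s (rev [i..<i + b]) v)"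
   unfolding eqv_def v using run_mirror[OF w, of _ z s v'] map_mirror_upt[OF N] by (simp add: j_def)
  from spop_cong[OF this, of "Suc i" b z s] show ?thesis using N l by (simp add: eqv_def)
 qed
 finally show "run z s (rev [i..<i + b]) (spop z s i b v) es = spop z s (Suc i) b (run z s (rev [i..<i + b]) v) es" .
qed

text \<open>The crossings, in order, of a cable of \<open>a\<close> strands at position \<open>i\<close> with the next \<open>b\<close> strands.\<close>

fun gridw :: "nat => nat => nat => nat list" where
 "gridw i 0 b = []"
| "gridw i (Suc a) b = gridw (Suc i) a b @ [i..<i + b]"

lemma gridw_bound: "j \<in> set (gridw i a b) ==> j + 2 \<le> i + a + b"
 by (induction i a b rule: gridw.induct) auto

lemma gridw_cable: "concat (map (\<lambda>j. map (\<lambda>k. f (i + j + k)) [0..<b]) (rev [0..<a])) = map f (gridw i a b)"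
proof (induction a arbitrary: i)
 case (Suc a)
 have r: "rev [0..<Suc a] = map Suc (rev [0..<a]) @ [0]"
  by (simp add: rev_map[symmetric] map_Suc_upt upt_conv_Cons del: upt_Suc)
 have "map (\<lambda>k. f (i + k)) [0..<b] = map f [i..<i + b]"
  by (rule nth_equalityI) auto
 then show ?case unfolding r using Suc.IH[of "Suc i"] by (simp add: o_def)
qed simp

lemma cz_commute:
 assumes "i + 2 \<le> j" "j + 2 \<le> N"
 shows "eqv N (cz z s i (cz z s j v)) (cz z s j (cz z s i v))"
 unfolding eqv_def
proof (intro allI impI)
 fix es :: "bool list" assume l: "length es = N"
 define pre p r suf' where d: "pre = take i es" "p = es ! i" "r = es ! (i + 1)" "suf' = drop (i + 2) es"
 have e: "es = pre @ p # r # suf'" and lpre: "length pre = i" using nth_split2[of i es] assms l d by auto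
 define k where "k = j - i - 2"
 have k: "j = i + 2 + k" "k + 2 \<le> length suf'" using assms l e lpre by (auto simp: k_def)
 define suf p' r' \<gamma> where d': "suf = take k suf'" "p' = suf' ! k" "r' = suf' ! (k + 1)" "\<gamma> = drop (k + 2) suf'"
 have e': "suf' = suf @ p' # r' # \<gamma>" and lsuf: "length suf = k" using nth_split2[OF k(2)] k d' by auto
 have J: "cz z s j w (pre @ a # c # suf @ b # d # \<gamma>) =
  (if b = d then z * w (pre @ a # c # suf @ b # d # \<gamma>)
   else inverse z * w (pre @ a # c # suf @ d # b # \<gamma>) + (if b = s then 0 else (z - inverse z ^ 3) * w (pre @ a # c # suf @ b # d # \<gamma>)))"
  for w a b c d
  using cz_split[of "pre @ a # c # suf" j z s w b d \<gamma>] lpre lsuf k(1) by simp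
 show "cz z s i (cz z s j v) es = cz z s j (cz z s i v) es"
  unfolding e e' J cz_split[OF lpre] by (auto simp: algebra_simps)
qed

lemma cz_run_commute:
 assumes "\<forall>j\<in>set w. i + 2 \<le> j \<and> j + 2 \<le> N" "i + 2 \<le> N"
 shows "eqv N (cz z s i (run z s w v)) (run z s w (cz z s i v))"
 using assms
proof (induction w arbitrary: v)
 case (Cons j w)
 have "eqv N (cz z s i (run z s w (cz z s j v))) (run z s w (cz z s i (cz z s j v)))"
  using Cons by auto
 also have "eqv N \<dots> (run z s w (cz z s j (cz z s i v)))"
  using Cons.prems by (intro run_cong cz_commute) auto
 finally show ?case by simp
qed simp

lemma run_commute:
 assumes "\<forall>i\<in>set w1. \<forall>j\<in>set w2. i + 2 \<le> j" "\<forall>i\<in>set w1. i + 2 \<le> N" "\<forall>j\<in>set w2. j + 2 \<le> N"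
 shows "eqv N (run z s w1 (run z s w2 v)) (run z s w2 (run z s w1 v))"
 using assms
proof (induction w1 arbitrary: v)
 case (Cons i w1)
 have "eqv N (cz z s i (run z s w2 v)) (run z s w2 (cz z s i v))"
  using Cons.prems by (intro cz_run_commute) auto
 then have "eqv N (run z s w1 (cz z s i (run z s w2 v))) (run z s w1 (run z s w2 (cz z s i v)))"
  using Cons.prems by (intro run_cong) auto
 also have "eqv N \<dots> (run z s w2 (run z s w1 (cz z s i v)))"
  using Cons by auto
 finally show ?case by simp
qed simp

text \<open>The crossings of a grid may also be done column by column, since distant crossings
commute. The row form serves to slide a projection on one cable, the column form on the other.\<close>

lemma gridw_column:
 assumes "i + a + Suc b \<le> N"
 shows "eqv N (run z s (gridw i a (Suc b)) v) (run z s (rev [i + b..<i + b + a]) (run z s (gridw i a b) v))"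
 using assms
proof (induction a arbitrary: i)
 case (Suc a)
 let ?w = "rev [Suc i + b..<Suc i + b + a]"
 have r: "rev [i + b..<i + b + Suc a] = ?w @ [i + b]"
  by (simp add: upt_conv_Cons del: upt_Suc)
 have "Suc i + a + Suc b \<le> N" using Suc.prems by simp
 then have "eqv N (run z s (gridw (Suc i) a (Suc b)) v) (run z s ?w (run z s (gridw (Suc i) a b) v))"
  by (rule Suc.IH)
 then have "eqv N (run z s [i..<i + b] (run z s (gridw (Suc i) a (Suc b)) v)) (run z s [i..<i + b] (run z s ?w (run z s (gridw (Suc i) a b) v)))"
  using Suc.prems by (intro run_cong) auto
 also have "eqv N \<dots> (run z s ?w (run z s [i..<i + b] (run z s (gridw (Suc i) a b) v)))"
  using Suc.prems by (intro run_commute) auto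
 finally have "eqv N (cz z s (i + b) (run z s [i..<i + b] (run z s (gridw (Suc i) a (Suc b)) v)))
   (cz z s (i + b) (run z s ?w (run z s [i..<i + b] (run z s (gridw (Suc i) a b) v))))"
  using Suc.prems by (intro cz_cong) auto
 then show ?case unfolding r by simp
qed simp

lemma gridw_0: "gridw i a 0 = []"
 by (induction a arbitrary: i) auto

lemma grid_spop_right:
 assumes z: "unit_A z" and "i + a + b \<le> N"
 shows "eqv N (run z s (gridw i a b) (spop z s (i + a) b v)) (spop z s i b (run z s (gridw i a b) v))"
 using assms(2)
proof (induction a arbitrary: i)
 case (Suc a)
 have "eqv N (run z s (gridw (Suc i) a b) (spop z s (i + Suc a) b v)) (spop z s (Suc i) b (run z s (gridw (Suc i) a b) v))"
  using Suc.IH[of "Suc i"] Suc.prems by simp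
 then have "eqv N (run z s [i..<i + b] (run z s (gridw (Suc i) a b) (spop z s (i + Suc a) b v)))
   (run z s [i..<i + b] (spop z s (Suc i) b (run z s (gridw (Suc i) a b) v)))"
  using Suc.prems by (intro run_cong) auto
 also have "eqv N \<dots> (spop z s i b (run z s [i..<i + b] (run z s (gridw (Suc i) a b) v)))"
  using Suc.prems by (intro strand_right_spop[OF z]) auto
 finally show ?case by simp
qed simp

lemma grid_spop_left:
 assumes z: "unit_A z" and "i + a + b \<le> N"
 shows "eqv N (run z s (gridw i a b) (spop z s i a v)) (spop z s (i + b) a (run z s (gridw i a b) v))"
 using assms(2)
proof (induction b)
 case 0
 then show ?case by (simp add: gridw_0)
next
 case (Suc b)
 let ?w = "rev [i + b..<i + b + a]"
 have w: "\<forall>j\<in>set ?w. j + 2 \<le> N" using Suc.prems by auto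
 have "eqv N (run z s (gridw i a (Suc b)) (spop z s i a v)) (run z s ?w (run z s (gridw i a b) (spop z s i a v)))"
  using Suc.prems by (intro gridw_column) auto
 also have "eqv N \<dots> (run z s ?w (spop z s (i + b) a (run z s (gridw i a b) v)))"
  using Suc by (intro run_cong w) auto
 also have "eqv N \<dots> (spop z s (Suc (i + b)) a (run z s ?w (run z s (gridw i a b) v)))"
  using Suc.prems by (intro strand_left_spop[OF z]) auto
 also have "eqv N \<dots> (spop z s (Suc (i + b)) a (run z s (gridw i a (Suc b)) v))"
  using Suc.prems by (intro spop_cong eqv_sym[OF gridw_column]) auto
 finally show ?case by simp
qed

lemma xw_inverse_False:
 "xw (inverse A) False es = A powi (- 2 * (int (cnt True es) * (int (length es) - int (cnt True es)))) * xw A True es"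
proof -
 have "int (ninv True es) + int (ninv False es) = int (cnt True es * (length es - cnt True es))"
 proof -
  have "ninv True es + ninv False es = cnt True es * (length es - cnt True es)"
   using ninv_Not[where s = True and es = es] by simp
  then show ?thesis by (simp only: of_nat_add[symmetric])
 qed
 also have "\<dots> = int (cnt True es) * (int (length es) - int (cnt True es))"
  using cnt_le_length[of es True] by (simp add: of_nat_diff)
 finally have "- (2 * int (ninv False es)) = - 2 * (int (cnt True es) * (int (length es) - int (cnt True es))) + 2 * int (ninv True es)"
  by simp
 then show ?thesis
  unfolding xw_def inverse_A_powi power_int_add[OF disjI1[OF A_nonzero], symmetric] by (rule arg_cong)
qed

text \<open>Positive crossings suggest the parameters \<open>A\<close>, \<open>True\<close>, negative ones \<open>1/A\<close>, \<open>False\<close>. The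
symmetric functions differ by a factor depending on the number of signs only, so the projection is the same.\<close>

lemma sp_inverse:
 assumes "length ts = b"
 shows "sp (inverse A) False b f ts = sp A True b f ts"
proof -
 let ?k = "cnt True ts"
 let ?d = "int ?k * (int b - int ?k)"
 have le: "?k \<le> b" using cnt_le_length[of ts True] assms by simp
 have c: "cnt False ts = b - ?k" using cnt_Not'[OF assms, of True] by simp
 have "phi (inverse A) False b (int (b - ?k)) f = A powi (- 2 * ?d) * phi A True b (int ?k) f"
  unfolding phi_def sum_distrib_left
 proof (rule sum.cong[OF refl])
  fix es assume "es \<in> words b"
  then have l: "length es = b" by (simp add: words_def)
  have "int (cnt False es) = int (b - ?k) \<longleftrightarrow> int (cnt True es) = int ?k"
   using cnt_Not'[OF l, of True] cnt_le_length[of es True] l le by auto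
  then show "(if int (cnt False es) = int (b - ?k) then xw (inverse A) False es * f es else 0)
    = A powi (- 2 * ?d) * (if int (cnt True es) = int ?k then xA es * f es else 0)"
   using l by (auto simp: xw_inverse_False)
 qed
 moreover have "inverse A powi (- 2 * (int (b - ?k) * (int b - int (b - ?k)))) = A powi (2 * ?d)"
  unfolding inverse_A_powi by (rule arg_cong) (use le in \<open>simp add: of_nat_diff mult.commute\<close>)
 moreover have "A powi (- 2 * ?d) * A powi (2 * ?d) = 1"
  by (simp flip: power_int_add)
 moreover have "xw (inverse A) False ts = A powi (- 2 * ?d) * xA ts"
  using assms by (simp add: xw_inverse_False)
 ultimately show ?thesis
  unfolding sp_def c qbin_sym[OF le] by (simp add: mult_ac)
qed

lemma spop_A: "spop A True = Pop"
 by (intro ext) (simp add: spop_def Pop_def)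

lemma spop_inverse_A:
 assumes "i + b \<le> N"
 shows "eqv N (spop (inverse A) False i b v) (Pop i b v)"
 unfolding eqv_def
proof (intro allI impI)
 fix es :: "bool list" assume l: "length es = N"
 obtain pre ts suf where e: "es = pre @ ts @ suf" "length pre = i" "length ts = b"
  using list_window[of i b es] assms l by metis
 show "spop (inverse A) False i b v es = Pop i b v es"
  unfolding e(1) spop_split[OF e(2,3)] Pop_split[OF e(2,3)] by (rule sp_inverse[OF e(3)])
qed

lemma Pop_cong: "eqv N v u ==> i + b \<le> N ==> eqv N (Pop i b v) (Pop i b u)"
 using spop_cong[of N v u i b A True] by (simp add: spop_A)

text \<open>The parameters of positive and of negative crossings.\<close>

definition signed :: "ratfun => bool => bool" where
 "signed z s \<longleftrightarrow> z = A \<and> s \<or> z = inverse A \<and> \<not> s"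

lemma signed_unit: "signed z s ==> unit_A z"
 by (auto simp: signed_def)

lemma spop_signed: "signed z s ==> i + b \<le> N ==> eqv N (spop z s i b v) (Pop i b v)"
 using spop_inverse_A[of i b N v] by (auto simp: signed_def spop_A)

lemma grid_Pop_right:
 assumes z: "signed z s" and N: "i + a + b \<le> N"
 shows "eqv N (run z s (gridw i a b) (Pop (i + a) b v)) (Pop i b (run z s (gridw i a b) v))"
proof -
 have w: "\<forall>j\<in>set (gridw i a b). j + 2 \<le> N" using gridw_bound N by fastforce
 have "eqv N (run z s (gridw i a b) (Pop (i + a) b v)) (run z s (gridw i a b) (spop z s (i + a) b v))"
  using N by (intro run_cong[OF eqv_sym[OF spop_signed[OF z]] w]) auto
 also have "eqv N \<dots> (spop z s i b (run z s (gridw i a b) v))"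
  by (rule grid_spop_right[OF signed_unit[OF z] N])
 also have "eqv N \<dots> (Pop i b (run z s (gridw i a b) v))"
  using N by (intro spop_signed[OF z]) auto
 finally show ?thesis .
qed

lemma grid_Pop_left:
 assumes z: "signed z s" and N: "i + a + b \<le> N"
 shows "eqv N (run z s (gridw i a b) (Pop i a v)) (Pop (i + b) a (run z s (gridw i a b) v))"
proof -
 have w: "\<forall>j\<in>set (gridw i a b). j + 2 \<le> N" using gridw_bound N by fastforce
 have "eqv N (run z s (gridw i a b) (Pop i a v)) (run z s (gridw i a b) (spop z s i a v))"
  using N by (intro run_cong[OF eqv_sym[OF spop_signed[OF z]] w]) auto
 also have "eqv N \<dots> (spop z s (i + b) a (run z s (gridw i a b) v))"
  by (rule grid_spop_left[OF signed_unit[OF z] N])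
 also have "eqv N \<dots> (Pop (i + b) a (run z s (gridw i a b) v))"
  using N by (intro spop_signed[OF z]) auto
 finally show ?thesis .
qed

text \<open>The Gaussian binomial counts words by inversions.\<close>

lemma phi_xw:
 assumes z: "unit_A z" and "k \<le> b"
 shows "phi z s b (int k) (xw z s) = z powi (2 * (int k * (int b - int k))) * qbin b k"
 using assms(2)
proof (induction b arbitrary: k)
 case 0
 then show ?case by (simp add: phi_0 xw_def)
next
 case (Suc b)
 have z0: "z \<noteq> 0" and z': "unit_A (inverse z)" using z by auto
 have r: "phi z s (Suc b) (int k) (xw z s) = phi z s b (int k - 1) (xw z s) + z powi (4 * int k) * phi z s b (int k) (xw z s)"
 proof -
  have "phi z s b (int k) (\<lambda>es. xw z s ((\<not> s) # es)) = z powi (2 * int k) * phi z s b (int k) (xw z s)"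
   unfolding phi_scale[symmetric] by (rule phi_cong) (simp add: xw_Cons[OF z0])
  moreover have "phi z s b (int k - 1) (\<lambda>es. xw z s (s # es)) = phi z s b (int k - 1) (xw z s)"
   by (rule phi_cong) (simp add: xw_Cons[OF z0])
  moreover have "z powi (4 * int k) = z powi (2 * int k) * z powi (2 * int k)"
   unfolding power_unit_add[OF z, symmetric] by (rule arg_cong) simp
  ultimately show ?thesis unfolding phi_Cons[OF z0] by simp
 qed
 show ?case
 proof (cases k)
  case 0
  then show ?thesis unfolding r using Suc.IH[of 0] by (simp add: phi_neg)
 next
  case (Suc j)
  then have jb: "j \<le> b" using Suc.prems by simp
  have 1: "phi z s b (int k - 1) (xw z s) = z powi (2 * (int j * (int b - int j))) * qbin b j"
   using Suc.IH[OF jb] Suc by simp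
  have 2: "phi z s b (int k) (xw z s) = z powi (2 * (int k * (int b - int k))) * qbin b k"
  proof (cases "k \<le> b")
   case True
   then show ?thesis by (rule Suc.IH)
  next
   case False
   then show ?thesis by (simp add: phi_large)
  qed
  have inv: "inverse z powi m = z powi (- m)" for m
   by (simp add: power_int_inverse power_int_minus)
  have e1: "z powi (2 * (int k * (int (Suc b) - int k))) * z powi (- (2 * (int b - int j))) = z powi (2 * (int j * (int b - int j)))"
   unfolding power_unit_add[OF z, symmetric] by (rule arg_cong) (simp add: Suc algebra_simps)
  have e2: "z powi (2 * (int k * (int (Suc b) - int k))) * z powi (- (- 2 * int k)) = z powi (4 * int k) * z powi (2 * (int k * (int b - int k)))"
   unfolding power_unit_add[OF z, symmetric] by (rule arg_cong) (simp add: algebra_simps)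
  show ?thesis
   unfolding r 1 2 using e1 e2 unfolding Suc qbin_Pascal[OF z'] inv
   by (simp only: distrib_left mult.assoc[symmetric])
 qed
qed

lemma phi_symmetric:
 assumes z: "unit_A z" and "k \<le> b" and "\<And>es. length es = b ==> f es = xw z s es * g (cnt s es)"
 shows "phi z s b (int k) f = z powi (2 * (int k * (int b - int k))) * qbin b k * g k"
proof -
 have "phi z s b (int k) f = phi z s b (int k) (\<lambda>es. g k * xw z s es)"
  by (rule phi_cong) (simp add: assms(3))
 then show ?thesis using phi_xw[OF z assms(2)] by (simp add: phi_scale mult_ac)
qed

lemma sp_symmetric:
 assumes z: "unit_A z" and "\<And>es. length es = b ==> f es = xw z s es * g (cnt s es)" and l: "length ts = b"
 shows "sp z s b f ts = f ts"
proof -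
 let ?k = "cnt s ts" let ?d = "int (cnt s ts) * (int b - int (cnt s ts))"
 have le: "?k \<le> b" using cnt_le_length[of ts s] l by simp
 have "z powi (- 2 * ?d) * z powi (2 * ?d) = 1"
  unfolding power_unit_add[OF z, symmetric] by simp
 moreover have "qbin b ?k \<noteq> 0" using le by (simp add: qbin_def)
 moreover have "p / q' * (r * q' * h) = h" if "p * r = 1" "q' \<noteq> 0" for p q' r h :: ratfun
 proof -
  have "p / q' * (r * q' * h) = (p * r) * h" using that(2) by simp
  then show ?thesis using that(1) by simp
 qed
 ultimately have "z powi (- 2 * ?d) / qbin b ?k * (z powi (2 * ?d) * qbin b ?k * g ?k) = g ?k"
  by blast
 moreover have "phi z s b (int ?k) f = z powi (2 * ?d) * qbin b ?k * g ?k"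
  by (rule phi_symmetric[OF z le assms(2)])
 ultimately show ?thesis
  by (simp only: sp_def assms(2)[OF l])
qed

lemma Pop_idem:
 assumes "i + b \<le> N"
 shows "eqv N (Pop i b (Pop i b v)) (Pop i b v)"
 unfolding eqv_def
proof (intro allI impI)
 fix es :: "bool list" assume l: "length es = N"
 obtain pre ts suf where e: "es = pre @ ts @ suf" "length pre = i" "length ts = b"
  using list_window[of i b es] assms l by metis
 have "Pop i b v (pre @ \<xi> @ suf) = xA \<xi> * (A powi (- 2 * (int (cnt True \<xi>) * (int b - int (cnt True \<xi>)))) / qbin b (cnt True \<xi>)
   * phi A True b (int (cnt True \<xi>)) (\<lambda>ds. v (pre @ ds @ suf)))" if "length \<xi> = b" for \<xi>
  unfolding Pop_split[OF e(2) that] sp_def ..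
 then have "sp A True b (\<lambda>ds. Pop i b v (pre @ ds @ suf)) ts = Pop i b v (pre @ ts @ suf)"
  by (intro sp_symmetric[OF _ _ e(3), where g = "\<lambda>k. A powi (- 2 * (int k * (int b - int k))) / qbin b k
   * phi A True b (int k) (\<lambda>ds. v (pre @ ds @ suf))"]) auto
 then show "Pop i b (Pop i b v) es = Pop i b v es"
  unfolding e(1) Pop_split[OF e(2,3), of "Pop i b v"] .
qed

definition qfall :: "nat => nat => ratfun" where
 "qfall m n = (if n \<le> m then qfact m / qfact (m - n) else 0)"

lemma qfall_0 [simp]: "qfall m 0 = 1"
 by (simp add: qfall_def)

lemma qfall_Suc: "qfall m (Suc n) = qint m * qfall (m - 1) n"
 by (cases m) (auto simp: qfall_def qfact_Suc)

text \<open>The matrix entry of two crossing symmetric cables: \<open>n\<close> signs are exchanged. It is the term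
of degree \<open>n\<close> of the universal R-matrix, \<open>qfall\<close> and \<open>qbin\<close> coming from powers and divided
powers of the root vectors.\<close>

definition gcoeff :: "ratfun => nat => nat => nat => nat => nat => ratfun" where
 "gcoeff z a b k l n = z powi ((int a - 2 * (int k - int n)) * (int b - 2 * (int l + int n)) + int n * (int n - 1))
   * (z powi 2 - z powi (- 2)) ^ n * qbin k n * qfall (b - l) n"

text \<open>Induction over the first cable, one strand at a time by \<open>strand_right_sym\<close>. The terms for \<open>n\<close>
and \<open>n - 1\<close> exchanged signs combine by the Pascal rule.\<close>

lemma grid_symmetric:
 assumes z: "unit_A z"
 assumes "length pre = i"
  and "\<And>\<zeta> ts. length \<zeta> = a ==> length ts = b ==> u (pre @ \<zeta> @ ts @ suf) = xw z s \<zeta> * xw z s ts * g (cnt s \<zeta>) (cnt s ts)"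
  and "length ts = b" "length \<zeta> = a"
 shows "run z s (gridw i a b) u (pre @ ts @ \<zeta> @ suf) = xw z s ts * xw z s \<zeta> *
  (\<Sum>n\<le>cnt s \<zeta>. gcoeff z a b (cnt s \<zeta>) (cnt s ts) n * g (cnt s \<zeta> - n) (cnt s ts + n))"
 using assms(2-)
proof (induction a arbitrary: i pre g \<zeta> ts)
 case 0
 then show ?case using "0.prems"(2)[of "[]" ts] by (simp add: xw_def gcoeff_def)
next
 case (Suc a)
 have z0: "z \<noteq> 0" using z by (rule unit_A_nonzero)
 obtain h \<zeta>' where \<zeta>: "\<zeta> = h # \<zeta>'" and l\<zeta>: "length \<zeta>' = a"
  using Suc.prems(4) by (cases \<zeta>) auto
 define gh where "gh h k l = (if h = s then g (Suc k) l else z powi (2 * int k) * g k l)" for h k l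
 define F where "F h k l = (\<Sum>n\<le>k. gcoeff z a b k l n * gh h (k - n) (l + n))" for h k l
 define k where "k = cnt s \<zeta>'"
 define l where "l = cnt s ts"
 have lb: "l \<le> b" using cnt_le_length[of ts s] Suc.prems(3) by (simp add: l_def)
 define u' where "u' = run z s (gridw (Suc i) a b) u"
 have u': "u' (pre @ h # \<xi> @ \<zeta>' @ suf) = xw z s \<xi> * (xw z s \<zeta>' * F h k (cnt s \<xi>))" if "length \<xi> = b" for \<xi> h
 proof -
  have "u ((pre @ [h]) @ \<zeta>1 @ ts1 @ suf) = xw z s \<zeta>1 * xw z s ts1 * gh h (cnt s \<zeta>1) (cnt s ts1)"
   if "length \<zeta>1 = a" "length ts1 = b" for \<zeta>1 ts1
   using Suc.prems(2)[of "h # \<zeta>1" ts1] that by (auto simp: xw_Cons[OF z0] gh_def)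
  from Suc.IH[OF _ this that l\<zeta>] show ?thesis
   using Suc.prems(1) by (simp add: u'_def F_def k_def mult_ac)
 qed
 have "run z s (gridw i (Suc a) b) u (pre @ ts @ \<zeta> @ suf) = run z s [i..<i + b] u' (pre @ ts @ h # (\<zeta>' @ suf))"
  by (simp add: u'_def \<zeta>)
 also have "\<dots> = xw z s ts *
  (if h = s then z powi (2 * int l - int b) * (xw z s \<zeta>' * F s k l)
    + (z - inverse z ^ 3) * z powi (int b - 2 * int l - 1) * qint (b - l) * (xw z s \<zeta>' * F (\<not> s) k (Suc l))
   else z powi (int b - 2 * int l) * (xw z s \<zeta>' * F (\<not> s) k l))"
  unfolding l_def by (rule strand_right_sym[OF z Suc.prems(1) _ Suc.prems(3)]) (rule u')
 finally have val: "run z s (gridw i (Suc a) b) u (pre @ ts @ \<zeta> @ suf) = \<dots>" .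
 define D where "D = z powi 2 - z powi (- 2)"
 have zD: "z - inverse z ^ 3 = z powi (- 1) * D"
  using z0 by (simp add: D_def power_int_minus field_simps eval_nat_numeral)
 show ?case
 proof (cases "h = s")
  case False
  have c: "cnt s \<zeta> = k" using False by (simp add: \<zeta> k_def)
  have x: "xw z s \<zeta> = z powi (2 * int k) * xw z s \<zeta>'" using False by (simp add: \<zeta> xw_Cons[OF z0] k_def)
  have "z powi (int b - 2 * int l) * F (\<not> s) k l = z powi (2 * int k) * (\<Sum>n\<le>k. gcoeff z (Suc a) b k l n * g (k - n) (l + n))"
   unfolding F_def sum_distrib_left
  proof (rule sum.cong[OF refl])
   fix n assume n: "n \<in> {..k}"
   have "z powi (int b - 2 * int l) * (z powi ((int a - 2 * (int k - int n)) * (int b - 2 * (int l + int n)) + int n * (int n - 1)) * z powi (2 * int (k - n)))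
    = z powi (2 * int k) * z powi ((int (Suc a) - 2 * (int k - int n)) * (int b - 2 * (int l + int n)) + int n * (int n - 1))"
    unfolding power_unit_add[OF z, symmetric] using n by (intro arg_cong[of _ _ "(powi) z"]) (simp add: of_nat_diff algebra_simps)
   then show "z powi (int b - 2 * int l) * (gcoeff z a b k l n * gh (\<not> s) (k - n) (l + n))
     = z powi (2 * int k) * (gcoeff z (Suc a) b k l n * g (k - n) (l + n))"
    unfolding gcoeff_def gh_def by (simp add: mult_ac)
  qed
  then show ?thesis unfolding val if_not_P[OF False] c x l_def[symmetric] by (simp add: mult_ac)
 next
  case True
  have c: "cnt s \<zeta> = Suc k" by (simp add: \<zeta> k_def True)
  have x: "xw z s \<zeta> = xw z s \<zeta>'" by (simp add: \<zeta> xw_Cons[OF z0] True)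
  define E where "E n = z powi ((int (Suc a) - 2 * (int (Suc k) - int n)) * (int b - 2 * (int l + int n)) + int n * (int n - 1))" for n
  define t where "t n = E n * D ^ n * qfall (b - l) n * g (Suc k - n) (l + n)" for n
  have 1: "z powi (2 * int l - int b) * F s k l = (\<Sum>n\<le>k. z powi (- 2 * int n) * qbin k n * t n)"
   unfolding F_def sum_distrib_left
  proof (rule sum.cong[OF refl])
   fix n assume n: "n \<in> {..k}"
   have "z powi (2 * int l - int b) * z powi ((int a - 2 * (int k - int n)) * (int b - 2 * (int l + int n)) + int n * (int n - 1))
    = z powi (- 2 * int n) * E n"
    unfolding E_def power_unit_add[OF z, symmetric] by (rule arg_cong) (simp add: algebra_simps)
   moreover have "Suc k - n = Suc (k - n)" using n by auto
   ultimately show "z powi (2 * int l - int b) * (gcoeff z a b k l n * gh s (k - n) (l + n)) = z powi (- 2 * int n) * qbin k n * t n"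
    unfolding gcoeff_def gh_def t_def D_def[symmetric] by (simp add: mult_ac)
  qed
  have 2: "(z - inverse z ^ 3) * z powi (int b - 2 * int l - 1) * qint (b - l) * F (\<not> s) k (Suc l)
    = (\<Sum>n\<le>k. z powi (2 * (int k - int n)) * qbin k n * t (Suc n))"
   unfolding F_def sum_distrib_left
  proof (rule sum.cong[OF refl])
   fix n assume n: "n \<in> {..k}"
   have "z powi (- 1) * (z powi (int b - 2 * int l - 1) * (z powi ((int a - 2 * (int k - int n)) * (int b - 2 * (int (Suc l) + int n)) + int n * (int n - 1)) * z powi (2 * int (k - n))))
    = z powi (2 * (int k - int n)) * E (Suc n)"
    unfolding E_def power_unit_add[OF z, symmetric] using n by (intro arg_cong[of _ _ "(powi) z"]) (simp add: of_nat_diff algebra_simps)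
   moreover have "qfall (b - l) (Suc n) = qint (b - l) * qfall (b - Suc l) n"
    by (simp add: qfall_Suc)
   moreover have "Suc k - Suc n = k - n" "l + Suc n = Suc l + n" by simp_all
   ultimately show "(z - inverse z ^ 3) * z powi (int b - 2 * int l - 1) * qint (b - l) * (gcoeff z a b k (Suc l) n * gh (\<not> s) (k - n) (Suc l + n))
     = z powi (2 * (int k - int n)) * qbin k n * t (Suc n)"
    unfolding gcoeff_def gh_def t_def D_def[symmetric] zD by (simp add: mult_ac)
  qed
  have 3: "gcoeff z (Suc a) b (Suc k) l n * g (Suc k - n) (l + n) = qbin (Suc k) n * t n" for n
   unfolding gcoeff_def t_def E_def D_def by (simp add: mult_ac)
  have "(\<Sum>n\<le>Suc k. gcoeff z (Suc a) b (Suc k) l n * g (Suc k - n) (l + n)) = (\<Sum>n\<le>Suc k. qbin (Suc k) n * t n)"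
   by (simp only: 3)
  also have "\<dots> = t 0 + (\<Sum>n\<le>k. qbin (Suc k) (Suc n) * t (Suc n))"
   by (subst sum.atMost_Suc_shift) simp
  also have "(\<Sum>n\<le>k. qbin (Suc k) (Suc n) * t (Suc n)) = (\<Sum>n\<le>k. z powi (- 2 * int (Suc n)) * qbin k (Suc n) * t (Suc n))
    + (\<Sum>n\<le>k. z powi (2 * (int k - int n)) * qbin k n * t (Suc n))"
   by (simp only: qbin_Pascal[OF z] distrib_right sum.distrib)
  also have "t 0 + ((\<Sum>n\<le>k. z powi (- 2 * int (Suc n)) * qbin k (Suc n) * t (Suc n)) + (\<Sum>n\<le>k. z powi (2 * (int k - int n)) * qbin k n * t (Suc n)))
    = (\<Sum>n\<le>Suc k. z powi (- 2 * int n) * qbin k n * t n) + (\<Sum>n\<le>k. z powi (2 * (int k - int n)) * qbin k n * t (Suc n))"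
   by (simp only: sum.atMost_Suc_shift add.assoc) simp
  also have "(\<Sum>n\<le>Suc k. z powi (- 2 * int n) * qbin k n * t n) = (\<Sum>n\<le>k. z powi (- 2 * int n) * qbin k n * t n)"
   by simp
  finally have sum: "(\<Sum>n\<le>Suc k. gcoeff z (Suc a) b (Suc k) l n * g (Suc k - n) (l + n)) =
    z powi (2 * int l - int b) * F s k l + (z - inverse z ^ 3) * z powi (int b - 2 * int l - 1) * qint (b - l) * F (\<not> s) k (Suc l)"
   by (simp only: 1 2)
  show ?thesis unfolding val if_P[OF True] c x l_def[symmetric] sum by (simp add: algebra_simps)
 qed
qed

section \<open>Symmetric cables, maxima and minima\<close>

text \<open>Operators with a kernel on \<open>m\<close> strands at position \<open>i\<close>, producing \<open>m'\<close> strands. All that is needed of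
this is that operators on disjoint groups of strands commute.\<close>

definition local_op :: "(bool list => bool list => ratfun) => nat => nat => nat => (vec => vec) => bool" where
 "local_op K i m m' f \<longleftrightarrow> (\<forall>v pre ts suf. length pre = i \<longrightarrow> length ts = m' \<longrightarrow>
   f v (pre @ ts @ suf) = (\<Sum>ds\<in>words m. K ts ds * v (pre @ ds @ suf)))"

lemma local_opD: "local_op K i m m' f ==> length pre = i ==> length ts = m' ==>
  f v (pre @ ts @ suf) = (\<Sum>ds\<in>words m. K ts ds * v (pre @ ds @ suf))"
 by (auto simp: local_op_def)

lemma local_op_commute:
 assumes 1: "local_op K1 i m1 m1' f" and 2: "local_op K2 (i + m1' + d) m2 m2' g"
  and 3: "local_op K2 (i + m1 + d) m2 m2' g'" and N: "i + m1' + d + m2' \<le> N"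
 shows "eqv N (g (f v)) (f (g' v))"
 unfolding eqv_def
proof (intro allI impI)
 fix es :: "bool list" assume l: "length es = N"
 obtain pre ts suf' where e: "es = pre @ ts @ suf'" "length pre = i" "length ts = m1'"
  using list_window[of i m1' es] N l by auto
 obtain \<gamma> ts' suf where e': "suf' = \<gamma> @ ts' @ suf" "length \<gamma> = d" "length ts' = m2'"
  using list_window[of d m2' suf'] N l e by auto
 have A: "g w (pre @ ts @ \<gamma> @ ts' @ suf) = (\<Sum>ds'\<in>words m2. K2 ts' ds' * w (pre @ ts @ \<gamma> @ ds' @ suf))" for w
  using local_opD[OF 2, of "pre @ ts @ \<gamma>" ts' w suf] e e' by simp
 have B: "g' w (pre @ ds @ \<gamma> @ ts' @ suf) = (\<Sum>ds'\<in>words m2. K2 ts' ds' * w (pre @ ds @ \<gamma> @ ds' @ suf))" if "ds \<in> words m1" for w ds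
  using local_opD[OF 3, of "pre @ ds @ \<gamma>" ts' w suf] e e' that by (simp add: words_def)
 have "g (f v) es = (\<Sum>ds'\<in>words m2. K2 ts' ds' * (\<Sum>ds\<in>words m1. K1 ts ds * v (pre @ ds @ \<gamma> @ ds' @ suf)))"
  unfolding e(1) e'(1) A local_opD[OF 1 e(2,3)] ..
 also have "\<dots> = (\<Sum>ds\<in>words m1. K1 ts ds * (\<Sum>ds'\<in>words m2. K2 ts' ds' * v (pre @ ds @ \<gamma> @ ds' @ suf)))"
  unfolding sum_distrib_left by (subst sum.swap) (simp add: mult_ac)
 also have "\<dots> = f (g' v) es"
  unfolding e(1) e'(1) local_opD[OF 1 e(2,3)] by (intro sum.cong refl) (simp add: B)
 finally show "g (f v) es = f (g' v) es" .
qed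

definition PopK :: "nat => bool list => bool list => ratfun" where
 "PopK b ts ds = xA ts * (A powi (- 2 * (int (cnt True ts) * (int b - int (cnt True ts)))) / qbin b (cnt True ts))
   * (if cnt True ds = cnt True ts then xA ds else 0)"

lemma local_Pop: "local_op (PopK b) i b b (Pop i b)"
 unfolding local_op_def
proof (intro allI impI)
 fix v :: vec and pre ts suf :: "bool list" assume "length pre = i" "length ts = b"
 then show "Pop i b v (pre @ ts @ suf) = (\<Sum>ds\<in>words b. PopK b ts ds * v (pre @ ds @ suf))"
  unfolding Pop_split[OF \<open>length pre = i\<close> \<open>length ts = b\<close>] sp_def phi_def sum_distrib_left PopK_def
  by (intro sum.cong refl) auto
qed

fun shift :: "nat => slice => slice" where
 "shift i (Arcs j ls) = Arcs (i + j) ls"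
| "shift i (Join j) = Join (i + j)"
| "shift i (CrossPos j) = CrossPos (i + j)"
| "shift i (CrossNeg j) = CrossNeg (i + j)"

lemma act_shift:
 assumes "length pre = i" "sfit s m" "length ds = swd s m"
 shows "act (shift i s) v (pre @ ds @ suf) = act s (\<lambda>es. v (pre @ es @ suf)) ds"
proof -
 have c: "cz z t (i + j) v (pre @ ds @ suf) = cz z t j (\<lambda>es. v (pre @ es @ suf)) ds" if "j + 2 \<le> length ds" for z t j
  by (rule cz_shift[OF assms(1) that])
 show ?thesis
 proof (cases s)
  case (Arcs j ls)
  have "j + length ls \<le> length ds" using assms Arcs by simp
  then show ?thesis using assms Arcs by simp
 next
  case (Join j)
  then have "j \<le> length ds" using assms by simp
  then show ?thesis using assms Join by (simp add: cap_at_def)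
 next
  case (CrossPos j)
  then have "act (shift i s) v (pre @ ds @ suf) = cz A True (i + j) v (pre @ ds @ suf)"
   using assms by (simp add: act_CrossPos del: act.simps)
  then show ?thesis using assms CrossPos by (simp add: c act_CrossPos del: act.simps)
 next
  case (CrossNeg j)
  then have "act (shift i s) v (pre @ ds @ suf) = cz (inverse A) False (i + j) v (pre @ ds @ suf)"
   using assms by (simp add: act_CrossNeg del: act.simps)
  then show ?thesis using assms CrossNeg by (simp add: c act_CrossNeg del: act.simps)
 qed
qed

lemma runs_shift:
 "vword m w m' ==> length pre = i ==> length ts = m' ==>
  runs (map (shift i) w) v (pre @ ts @ suf) = runs w (\<lambda>es. v (pre @ es @ suf)) ts"
proof (induction w arbitrary: m v)
 case (Cons s w)
 have "eqv (swd s m) (\<lambda>ds. act (shift i s) v (pre @ ds @ suf)) (act s (\<lambda>es. v (pre @ es @ suf)))"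
  unfolding eqv_def using Cons.prems by (intro allI impI act_shift[where m = m]) auto
 from runs_cong[OF this, of w m'] show ?case using Cons by (auto simp: eqv_def)
qed simp

lemma runs_sum:
 "finite I ==> runs w (\<lambda>es. \<Sum>j\<in>I. f j * v j es) es = (\<Sum>j\<in>I. f j * runs w (v j) es)"
proof (induction I rule: finite_induct)
 case empty
 then show ?case using runs_lin[of w 0 "\<lambda>_. 0" 0 "\<lambda>_. 0"] by simp
next
 case (insert j I)
 then show ?case using runs_lin[of w "f j" "v j" 1 "\<lambda>es. \<Sum>j\<in>I. f j * v j es"] by simp
qed

lemma local_runs:
 assumes "vword m w m'"
 shows "local_op (\<lambda>ts ds. runs w (\<lambda>es. if es = ds then 1 else 0) ts) i m m' (runs (map (shift i) w))"
 unfolding local_op_def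
proof (intro allI impI)
 fix v :: vec and pre ts suf :: "bool list" assume l: "length pre = i" "length ts = m'"
 have "eqv m (\<lambda>es. v (pre @ es @ suf)) (\<lambda>es. \<Sum>ds\<in>words m. v (pre @ ds @ suf) * (if es = ds then 1 else 0))"
  unfolding eqv_def
 proof (intro allI impI)
  fix es :: "bool list" assume "length es = m"
  then have "es \<in> words m" by (simp add: words_def)
  moreover have "(\<Sum>ds\<in>words m. v (pre @ ds @ suf) * (if es = ds then 1 else 0)) = (\<Sum>ds\<in>words m. if ds = es then v (pre @ es @ suf) else 0)"
   by (rule sum.cong) auto
  ultimately show "v (pre @ es @ suf) = (\<Sum>ds\<in>words m. v (pre @ ds @ suf) * (if es = ds then 1 else 0))"
   by simp
 qed
 from runs_cong[OF this assms] l
 have "runs w (\<lambda>es. v (pre @ es @ suf)) ts = (\<Sum>ds\<in>words m. v (pre @ ds @ suf) * runs w (\<lambda>es. if es = ds then 1 else 0) ts)"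
  by (simp add: eqv_def runs_sum)
 then show "runs (map (shift i) w) v (pre @ ts @ suf) = (\<Sum>ds\<in>words m. runs w (\<lambda>es. if es = ds then 1 else 0) ts * v (pre @ ds @ suf))"
  unfolding runs_shift[OF assms l] by (simp add: mult.commute)
qed

definition capw :: "bool list => ratfun" where
 "capw es = prod_list (map (\<lambda>a. if a then - A else inverse A) es)"

definition cupw :: "bool list => ratfun" where
 "cupw es = prod_list (map (\<lambda>a. if a then A else - inverse A) es)"

lemma capw_eq: "length es = b ==> capw es = (- A) ^ cnt True es * inverse A ^ (b - cnt True es)"
proof (induction es arbitrary: b)
 case (Cons a es)
 have "Suc (length es) - cnt True es = Suc (length es - cnt True es)"
  using cnt_le_length[of es True] by (simp add: Suc_diff_le)
 then show ?case using Cons.IH[OF refl] Cons.prems by (auto simp: capw_def)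
qed (simp add: capw_def)

lemma cupw_eq: "length es = b ==> cupw es = A ^ cnt True es * (- inverse A) ^ (b - cnt True es)"
proof (induction es arbitrary: b)
 case (Cons a es)
 have "Suc (length es) - cnt True es = Suc (length es - cnt True es)"
  using cnt_le_length[of es True] by (simp add: Suc_diff_le)
 then show ?case using Cons.IH[OF refl] Cons.prems by (auto simp: cupw_def)
qed (simp add: cupw_def)

abbreviation dual :: "bool list => bool list" where
 "dual es \<equiv> rev (map Not es)"

lemma dual_dual: "dual (dual es) = es"
 by (simp add: rev_map o_def)

lemma xw_dual: "xw z s (dual es) = xw z s es"
 by (simp add: xw_def ninv_rev ninv_map_Not)

lemma cnt_dual: "length es = b ==> cnt s (dual es) = b - cnt s es"
 using cnt_Not'[of es b s] by (simp add: cnt_map_Not)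

definition CAP :: "nat => nat => vec => vec" where
 "CAP i b = runs (map (\<lambda>j. Join (i + j)) (rev [0..<b]))"

text \<open>The \<open>b\<close> nested maxima pair a word with its reversed opposite.\<close>

lemma CAP_split: "length pre = i ==> CAP i b v (pre @ suf) = (\<Sum>es\<in>words b. capw es * v (pre @ es @ dual es @ suf))"
proof (induction b arbitrary: v)
 case 0
 then show ?case by (simp add: CAP_def capw_def)
next
 case (Suc b)
 have "CAP i (Suc b) v (pre @ suf) = CAP i b (cap_at (i + b) v) (pre @ suf)"
  by (simp add: CAP_def)
 also have "\<dots> = (\<Sum>es\<in>words b. capw es * cap_at (i + b) v (pre @ es @ dual es @ suf))"
  by (rule Suc.IH[OF Suc.prems])
 also have "\<dots> = (\<Sum>es\<in>words b. capw es * capsum (\<lambda>a c. v (pre @ es @ a # c # dual es @ suf)))"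
 proof (rule sum.cong[OF refl])
  fix es assume "es \<in> words b"
  then have "length (pre @ es) = i + b" using Suc.prems by (simp add: words_def)
  from cap_at_split[OF this, of v "dual es @ suf"]
  show "capw es * cap_at (i + b) v (pre @ es @ dual es @ suf) = capw es * capsum (\<lambda>a c. v (pre @ es @ a # c # dual es @ suf))"
   by simp
 qed
 also have "\<dots> = (\<Sum>es\<in>words (Suc b). capw es * v (pre @ es @ dual es @ suf))"
  unfolding sum_words_snoc[of _ b True] sum.distrib[symmetric]
  by (intro sum.cong refl) (simp add: capw_def capsum_def algebra_simps)
 finally show ?case .
qed

lemma CAP_runs: "CAP i b = runs (map (shift i) (map Join (rev [0..<b])))"
 by (simp add: CAP_def o_def)

lemma vword_Joins: "vword (2 * b + m) (map Join (rev [0..<b])) m \<longleftrightarrow> True"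
proof (induction b arbitrary: m)
 case (Suc b)
 have "2 * Suc b + m - 2 = 2 * b + m" by simp
 then show ?case using Suc by simp
qed simp

lemma local_CAP: "\<exists>K. local_op K i (2 * b) 0 (CAP i b)"
 unfolding CAP_runs by (rule exI, rule local_runs) (use vword_Joins[of b 0] in simp)

lemma sum_words_dual: "(\<Sum>es\<in>words b. f (dual es)) = (\<Sum>es\<in>words b. f es)"
 by (rule sum.reindex_bij_witness[of _ dual dual]) (auto simp: words_def rev_map o_def)

abbreviation pcoeff :: "nat => nat => ratfun" where
 "pcoeff b k \<equiv> A powi (- 2 * (int k * (int b - int k))) / qbin b k"

lemma pcoeff_sym: "k \<le> b ==> pcoeff b (b - k) = pcoeff b k"
 by (simp add: qbin_sym of_nat_diff mult.commute)

lemma pcoeff_eq: "k \<le> b ==> pcoeff b k = A powi (- 2 * (int k * (int b - int k))) * qfact k * qfact (b - k) / qfact b"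
 by (simp add: qbin_def)

text \<open>Reversing and negating words maps the symmetric function to itself, so the projection can pass to the
other leg of the maximum.\<close>

lemma CAP_Pop:
 assumes "i \<le> N"
 shows "eqv N (CAP i b (Pop i b v)) (CAP i b (Pop (i + b) b v))"
 unfolding eqv_def
proof (intro allI impI)
 fix es :: "bool list" assume l: "length es = N"
 define pre suf where d: "pre = take i es" "suf = drop i es"
 have e: "es = pre @ suf" "length pre = i" using l assms by (auto simp: d)
 define Z where "Z es ds = capw es * PopK b es ds * v (pre @ ds @ dual es @ suf)" for es ds
 have L: "CAP i b (Pop i b v) es = (\<Sum>es\<in>words b. \<Sum>ds\<in>words b. Z es ds)"
  unfolding e(1) CAP_split[OF e(2)]
 proof (rule sum.cong[OF refl])
  fix es assume "es \<in> words b"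
  then have "length es = b" by (simp add: words_def)
  from local_opD[OF local_Pop e(2) this, of v "dual es @ suf"]
  show "capw es * Pop i b v (pre @ es @ dual es @ suf) = (\<Sum>ds\<in>words b. Z es ds)"
   by (simp add: Z_def sum_distrib_left mult_ac)
 qed
 have R: "CAP i b (Pop (i + b) b v) es = (\<Sum>es\<in>words b. \<Sum>ds\<in>words b. Z ds es)"
  unfolding e(1) CAP_split[OF e(2)]
 proof (rule sum.cong[OF refl])
  fix es assume "es \<in> words b"
  then have le: "length es = b" by (simp add: words_def)
  then have "length (pre @ es) = i + b" "length (dual es) = b" using e by auto
  from local_opD[OF local_Pop this, of v "suf"]
  have "Pop (i + b) b v (pre @ es @ dual es @ suf) = (\<Sum>ds\<in>words b. PopK b (dual es) ds * v (pre @ es @ ds @ suf))"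
   by simp
  also have "\<dots> = (\<Sum>ds\<in>words b. PopK b (dual es) (dual ds) * v (pre @ es @ dual ds @ suf))"
   by (rule sum_words_dual[symmetric])
  finally have P: "Pop (i + b) b v (pre @ es @ dual es @ suf) = \<dots>" .
  show "capw es * Pop (i + b) b v (pre @ es @ dual es @ suf) = (\<Sum>ds\<in>words b. Z ds es)"
   unfolding P sum_distrib_left
  proof (rule sum.cong[OF refl])
   fix ds assume "ds \<in> words b"
   then have ld: "length ds = b" by (simp add: words_def)
   have k: "cnt True es \<le> b" "cnt True ds \<le> b" using cnt_le_length le ld by metis+
   have "capw es * PopK b (dual es) (dual ds) = capw ds * PopK b ds es"
   proof (cases "cnt True es = cnt True ds")
    case True
    have "capw es = capw ds" using True by (simp add: capw_eq[OF le] capw_eq[OF ld])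
    moreover have "PopK b (dual es) (dual ds) = PopK b ds es"
     unfolding PopK_def xw_dual cnt_dual[OF le] cnt_dual[OF ld] True pcoeff_sym[OF k(2)]
     by (simp add: mult_ac)
    ultimately show ?thesis by simp
   next
    case False
    then have n: "cnt True (dual ds) \<noteq> cnt True (dual es)" unfolding cnt_dual[OF le] cnt_dual[OF ld] using k by arith
    show ?thesis unfolding PopK_def if_not_P[OF n] if_not_P[OF False] by simp
   qed
   then show "capw es * (PopK b (dual es) (dual ds) * v (pre @ es @ dual ds @ suf)) = Z ds es"
    by (simp add: Z_def mult.assoc[symmetric])
  qed
 qed
 show "CAP i b (Pop i b v) es = CAP i b (Pop (i + b) b v) es"
  unfolding L R by (rule sum.swap)
qed

lemma sum_words_by_cnt:
 fixes f :: "nat => ratfun"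
 shows "(\<Sum>es\<in>words b. f (cnt s es) * h es) = (\<Sum>k\<le>b. f k * (\<Sum>es\<in>words b. if cnt s es = k then h es else 0))"
proof -
 have "(\<Sum>k\<le>b. f k * (\<Sum>es\<in>words b. if cnt s es = k then h es else 0))
   = (\<Sum>k\<le>b. \<Sum>es\<in>words b. if cnt s es = k then f k * h es else 0)"
 proof (rule sum.cong[OF refl])
  fix k
  show "f k * (\<Sum>es\<in>words b. if cnt s es = k then h es else 0) = (\<Sum>es\<in>words b. if cnt s es = k then f k * h es else 0)"
   unfolding sum_distrib_left by (rule sum.cong) auto
 qed
 also have "\<dots> = (\<Sum>es\<in>words b. \<Sum>k\<le>b. if cnt s es = k then f k * h es else 0)"
  by (rule sum.swap)
 also have "\<dots> = (\<Sum>es\<in>words b. f (cnt s es) * h es)"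
 proof (rule sum.cong[OF refl])
  fix es assume "es \<in> words b"
  then have "cnt s es \<le> b" using cnt_le_length[of es s] by (simp add: words_def)
  then show "(\<Sum>k\<le>b. if cnt s es = k then f k * h es else 0) = f (cnt s es) * h es" by simp
 qed
 finally show ?thesis by simp
qed

lemma CAP_symmetric:
 assumes "length pre = i"
  and "\<And>ts ts'. length ts = b ==> length ts' = b ==> v (pre @ ts @ ts' @ suf) = xA ts * xA ts' * g (cnt True ts) (cnt True ts')"
 shows "CAP i b v (pre @ suf) = (\<Sum>k\<le>b. (- A) ^ k * inverse A ^ (b - k) * A powi (2 * (int k * (int b - int k))) * qbin b k * g k (b - k))"
proof -
 have "CAP i b v (pre @ suf) = (\<Sum>es\<in>words b. ((- A) ^ cnt True es * inverse A ^ (b - cnt True es) * g (cnt True es) (b - cnt True es)) * (xA es * xA es))"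
  unfolding CAP_split[OF assms(1)]
 proof (rule sum.cong[OF refl])
  fix es assume "es \<in> words b"
  then have l: "length es = b" by (simp add: words_def)
  then have l': "length (dual es) = b" by simp
  show "capw es * v (pre @ es @ dual es @ suf) = ((- A) ^ cnt True es * inverse A ^ (b - cnt True es) * g (cnt True es) (b - cnt True es)) * (xA es * xA es)"
   unfolding assms(2)[OF l l'] xw_dual cnt_dual[OF l] capw_eq[OF l] by (simp only: mult_ac)
 qed
 also have "\<dots> = (\<Sum>k\<le>b. ((- A) ^ k * inverse A ^ (b - k) * g k (b - k)) * (\<Sum>es\<in>words b. if cnt True es = k then xA es * xA es else 0))"
  by (rule sum_words_by_cnt)
 also have "\<dots> = (\<Sum>k\<le>b. (- A) ^ k * inverse A ^ (b - k) * A powi (2 * (int k * (int b - int k))) * qbin b k * g k (b - k))"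
 proof (rule sum.cong[OF refl])
  fix k assume "k \<in> {..b}"
  then have "phi A True b (int k) xA = A powi (2 * (int k * (int b - int k))) * qbin b k"
   by (intro phi_xw) auto
  moreover have "phi A True b (int k) xA = (\<Sum>es\<in>words b. if cnt True es = k then xA es * xA es else 0)"
   by (simp add: phi_def)
  ultimately show "((- A) ^ k * inverse A ^ (b - k) * g k (b - k)) * (\<Sum>es\<in>words b. if cnt True es = k then xA es * xA es else 0)
    = (- A) ^ k * inverse A ^ (b - k) * A powi (2 * (int k * (int b - int k))) * qbin b k * g k (b - k)"
   by (simp only: mult_ac)
 qed
 finally show ?thesis .
qed

text \<open>The arcs of a cabled minimum.\<close>

definition cup_labels :: "nat => nat list" where
 "cup_labels b = [0..<b] @ rev [0..<b]"

lemma length_cup_labels [simp]: "length (cup_labels b) = 2 * b"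
 by (simp add: cup_labels_def)

lemma cup_labels_Suc: "cup_labels (Suc b) = [0..<b] @ [b, b] @ rev [0..<b]"
 by (simp add: cup_labels_def)

lemma planar_cup_labels: "planar (cup_labels b)"
proof (induction b)
 case 0
 then show ?case by (simp add: cup_labels_def planar_Nil)
next
 case (Suc b)
 then show ?case unfolding cup_labels_Suc by (intro planar_insert) (auto simp: cup_labels_def)
qed

lemma arcw_cup_labels:
 "length es = b ==> length es' = b ==> arcw (cup_labels b) (es @ es') = (if es' = dual es then cupw es else 0)"
proof (induction b arbitrary: es es')
 case 0
 then show ?case by (simp add: cup_labels_def cupw_def)
next
 case (Suc b)
 obtain \<zeta> a where e: "es = \<zeta> @ [a]" "length \<zeta> = b" using Suc.prems(1) by (cases es rule: rev_cases) auto
 obtain c \<zeta>' where e': "es' = c # \<zeta>'" "length \<zeta>' = b" using Suc.prems(2) by (cases es') auto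
 have "arcw (cup_labels (Suc b)) (es @ es') = cupM a c * arcw (cup_labels b) (\<zeta> @ \<zeta>')"
  using arcw_insert[of b "[0..<b]" "rev [0..<b]" \<zeta> \<zeta>' a c] e e' by (simp add: cup_labels_def)
 then show ?case using Suc.IH[OF e(2) e'(2)] by (auto simp: e e' cupM_def cupw_def)
qed

definition CUP :: "nat => nat => vec => vec" where
 "CUP i b = act (Arcs i (cup_labels b))"

lemma act_Arcs_split: "length pre = i ==> length ds = length ls ==> act (Arcs i ls) v (pre @ ds @ suf) = arcw ls ds * v (pre @ suf)"
 by simp

lemma CUP_split: "length pre = i ==> length es = b ==> length es' = b ==>
  CUP i b v (pre @ es @ es' @ suf) = (if es' = dual es then cupw es else 0) * v (pre @ suf)"
 unfolding CUP_def using act_Arcs_split[of pre i "es @ es'" "cup_labels b" v suf] arcw_cup_labels[of es b es']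
 by simp

lemma local_Arcs: "local_op (\<lambda>ts ds. arcw ls ts) i 0 (length ls) (act (Arcs i ls))"
 unfolding local_op_def by simp

abbreviation cupk :: "nat => nat => ratfun" where
 "cupk b k \<equiv> A ^ k * (- inverse A) ^ (b - k)"

lemma Pop_CUP_left:
 assumes "length pre = i" "length ts = b" "length ts' = b"
 shows "Pop i b (CUP i b v) (pre @ ts @ ts' @ suf) =
  (if cnt True ts + cnt True ts' = b then xA ts * xA ts' * pcoeff b (cnt True ts) * cupk b (cnt True ts) else 0) * v (pre @ suf)"
proof -
 have k: "cnt True ts \<le> b" "cnt True ts' \<le> b" using cnt_le_length assms by metis+
 have ld: "length (dual ts') = b" using assms by simp
 have "Pop i b (CUP i b v) (pre @ ts @ ts' @ suf) = (\<Sum>ds\<in>words b. PopK b ts ds * CUP i b v (pre @ ds @ ts' @ suf))"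
  by (rule local_opD[OF local_Pop assms(1,2)])
 also have "\<dots> = (\<Sum>ds\<in>words b. if ds = dual ts' then PopK b ts (dual ts') * cupw (dual ts') * v (pre @ suf) else 0)"
 proof (rule sum.cong[OF refl])
  fix ds assume "ds \<in> words b"
  then have "length ds = b" by (simp add: words_def)
  moreover have "ts' = dual ds \<longleftrightarrow> ds = dual ts'" using dual_dual by metis
  ultimately show "PopK b ts ds * CUP i b v (pre @ ds @ ts' @ suf) = (if ds = dual ts' then PopK b ts (dual ts') * cupw (dual ts') * v (pre @ suf) else 0)"
   using CUP_split[OF assms(1) _ assms(3), of ds v suf] by auto
 qed
 also have "\<dots> = PopK b ts (dual ts') * cupw (dual ts') * v (pre @ suf)"
 proof -
  have "dual ts' \<in> words b" unfolding words_def using ld by blast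
  then show ?thesis by simp
 qed
 also have "PopK b ts (dual ts') * cupw (dual ts') =
  (if cnt True ts + cnt True ts' = b then xA ts * xA ts' * pcoeff b (cnt True ts) * cupk b (cnt True ts) else 0)"
  unfolding PopK_def cupw_eq[OF ld] xw_dual cnt_dual[OF assms(3)] using k by auto
 finally show ?thesis .
qed

lemma Pop_CUP_right:
 assumes "length pre = i" "length ts = b" "length ts' = b"
 shows "Pop (i + b) b (CUP i b v) (pre @ ts @ ts' @ suf) =
  (if cnt True ts + cnt True ts' = b then xA ts * xA ts' * pcoeff b (cnt True ts) * cupk b (cnt True ts) else 0) * v (pre @ suf)"
proof -
 have k: "cnt True ts \<le> b" "cnt True ts' \<le> b" using cnt_le_length assms by metis+
 have ld: "length (dual ts) = b" using assms by simp
 have l2: "length (pre @ ts) = i + b" using assms by simp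
 have "Pop (i + b) b (CUP i b v) ((pre @ ts) @ ts' @ suf) = (\<Sum>ds\<in>words b. PopK b ts' ds * CUP i b v ((pre @ ts) @ ds @ suf))"
  by (rule local_opD[OF local_Pop l2 assms(3)])
 also have "\<dots> = (\<Sum>ds\<in>words b. if ds = dual ts then PopK b ts' (dual ts) * cupw ts * v (pre @ suf) else 0)"
 proof (rule sum.cong[OF refl])
  fix ds assume "ds \<in> words b"
  then have "length ds = b" by (simp add: words_def)
  then show "PopK b ts' ds * CUP i b v ((pre @ ts) @ ds @ suf) = (if ds = dual ts then PopK b ts' (dual ts) * cupw ts * v (pre @ suf) else 0)"
   using CUP_split[OF assms(1,2), of ds v suf] by auto
 qed
 also have "\<dots> = PopK b ts' (dual ts) * cupw ts * v (pre @ suf)"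
 proof -
  have "dual ts \<in> words b" unfolding words_def using ld by blast
  then show ?thesis by simp
 qed
 also have "PopK b ts' (dual ts) * cupw ts =
  (if cnt True ts + cnt True ts' = b then xA ts * xA ts' * pcoeff b (cnt True ts) * cupk b (cnt True ts) else 0)"
 proof (cases "cnt True ts + cnt True ts' = b")
  case True
  then have c: "cnt True ts' = b - cnt True ts" by simp
  show ?thesis unfolding PopK_def cupw_eq[OF assms(2)] xw_dual cnt_dual[OF assms(2)] c pcoeff_sym[OF k(1)]
   using True c k by simp
 next
  case False
  then show ?thesis unfolding PopK_def cnt_dual[OF assms(2)] using k by auto
 qed
 finally show ?thesis by simp
qed

lemma Pop_CUP:
 assumes "i + 2 * b \<le> N"
 shows "eqv N (Pop (i + b) b (CUP i b v)) (Pop i b (CUP i b v))"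
 unfolding eqv_def
proof (intro allI impI)
 fix es :: "bool list" assume l: "length es = N"
 obtain pre ts suf' where e: "es = pre @ ts @ suf'" "length pre = i" "length ts = b"
  using list_window[of i b es] assms l by auto
 define ts' suf where "ts' = take b suf'" "suf = drop b suf'"
 then have e': "suf' = [] @ ts' @ suf" "length ts' = b" using assms l e by auto
 show "Pop (i + b) b (CUP i b v) es = Pop i b (CUP i b v) es"
  unfolding e(1) e'(1) append_Nil Pop_CUP_left[OF e(2,3) e'(2)] Pop_CUP_right[OF e(2,3) e'(2)] ..
qed

section \<open>Integrality of crossings, maxima and minima\<close>

text \<open>The basis of the lattice: for each cable the factor \<open>[k]! A^(2 inv)\<close> with \<open>k\<close> positive signs.\<close>

definition basis_w :: "bool list list => ratfun" where
 "basis_w Es = prod_list (map (\<lambda>E. qfact (cnt True E) * xA E) Es)"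

lemma basis_w_append [simp]: "basis_w (Es @ Fs) = basis_w Es * basis_w Fs"
 by (simp add: basis_w_def)

lemma basis_w_Cons [simp]: "basis_w (E # Es) = qfact (cnt True E) * xA E * basis_w Es"
 by (simp add: basis_w_def)

lemma basis_w_Nil [simp]: "basis_w [] = 1"
 by (simp add: basis_w_def)

text \<open>Functions on words cut into cables of sizes \<open>bs\<close> that are symmetric in each cable, with coefficients
\<open>g\<close> in \<open>\<int>[A, 1/A]\<close> depending on the numbers of positive signs.\<close>

definition integral_vec :: "nat list => vec => bool" where
 "integral_vec bs v \<longleftrightarrow> (\<exists>g. (\<forall>ks. g ks \<in> LA) \<and> (\<forall>Es. map length Es = bs \<longrightarrow> v (concat Es) = g (map (cnt True) Es) * basis_w Es))"

lemma integral_vec_Nil: "v [] \<in> LA ==> integral_vec [] v"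
 unfolding integral_vec_def by (intro exI[of _ "\<lambda>_. v []"]) auto

lemma integral_vec_Nil_D: "integral_vec [] v ==> v [] \<in> LA"
 unfolding integral_vec_def by (metis basis_w_Nil concat.simps(1) list.map_disc_iff mult.right_neutral)

text \<open>The crossing formulas count the sign \<open>s\<close>, the lattice the positive sign; \<open>tc\<close> and \<open>sexp\<close>
translate the number and the power of \<open>A\<close>.\<close>

definition tc :: "bool => nat => nat => nat" where
 "tc s b k = (if s then k else b - k)"

definition sexp :: "bool => nat => nat => int" where
 "sexp s b k = (if s then 0 else 2 * (int k * (int b - int k)))"

lemma cnt_tc: "length es = b ==> cnt True es = tc s b (cnt s es)"
 using cnt_Not'[of es b False] by (auto simp: tc_def)

lemma xA_xw:
 assumes "signed z s" "length es = b"
 shows "xA es = A powi (sexp s b (cnt s es)) * xw z s es"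
proof (cases s)
 case True
 then show ?thesis using assms by (simp add: signed_def sexp_def)
next
 case False
 let ?d = "int (cnt True es) * (int b - int (cnt True es))"
 have z: "z = inverse A" using assms False by (simp add: signed_def)
 have "int (cnt False es) * (int b - int (cnt False es)) = ?d"
  using cnt_Not'[of es b True] cnt_le_length[of es True] assms by (simp add: of_nat_diff mult.commute)
 moreover have "A powi (2 * ?d) * A powi (- 2 * ?d) = 1"
  unfolding power_int_add[OF disjI1[OF A_nonzero], symmetric] by simp
 ultimately show ?thesis
  unfolding z using False assms by (simp add: xw_inverse_False sexp_def)
qed

definition lcoeff :: "ratfun => bool => nat => nat => nat => nat => nat => ratfun" where
 "lcoeff z s a b k l n = gcoeff z a b k l n * qfact (tc s a (k - n)) * qfact (tc s b (l + n)) / (qfact (tc s a k) * qfact (tc s b l))"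

lemma qfall_LA [simp]: "qfall m n \<in> LA"
proof (cases "n \<le> m")
 case True
 have "qfall m n = qbin m n * qfact n" using True by (simp add: qfall_def qbin_def)
 then show ?thesis by simp
qed (simp add: qfall_def)

text \<open>The factorials of the lattice absorb the denominators of the divided powers: what remains are Gaussian
binomials and quotients \<open>[m]!/[m - n]!\<close>.\<close>

lemma lcoeff_LA:
 assumes z: "signed z s" and "k \<le> a" "l \<le> b" "n \<le> k"
 shows "lcoeff z s a b k l n \<in> LA"
proof -
 have u: "z powi m \<in> LA" for m using z by (intro unit_A_powi_LA signed_unit)
 define U where "U = z powi ((int a - 2 * (int k - int n)) * (int b - 2 * (int l + int n)) + int n * (int n - 1)) * (z powi 2 - z powi (- 2)) ^ n"
 have U: "U \<in> LA" unfolding U_def by (intro laurent_mult laurent_power laurent_diff u A_nonzero)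
 show ?thesis
 proof (cases "n \<le> b - l")
  case False
  then show ?thesis by (simp add: lcoeff_def gcoeff_def qfall_def)
 next
  case n: True
  show ?thesis
  proof (cases s)
   case True
   have alg: "U * (x / (y * w)) * (c / d) * w * e / (x * f) = U * (c / (y * d)) * (e / f)"
    if "x \<noteq> 0" "w \<noteq> 0" for x y w c d e f :: ratfun
    using that by simp
   have "lcoeff z s a b k l n = U * (qfact k / (qfact n * qfact (k - n))) * (qfact (b - l) / qfact (b - l - n)) * qfact (k - n) * qfact (l + n) / (qfact k * qfact l)"
   proof -
    have "tc s a (k - n) = k - n" "tc s b (l + n) = l + n" "tc s a k = k" "tc s b l = l"
     using True by (simp_all add: tc_def)
    moreover have "qbin k n = qfact k / (qfact n * qfact (k - n))" "qfall (b - l) n = qfact (b - l) / qfact (b - l - n)"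
     using n assms(4) by (simp_all add: qbin_def qfall_def)
    ultimately show ?thesis unfolding lcoeff_def gcoeff_def U_def[symmetric] by (simp only:)
   qed
   also have "\<dots> = U * (qfact (b - l) / (qfact n * qfact (b - l - n))) * (qfact (l + n) / qfact l)"
    by (rule alg) simp_all
   also have "\<dots> = U * qbin (b - l) n * qfall (l + n) n"
    using n by (simp add: qbin_def qfall_def)
   finally have "lcoeff z s a b k l n = U * qbin (b - l) n * qfall (l + n) n" .
   then show ?thesis using U by simp
  next
   case False
   have 2: "a - (k - n) = a - k + n" using assms by simp
   have alg: "U * y * (c / d) * e * d / (f * c) = U * y * (e / f)"
    if "c \<noteq> 0" "d \<noteq> 0" "f \<noteq> 0" for y c d e f :: ratfun
    using that by (simp add: field_simps)
   have "lcoeff z s a b k l n = U * qbin k n * (qfact (b - l) / qfact (b - l - n)) * qfact (a - k + n) * qfact (b - l - n) / (qfact (a - k) * qfact (b - l))"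
   proof -
    have "tc s a (k - n) = a - k + n" "tc s b (l + n) = b - l - n" "tc s a k = a - k" "tc s b l = b - l"
     using False 2 by (simp_all add: tc_def)
    moreover have "qfall (b - l) n = qfact (b - l) / qfact (b - l - n)"
     using n by (simp add: qfall_def)
    ultimately show ?thesis unfolding lcoeff_def gcoeff_def U_def[symmetric] by (simp only:)
   qed
   also have "\<dots> = U * qbin k n * (qfact (a - k + n) / qfact (a - k))"
    by (rule alg) simp_all
   also have "\<dots> = U * qbin k n * qfall (a - k + n) n"
    by (simp add: qfall_def)
   finally have "lcoeff z s a b k l n = U * qbin k n * qfall (a - k + n) n" .
   then show ?thesis using U by simp
  qed
 qed
qed

lemma map_length_append3:
 assumes "map length Es = bs1 @ [b, a] @ bs2"
 obtains Es1 H Z Es2 where "Es = Es1 @ [H, Z] @ Es2" "map length Es1 = bs1" "map length Es2 = bs2" "length H = b" "length Z = a"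
proof -
 obtain Es1 Fs where 1: "Es = Es1 @ Fs" "map length Es1 = bs1" "map length Fs = [b, a] @ bs2"
  using assms by (auto simp: map_eq_append_conv)
 obtain H Fs' where 2: "Fs = H # Fs'" "length H = b" "map length Fs' = a # bs2"
  using 1(3) by (cases Fs) auto
 obtain Z Es2 where 3: "Fs' = Z # Es2" "length Z = a" "map length Es2 = bs2"
  using 2(3) by (cases Fs') auto
 show ?thesis using that[of Es1 H Z Es2] 1 2 3 by simp
qed

lemma length_concat_map: "map length Es = bs ==> length (concat Es) = sum_list bs"
 by (simp add: length_concat)

lemma integral_vec_cross:
 assumes z: "signed z s" and v: "integral_vec (bs1 @ [a, b] @ bs2) v" and i: "i = sum_list bs1"
 shows "integral_vec (bs1 @ [b, a] @ bs2) (run z s (gridw i a b) v)"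
proof -
 obtain g where g: "\<And>ks. g ks \<in> LA"
  and v: "\<And>Es. map length Es = bs1 @ [a, b] @ bs2 ==> v (concat Es) = g (map (cnt True) Es) * basis_w Es"
  using v unfolding integral_vec_def by auto
 define m where "m = length bs1"
 define T where "T ks k l n = lcoeff z s a b k l n * A powi (sexp s a (k - n) + sexp s b (l + n) - sexp s b l - sexp s a k)
   * g (take m ks @ [tc s a (k - n), tc s b (l + n)] @ drop (m + 2) ks)" for ks k l n
 define g' where "g' ks = (if ks ! m \<le> b \<and> ks ! (m + 1) \<le> a
   then (\<Sum>n\<le>tc s a (ks ! (m + 1)). T ks (tc s a (ks ! (m + 1))) (tc s b (ks ! m)) n) else 0)" for ks
 have tcle: "tc s b x \<le> b" if "x \<le> b" for b x
  using that by (simp add: tc_def)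
 have "g' ks \<in> LA" for ks
  unfolding g'_def T_def
  by (auto intro!: laurent_sum laurent_mult g lcoeff_LA[OF z] tcle)
 moreover have "run z s (gridw i a b) v (concat Es) = g' (map (cnt True) Es) * basis_w Es"
  if Es: "map length Es = bs1 @ [b, a] @ bs2" for Es
 proof -
  obtain Es1 H Z Es2 where E: "Es = Es1 @ [H, Z] @ Es2" and l: "map length Es1 = bs1" "map length Es2 = bs2" "length H = b" "length Z = a"
   using map_length_append3[OF Es] by metis
  define pre suf where d: "pre = concat Es1" "suf = concat Es2"
  have lpre: "length pre = i" using l by (simp add: d i length_concat_map)
  define W where "W = basis_w Es1 * basis_w Es2"
  define k l where kl: "k = cnt s Z" "l = cnt s H"
  have kl_le: "k \<le> a" "l \<le> b" using cnt_le_length \<open>length H = b\<close> \<open>length Z = a\<close> unfolding kl by metis+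
  define h where "h k l = A powi (sexp s a k) * A powi (sexp s b l) * qfact (tc s a k) * qfact (tc s b l) * W
    * g (map (cnt True) Es1 @ [tc s a k, tc s b l] @ map (cnt True) Es2)" for k l
  have hyp: "v (pre @ \<zeta> @ ts @ suf) = xw z s \<zeta> * xw z s ts * h (cnt s \<zeta>) (cnt s ts)" if "length \<zeta> = a" "length ts = b" for \<zeta> ts
  proof -
   have "v (concat (Es1 @ [\<zeta>, ts] @ Es2)) = g (map (cnt True) (Es1 @ [\<zeta>, ts] @ Es2)) * basis_w (Es1 @ [\<zeta>, ts] @ Es2)"
    by (rule v) (use l that in simp)
   then show ?thesis
    by (simp add: d h_def W_def xA_xw[OF z that(1)] xA_xw[OF z that(2)] cnt_tc[OF that(1), of s] cnt_tc[OF that(2), of s] mult_ac)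
  qed
  have R: "run z s (gridw i a b) v (pre @ H @ Z @ suf) = xw z s H * xw z s Z * (\<Sum>n\<le>k. gcoeff z a b k l n * h (k - n) (l + n))"
   unfolding kl by (rule grid_symmetric[OF signed_unit[OF z] lpre hyp l(3,4)])
  have x: "xw z s H = A powi (- sexp s b l) * xA H" "xw z s Z = A powi (- sexp s a k) * xA Z"
   unfolding xA_xw[OF z l(3)] xA_xw[OF z l(4)] kl by (simp_all add: power_int_minus)
  have c: "map (cnt True) Es = map (cnt True) Es1 @ [tc s b l, tc s a k] @ map (cnt True) Es2"
   using cnt_tc[OF l(3), of s] cnt_tc[OF l(4), of s] by (simp add: E kl)
  have m: "length (map (cnt True) Es1) = m" using arg_cong[OF l(1), of length] by (simp add: m_def)
  have idx: "map (cnt True) Es ! m = tc s b l" "map (cnt True) Es ! (m + 1) = tc s a k"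
   "take m (map (cnt True) Es) = map (cnt True) Es1" "drop (m + 2) (map (cnt True) Es) = map (cnt True) Es2"
   unfolding c using m by (simp_all add: nth_append)
  have tt: "tc s b (tc s b l) = l" "tc s a (tc s a k) = k" "tc s b l \<le> b" "tc s a k \<le> a"
   using kl_le by (auto simp: tc_def)
  have g'eq: "g' (map (cnt True) Es) = (\<Sum>n\<le>k. lcoeff z s a b k l n * A powi (sexp s a (k - n) + sexp s b (l + n) - sexp s b l - sexp s a k)
    * g (map (cnt True) Es1 @ [tc s a (k - n), tc s b (l + n)] @ map (cnt True) Es2))"
   unfolding g'_def T_def idx using tt by simp
  have bwE: "basis_w Es = qfact (tc s b l) * xA H * (qfact (tc s a k) * xA Z) * W"
   using cnt_tc[OF l(3), of s] cnt_tc[OF l(4), of s] by (simp add: E W_def kl mult_ac)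
  have "run z s (gridw i a b) v (concat Es) = g' (map (cnt True) Es) * basis_w Es"
  proof -
   have "concat Es = pre @ H @ Z @ suf" by (simp add: E d)
   moreover have "xw z s H * xw z s Z * (\<Sum>n\<le>k. gcoeff z a b k l n * h (k - n) (l + n)) = g' (map (cnt True) Es) * basis_w Es"
    unfolding g'eq sum_distrib_left sum_distrib_right
   proof (rule sum.cong[OF refl])
    fix n
    have p: "A powi (sexp s a (k - n) + sexp s b (l + n) - sexp s b l - sexp s a k)
     = A powi (sexp s a (k - n)) * A powi (sexp s b (l + n)) * A powi (- sexp s b l) * A powi (- sexp s a k)"
     by (simp add: power_int_add power_int_diff power_int_minus divide_inverse)
    have q: "lcoeff z s a b k l n * (qfact (tc s a k) * qfact (tc s b l)) = gcoeff z a b k l n * qfact (tc s a (k - n)) * qfact (tc s b (l + n))"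
     unfolding lcoeff_def by simp
    let ?g = "g (map (cnt True) Es1 @ [tc s a (k - n), tc s b (l + n)] @ map (cnt True) Es2)"
    have "lcoeff z s a b k l n * A powi (sexp s a (k - n) + sexp s b (l + n) - sexp s b l - sexp s a k) * ?g * basis_w Es
     = (lcoeff z s a b k l n * (qfact (tc s a k) * qfact (tc s b l))) * A powi (sexp s a (k - n)) * A powi (sexp s b (l + n)) * A powi (- sexp s b l) * A powi (- sexp s a k) * ?g * xA H * xA Z * W"
     unfolding p bwE by (simp only: mult_ac)
    then show "xw z s H * xw z s Z * (gcoeff z a b k l n * h (k - n) (l + n)) = lcoeff z s a b k l n * A powi (sexp s a (k - n) + sexp s b (l + n) - sexp s b l - sexp s a k) * ?g * basis_w Es"
     unfolding q x h_def by (simp only: mult_ac)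
   qed
   ultimately show ?thesis using R by simp
  qed
  then show ?thesis .
 qed
 ultimately show ?thesis unfolding integral_vec_def by (intro exI[of _ g']) auto
qed

text \<open>The sum over \<open>k\<close> has the factor \<open>[k]! [b - k]!\<close> from the basis and a Gaussian binomial from
the number of words; together they give \<open>[b]!\<close>.\<close>

lemma integral_vec_cap:
 assumes v: "integral_vec (bs1 @ [b, b] @ bs2) v" and i: "i = sum_list bs1"
 shows "integral_vec (bs1 @ bs2) (\<lambda>es. CAP i b v es / qfact b)"
proof -
 obtain g where g: "\<And>ks. g ks \<in> LA"
  and v: "\<And>Es. map length Es = bs1 @ [b, b] @ bs2 ==> v (concat Es) = g (map (cnt True) Es) * basis_w Es"
  using v unfolding integral_vec_def by auto
 define m where "m = length bs1"
 define g' where "g' ks = (\<Sum>k\<le>b. (- A) ^ k * inverse A ^ (b - k) * A powi (2 * (int k * (int b - int k))) * g (take m ks @ [k, b - k] @ drop m ks))" for ks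
 have "g' ks \<in> LA" for ks
  unfolding g'_def by (intro laurent_sum laurent_mult laurent_power laurent_minus laurent_A laurent_A_inverse laurent_powi g A_nonzero)
 moreover have "CAP i b v (concat Es) / qfact b = g' (map (cnt True) Es) * basis_w Es"
  if Es: "map length Es = bs1 @ bs2" for Es
 proof -
  obtain Es1 Es2 where E: "Es = Es1 @ Es2" and l: "map length Es1 = bs1" "map length Es2 = bs2"
   using Es by (auto simp: map_eq_append_conv)
  have m: "length Es1 = m" using arg_cong[OF l(1), of length] by (simp add: m_def)
  define h where "h k k' = g (map (cnt True) Es1 @ [k, k'] @ map (cnt True) Es2) * (qfact k * qfact k' * basis_w Es1 * basis_w Es2)" for k k'
  have lpre: "length (concat Es1) = i" using l by (simp add: i length_concat_map)
  have hyp: "v (concat Es1 @ \<zeta> @ ts @ concat Es2) = xA \<zeta> * xA ts * h (cnt True \<zeta>) (cnt True ts)" if "length \<zeta> = b" "length ts = b" for \<zeta> ts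
  proof -
   have "v (concat (Es1 @ [\<zeta>, ts] @ Es2)) = g (map (cnt True) (Es1 @ [\<zeta>, ts] @ Es2)) * basis_w (Es1 @ [\<zeta>, ts] @ Es2)"
    by (rule v) (use l that in simp)
   then show ?thesis by (simp add: h_def mult_ac)
  qed
  have "CAP i b v (concat Es) / qfact b = (\<Sum>k\<le>b. (- A) ^ k * inverse A ^ (b - k) * A powi (2 * (int k * (int b - int k))) * qbin b k * h k (b - k)) / qfact b"
   using CAP_symmetric[OF lpre hyp] by (simp add: E)
  also have "\<dots> = g' (map (cnt True) Es) * basis_w Es"
   unfolding g'_def sum_distrib_right sum_divide_distrib
  proof (rule sum.cong[OF refl])
   fix k assume "k \<in> {..b}"
   then have q: "qbin b k * (qfact k * qfact (b - k)) / qfact b = 1" by (simp add: qbin_def)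
   let ?g = "g (map (cnt True) Es1 @ [k, b - k] @ map (cnt True) Es2)"
   let ?X = "(- A) ^ k * inverse A ^ (b - k) * A powi (2 * (int k * (int b - int k)))"
   have "?X * qbin b k * h k (b - k) / qfact b = (qbin b k * (qfact k * qfact (b - k)) / qfact b) * (?X * ?g * basis_w Es)"
    unfolding h_def by (simp add: E mult_ac)
   also have "\<dots> = ?X * ?g * basis_w Es" unfolding q by simp
   finally show "?X * qbin b k * h k (b - k) / qfact b = ?X * g (take m (map (cnt True) Es) @ [k, b - k] @ drop m (map (cnt True) Es)) * basis_w Es"
    using m by (simp add: E)
  qed
  finally show ?thesis .
 qed
 ultimately show ?thesis unfolding integral_vec_def by (intro exI[of _ g']) auto
qed

text \<open>The projection produces the inverse Gaussian binomial \<open>[k]! [b - k]!/[b]!\<close>. Its numerator belongs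
to the basis, and \<open>[b]!\<close> clears its denominator.\<close>

lemma integral_vec_cup:
 assumes v: "integral_vec (bs1 @ bs2) v" and i: "i = sum_list bs1"
 shows "integral_vec (bs1 @ [b, b] @ bs2) (\<lambda>es. qfact b * Pop i b (CUP i b v) es)"
proof -
 obtain g where g: "\<And>ks. g ks \<in> LA"
  and v: "\<And>Es. map length Es = bs1 @ bs2 ==> v (concat Es) = g (map (cnt True) Es) * basis_w Es"
  using v unfolding integral_vec_def by auto
 define m where "m = length bs1"
 define g' where "g' ks = (if ks ! m + ks ! (m + 1) = b then A powi (- 2 * (int (ks ! m) * (int b - int (ks ! m)))) * cupk b (ks ! m) * g (take m ks @ drop (m + 2) ks) else 0)" for ks
 have "g' ks \<in> LA" for ks
  unfolding g'_def by (auto intro!: laurent_mult laurent_power laurent_minus laurent_A laurent_A_inverse laurent_powi g)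
 moreover have "qfact b * Pop i b (CUP i b v) (concat Es) = g' (map (cnt True) Es) * basis_w Es"
  if Es: "map length Es = bs1 @ [b, b] @ bs2" for Es
 proof -
  obtain Es1 H Z Es2 where E: "Es = Es1 @ [H, Z] @ Es2" and l: "map length Es1 = bs1" "map length Es2 = bs2" "length H = b" "length Z = b"
   using map_length_append3[OF Es] by metis
  have m: "length Es1 = m" using arg_cong[OF l(1), of length] by (simp add: m_def)
  have lpre: "length (concat Es1) = i" using l by (simp add: i length_concat_map)
  have idx: "map (cnt True) Es ! m = cnt True H" "map (cnt True) Es ! (m + 1) = cnt True Z"
   "take m (map (cnt True) Es) = map (cnt True) Es1" "drop (m + 2) (map (cnt True) Es) = map (cnt True) Es2"
   using m by (simp_all add: E nth_append)
  have v': "v (concat Es1 @ concat Es2) = g (map (cnt True) Es1 @ map (cnt True) Es2) * (basis_w Es1 * basis_w Es2)"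
   using v[of "Es1 @ Es2"] l by simp
  have "Pop i b (CUP i b v) (concat Es) = Pop i b (CUP i b v) (concat Es1 @ H @ Z @ concat Es2)"
   by (simp add: E)
  also have "\<dots> = (if cnt True H + cnt True Z = b then xA H * xA Z * pcoeff b (cnt True H) * cupk b (cnt True H) else 0) * v (concat Es1 @ concat Es2)"
   by (rule Pop_CUP_left[OF lpre l(3,4)])
  finally have P: "Pop i b (CUP i b v) (concat Es) = \<dots>" .
  show ?thesis
  proof (cases "cnt True H + cnt True Z = b")
   case True
   then have Z: "cnt True Z = b - cnt True H" and le: "cnt True H \<le> b" by auto
   have g'e: "g' (map (cnt True) Es) = A powi (- 2 * (int (cnt True H) * (int b - int (cnt True H)))) * cupk b (cnt True H) * g (map (cnt True) Es1 @ map (cnt True) Es2)"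
    unfolding g'_def idx using True by simp
   have bwE: "basis_w Es = qfact (cnt True H) * qfact (b - cnt True H) * xA H * xA Z * (basis_w Es1 * basis_w Es2)"
    by (simp add: E Z mult_ac)
   show ?thesis unfolding P if_P[OF True] v' pcoeff_eq[OF le] g'e bwE
    by (simp add: field_simps)
  next
   case False
   then show ?thesis unfolding P if_not_P[OF False] g'_def idx by simp
  qed
 qed
 ultimately show ?thesis unfolding integral_vec_def by (intro exI[of _ g']) auto
qed

section \<open>Arcs of a vertex\<close>

text \<open>An arc is labelled by its left end.\<close>

definition mlab :: "nat list => nat list" where
 "mlab p = map (\<lambda>j. min j (p ! j)) [0..<length p]"

definition matching :: "nat list => bool" where
 "matching p \<longleftrightarrow> (\<forall>j<length p. p ! j < length p \<and> p ! j \<noteq> j \<and> p ! (p ! j) = j)"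

definition noncross :: "nat list => bool" where
 "noncross p \<longleftrightarrow> (\<forall>j<length p. \<forall>k<length p. \<not> (j < k \<and> k < p ! j \<and> p ! j < p ! k))"

text \<open>The first label to be repeated is repeated at once: a label in between would occur again
later and interlace with it.\<close>

lemma planar_list:
 "\<forall>x\<in>set ls. count_list ls x = 2 ==> \<forall>x y. x \<noteq> y \<longrightarrow> \<not> subseq [x, y, x, y] ls ==> planar ls"
proof (induction "length ls" arbitrary: ls rule: less_induct)
 case less
 show ?case
 proof (cases "ls = []")
  case True
  then show ?thesis by (simp add: planar_Nil)
 next
  case False
  then obtain h t where ht: "ls = h # t" by (cases ls) auto
  have "\<not> distinct ls"
  proof
   assume "distinct ls"
   then have "h \<notin> set t" by (simp add: ht)
   then have "count_list ls h = 1" by (simp add: ht count_list_0_iff)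
   moreover have "count_list ls h = 2" using less.prems(1) ht by (metis list.set_intros(1))
   ultimately show False by simp
  qed
  then obtain us x vs where u: "ls = us @ x # vs" "x \<in> set us" "distinct us"
   unfolding not_distinct_conv_prefix by blast
  obtain as bs where us: "us = as @ x # bs" using u(2) by (metis split_list)
  have ls: "ls = as @ x # bs @ x # vs" by (simp add: u(1) us)
  have "bs = []"
  proof (rule ccontr)
   assume "bs \<noteq> []"
   then obtain z bs' where bs: "bs = z # bs'" by (cases bs) auto
   have z: "z \<noteq> x" "z \<notin> set as" "z \<notin> set bs'" using u(3) by (auto simp: us bs)
   have "count_list ls z = Suc (count_list vs z)"
    using z by (simp add: ls bs count_list_0_iff)
   moreover have "count_list ls z = 2" using less.prems(1) by (simp add: ls bs)
   ultimately have "count_list vs z \<noteq> 0" by simp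
   then have "z \<in> set vs" by (metis count_list_0_iff)
   then obtain vs1 vs2 where vs: "vs = vs1 @ z # vs2" by (metis split_list)
   have "subseq [x, z, x, z] ls"
    unfolding ls bs vs by (simp add: list_emb_append2 subseq_Cons2 list_emb_append2[of _ _ "z # vs2" ])
   then show False using less.prems(2) z(1) by metis
  qed
  then have ls': "ls = as @ [x, x] @ vs" by (simp add: ls)
  have cx: "count_list ls x = 2" using less.prems(1) by (simp add: ls')
  then have x: "x \<notin> set (as @ vs)" by (simp add: ls' count_list_0_iff)
  have "planar (as @ vs)"
  proof (rule less.hyps)
   show "length (as @ vs) < length ls" by (simp add: ls')
   show "\<forall>y\<in>set (as @ vs). count_list (as @ vs) y = 2"
   proof
    fix y assume y: "y \<in> set (as @ vs)"
    then have "y \<noteq> x" using x by auto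
    moreover have "count_list ls y = 2" using less.prems(1) y by (auto simp: ls')
    ultimately show "count_list (as @ vs) y = 2" by (simp add: ls')
   qed
   have "subseq (as @ vs) ls" unfolding ls' by (intro list_emb_append_mono) (auto intro: list_emb_Cons)
   then show "\<forall>a b. a \<noteq> b \<longrightarrow> \<not> subseq [a, b, a, b] (as @ vs)"
    using less.prems(2) subseq_order.order_trans by metis
  qed
  then show ?thesis unfolding ls' by (rule planar_insert[OF _ x])
 qed
qed

lemma count_list_map_upt: "count_list (map f [0..<n]) x = card {j. j < n \<and> f j = x}"
proof (induction n)
 case (Suc n)
 have "{j. j < Suc n \<and> f j = x} = (if f n = x then insert n {j. j < n \<and> f j = x} else {j. j < n \<and> f j = x})"
  by (auto simp: less_Suc_eq)
 then show ?case using Suc by (simp add: count_list_append)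
qed simp

lemma subseq4_indices:
 assumes "subseq [a, b, c, e] ls"
 obtains i j k l where "i < j" "j < k" "k < l" "l < length ls" "ls ! i = a" "ls ! j = b" "ls ! k = c" "ls ! l = e"
proof -
 obtain u1 r1 where 1: "ls = u1 @ a # r1" "subseq [b, c, e] r1" using list_emb_ConsD[OF assms] by auto
 obtain u2 r2 where 2: "r1 = u2 @ b # r2" "subseq [c, e] r2" using list_emb_ConsD[OF 1(2)] by auto
 obtain u3 r3 where 3: "r2 = u3 @ c # r3" "subseq [e] r3" using list_emb_ConsD[OF 2(2)] by auto
 obtain u4 r4 where 4: "r3 = u4 @ e # r4" using list_emb_ConsD[OF 3(2)] by auto
 show ?thesis
  by (rule that[of "length u1" "Suc (length u1 + length u2)" "Suc (Suc (length u1 + length u2 + length u3))"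
     "Suc (Suc (Suc (length u1 + length u2 + length u3 + length u4)))"])
   (simp_all add: 1(1) 2(1) 3(1) 4(1) nth_append)
qed

lemma mlab_eq_iff:
 assumes "matching p" "j < length p" "k < length p"
 shows "min j (p ! j) = min k (p ! k) \<longleftrightarrow> k = j \<or> k = p ! j"
 using assms unfolding matching_def by (metis min.commute min_def)

lemma planar_mlab:
 assumes m: "matching p" and nx: "noncross p"
 shows "planar (mlab p)"
proof (rule planar_list)
 show "\<forall>x\<in>set (mlab p). count_list (mlab p) x = 2"
 proof
  fix x assume "x \<in> set (mlab p)"
  then obtain j where j: "j < length p" "x = min j (p ! j)" by (auto simp: mlab_def)
  have "{k. k < length p \<and> min k (p ! k) = x} = {j, p ! j}"
  proof -
   have pj: "p ! j < length p" using m j(1) by (simp add: matching_def)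
   have "k < length p \<and> min k (p ! k) = x \<longleftrightarrow> k = j \<or> k = p ! j" for k
   proof (cases "k < length p")
    case True
    show ?thesis using mlab_eq_iff[OF m j(1) True] True unfolding j(2) by (metis (no_types))
   next
    case False
    then show ?thesis using j(1) pj by auto
   qed
   then show ?thesis by blast
  qed
  moreover have "p ! j \<noteq> j" using m j(1) by (simp add: matching_def)
  ultimately show "count_list (mlab p) x = 2"
   unfolding mlab_def count_list_map_upt by simp
 qed
 show "\<forall>x y. x \<noteq> y \<longrightarrow> \<not> subseq [x, y, x, y] (mlab p)"
 proof (intro allI impI notI)
  fix x y assume xy: "x \<noteq> y" and "subseq [x, y, x, y] (mlab p)"
  then obtain i j k l where *: "i < j" "j < k" "k < l" "l < length (mlab p)"
   "mlab p ! i = x" "mlab p ! j = y" "mlab p ! k = x" "mlab p ! l = y"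
   by (metis subseq4_indices)
  have len: "length (mlab p) = length p" by (simp add: mlab_def)
  have nth: "mlab p ! t = min t (p ! t)" if "t < length p" for t using that by (simp add: mlab_def)
  have lt: "i < length p" "j < length p" "k < length p" "l < length p"
   using *(1-4) len by linarith+
  have "min i (p ! i) = min k (p ! k)" "min j (p ! j) = min l (p ! l)"
   using *(5-8) by (simp_all add: nth lt)
  then have "k = p ! i" "l = p ! j"
   using mlab_eq_iff[OF m lt(1,3)] mlab_eq_iff[OF m lt(2,4)] *(1-3) by auto
  moreover have "\<not> (i < j \<and> j < p ! i \<and> p ! i < p ! j)"
   using nx lt(1,2) unfolding noncross_def by blast
  ultimately show False using *(1-3) by simp
 qed
qed

lemma filter_upt_pair:
 assumes "{t. t < n \<and> P t} = {a, b}" "a < b"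
 shows "filter P [0..<n] = [a, b]"
proof (rule sorted_distinct_set_unique)
 show "set (filter P [0..<n]) = set [a, b]" using assms(1) by auto
 show "sorted (filter P [0..<n])" by (rule sorted_wrt_filter) simp
qed (use assms(2) in simp_all)

lemma arcw_mlab:
 assumes m: "matching p" and l: "length ds = length p"
 shows "arcw (mlab p) ds = (\<Prod>j\<in>{j. j < length p \<and> j < p ! j}. cupM (ds ! j) (ds ! (p ! j)))"
proof -
 let ?n = "length p"
 have set: "set (mlab p) = {j. j < ?n \<and> j < p ! j}"
 proof
  show "set (mlab p) \<subseteq> {j. j < ?n \<and> j < p ! j}"
  proof
   fix x assume "x \<in> set (mlab p)"
   then obtain j where j: "j < ?n" "x = min j (p ! j)" by (auto simp: mlab_def)
   then show "x \<in> {j. j < ?n \<and> j < p ! j}"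
    using m unfolding matching_def by (cases "j < p ! j") (auto simp: min_def nat_neq_iff)
  qed
  show "{j. j < ?n \<and> j < p ! j} \<subseteq> set (mlab p)"
   by (auto simp: mlab_def image_iff min_def intro!: bexI)
 qed
 have zip: "zip (mlab p) ds = map (\<lambda>t. (min t (p ! t), ds ! t)) [0..<?n]"
  by (rule nth_equalityI) (use l in \<open>auto simp: mlab_def\<close>)
 show ?thesis
  unfolding arcw_def set
 proof (rule prod.cong[OF refl])
  fix j assume j: "j \<in> {j. j < ?n \<and> j < p ! j}"
  have "{t. t < ?n \<and> min t (p ! t) = j} = {j, p ! j}"
  proof -
   have "min j (p ! j) = j" using j by simp
   then show ?thesis using mlab_eq_iff[OF m, of j] j m by (auto simp: matching_def)
  qed
  then have "filter (\<lambda>t. min t (p ! t) = j) [0..<?n] = [j, p ! j]"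
   using j by (intro filter_upt_pair) auto
  then have "filter (\<lambda>q. fst q = j) (zip (mlab p) ds) = [(min j (p ! j), ds ! j), (min (p ! j) (p ! (p ! j)), ds ! (p ! j))]"
   unfolding zip by (simp add: filter_map o_def)
  then show "pair_w (map snd (filter (\<lambda>q. fst q = j) (zip (mlab p) ds))) = cupM (ds ! j) (ds ! (p ! j))"
   by simp
 qed
qed

lemma leg_of_Cons:
 assumes "j < a + sum_list c"
 shows "leg_of (a # c) j = (if j < a then 0 else Suc (leg_of c (j - a)))"
proof (cases "j < a")
 case True
 then show ?thesis unfolding leg_of_def by (auto intro!: Least_equality)
next
 case False
 have "leg_of (a # c) j = Suc (LEAST i. j < sum_list (take (Suc i + 1) (a # c)))"
  unfolding leg_of_def
 proof (rule Least_Suc)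
  show "j < sum_list (take (length c + 1) (a # c))" using assms by simp
  show "\<not> j < sum_list (take (0 + 1) (a # c))" using False by simp
 qed
 also have "(\<lambda>i. j < sum_list (take (Suc i + 1) (a # c))) = (\<lambda>i. j - a < sum_list (take (i + 1) c))"
  using False by (auto simp: fun_eq_iff)
 finally show ?thesis using False by (simp add: leg_of_def)
qed

lemma leg_of_less: "j < sum_list c ==> leg_of c j < length c"
proof (induction c arbitrary: j)
 case (Cons a c)
 then show ?case using leg_of_Cons[of j a c] Cons.IH[of "j - a"] by auto
qed simp

lemma leg_of_mono: "j \<le> k ==> k < sum_list c ==> leg_of c j \<le> leg_of c k"
proof (induction c arbitrary: j k)
 case (Cons a c)
 then show ?case using leg_of_Cons[of j a c] leg_of_Cons[of k a c] Cons.IH[of "j - a" "k - a"] by auto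
qed simp

lemma sum_lessThan_add: "sum f {..<m + n :: nat} = sum f {..<m} + (\<Sum>i<n. f (m + i) :: nat)"
 by (induction n) (auto simp: add.assoc)

text \<open>Numbers of positive signs and of inversions within the legs, for signs given as a predicate on
positions.\<close>

definition pcount :: "nat list => (nat => bool) => nat => nat" where
 "pcount c e i = (\<Sum>x<sum_list c. of_bool (leg_of c x = i \<and> e x))"

definition pinv :: "nat list => (nat => bool) => nat" where
 "pinv c e = (\<Sum>y<sum_list c. \<Sum>x<y. of_bool (leg_of c x = leg_of c y \<and> \<not> e x \<and> e y))"

lemma cnt_sum: "cnt True E = (\<Sum>x<length E. of_bool (E ! x))"
 by (induction E rule: rev_induct) (auto simp: nth_append)

lemma ninv_sum: "ninv True E = (\<Sum>y<length E. \<Sum>x<y. of_bool (\<not> E ! x \<and> E ! y))"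
proof (induction E rule: rev_induct)
 case (snoc a E)
 have 1: "(\<Sum>y<length E. \<Sum>x<y. of_bool (\<not> (E @ [a]) ! x \<and> (E @ [a]) ! y)) = (\<Sum>y<length E. \<Sum>x<y. of_bool (\<not> E ! x \<and> E ! y))"
  by (intro sum.cong refl) (auto simp: nth_append)
 have "(\<Sum>x<length E. of_bool (\<not> E ! x)) + (\<Sum>x<length E. of_bool (E ! x)) = (\<Sum>x<length E. 1 :: nat)"
  unfolding sum.distrib[symmetric] by (rule sum.cong) auto
 then have 2: "(\<Sum>x<length E. of_bool (\<not> E ! x)) = length E - cnt True E"
  unfolding cnt_sum by simp
 have 3: "(\<Sum>x<length E. of_bool (\<not> (E @ [a]) ! x \<and> (E @ [a]) ! length E)) = (if a then length E - cnt True E else 0)"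
  unfolding 2[symmetric] by (auto simp: nth_append intro!: sum.cong sum.neutral)
 have len: "length (E @ [a]) = Suc (length E)" by simp
 show ?case unfolding len sum.lessThan_Suc 1 3 snoc[symmetric] by (simp add: ninv_append)
qed simp

lemma pcount_Cons:
 "pcount (length E # c) (\<lambda>x. (E @ es) ! x) i = (case i of 0 => cnt True E | Suc i => pcount c (\<lambda>x. es ! x) i)"
proof -
 have 1: "(\<Sum>x<length E. of_bool (leg_of (length E # c) x = i \<and> (E @ es) ! x)) = (if i = 0 then cnt True E else 0)"
  unfolding cnt_sum by (auto simp: leg_of_Cons nth_append intro!: sum.cong)
 have 2: "(\<Sum>x<sum_list c. of_bool (leg_of (length E # c) (length E + x) = i \<and> (E @ es) ! (length E + x)))
   = (case i of 0 => 0 | Suc i => pcount c (\<lambda>x. es ! x) i)"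
  unfolding pcount_def by (cases i) (auto simp: leg_of_Cons nth_append intro!: sum.cong)
 show ?thesis unfolding pcount_def[of "length E # c"] sum_list.Cons sum_lessThan_add 1 2
  by (cases i) auto
qed

lemma pinv_Cons:
 "pinv (length E # c) (\<lambda>x. (E @ es) ! x) = ninv True E + pinv c (\<lambda>x. es ! x)"
proof -
 let ?L = "leg_of (length E # c)"
 have 1: "(\<Sum>y<length E. \<Sum>x<y. of_bool (?L x = ?L y \<and> \<not> (E @ es) ! x \<and> (E @ es) ! y)) = ninv True E"
  unfolding ninv_sum by (intro sum.cong refl) (auto simp: leg_of_Cons nth_append)
 have 2: "(\<Sum>y<sum_list c. \<Sum>x<length E + y. of_bool (?L x = ?L (length E + y) \<and> \<not> (E @ es) ! x \<and> (E @ es) ! (length E + y)))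
   = pinv c (\<lambda>x. es ! x)"
  unfolding pinv_def
 proof (rule sum.cong[OF refl])
  fix y assume y: "y \<in> {..<sum_list c}"
  have "(\<Sum>x<length E. of_bool (?L x = ?L (length E + y) \<and> \<not> (E @ es) ! x \<and> (E @ es) ! (length E + y))) = (0 :: nat)"
   using y by (intro sum.neutral) (auto simp: leg_of_Cons)
  moreover have "(\<Sum>x<y. of_bool (?L (length E + x) = ?L (length E + y) \<and> \<not> (E @ es) ! (length E + x) \<and> (E @ es) ! (length E + y)))
   = (\<Sum>x<y. of_bool (leg_of c x = leg_of c y \<and> \<not> es ! x \<and> es ! y) :: nat)"
   using y by (intro sum.cong refl) (auto simp: leg_of_Cons nth_append)
  ultimately show "(\<Sum>x<length E + y. of_bool (?L x = ?L (length E + y) \<and> \<not> (E @ es) ! x \<and> (E @ es) ! (length E + y)))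
   = (\<Sum>x<y. of_bool (leg_of c x = leg_of c y \<and> \<not> es ! x \<and> es ! y) :: nat)"
   unfolding sum_lessThan_add by simp
 qed
 show ?thesis unfolding pinv_def[of "length E # c"] sum_list.Cons sum_lessThan_add[of _ "length E" "sum_list c"] 1 2 ..
qed

lemma map_cnt_pcount: "map length Es = c ==> map (cnt True) Es = map (pcount c (\<lambda>x. concat Es ! x)) [0..<length c]"
proof (induction Es arbitrary: c)
 case (Cons E Es)
 then obtain c' where c: "c = length E # c'" "map length Es = c'" by auto
 have u: "[0..<Suc (length c')] = 0 # map Suc [0..<length c']"
  by (simp add: map_Suc_upt upt_conv_Cons del: upt_Suc)
 show ?case using Cons.IH[OF c(2)] by (simp add: c(1) pcount_Cons u o_def del: upt_Suc)
qed simp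

lemma prod_xA_pinv: "map length Es = c ==> prod_list (map xA Es) = A powi (2 * int (pinv c (\<lambda>x. concat Es ! x)))"
proof (induction Es arbitrary: c)
 case (Cons E Es)
 then obtain c' where c: "c = length E # c'" "map length Es = c'" by auto
 show ?case using Cons.IH[OF c(2)] by (simp add: c(1) pinv_Cons xw_def power_int_add distrib_left)
qed (simp add: pinv_def)

text \<open>Words cut into pieces of given lengths, and below the way to cut a word.\<close>

definition blk :: "nat list => bool list list set" where
 "blk c = {Es. map length Es = c}"

fun chop :: "nat list => 'a list => 'a list list" where
 "chop [] xs = []"
| "chop (c # cs) xs = take c xs # chop cs (drop c xs)"

lemma chop_concat: "chop (map length Es) (concat Es) = Es"
 by (induction Es) auto

lemma concat_chop: "length xs = sum_list c ==> concat (chop c xs) = xs \<and> map length (chop c xs) = c"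
 by (induction c arbitrary: xs) auto

lemma sum_blk: "(\<Sum>Es\<in>blk c. f (concat Es)) = (\<Sum>es\<in>words (sum_list c). f es)"
 by (rule sum.reindex_bij_witness[of _ "chop c" concat])
  (auto simp: blk_def words_def concat_chop chop_concat length_concat)

lemma card_fibres:
 assumes "finite S" "finite T" "g ` S \<subseteq> T"
 shows "card S = (\<Sum>y\<in>T. card {x \<in> S. g x = y})"
 using sum.group[OF assms, of "\<lambda>_. 1 :: nat"] by simp

text \<open>A set of arcs is a family of subsets of the bundles. If a summand depends on the number of
chosen arcs per bundle, times a factor per bundle, the sum can be taken bundle by bundle.\<close>

lemma sum_Pow_bundles:
 fixes h :: "('i => nat) => ratfun" and y :: "'i => 'b set => ratfun"
 assumes I: "finite I" and B: "\<And>i. i \<in> I ==> finite (B i)"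
  and disj: "\<And>i j. i \<in> I ==> j \<in> I ==> i \<noteq> j ==> B i \<inter> B j = {}"
 shows "(\<Sum>P\<in>Pow (\<Union>i\<in>I. B i). h (\<lambda>i\<in>I. card (P \<inter> B i)) * (\<Prod>i\<in>I. y i (P \<inter> B i)))
  = (\<Sum>s\<in>PiE I (\<lambda>i. {..card (B i)}). h s * (\<Prod>i\<in>I. \<Sum>P | P \<subseteq> B i \<and> card P = s i. y i P))"
proof -
 let ?F = "PiE I (\<lambda>i. Pow (B i))" and ?S = "PiE I (\<lambda>i. {..card (B i)})"
 have fin: "finite ?F" "finite ?S" using I B by (auto intro!: finite_PiE)
 have "(\<Sum>P\<in>Pow (\<Union>i\<in>I. B i). h (\<lambda>i\<in>I. card (P \<inter> B i)) * (\<Prod>i\<in>I. y i (P \<inter> B i)))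
   = (\<Sum>f\<in>?F. h (\<lambda>i\<in>I. card (f i)) * (\<Prod>i\<in>I. y i (f i)))"
 proof (rule sum.reindex_bij_witness[of _ "\<lambda>f. \<Union>i\<in>I. f i" "\<lambda>P. \<lambda>i\<in>I. P \<inter> B i"])
  fix f assume f: "f \<in> ?F"
  have "(\<Union>j\<in>I. f j) \<inter> B i = f i" if "i \<in> I" for i
  proof
   show "(\<Union>j\<in>I. f j) \<inter> B i \<subseteq> f i"
   proof
    fix x assume "x \<in> (\<Union>j\<in>I. f j) \<inter> B i"
    then obtain j where j: "j \<in> I" "x \<in> f j" "x \<in> B i" by auto
    then have "x \<in> B j" using f by (auto simp: PiE_iff)
    then have "j = i" using disj[of i j] j that by auto
    then show "x \<in> f i" using j by simp
   qed
   show "f i \<subseteq> (\<Union>j\<in>I. f j) \<inter> B i" using f that by (auto simp: PiE_iff)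
  qed
  then show "(\<lambda>i\<in>I. (\<Union>i\<in>I. f i) \<inter> B i) = f"
   using f by (auto simp: fun_eq_iff PiE_iff extensional_def)
  show "(\<Union>i\<in>I. f i) \<in> Pow (\<Union>i\<in>I. B i)" using f by (auto simp: PiE_iff)
 next
  fix P assume P: "P \<in> Pow (\<Union>i\<in>I. B i)"
  then show "(\<Union>i\<in>I. (\<lambda>i\<in>I. P \<inter> B i) i) = P" by auto
  show "(\<lambda>i\<in>I. P \<inter> B i) \<in> ?F" by auto
  have "(\<lambda>i\<in>I. card ((\<lambda>i\<in>I. P \<inter> B i) i)) = (\<lambda>i\<in>I. card (P \<inter> B i))" by auto
  moreover have "(\<Prod>i\<in>I. y i ((\<lambda>i\<in>I. P \<inter> B i) i)) = (\<Prod>i\<in>I. y i (P \<inter> B i))" by (rule prod.cong) auto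
  ultimately show "h (\<lambda>i\<in>I. card ((\<lambda>i\<in>I. P \<inter> B i) i)) * (\<Prod>i\<in>I. y i ((\<lambda>i\<in>I. P \<inter> B i) i))
    = h (\<lambda>i\<in>I. card (P \<inter> B i)) * (\<Prod>i\<in>I. y i (P \<inter> B i))" by simp
 qed
 also have "\<dots> = (\<Sum>s\<in>?S. \<Sum>f | f \<in> ?F \<and> (\<lambda>i\<in>I. card (f i)) = s. h (\<lambda>i\<in>I. card (f i)) * (\<Prod>i\<in>I. y i (f i)))"
 proof (rule sum.group[symmetric, OF fin])
  have "card (f i) \<le> card (B i)" if "f \<in> ?F" "i \<in> I" for f i
   using PiE_mem[OF that] B[OF that(2)] by (intro card_mono) auto
  then show "(\<lambda>f. \<lambda>i\<in>I. card (f i)) ` ?F \<subseteq> ?S" by auto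
 qed
 also have "\<dots> = (\<Sum>s\<in>?S. h s * (\<Prod>i\<in>I. \<Sum>P | P \<subseteq> B i \<and> card P = s i. y i P))"
 proof (rule sum.cong[OF refl])
  fix s assume s: "s \<in> ?S"
  have set: "{f \<in> ?F. (\<lambda>i\<in>I. card (f i)) = s} = PiE I (\<lambda>i. {P. P \<subseteq> B i \<and> card P = s i})"
  proof (intro set_eqI iffI)
   fix f assume "f \<in> {f \<in> ?F. (\<lambda>i\<in>I. card (f i)) = s}"
   then show "f \<in> PiE I (\<lambda>i. {P. P \<subseteq> B i \<and> card P = s i})" by (auto simp: PiE_iff)
  next
   fix f assume f: "f \<in> PiE I (\<lambda>i. {P. P \<subseteq> B i \<and> card P = s i})"
   have "(\<lambda>i\<in>I. card (f i)) = s"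
   proof
    fix i show "(\<lambda>i\<in>I. card (f i)) i = s i"
     using f s by (cases "i \<in> I") (auto simp: PiE_iff extensional_def)
   qed
   then show "f \<in> {f \<in> ?F. (\<lambda>i\<in>I. card (f i)) = s}" using f by (auto simp: PiE_iff)
  qed
  have "(\<Sum>f | f \<in> ?F \<and> (\<lambda>i\<in>I. card (f i)) = s. h (\<lambda>i\<in>I. card (f i)) * (\<Prod>i\<in>I. y i (f i)))
    = (\<Sum>f | f \<in> ?F \<and> (\<lambda>i\<in>I. card (f i)) = s. h s * (\<Prod>i\<in>I. y i (f i)))"
   by (rule sum.cong) auto
  also have "\<dots> = h s * (\<Sum>f\<in>PiE I (\<lambda>i. {P. P \<subseteq> B i \<and> card P = s i}). \<Prod>i\<in>I. y i (f i))"
   unfolding set sum_distrib_left ..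
  also have "(\<Sum>f\<in>PiE I (\<lambda>i. {P. P \<subseteq> B i \<and> card P = s i}). \<Prod>i\<in>I. y i (f i)) = (\<Prod>i\<in>I. \<Sum>P | P \<subseteq> B i \<and> card P = s i. y i P)"
   using I B by (intro prod_sum_PiE[symmetric]) auto
  finally show "(\<Sum>f | f \<in> ?F \<and> (\<lambda>i\<in>I. card (f i)) = s. h (\<lambda>i\<in>I. card (f i)) * (\<Prod>i\<in>I. y i (f i)))
    = h s * (\<Prod>i\<in>I. \<Sum>P | P \<subseteq> B i \<and> card P = s i. y i P)" .
 qed
 finally show ?thesis .
qed

definition binv :: "nat set => nat set => nat" where
 "binv B P = card {(x, y). x \<in> B \<and> y \<in> B \<and> x < y \<and> x \<notin> P \<and> y \<in> P}"

text \<open>Another form of \<open>phi_xw\<close>. The exponent is \<open>4\<close> rather than \<open>2\<close> because the parallel arcs of a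
bundle produce the same inversions at both of their legs.\<close>

lemma subset_sum_qbin:
 assumes "finite B"
 shows "(\<Sum>P | P \<subseteq> B \<and> card P = s. A powi (4 * int (binv B P))) = A powi (2 * (int s * (int (card B) - int s))) * qbin (card B) s"
 using assms
proof (induction B arbitrary: s rule: finite_linorder_max_induct)
 case empty
 show ?case
 proof (cases "s = 0")
  case True
  have "{P :: nat set. P \<subseteq> {} \<and> card P = s} = {{}}" using True by auto
  moreover have "binv {} {} = 0" by (simp add: binv_def)
  ultimately show ?thesis using True by simp
 next
  case False
  have e: "{P :: nat set. P \<subseteq> {} \<and> card P = s} = {}" using False by auto
  show ?thesis unfolding e using False by simp
 qed
next
 case (insert b B)
 have b: "b \<notin> B" using insert.hyps by auto
 have fB: "finite B" by fact
 let ?f = "\<lambda>P. A powi (4 * int (binv (insert b B) P))"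
 have out: "binv (insert b B) P = binv B P" if "P \<subseteq> B" for P
 proof -
  have "{(x, y). x \<in> insert b B \<and> y \<in> insert b B \<and> x < y \<and> x \<notin> P \<and> y \<in> P}
   = {(x, y). x \<in> B \<and> y \<in> B \<and> x < y \<and> x \<notin> P \<and> y \<in> P}"
  proof -
   have "x \<in> insert b B \<and> y \<in> insert b B \<and> x < y \<and> x \<notin> P \<and> y \<in> P \<longleftrightarrow> x \<in> B \<and> y \<in> B \<and> x < y \<and> x \<notin> P \<and> y \<in> P" for x y
   proof
    assume L: "x \<in> insert b B \<and> y \<in> insert b B \<and> x < y \<and> x \<notin> P \<and> y \<in> P"
    then have "y \<in> B" using that by auto
    then have "y < b" using insert.hyps(2) by auto
    then have "x \<noteq> b" using L by auto
    then show "x \<in> B \<and> y \<in> B \<and> x < y \<and> x \<notin> P \<and> y \<in> P" using L \<open>y \<in> B\<close> by auto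
   qed auto
   then show ?thesis by simp
  qed
  then show ?thesis by (simp add: binv_def)
 qed
 have inn: "binv (insert b B) (insert b P) = binv B P + (card B - card P)" if "P \<subseteq> B" for P
 proof -
  have "{(x, y). x \<in> insert b B \<and> y \<in> insert b B \<and> x < y \<and> x \<notin> insert b P \<and> y \<in> insert b P}
   = {(x, y). x \<in> B \<and> y \<in> B \<and> x < y \<and> x \<notin> P \<and> y \<in> P} \<union> (\<lambda>x. (x, b)) ` (B - P)"
   using that b insert.hyps(2) by (auto simp: image_iff)
  moreover have "card ((\<lambda>x. (x, b)) ` (B - P)) = card B - card P"
   using that fB by (simp add: card_image inj_on_def card_Diff_subset finite_subset)
  moreover have "finite {(x, y). x \<in> B \<and> y \<in> B \<and> x < y \<and> x \<notin> P \<and> y \<in> P}"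
   by (rule finite_subset[of _ "B \<times> B"]) (use fB in auto)
  moreover have "{(x, y). x \<in> B \<and> y \<in> B \<and> x < y \<and> x \<notin> P \<and> y \<in> P} \<inter> (\<lambda>x. (x, b)) ` (B - P) = {}"
   using b by auto
  ultimately show ?thesis unfolding binv_def using fB by (simp add: card_Un_disjoint)
 qed
 show ?case
 proof (cases s)
  case 0
  have "{P. P \<subseteq> insert b B \<and> card P = s} = {P. P \<subseteq> B \<and> card P = s}"
   using 0 fB by (auto simp: card_eq_0_iff dest: finite_subset)
  moreover have "(\<Sum>P | P \<subseteq> B \<and> card P = s. ?f P) = (\<Sum>P | P \<subseteq> B \<and> card P = s. A powi (4 * int (binv B P)))"
   by (rule sum.cong) (auto simp: out)
  ultimately show ?thesis using insert.IH[of s] 0 by simp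
 next
  case (Suc t)
  have split: "{P. P \<subseteq> insert b B \<and> card P = s} = {P. P \<subseteq> B \<and> card P = s} \<union> insert b ` {P. P \<subseteq> B \<and> card P = t}"
  proof (intro set_eqI iffI)
   fix P assume P: "P \<in> {P. P \<subseteq> insert b B \<and> card P = s}"
   show "P \<in> {P. P \<subseteq> B \<and> card P = s} \<union> insert b ` {P. P \<subseteq> B \<and> card P = t}"
   proof (cases "b \<in> P")
    case True
    then have "P = insert b (P - {b})" "P - {b} \<subseteq> B" "card (P - {b}) = t"
     using P Suc fB by (auto simp: finite_subset[of P "insert b B"])
    then show ?thesis by blast
   next
    case False
    then show ?thesis using P by auto
   qed
  next
   fix P assume "P \<in> {P. P \<subseteq> B \<and> card P = s} \<union> insert b ` {P. P \<subseteq> B \<and> card P = t}"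
   then show "P \<in> {P. P \<subseteq> insert b B \<and> card P = s}"
   proof
    assume "P \<in> insert b ` {P. P \<subseteq> B \<and> card P = t}"
    then obtain R where "P = insert b R" "R \<subseteq> B" "card R = t" by auto
    moreover from this have "finite R" "b \<notin> R" using fB b by (auto dest: finite_subset)
    ultimately show ?thesis using Suc by auto
   qed auto
  qed
  have inj: "inj_on (insert b) {P. P \<subseteq> B \<and> card P = t}"
   using b by (auto simp: inj_on_def dest!: insert_ident[THEN iffD1, rotated 2])
  have "(\<Sum>P | P \<subseteq> insert b B \<and> card P = s. ?f P)
    = (\<Sum>P | P \<subseteq> B \<and> card P = s. ?f P) + (\<Sum>P\<in>insert b ` {P. P \<subseteq> B \<and> card P = t}. ?f P)"
   unfolding split by (rule sum.union_disjoint) (use fB b in auto)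
  also have "(\<Sum>P | P \<subseteq> B \<and> card P = s. ?f P) = A powi (2 * (int s * (int (card B) - int s))) * qbin (card B) s"
   unfolding insert.IH[symmetric] by (rule sum.cong) (auto simp: out)
  also have "(\<Sum>P\<in>insert b ` {P. P \<subseteq> B \<and> card P = t}. ?f P) = (\<Sum>P | P \<subseteq> B \<and> card P = t. A powi (4 * (int (card B) - int t)) * A powi (4 * int (binv B P)))"
   unfolding sum.reindex[OF inj] o_def
  proof (rule sum.cong[OF refl])
   fix P assume P: "P \<in> {P. P \<subseteq> B \<and> card P = t}"
   then have "t \<le> card B" using fB by (auto intro: card_mono)
   then show "?f (insert b P) = A powi (4 * (int (card B) - int t)) * A powi (4 * int (binv B P))"
    unfolding power_int_add[OF disjI1[OF A_nonzero], symmetric] using P inn[of P] by (intro arg_cong[of _ _ "(powi) A"]) (simp add: of_nat_diff)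
  qed
  also have "\<dots> = A powi (4 * (int (card B) - int t)) * (A powi (2 * (int t * (int (card B) - int t))) * qbin (card B) t)"
   unfolding insert.IH[symmetric] sum_distrib_left ..
  finally have L: "(\<Sum>P | P \<subseteq> insert b B \<and> card P = s. ?f P) = A powi (2 * (int s * (int (card B) - int s))) * qbin (card B) s
    + A powi (4 * (int (card B) - int t)) * (A powi (2 * (int t * (int (card B) - int t))) * qbin (card B) t)" .
  have cI: "card (insert b B) = Suc (card B)" using b fB by simp
  have e1: "A powi (2 * (int s * (int (Suc (card B)) - int s))) * A powi (- 2 * int s) = A powi (2 * (int s * (int (card B) - int s)))"
   unfolding power_int_add[OF disjI1[OF A_nonzero], symmetric] by (rule arg_cong) (simp add: algebra_simps)
  have e2: "A powi (2 * (int s * (int (Suc (card B)) - int s))) * A powi (2 * (int (card B) - int t))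
    = A powi (4 * (int (card B) - int t)) * A powi (2 * (int t * (int (card B) - int t)))"
   unfolding power_int_add[OF disjI1[OF A_nonzero], symmetric] by (rule arg_cong) (simp add: Suc algebra_simps)
  have P: "qbin (Suc (card B)) s = A powi (- 2 * int s) * qbin (card B) s + A powi (2 * (int (card B) - int t)) * qbin (card B) t"
   unfolding Suc by (rule qbin_Pascal) simp
  have alg: "X * (u * Q + w * R) = (X * u) * Q + (X * w) * R" for X u Q w R :: ratfun
   by (simp add: algebra_simps)
  show ?thesis unfolding L cI P alg e1 e2 by (simp only: mult.assoc)
 qed
qed

section \<open>Integrality at a vertex\<close>

locale projector_setup =
 fixes \<pi> :: projector
 assumes lp: "local_projector \<pi>"
begin

abbreviation c where "c \<equiv> legs \<pi>"
abbreviation p where "p \<equiv> partner \<pi>"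
abbreviation n where "n \<equiv> sum_list (legs \<pi>)"
abbreviation d where "d \<equiv> length (legs \<pi>)"
abbreviation L where "L \<equiv> leg_of (legs \<pi>)"

lemma len_p: "length p = n"
 using lp by (simp add: local_projector_def Let_def)

lemma p_less: "x < n ==> p ! x < n"
 and p_neq: "x < n ==> p ! x \<noteq> x"
 and p_p: "x < n ==> p ! (p ! x) = x"
 and L_neq: "x < n ==> L (p ! x) \<noteq> L x"
 using lp by (simp_all add: local_projector_def Let_def)

lemma no_cross: "x < n ==> y < n ==> x < y ==> y < p ! x ==> p ! x < p ! y ==> False"
 using lp unfolding local_projector_def Let_def by blast

lemma matching_p: "matching p"
 unfolding matching_def len_p using p_less p_neq p_p by blast

lemma noncross_p: "noncross p"
 unfolding noncross_def len_p using no_cross by blast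

lemma L_less: "x < n ==> L x < d"
 by (rule leg_of_less)

lemma L_mono: "x \<le> y ==> y < n ==> L x \<le> L y"
 by (rule leg_of_mono)

lemma L_less_imp: "x < n ==> L x < L y ==> x < y"
 using L_mono[of y x] by (meson leD leI)

lemma left_iff: "x < n ==> x < p ! x \<longleftrightarrow> L x < L (p ! x)"
 using L_mono[of x "p ! x"] p_less[of x] L_neq[of x] L_less_imp[of x "p ! x"] by fastforce

text \<open>The legs in cyclic order, starting after leg \<open>i\<close>.\<close>

definition cl :: "nat => nat => nat" where
 "cl i k = (if i < k then k else k + d)"

text \<open>Arcs do not cross: read along one leg, the arcs go to legs in
decreasing cyclic order, and arcs to the same leg are nested.\<close>

lemma partner_order:
 assumes xy: "x < y" "y < n" "L x = L y"
 shows "cl (L x) (L (p ! y)) \<le> cl (L x) (L (p ! x))"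
  and "L (p ! x) = L (p ! y) ==> p ! y < p ! x"
proof -
 have x: "x < n" using xy by simp
 note px = p_less[OF x] L_neq[OF x] p_p[OF x] and py = p_less[OF xy(2)] L_neq[OF xy(2)] p_p[OF xy(2)]
 have neq: "p ! x \<noteq> p ! y" using px(3) py(3) xy(1) by auto
 have "cl (L x) (L (p ! y)) \<le> cl (L x) (L (p ! x)) \<and> (L (p ! x) = L (p ! y) \<longrightarrow> p ! y < p ! x)"
 proof (cases "L x < L (p ! x)")
  case R: True
  then have ypx: "y < p ! x" using L_less_imp[OF xy(2), of "p ! x"] xy(3) by simp
  show ?thesis
  proof (cases "L x < L (p ! y)")
   case True
   have "\<not> p ! x < p ! y" using no_cross[OF x xy(2) xy(1) ypx] by blast
   then have lt: "p ! y < p ! x" using neq by simp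
   then have "L (p ! y) \<le> L (p ! x)" using L_mono[of "p ! y" "p ! x"] px(1) by simp
   then show ?thesis using R True lt by (simp add: cl_def)
  next
   case False
   then have "L (p ! y) < L x" using py(2) xy(3) by simp
   then have "p ! y < x" using L_less_imp[OF py(1), of x] by simp
   then have False using no_cross[of "p ! y" x] py px x xy(1) ypx by simp
   then show ?thesis ..
  qed
 next
  case False
  then have Lx: "L (p ! x) < L x" using px(2) by simp
  show ?thesis
  proof (cases "L x < L (p ! y)")
   case True
   then show ?thesis using Lx False L_less[OF py(1)] by (simp add: cl_def)
  next
   case F: False
   then have Ly: "L (p ! y) < L x" using py(2) xy(3) by simp
   have lx: "p ! x < x" "p ! y < x" using L_less_imp[OF px(1), of x] L_less_imp[OF py(1), of x] Lx Ly by simp_all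
   have "\<not> p ! x < p ! y"
   proof
    assume "p ! x < p ! y"
    then show False using no_cross[of "p ! x" "p ! y"] px py lx xy(1) by simp
   qed
   then have lt: "p ! y < p ! x" using neq by simp
   then have "L (p ! y) \<le> L (p ! x)" using L_mono[of "p ! y" "p ! x"] px(1) by simp
   then show ?thesis using False F lt by (simp add: cl_def)
  qed
 qed
 then show "cl (L x) (L (p ! y)) \<le> cl (L x) (L (p ! x))" "L (p ! x) = L (p ! y) ==> p ! y < p ! x"
  by blast+
qed

definition arcs :: "nat set" where
 "arcs = {j. j < n \<and> j < p ! j}"

text \<open>A bundle: the points of one leg that are connected with another given leg.\<close>

definition bund :: "nat \<times> nat => nat set" where
 "bund B = {j. j < n \<and> L j = fst B \<and> L (p ! j) = snd B}"

definition prs :: "(nat \<times> nat) set" where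
 "prs = {(i, k). i < k \<and> k < d}"

lemma finite_prs [simp]: "finite prs"
 by (rule finite_subset[of _ "{..<d} \<times> {..<d}"]) (auto simp: prs_def)

lemma finite_bund [simp]: "finite (bund B)"
 by (simp add: bund_def)

lemma finite_arcs [simp]: "finite arcs"
 by (simp add: arcs_def)

lemma card_bund: "card (bund (i, k)) = arc_number \<pi> i k"
 by (simp add: bund_def arc_number_def)

lemma bund_disj: "B \<noteq> B' ==> bund B \<inter> bund B' = {}"
 by (auto simp: bund_def prod_eq_iff)

lemma arcs_Union: "arcs = (\<Union>B\<in>prs. bund B)"
proof (intro set_eqI iffI)
 fix j assume "j \<in> arcs"
 then have j: "j < n" "j < p ! j" by (auto simp: arcs_def)
 then have "(L j, L (p ! j)) \<in> prs" "j \<in> bund (L j, L (p ! j))"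
  using left_iff[OF j(1)] L_less[OF p_less[OF j(1)]] by (auto simp: prs_def bund_def)
 then show "j \<in> (\<Union>B\<in>prs. bund B)" by blast
next
 fix j assume "j \<in> (\<Union>B\<in>prs. bund B)"
 then show "j \<in> arcs" using left_iff by (auto simp: prs_def bund_def arcs_def)
qed

lemma bund_mirror: "bund (i, k) = (!) p ` bund (k, i)"
proof (intro set_eqI iffI)
 fix x assume "x \<in> bund (i, k)"
 then have "x = p ! (p ! x)" "p ! x \<in> bund (k, i)" using p_p p_less by (auto simp: bund_def)
 then show "x \<in> (!) p ` bund (k, i)" by blast
next
 fix x assume "x \<in> (!) p ` bund (k, i)"
 then show "x \<in> bund (i, k)" using p_p p_less by (auto simp: bund_def)
qed

lemma inj_p: "inj_on ((!) p) (bund B)"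
 by (rule inj_onI) (metis (mono_tags, lifting) bund_def mem_Collect_eq p_p)

lemma bund_self: "bund (i, i) = {}"
 using L_neq by (auto simp: bund_def)

text \<open>The ends of an arc carry opposite signs, so the words of nonzero weight correspond to the sets \<open>P\<close> of
arcs whose left end is positive.\<close>

definition orient :: "nat set => nat => bool" where
 "orient P x = (if x < p ! x then x \<in> P else p ! x \<notin> P)"

definition ccount :: "nat set => nat \<times> nat => nat" where
 "ccount P = (\<lambda>B\<in>prs. card (P \<inter> bund B))"

text \<open>The numbers of positive and of negative ends at leg \<open>i\<close> of the arcs to leg \<open>k\<close>, if
\<open>s B\<close> arcs of the bundle \<open>B\<close> have a positive left end.\<close>

definition plus :: "(nat \<times> nat => nat) => nat => nat => nat" where
 "plus s i k = (if i < k then s (i, k) else if k < i then card (bund (k, i)) - s (k, i) else 0)"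

definition minus :: "(nat \<times> nat => nat) => nat => nat => nat" where
 "minus s i k = (if i < k then card (bund (i, k)) - s (i, k) else if k < i then s (k, i) else 0)"

lemma plus_card:
 assumes "P \<subseteq> arcs" "i < d" "k < d"
 shows "card {x \<in> bund (i, k). orient P x} = plus (ccount P) i k"
  and "card {x \<in> bund (i, k). \<not> orient P x} = minus (ccount P) i k"
proof -
 have "card {x \<in> bund (i, k). orient P x} = plus (ccount P) i k \<and> card {x \<in> bund (i, k). \<not> orient P x} = minus (ccount P) i k"
 proof -
  consider "i < k" | "k < i" | "i = k" by linarith
  then show ?thesis
  proof cases
   case 1
   then have in_prs: "(i, k) \<in> prs" using assms by (simp add: prs_def)
   have "orient P x \<longleftrightarrow> x \<in> P" if "x \<in> bund (i, k)" for x
    using that 1 left_iff[of x] by (auto simp: bund_def orient_def)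
   then have "{x \<in> bund (i, k). orient P x} = P \<inter> bund (i, k)" "{x \<in> bund (i, k). \<not> orient P x} = bund (i, k) - P \<inter> bund (i, k)"
    by auto
   then show ?thesis using 1 in_prs by (simp add: plus_def minus_def ccount_def card_Diff_subset)
  next
   case 2
   then have in_prs: "(k, i) \<in> prs" using assms by (simp add: prs_def)
   have o: "orient P (p ! x) \<longleftrightarrow> x \<notin> P" if "x \<in> bund (k, i)" for x
    using that 2 left_iff[of x] p_p[of x] by (auto simp: bund_def orient_def)
   have "{x \<in> bund (i, k). orient P x} = (!) p ` (bund (k, i) - P \<inter> bund (k, i))"
    "{x \<in> bund (i, k). \<not> orient P x} = (!) p ` (P \<inter> bund (k, i))"
    unfolding bund_mirror[of i k] using o by auto
   moreover have "inj_on ((!) p) (bund (k, i) - P \<inter> bund (k, i))" "inj_on ((!) p) (P \<inter> bund (k, i))"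
    by (rule inj_on_subset[OF inj_p[of "(k, i)"]], blast)+
   ultimately show ?thesis using 2 in_prs by (simp add: plus_def minus_def ccount_def card_Diff_subset card_image)
  next
   case 3
   then show ?thesis by (simp add: bund_self plus_def minus_def)
  qed
 qed
 then show "card {x \<in> bund (i, k). orient P x} = plus (ccount P) i k"
  "card {x \<in> bund (i, k). \<not> orient P x} = minus (ccount P) i k" by blast+
qed

lemma sum_of_bool_card: "(\<Sum>x<m. of_bool (Q x)) = card {x. x < m \<and> Q x}" for m :: nat
proof -
 have "{..<m} \<inter> {x. Q x} = {x. x < m \<and> Q x}" by auto
 then show ?thesis by simp
qed

lemma leg_card:
 "card {x. x < n \<and> L x = i \<and> Q x} = (\<Sum>k<d. card {x \<in> bund (i, k). Q x})"
proof -
 have "card {x. x < n \<and> L x = i \<and> Q x} = (\<Sum>k<d. card {x \<in> {x. x < n \<and> L x = i \<and> Q x}. L (p ! x) = k})"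
  by (rule card_fibres) (use L_less p_less in auto)
 also have "\<dots> = (\<Sum>k<d. card {x \<in> bund (i, k). Q x})"
  by (intro sum.cong refl arg_cong[of _ _ card]) (auto simp: bund_def)
 finally show ?thesis .
qed

lemma pcount_orient:
 assumes "P \<subseteq> arcs" "i < d"
 shows "pcount c (orient P) i = (\<Sum>k<d. plus (ccount P) i k)"
 unfolding pcount_def sum_of_bool_card leg_card using plus_card[OF assms] by simp

lemma leg_size: "i < length cs ==> card {x. x < sum_list cs \<and> leg_of cs x = i} = cs ! i"
proof (induction cs arbitrary: i)
 case (Cons a cs)
 show ?case
 proof (cases i)
  case 0
  have "{x. x < sum_list (a # cs) \<and> leg_of (a # cs) x = i} = {..<a}"
   using 0 leg_of_Cons[of _ a cs] by (auto split: if_splits)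
  then show ?thesis using 0 by simp
 next
  case (Suc j)
  have "{x. x < sum_list (a # cs) \<and> leg_of (a # cs) x = i} = (+) a ` {x. x < sum_list cs \<and> leg_of cs x = j}"
  proof (intro set_eqI iffI)
   fix x assume x: "x \<in> {x. x < sum_list (a # cs) \<and> leg_of (a # cs) x = i}"
   then have "\<not> x < a" using Suc leg_of_Cons[of x a cs] by (auto split: if_splits)
   then have "x = a + (x - a)" "x - a \<in> {x. x < sum_list cs \<and> leg_of cs x = j}"
    using x Suc leg_of_Cons[of x a cs] by auto
   then show "x \<in> (+) a ` {x. x < sum_list cs \<and> leg_of cs x = j}" by blast
  next
   fix x assume "x \<in> (+) a ` {x. x < sum_list cs \<and> leg_of cs x = j}"
   then show "x \<in> {x. x < sum_list (a # cs) \<and> leg_of (a # cs) x = i}"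
    using Suc leg_of_Cons[of x a cs] by auto
  qed
  then show ?thesis using Cons Suc by (simp add: card_image)
 qed
qed simp

lemma leg_sum:
 assumes "P \<subseteq> arcs" "i < d"
 shows "c ! i = (\<Sum>k<d. plus (ccount P) i k) + (\<Sum>k<d. minus (ccount P) i k)"
proof -
 have "c ! i = card {x. x < n \<and> L x = i \<and> True}" using leg_size[OF assms(2)] by simp
 also have "\<dots> = (\<Sum>k<d. card {x \<in> bund (i, k). orient P x} + card {x \<in> bund (i, k). \<not> orient P x})"
  unfolding leg_card
 proof (rule sum.cong[OF refl])
  fix k
  have e: "{x \<in> bund (i, k). True} = {x \<in> bund (i, k). orient P x} \<union> {x \<in> bund (i, k). \<not> orient P x}" by blast
  show "card {x \<in> bund (i, k). True} = card {x \<in> bund (i, k). orient P x} + card {x \<in> bund (i, k). \<not> orient P x}"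
   unfolding e by (rule card_Un_disjoint) auto
 qed
 finally show ?thesis using plus_card[OF assms] by (simp add: sum.distrib)
qed

text \<open>The inversions at leg \<open>i\<close> between ends of arcs to \<open>k\<close> and ends of arcs to \<open>k'\<close>.\<close>

definition fib :: "nat set => nat => nat => nat => (nat \<times> nat) set" where
 "fib P i k k' = {(x, y). x \<in> bund (i, k) \<and> y \<in> bund (i, k') \<and> x < y \<and> \<not> orient P x \<and> orient P y}"

lemma fib_same:
 assumes "P \<subseteq> arcs" "i < k"
 shows "card (fib P i k k) = binv (bund (i, k)) (P \<inter> bund (i, k))"
  and "card (fib P k i i) = binv (bund (i, k)) (P \<inter> bund (i, k))"
proof -
 have o: "orient P x \<longleftrightarrow> x \<in> P" "orient P (p ! x) \<longleftrightarrow> x \<notin> P" if "x \<in> bund (i, k)" for x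
  using that assms left_iff[of x] p_p[of x] by (auto simp: bund_def orient_def)
 have "fib P i k k = {(x, y). x \<in> bund (i, k) \<and> y \<in> bund (i, k) \<and> x < y \<and> x \<notin> P \<inter> bund (i, k) \<and> y \<in> P \<inter> bund (i, k)}"
  using o by (auto simp: fib_def)
 then show "card (fib P i k k) = binv (bund (i, k)) (P \<inter> bund (i, k))" by (simp add: binv_def)
 have rev: "p ! y < p ! x \<longleftrightarrow> x < y" if "x \<in> bund (i, k)" "y \<in> bund (i, k)" for x y
 proof
  assume "x < y"
  then show "p ! y < p ! x" using partner_order(2)[of x y] that by (auto simp: bund_def)
 next
  assume lt: "p ! y < p ! x"
  then have "x \<noteq> y" by auto
  moreover have "\<not> y < x" using partner_order(2)[of y x] that lt by (auto simp: bund_def)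
  ultimately show "x < y" by simp
 qed
 let ?S = "{(x, y). x \<in> bund (i, k) \<and> y \<in> bund (i, k) \<and> x < y \<and> x \<notin> P \<inter> bund (i, k) \<and> y \<in> P \<inter> bund (i, k)}"
 have "fib P k i i = (\<lambda>(x, y). (p ! y, p ! x)) ` ?S"
 proof (intro set_eqI iffI)
  fix z assume "z \<in> fib P k i i"
  then obtain x y where z: "z = (x, y)" "x \<in> bund (k, i)" "y \<in> bund (k, i)" "x < y" "\<not> orient P x" "orient P y"
   by (auto simp: fib_def)
  obtain x' y' where x': "x' \<in> bund (i, k)" "x = p ! x'" and y': "y' \<in> bund (i, k)" "y = p ! y'"
   using z(2,3) unfolding bund_mirror[of k i] by auto
  have "(y', x') \<in> ?S" using x' y' z rev[of y' x'] o by auto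
  then show "z \<in> (\<lambda>(x, y). (p ! y, p ! x)) ` ?S" using z(1) x' y' by force
 next
  fix z assume "z \<in> (\<lambda>(x, y). (p ! y, p ! x)) ` ?S"
  then obtain x y where z: "z = (p ! y, p ! x)" "x \<in> bund (i, k)" "y \<in> bund (i, k)" "x < y" "x \<notin> P" "y \<in> P"
   by auto
  then show "z \<in> fib P k i i" using rev[of x y] o unfolding fib_def bund_mirror[of k i] by auto
 qed
 moreover have "inj_on (\<lambda>(x, y). (p ! y, p ! x)) ?S"
 proof (rule inj_onI)
  fix z z' assume "z \<in> ?S" "z' \<in> ?S" "(\<lambda>(x, y). (p ! y, p ! x)) z = (\<lambda>(x, y). (p ! y, p ! x)) z'"
  then show "z = z'" using inj_p[of "(i, k)"] by (auto simp: inj_on_def)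
 qed
 ultimately show "card (fib P k i i) = binv (bund (i, k)) (P \<inter> bund (i, k))"
  by (simp add: card_image binv_def)
qed

lemma cl_inj: "k < d ==> k' < d ==> cl i k = cl i k' ==> k = k'"
 by (auto simp: cl_def split: if_splits)

text \<open>The two groups of points are ordered by \<open>partner_order\<close>, so inversions are all pairs or none.\<close>

lemma fib_diff:
 assumes "P \<subseteq> arcs" "i < d" "k < d" "k' < d" "k \<noteq> k'"
 shows "card (fib P i k k') = (if cl i k' < cl i k then minus (ccount P) i k * plus (ccount P) i k' else 0)"
proof -
 have iff: "x < y \<longleftrightarrow> cl i k' < cl i k" if "x \<in> bund (i, k)" "y \<in> bund (i, k')" for x y
 proof
  have x: "x < n" "L x = i" "L (p ! x) = k" and y: "y < n" "L y = i" "L (p ! y) = k'"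
   using that by (auto simp: bund_def)
  have ncl: "cl i k \<noteq> cl i k'" using cl_inj assms by blast
  show "cl i k' < cl i k" if "x < y"
   using partner_order(1)[OF that y(1)] x y ncl by simp
  show "x < y" if c: "cl i k' < cl i k"
  proof (rule ccontr)
   assume "\<not> x < y"
   moreover have "x \<noteq> y" using x y assms(5) by auto
   ultimately have "y < x" by simp
   then show False using partner_order(1)[of y x] x y c by simp
  qed
 qed
 show ?thesis
 proof (cases "cl i k' < cl i k")
  case True
  then have "fib P i k k' = {x \<in> bund (i, k). \<not> orient P x} \<times> {y \<in> bund (i, k'). orient P y}"
   using iff by (auto simp: fib_def)
  then show ?thesis using True plus_card[OF assms(1,2,3)] plus_card[OF assms(1,2,4)] by (simp add: card_cartesian_product)
 next
  case False
  then have "fib P i k k' = {}" using iff by (auto simp: fib_def)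
  then show ?thesis using False by simp
 qed
qed

definition cross :: "(nat \<times> nat => nat) => nat" where
 "cross s = (\<Sum>i<d. \<Sum>k<d. \<Sum>k'<d. if k \<noteq> k' \<and> cl i k' < cl i k then minus s i k * plus s i k' else 0)"

lemma sum_prs: "(\<Sum>i<d. \<Sum>k<d. f i k) = (\<Sum>B\<in>prs. f (fst B) (snd B) + f (snd B) (fst B)) + (\<Sum>i<d. f i i)"
 for f :: "nat => nat => nat"
proof -
 have "(\<Sum>i<d. \<Sum>k<d. f i k) = (\<Sum>B\<in>{..<d} \<times> {..<d}. f (fst B) (snd B))"
  by (simp add: sum.cartesian_product case_prod_unfold)
 also have "{..<d} \<times> {..<d} = prs \<union> prod.swap ` prs \<union> (\<lambda>i. (i, i)) ` {..<d}"
  by (auto simp: prs_def image_iff)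
 also have "(\<Sum>B\<in>\<dots>. f (fst B) (snd B)) = (\<Sum>B\<in>prs \<union> prod.swap ` prs. f (fst B) (snd B)) + (\<Sum>B\<in>(\<lambda>i. (i, i)) ` {..<d}. f (fst B) (snd B))"
  by (rule sum.union_disjoint) (simp, simp, auto simp: prs_def)
 also have "(\<Sum>B\<in>prs \<union> prod.swap ` prs. f (fst B) (snd B)) = (\<Sum>B\<in>prs. f (fst B) (snd B)) + (\<Sum>B\<in>prod.swap ` prs. f (fst B) (snd B))"
  by (rule sum.union_disjoint) (simp, simp, auto simp: prs_def)
 also have "(\<Sum>B\<in>prod.swap ` prs. f (fst B) (snd B)) = (\<Sum>B\<in>prs. f (snd B) (fst B))"
  by (subst sum.reindex) (auto simp: o_def)
 also have "(\<Sum>B\<in>(\<lambda>i. (i, i)) ` {..<d}. f (fst B) (snd B)) = (\<Sum>i<d. f i i)"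
  by (subst sum.reindex) (auto simp: inj_on_def o_def)
 finally show ?thesis by (simp add: sum.distrib)
qed

lemma prod_prs: "(\<Prod>i<d. \<Prod>k<d. f i k) = (\<Prod>B\<in>prs. f (fst B) (snd B) * f (snd B) (fst B)) * (\<Prod>i<d. f i i)"
 for f :: "nat => nat => ratfun"
proof -
 have "(\<Prod>i<d. \<Prod>k<d. f i k) = (\<Prod>B\<in>{..<d} \<times> {..<d}. f (fst B) (snd B))"
  by (simp add: prod.cartesian_product case_prod_unfold)
 also have "{..<d} \<times> {..<d} = prs \<union> prod.swap ` prs \<union> (\<lambda>i. (i, i)) ` {..<d}"
  by (auto simp: prs_def image_iff)
 also have "(\<Prod>B\<in>\<dots>. f (fst B) (snd B)) = (\<Prod>B\<in>prs \<union> prod.swap ` prs. f (fst B) (snd B)) * (\<Prod>B\<in>(\<lambda>i. (i, i)) ` {..<d}. f (fst B) (snd B))"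
  by (rule prod.union_disjoint) (simp, simp, auto simp: prs_def)
 also have "(\<Prod>B\<in>prs \<union> prod.swap ` prs. f (fst B) (snd B)) = (\<Prod>B\<in>prs. f (fst B) (snd B)) * (\<Prod>B\<in>prod.swap ` prs. f (fst B) (snd B))"
  by (rule prod.union_disjoint) (simp, simp, auto simp: prs_def)
 also have "(\<Prod>B\<in>prod.swap ` prs. f (fst B) (snd B)) = (\<Prod>B\<in>prs. f (snd B) (fst B))"
  by (subst prod.reindex) (auto simp: o_def)
 also have "(\<Prod>B\<in>(\<lambda>i. (i, i)) ` {..<d}. f (fst B) (snd B)) = (\<Prod>i<d. f i i)"
  by (subst prod.reindex) (auto simp: inj_on_def o_def)
 finally show ?thesis by (simp add: prod.distrib)
qed

lemma pinv_orient:
 assumes "P \<subseteq> arcs"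
 shows "pinv c (orient P) = 2 * (\<Sum>B\<in>prs. binv (bund B) (P \<inter> bund B)) + cross (ccount P)"
proof -
 define S where "S = {(x, y). y < n \<and> x < y \<and> L x = L y \<and> \<not> orient P x \<and> orient P y}"
 have S_swap: "S = prod.swap ` (SIGMA y:{..<n}. {x. x < y \<and> L x = L y \<and> \<not> orient P x \<and> orient P y})"
  by (auto simp: S_def image_iff)
 have "pinv c (orient P) = card (SIGMA y:{..<n}. {x. x < y \<and> L x = L y \<and> \<not> orient P x \<and> orient P y})"
  unfolding pinv_def sum_of_bool_card by (rule card_SigmaI[symmetric]) auto
 also have "\<dots> = card S" unfolding S_swap by (simp add: card_image)
 also have "card S = (\<Sum>t\<in>{..<d} \<times> {..<d} \<times> {..<d}. card {z \<in> S. (L (fst z), L (p ! fst z), L (p ! snd z)) = t})"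
 proof (rule card_fibres)
  show "finite S" by (rule finite_subset[of _ "{..<n} \<times> {..<n}"]) (auto simp: S_def)
  show "(\<lambda>z. (L (fst z), L (p ! fst z), L (p ! snd z))) ` S \<subseteq> {..<d} \<times> {..<d} \<times> {..<d}"
   using L_less p_less by (auto simp: S_def)
 qed simp
 also have "\<dots> = (\<Sum>i<d. \<Sum>k<d. \<Sum>k'<d. card (fib P i k k'))"
 proof -
  have "{z \<in> S. (L (fst z), L (p ! fst z), L (p ! snd z)) = (i, k, k')} = fib P i k k'" for i k k'
   by (auto simp: S_def fib_def bund_def)
  then have "(\<Sum>i<d. \<Sum>k<d. \<Sum>k'<d. card (fib P i k k')) = (\<Sum>i<d. \<Sum>k<d. \<Sum>k'<d. card {z \<in> S. (L (fst z), L (p ! fst z), L (p ! snd z)) = (i, k, k')})"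
   by (simp only:)
  also have "\<dots> = (\<Sum>t\<in>{..<d} \<times> {..<d} \<times> {..<d}. card {z \<in> S. (L (fst z), L (p ! fst z), L (p ! snd z)) = t})"
   unfolding sum.cartesian_product case_prod_unfold prod.collapse ..
  finally show ?thesis by (rule sym)
 qed
 also have "\<dots> = (\<Sum>i<d. \<Sum>k<d. card (fib P i k k) + (\<Sum>k'<d. if k \<noteq> k' \<and> cl i k' < cl i k then minus (ccount P) i k * plus (ccount P) i k' else 0))"
 proof (intro sum.cong refl)
  fix i k assume i: "i \<in> {..<d}" and k: "k \<in> {..<d}"
  have "(\<Sum>k'<d. card (fib P i k k')) = (\<Sum>k'<d. (if k' = k then card (fib P i k k) else 0) + (if k \<noteq> k' \<and> cl i k' < cl i k then minus (ccount P) i k * plus (ccount P) i k' else 0))"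
   using i k fib_diff[OF assms] by (intro sum.cong refl) auto
  also have "\<dots> = card (fib P i k k) + (\<Sum>k'<d. if k \<noteq> k' \<and> cl i k' < cl i k then minus (ccount P) i k * plus (ccount P) i k' else 0)"
   using k by (simp add: sum.distrib)
  finally show "(\<Sum>k'<d. card (fib P i k k')) = \<dots>" .
 qed
 also have "\<dots> = (\<Sum>i<d. \<Sum>k<d. card (fib P i k k)) + cross (ccount P)"
  by (simp add: sum.distrib cross_def)
 also have "(\<Sum>i<d. \<Sum>k<d. card (fib P i k k)) = 2 * (\<Sum>B\<in>prs. binv (bund B) (P \<inter> bund B))"
 proof -
  have "(\<Sum>i<d. card (fib P i i i)) = 0" by (simp add: fib_def bund_self)
  moreover have "(\<Sum>B\<in>prs. card (fib P (fst B) (snd B) (snd B)) + card (fib P (snd B) (fst B) (fst B)))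
    = (\<Sum>B\<in>prs. 2 * binv (bund B) (P \<inter> bund B))"
   by (rule sum.cong) (auto simp: prs_def fib_same[OF assms])
  ultimately show ?thesis unfolding sum_prs by (simp add: sum_distrib_left)
 qed
 finally show ?thesis .
qed

definition oword :: "nat set => bool list" where
 "oword P = map (orient P) [0..<n]"

lemma length_oword [simp]: "length (oword P) = n"
 by (simp add: oword_def)

lemma oword_nth: "x < n ==> oword P ! x = orient P x"
 by (simp add: oword_def)

lemma pcount_cong: "(\<And>x. x < sum_list cs ==> e x = e' x) ==> pcount cs e = pcount cs e'"
 unfolding pcount_def by (rule ext, rule sum.cong) auto

lemma pinv_cong: "(\<And>x. x < sum_list cs ==> e x = e' x) ==> pinv cs e = pinv cs e'"
 unfolding pinv_def by (rule sum.cong[OF refl], rule sum.cong) auto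

lemma orient_arc: "j \<in> arcs ==> orient P j \<longleftrightarrow> j \<in> P" "j \<in> arcs ==> orient P (p ! j) \<longleftrightarrow> j \<notin> P"
 using p_p by (auto simp: arcs_def orient_def)

lemma arcw_oword:
 assumes "P \<subseteq> arcs"
 shows "arcw (mlab p) (oword P) = A ^ card P * (- inverse A) ^ (card arcs - card P)"
proof -
 have "arcw (mlab p) (oword P) = (\<Prod>j\<in>arcs. cupM (oword P ! j) (oword P ! (p ! j)))"
  unfolding arcs_def len_p[symmetric] by (rule arcw_mlab[OF matching_p]) (simp add: len_p)
 also have "\<dots> = (\<Prod>j\<in>arcs. if j \<in> P then A else - inverse A)"
 proof (rule prod.cong[OF refl])
  fix j assume j: "j \<in> arcs"
  then have "j < n" "p ! j < n" using p_less by (auto simp: arcs_def)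
  then show "cupM (oword P ! j) (oword P ! (p ! j)) = (if j \<in> P then A else - inverse A)"
   using orient_arc[OF j] by (simp add: oword_nth cupM_def)
 qed
 also have "\<dots> = (\<Prod>j\<in>P. A) * (\<Prod>j\<in>arcs - P. - inverse A)"
 proof -
  have "arcs \<inter> {j. j \<in> P} = P" "arcs \<inter> - {j. j \<in> P} = arcs - P" using assms by auto
  then show ?thesis by (simp add: prod.If_cases del: prod_constant)
 qed
 also have "\<dots> = A ^ card P * (- inverse A) ^ (card arcs - card P)"
  using assms by (simp add: card_Diff_subset finite_subset)
 finally show ?thesis .
qed

lemma sum_words_orient:
 "(\<Sum>es\<in>words n. f es * arcw (mlab p) es) = (\<Sum>P\<in>Pow arcs. f (oword P) * arcw (mlab p) (oword P))"
proof -
 have inj: "inj_on oword (Pow arcs)"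
 proof (rule inj_onI)
  fix P R assume PR: "P \<in> Pow arcs" "R \<in> Pow arcs" "oword P = oword R"
  have "j \<in> P \<longleftrightarrow> j \<in> R" if j: "j \<in> arcs" for j
  proof -
   have "j < n" using j by (simp add: arcs_def)
   then show ?thesis using PR(3) orient_arc(1)[OF j] oword_nth by metis
  qed
  then show "P = R" using PR by blast
 qed
 have zero: "arcw (mlab p) es = 0" if e: "es \<in> words n" "es \<notin> oword ` Pow arcs" for es
 proof -
  have l: "length es = n" using e by (simp add: words_def)
  define P where "P = {j \<in> arcs. es ! j}"
  have "\<exists>j\<in>arcs. es ! j = es ! (p ! j)"
  proof (rule ccontr)
   assume no: "\<not> (\<exists>j\<in>arcs. es ! j = es ! (p ! j))"
   have "es = oword P"
   proof (rule nth_equalityI)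
    fix x assume "x < length es"
    then have x: "x < n" using l by simp
    show "es ! x = oword P ! x"
    proof (cases "x < p ! x")
     case True
     then have "x \<in> arcs" using x by (simp add: arcs_def)
     then show ?thesis using True by (simp add: oword_nth[OF x] orient_def P_def)
    next
     case False
     then have "p ! x < x" using p_neq[OF x] by simp
     then have "p ! x \<in> arcs" using x p_less[OF x] p_p[OF x] by (simp add: arcs_def)
     then show ?thesis using False no p_p[OF x] by (auto simp: oword_nth[OF x] orient_def P_def)
    qed
   qed (simp add: l)
   then show False using e(2) by (auto simp: P_def)
  qed
  then obtain j where "j \<in> arcs" "cupM (es ! j) (es ! (p ! j)) = 0" by (auto simp: cupM_def)
  moreover have "arcw (mlab p) es = (\<Prod>j\<in>arcs. cupM (es ! j) (es ! (p ! j)))"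
   unfolding arcs_def len_p[symmetric] by (rule arcw_mlab[OF matching_p]) (simp add: len_p l)
  ultimately show ?thesis by (metis finite_arcs prod_zero)
 qed
 have "(\<Sum>es\<in>words n. f es * arcw (mlab p) es) = (\<Sum>es\<in>oword ` Pow arcs. f es * arcw (mlab p) es)"
 proof (rule sum.mono_neutral_right)
  show "finite (words n)" by simp
  show "oword ` Pow arcs \<subseteq> words n" by (auto simp: words_def)
  show "\<forall>es\<in>words n - oword ` Pow arcs. f es * arcw (mlab p) es = 0" using zero by simp
 qed
 also have "\<dots> = (\<Sum>P\<in>Pow arcs. f (oword P) * arcw (mlab p) (oword P))"
  by (simp add: sum.reindex[OF inj])
 finally show ?thesis .
qed

text \<open>The pairing of the arcs of a vertex with the symmetric functions on its legs.\<close>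

definition Phi :: "nat list => ratfun" where
 "Phi ks = (\<Sum>Es\<in>blk c. if map (cnt True) Es = ks then prod_list (map xA Es) * arcw (mlab p) (concat Es) else 0)"

definition hh :: "nat list => (nat \<times> nat => nat) => ratfun" where
 "hh ks s = (if map (\<lambda>i. \<Sum>k<d. plus s i k) [0..<d] = ks
   then A powi (2 * int (cross s)) * (A ^ (\<Sum>B\<in>prs. s B) * (- inverse A) ^ (card arcs - (\<Sum>B\<in>prs. s B))) else 0)"

lemma card_ccount:
 assumes "P \<subseteq> arcs"
 shows "card P = (\<Sum>B\<in>prs. ccount P B)"
proof -
 have "P = (\<Union>B\<in>prs. P \<inter> bund B)" using assms arcs_Union by blast
 then have "card P = card (\<Union>B\<in>prs. P \<inter> bund B)" by simp
 also have "\<dots> = (\<Sum>B\<in>prs. card (P \<inter> bund B))"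
 proof (rule card_UN_disjoint)
  show "\<forall>B\<in>prs. \<forall>B'\<in>prs. B \<noteq> B' \<longrightarrow> (P \<inter> bund B) \<inter> (P \<inter> bund B') = {}"
   using bund_disj by blast
 qed auto
 finally show ?thesis by (simp add: ccount_def)
qed

lemma Phi_eq:
 "Phi ks = (\<Sum>s\<in>PiE prs (\<lambda>B. {..card (bund B)}). hh ks s *
   (\<Prod>B\<in>prs. A powi (2 * (int (s B) * (int (card (bund B)) - int (s B)))) * qbin (card (bund B)) (s B)))"
proof -
 define F where "F es = (if map (pcount c ((!) es)) [0..<d] = ks then A powi (2 * int (pinv c ((!) es))) else 0)" for es
 have "Phi ks = (\<Sum>Es\<in>blk c. F (concat Es) * arcw (mlab p) (concat Es))"
  unfolding Phi_def
 proof (rule sum.cong[OF refl])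
  fix Es assume "Es \<in> blk c"
  then have Es: "map length Es = c" by (simp add: blk_def)
  show "(if map (cnt True) Es = ks then prod_list (map xA Es) * arcw (mlab p) (concat Es) else 0) = F (concat Es) * arcw (mlab p) (concat Es)"
   unfolding F_def map_cnt_pcount[OF Es] prod_xA_pinv[OF Es] by simp
 qed
 also have "\<dots> = (\<Sum>es\<in>words n. F es * arcw (mlab p) es)"
  by (rule sum_blk)
 also have "\<dots> = (\<Sum>P\<in>Pow arcs. F (oword P) * arcw (mlab p) (oword P))"
  by (rule sum_words_orient)
 also have "\<dots> = (\<Sum>P\<in>Pow (\<Union>B\<in>prs. bund B). hh ks (\<lambda>B\<in>prs. card (P \<inter> bund B)) * (\<Prod>B\<in>prs. A powi (4 * int (binv (bund B) (P \<inter> bund B)))))"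
  unfolding arcs_Union[symmetric]
 proof (rule sum.cong[OF refl])
  fix P assume "P \<in> Pow arcs"
  then have P: "P \<subseteq> arcs" by simp
  have pc: "pcount c ((!) (oword P)) = pcount c (orient P)" "pinv c ((!) (oword P)) = pinv c (orient P)"
   by (rule pcount_cong, simp add: oword_nth, rule pinv_cong, simp add: oword_nth)
  have m: "map (pcount c (orient P)) [0..<d] = map (\<lambda>i. \<Sum>k<d. plus (ccount P) i k) [0..<d]"
   using pcount_orient[OF P] by simp
  have "finite I ==> A powi (\<Sum>B\<in>I. f B) = (\<Prod>B\<in>I. A powi f B)" for f :: "nat \<times> nat => int" and I
   by (induction I rule: finite_induct) (simp_all add: power_int_add)
  note pr = this[OF finite_prs]
  have "A powi (2 * int (pinv c (orient P))) = A powi (2 * int (cross (ccount P))) * A powi (\<Sum>B\<in>prs. 4 * int (binv (bund B) (P \<inter> bund B)))"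
   unfolding pinv_orient[OF P] power_int_add[OF disjI1[OF A_nonzero], symmetric]
   by (rule arg_cong) (simp add: sum_distrib_left)
  then show "F (oword P) * arcw (mlab p) (oword P) = hh ks (\<lambda>B\<in>prs. card (P \<inter> bund B)) * (\<Prod>B\<in>prs. A powi (4 * int (binv (bund B) (P \<inter> bund B))))"
   unfolding F_def pc m hh_def arcw_oword[OF P] card_ccount[OF P] pr ccount_def[symmetric] by simp
 qed
 also have "\<dots> = (\<Sum>s\<in>PiE prs (\<lambda>B. {..card (bund B)}). hh ks s * (\<Prod>B\<in>prs. \<Sum>R | R \<subseteq> bund B \<and> card R = s B. A powi (4 * int (binv (bund B) R))))"
  by (rule sum_Pow_bundles) (use bund_disj in auto)
 finally show ?thesis by (simp only: subset_sum_qbin[OF finite_bund])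
qed

lemma projector_fact_prs: "projector_fact \<pi> = (\<Prod>B\<in>prs. qfact (card (bund B)))"
 unfolding projector_fact_def prs_def[symmetric] by (rule prod.cong) (auto simp: card_bund)

lemma leg_sum_s:
 assumes s: "s \<in> PiE prs (\<lambda>B. {..card (bund B)})" and i: "i < d"
 shows "c ! i = (\<Sum>k<d. plus s i k) + (\<Sum>k<d. minus s i k)"
proof -
 have "c ! i = (\<Sum>k<d. plus (ccount {}) i k + minus (ccount {}) i k)"
  using leg_sum[of "{}" i] i by (simp add: sum.distrib)
 also have "\<dots> = (\<Sum>k<d. plus s i k + minus s i k)"
 proof (rule sum.cong[OF refl])
  fix k assume k: "k \<in> {..<d}"
  have "(i, k) \<in> prs ==> s (i, k) \<le> card (bund (i, k))" "(k, i) \<in> prs ==> s (k, i) \<le> card (bund (k, i))"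
   using s by (auto simp: PiE_iff)
  then show "plus (ccount {}) i k + minus (ccount {}) i k = plus s i k + minus s i k"
   using i k by (auto simp: plus_def minus_def ccount_def prs_def)
 qed
 finally show ?thesis by (simp add: sum.distrib)
qed

text \<open>Summing over the arcs within each bundle gives Gaussian binomials \<open>[m]!/([s]! [m - s]!)\<close>. The
projector contributes \<open>1/[m]!\<close>, and for each leg \<open>i\<close> the numbers of negative ends of its bundles add up to
\<open>c ! i - ks ! i\<close>. So the quotient is a product of quantum multinomial coefficients, one per leg.\<close>

lemma Phi_integral:
 "Phi ks * (\<Prod>i<d. qfact (c ! i - ks ! i)) / projector_fact \<pi> \<in> LA"
proof -
 have "hh ks s * (\<Prod>B\<in>prs. A powi (2 * (int (s B) * (int (card (bund B)) - int (s B)))) * qbin (card (bund B)) (s B))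
    * (\<Prod>i<d. qfact (c ! i - ks ! i)) / projector_fact \<pi> \<in> LA"
  if s: "s \<in> PiE prs (\<lambda>B. {..card (bund B)})" for s
 proof (cases "map (\<lambda>i. \<Sum>k<d. plus s i k) [0..<d] = ks")
  case False
  then show ?thesis by (simp add: hh_def)
 next
  case True
  have hLA: "hh ks s \<in> LA" unfolding hh_def using True
   by (auto intro!: laurent_mult laurent_power laurent_minus)
  have sB: "s B \<le> card (bund B)" if "B \<in> prs" for B using s that by (auto simp: PiE_iff)
  have ks: "c ! i - ks ! i = (\<Sum>k<d. minus s i k)" if "i < d" for i
  proof -
   have "ks ! i = (\<Sum>k<d. plus s i k)" using that unfolding True[symmetric] by simp
   then show ?thesis using leg_sum_s[OF s that] by simp
  qed
  define U where "U = (\<Prod>B\<in>prs. A powi (2 * (int (s B) * (int (card (bund B)) - int (s B)))))"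
  have ULA: "U \<in> LA" unfolding U_def by (intro laurent_prod) auto
  have "(\<Prod>B\<in>prs. qbin (card (bund B)) (s B)) / projector_fact \<pi>
    = (\<Prod>B\<in>prs. qbin (card (bund B)) (s B) / qfact (card (bund B)))"
   unfolding projector_fact_prs by (rule prod_dividef[symmetric])
  also have "\<dots> = (\<Prod>B\<in>prs. 1 / (qfact (minus s (fst B) (snd B)) * qfact (minus s (snd B) (fst B))))"
  proof (rule prod.cong[OF refl])
   fix B assume B: "B \<in> prs"
   obtain i k where ik: "B = (i, k)" "i < k" using B by (auto simp: prs_def)
   then show "qbin (card (bund B)) (s B) / qfact (card (bund B)) = 1 / (qfact (minus s (fst B) (snd B)) * qfact (minus s (snd B) (fst B)))"
    using sB[OF B] by (simp add: minus_def qbin_def mult.commute)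
  qed
  also have "\<dots> = 1 / (\<Prod>i<d. \<Prod>k<d. qfact (minus s i k))"
   unfolding prod_prs by (simp add: prod_dividef minus_def)
  finally have q: "(\<Prod>B\<in>prs. qbin (card (bund B)) (s B)) / projector_fact \<pi> = 1 / (\<Prod>i<d. \<Prod>k<d. qfact (minus s i k))" .
  have "hh ks s * (\<Prod>B\<in>prs. A powi (2 * (int (s B) * (int (card (bund B)) - int (s B)))) * qbin (card (bund B)) (s B))
     * (\<Prod>i<d. qfact (c ! i - ks ! i)) / projector_fact \<pi>
   = hh ks s * U * ((\<Prod>B\<in>prs. qbin (card (bund B)) (s B)) / projector_fact \<pi>) * (\<Prod>i<d. qfact (c ! i - ks ! i))"
   by (simp add: prod.distrib U_def)
  also have "\<dots> = hh ks s * U * (\<Prod>i<d. qfact (\<Sum>k<d. minus s i k) / (\<Prod>k<d. qfact (minus s i k)))"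
   unfolding q prod_dividef using ks by simp
  also have "\<dots> \<in> LA"
   by (intro laurent_mult laurent_prod hLA ULA qmultinomial_LA) auto
  finally show ?thesis .
 qed
 then have "(\<Sum>s\<in>PiE prs (\<lambda>B. {..card (bund B)}). hh ks s *
   (\<Prod>B\<in>prs. A powi (2 * (int (s B) * (int (card (bund B)) - int (s B)))) * qbin (card (bund B)) (s B))
    * (\<Prod>i<d. qfact (c ! i - ks ! i)) / projector_fact \<pi>) \<in> LA"
  by (rule laurent_sum)
 then show ?thesis unfolding Phi_eq sum_distrib_right sum_divide_distrib .
qed

end

fun POPS :: "nat => nat list => vec => vec" where
 "POPS i [] v = v"
| "POPS i (c # cs) v = POPS (i + c) cs (Pop i c v)"

lemma blk_Nil [simp]: "blk [] = {[]}"
 by (auto simp: blk_def)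

lemma sum_blk_Cons: "(\<Sum>Es\<in>blk (c # cs). f Es) = (\<Sum>E\<in>words c. \<Sum>Es\<in>blk cs. f (E # Es))"
proof -
 have "(\<Sum>Es\<in>blk (c # cs). f Es) = (\<Sum>(E, Es)\<in>words c \<times> blk cs. f (E # Es))"
  by (rule sum.reindex_bij_witness[of _ "\<lambda>(E, Es). E # Es" "\<lambda>Es. (hd Es, tl Es)"])
   (auto simp: blk_def words_def map_eq_Cons_conv)
 then show ?thesis by (simp add: sum.cartesian_product)
qed

lemma POPS_split:
 "length pre = i ==> map length Hs = cs ==>
  POPS i cs v (pre @ concat Hs @ suf) = (\<Prod>H\<leftarrow>Hs. xA H * pcoeff (length H) (cnt True H))
   * (\<Sum>Es\<in>blk cs. (if map (cnt True) Es = map (cnt True) Hs then prod_list (map xA Es) else 0) * v (pre @ concat Es @ suf))"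
proof (induction cs arbitrary: i pre Hs v)
 case Nil
 then show ?case by simp
next
 case (Cons c cs)
 obtain H Hs' where Hs: "Hs = H # Hs'" "length H = c" "map length Hs' = cs"
  using Cons.prems(2) by (cases Hs) auto
 have l: "length (pre @ H) = i + c" using Cons.prems Hs by simp
 let ?W = "\<lambda>Hs. \<Prod>H\<leftarrow>Hs. xA H * pcoeff (length H) (cnt True H)"
 let ?I = "\<lambda>Es Hs. if map (cnt True) Es = map (cnt True) Hs then prod_list (map xA Es) else 0"
 have P: "Pop i c v ((pre @ H) @ concat Es @ suf) = (\<Sum>E\<in>words c. PopK c H E * v (pre @ E @ concat Es @ suf))" for Es
  using local_opD[OF local_Pop Cons.prems(1) Hs(2), of v "concat Es @ suf"] by simp
 have "POPS i (c # cs) v (pre @ concat Hs @ suf) = POPS (i + c) cs (Pop i c v) ((pre @ H) @ concat Hs' @ suf)"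
  by (simp add: Hs)
 also have "\<dots> = ?W Hs' * (\<Sum>Es\<in>blk cs. ?I Es Hs' * (\<Sum>E\<in>words c. PopK c H E * v (pre @ E @ concat Es @ suf)))"
  unfolding Cons.IH[OF l Hs(3)] P ..
 also have "(\<Sum>Es\<in>blk cs. ?I Es Hs' * (\<Sum>E\<in>words c. PopK c H E * v (pre @ E @ concat Es @ suf)))
   = (\<Sum>E\<in>words c. \<Sum>Es\<in>blk cs. ?I Es Hs' * (PopK c H E * v (pre @ E @ concat Es @ suf)))"
  unfolding sum_distrib_left by (rule sum.swap)
 also have "\<dots> = (\<Sum>E\<in>words c. \<Sum>Es\<in>blk cs. (xA H * pcoeff c (cnt True H)) * (?I (E # Es) (H # Hs') * v (pre @ concat (E # Es) @ suf)))"
  by (intro sum.cong refl) (auto simp: PopK_def)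
 also have "\<dots> = (xA H * pcoeff c (cnt True H)) * (\<Sum>Es\<in>blk (c # cs). ?I Es Hs * v (pre @ concat Es @ suf))"
  unfolding sum_blk_Cons Hs(1) sum_distrib_left ..
 finally show ?case by (simp add: Hs mult_ac)
qed

lemma prod_list_nth: "prod_list xs = (\<Prod>i<length xs. xs ! i)" for xs :: "ratfun list"
 by (simp add: prod.list_conv_set_nth atLeast0LessThan)

lemma integral_vec_vertex:
 assumes lp: "local_projector \<pi>" and v: "integral_vec (bs1 @ bs2) v" and i: "i = sum_list bs1"
 shows "integral_vec (bs1 @ legs \<pi> @ bs2)
  (\<lambda>es. (\<Prod>c\<leftarrow>legs \<pi>. qfact c) / projector_fact \<pi> * POPS i (legs \<pi>) (act (Arcs i (mlab (partner \<pi>))) v) es)"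
proof -
 interpret projector_setup \<pi> using lp by unfold_locales
 obtain g where g: "\<And>ks. g ks \<in> LA"
  and v: "\<And>Es. map length Es = bs1 @ bs2 ==> v (concat Es) = g (map (cnt True) Es) * basis_w Es"
  using v unfolding integral_vec_def by auto
 define m where "m = length bs1"
 define mid where "mid ks = take d (drop m ks)" for ks :: "nat list"
 define cf where "cf ls = (\<Prod>i<d. A powi (- 2 * (int (ls ! i) * (int (c ! i) - int (ls ! i)))))" for ls :: "nat list"
 define g' where "g' ks = (if length (mid ks) = d \<and> (\<forall>i<d. mid ks ! i \<le> c ! i) then
  cf (mid ks) * (Phi (mid ks) * (\<Prod>i<d. qfact (c ! i - mid ks ! i)) / projector_fact \<pi>) * g (take m ks @ drop (m + d) ks) else 0)" for ks
 have "g' ks \<in> LA" for ks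
 proof (cases "length (mid ks) = d \<and> (\<forall>i<d. mid ks ! i \<le> c ! i)")
  case True
  show ?thesis unfolding g'_def if_P[OF True] cf_def
   by (intro laurent_mult laurent_prod Phi_integral g laurent_powi A_nonzero)
 next
  case False
  show ?thesis unfolding g'_def if_not_P[OF False] by simp
 qed
 moreover have "(\<Prod>c\<leftarrow>c. qfact c) / projector_fact \<pi> * POPS i c (act (Arcs i (mlab p)) v) (concat Es) = g' (map (cnt True) Es) * basis_w Es"
  if Es: "map length Es = bs1 @ c @ bs2" for Es
 proof -
  obtain Es1 Fs where 1: "Es = Es1 @ Fs" "map length Es1 = bs1" "map length Fs = c @ bs2"
   using iffD1[OF map_eq_append_conv Es] by metis
  obtain Hs Es2 where 2: "Fs = Hs @ Es2" "map length Hs = c" "map length Es2 = bs2"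
   using iffD1[OF map_eq_append_conv 1(3)] by metis
  define pre suf where d: "pre = concat Es1" "suf = concat Es2"
  have lpre: "length pre = i" using 1 by (simp add: d i length_concat_map)
  have lens: "length Es1 = m" "length Hs = length c"
   using arg_cong[OF 1(2), of length] arg_cong[OF 2(2), of length] by (simp_all add: m_def)
  define ls where "ls = map (cnt True) Hs"
  have mid: "mid (map (cnt True) Es) = ls" "take m (map (cnt True) Es) = map (cnt True) Es1"
   "drop (m + length c) (map (cnt True) Es) = map (cnt True) Es2"
   using lens by (simp_all add: mid_def 1 2 ls_def)
  have lH: "length (Hs ! t) = c ! t" if "t < length c" for t
   using that lens arg_cong[OF 2(2), of "\<lambda>xs. xs ! t"] by simp
  have lls: "length ls = length c" "ls ! t = cnt True (Hs ! t)" if "t < length c" for t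
   using lens that by (simp_all add: ls_def)
  have lls': "length ls = length c" using lens by (simp add: ls_def)
  have le: "ls ! t \<le> c ! t" if "t < length c" for t
   using lls(2)[OF that] lH[OF that] cnt_le_length[of "Hs ! t" True] by simp
  have v': "v (pre @ suf) = g (map (cnt True) Es1 @ map (cnt True) Es2) * (basis_w Es1 * basis_w Es2)"
   using v[of "Es1 @ Es2"] 1 2 by (simp add: d)
  have "POPS i c (act (Arcs i (mlab p)) v) (concat Es) = POPS i c (act (Arcs i (mlab p)) v) (pre @ concat Hs @ suf)"
   by (simp add: 1 2 d)
  also have "\<dots> = (\<Prod>H\<leftarrow>Hs. xA H * pcoeff (length H) (cnt True H)) *
    (\<Sum>Es\<in>blk c. (if map (cnt True) Es = ls then prod_list (map xA Es) else 0) * act (Arcs i (mlab p)) v (pre @ concat Es @ suf))"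
   unfolding ls_def by (rule POPS_split[OF lpre 2(2)])
  also have "(\<Sum>Es\<in>blk c. (if map (cnt True) Es = ls then prod_list (map xA Es) else 0) * act (Arcs i (mlab p)) v (pre @ concat Es @ suf))
    = Phi ls * v (pre @ suf)"
   unfolding Phi_def sum_distrib_right
  proof (rule sum.cong[OF refl])
   fix Es assume "Es \<in> blk c"
   then have "length (concat Es) = length (mlab p)" by (simp add: blk_def mlab_def len_p length_concat)
   from act_Arcs_split[OF lpre this, of v suf]
   show "(if map (cnt True) Es = ls then prod_list (map xA Es) else 0) * act (Arcs i (mlab p)) v (pre @ concat Es @ suf)
    = (if map (cnt True) Es = ls then prod_list (map xA Es) * arcw (mlab p) (concat Es) else 0) * v (pre @ suf)"
    by (simp del: act.simps)
  qed
  finally have P: "POPS i c (act (Arcs i (mlab p)) v) (concat Es) = (\<Prod>H\<leftarrow>Hs. xA H * pcoeff (length H) (cnt True H)) * (Phi ls * v (pre @ suf))" .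
  have W: "(\<Prod>c\<leftarrow>c. qfact c) * (\<Prod>H\<leftarrow>Hs. xA H * pcoeff (length H) (cnt True H)) = cf ls * (\<Prod>i<length c. qfact (c ! i - ls ! i)) * basis_w Hs"
  proof -
   have "(\<Prod>c\<leftarrow>c. qfact c) * (\<Prod>H\<leftarrow>Hs. xA H * pcoeff (length H) (cnt True H))
    = (\<Prod>t<length c. qfact (c ! t) * (xA (Hs ! t) * pcoeff (c ! t) (ls ! t)))"
   proof -
    have "(\<Prod>H\<leftarrow>Hs. xA H * pcoeff (length H) (cnt True H)) = (\<Prod>t<length c. xA (Hs ! t) * pcoeff (c ! t) (ls ! t))"
     unfolding prod_list_nth by (rule prod.cong) (simp_all add: lens lH lls(2))
    moreover have "(\<Prod>c\<leftarrow>c. qfact c) = (\<Prod>t<length c. qfact (c ! t))" by (simp add: prod_list_nth)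
    ultimately show ?thesis by (simp only: prod.distrib)
   qed
   also have "\<dots> = (\<Prod>t<length c. A powi (- 2 * (int (ls ! t) * (int (c ! t) - int (ls ! t)))) * qfact (c ! t - ls ! t) * (qfact (cnt True (Hs ! t)) * xA (Hs ! t)))"
   proof (rule prod.cong[OF refl])
    fix t assume "t \<in> {..<length c}"
    then have t: "t < length c" by simp
    show "qfact (c ! t) * (xA (Hs ! t) * pcoeff (c ! t) (ls ! t)) = A powi (- 2 * (int (ls ! t) * (int (c ! t) - int (ls ! t)))) * qfact (c ! t - ls ! t) * (qfact (cnt True (Hs ! t)) * xA (Hs ! t))"
     unfolding pcoeff_eq[OF le[OF t]] lls(2)[OF t, symmetric] by simp
   qed
   also have "\<dots> = cf ls * (\<Prod>i<length c. qfact (c ! i - ls ! i)) * basis_w Hs"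
    unfolding prod.distrib cf_def basis_w_def prod_list_nth using lens by (simp add: prod.distrib)
   finally show ?thesis .
  qed
  have g'e: "g' (map (cnt True) Es) = cf ls * (Phi ls * (\<Prod>i<length c. qfact (c ! i - ls ! i)) / projector_fact \<pi>) * g (map (cnt True) Es1 @ map (cnt True) Es2)"
   unfolding g'_def mid using lls' le by simp
  have bwE: "basis_w Es = basis_w Es1 * basis_w Hs * basis_w Es2" by (simp add: 1 2 mult_ac)
  have "(\<Prod>c\<leftarrow>c. qfact c) / projector_fact \<pi> * POPS i c (act (Arcs i (mlab p)) v) (concat Es)
   = ((\<Prod>c\<leftarrow>c. qfact c) * (\<Prod>H\<leftarrow>Hs. xA H * pcoeff (length H) (cnt True H))) * (Phi ls * v (pre @ suf)) / projector_fact \<pi>"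
   unfolding P by simp
  also have "\<dots> = g' (map (cnt True) Es) * basis_w Es"
   unfolding W g'e v' bwE by (simp add: mult_ac)
  finally show ?thesis .
 qed
 ultimately show ?thesis unfolding integral_vec_def by (intro exI[of _ g']) auto
qed

section \<open>Sums over all permutation braids\<close>

lemma Pop_lin: "Pop i b (\<lambda>es. a * v es + c * u es) es = a * Pop i b v es + c * Pop i b u es"
 by (simp add: Pop_def sp_def phi_lin algebra_simps)

lemma Pop_scale: "Pop i b (\<lambda>es. a * v es) = (\<lambda>es. a * Pop i b v es)"
 using Pop_lin[of i b a v 0 v] by (intro ext) simp

lemma Pop_sum:
 "finite I ==> Pop i b (\<lambda>es. \<Sum>j\<in>I. f j * v j es) es = (\<Sum>j\<in>I. f j * Pop i b (v j) es)"
proof (induction I rule: finite_induct)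
 case empty
 then show ?case using Pop_lin[of i b 0 "\<lambda>_. 0" 0 "\<lambda>_. 0"] by simp
next
 case (insert j I)
 then show ?case using Pop_lin[of i b "f j" "v j" 1 "\<lambda>es. \<Sum>j\<in>I. f j * v j es"] by simp
qed

lemma runs_scale: "runs w (\<lambda>es. a * v es) = (\<lambda>es. a * runs w v es)"
 using runs_lin[of w a v 0 v] by simp

lemma run_scale: "run z s w (\<lambda>es. a * v es) = (\<lambda>es. a * run z s w v es)"
 using run_lin[of z s w a v 0 v] by simp

text \<open>A word of slices with gaps (for the edge in question, and its position) for permutation braids.\<close>

datatype citem = Fix "slice list" | Slot "nat set" nat

fun expand :: "(nat set => nat) => (nat set => nat => nat) => citem => slice list" where
 "expand b \<sigma> (Fix w) = w"
| "expand b \<sigma> (Slot e i) = perm_braid i (b e) (\<sigma> e)"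

fun exec :: "(nat set => nat) => citem => vec => vec" where
 "exec b (Fix w) v = runs w v"
| "exec b (Slot e i) v = Pop i (b e) v"

fun slots :: "citem list => nat set list" where
 "slots [] = []"
| "slots (Fix w # its) = slots its"
| "slots (Slot e i # its) = e # slots its"

fun ifits :: "(nat set => nat) => nat => citem => nat => bool" where
 "ifits b N (Fix w) N' \<longleftrightarrow> vword N w N'"
| "ifits b N (Slot e i) N' \<longleftrightarrow> i + b e \<le> N \<and> N' = N"

fun itfits :: "(nat set => nat) => nat => citem list => nat => bool" where
 "itfits b N [] N' \<longleftrightarrow> N = N'"
| "itfits b N (it # its) N' \<longleftrightarrow> (\<exists>M. ifits b N it M \<and> itfits b M its N')"

lemma itfits_append: "itfits b N (its @ its') N' \<longleftrightarrow> (\<exists>M. itfits b N its M \<and> itfits b M its' N')"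
 by (induction its arbitrary: N) auto

lemma slots_append [simp]: "slots (its @ its') = slots its @ slots its'"
 by (induction its rule: slots.induct) auto

definition wt :: "nat => (nat => nat) => ratfun" where
 "wt b \<tau> = A ^ (b * (b - 1)) * A powi (- 3 * int (inversions b \<tau>))"

lemma vword_expand: "itfits b N its N' ==> vword N (concat (map (expand b \<sigma>) its)) N'"
proof (induction its arbitrary: N)
 case (Cons it its)
 then obtain M where M: "ifits b N it M" "itfits b M its N'" by auto
 have "vword N (expand b \<sigma> it) M" using M(1) by (cases it) (auto simp: perm_braid_word)
 then show ?case using Cons.IH[OF M(2)] by (auto simp: vword_append)
qed simp

text \<open>Each gap belongs to a different edge, hence the sum over all families of permutations is an iterated
sum, and each of these replaces a gap by \<open>[b]!\<close> times a projection.\<close>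

lemma sum_slots:
 assumes "distinct (slots its)" "itfits b N its N'"
 shows "eqv N' (\<lambda>es. \<Sum>\<sigma>\<in>PiE (set (slots its)) (\<lambda>e. {\<tau>. \<tau> permutes {..<b e}}).
    (\<Prod>e\<in>set (slots its). wt (b e) (\<sigma> e)) * runs (concat (map (expand b \<sigma>) its)) v es)
   (\<lambda>es. (\<Prod>e\<in>set (slots its). qfact (b e)) * fold (exec b) its v es)"
 using assms
proof (induction its arbitrary: N' rule: rev_induct)
 case Nil
 then show ?case by simp
next
 case (snoc it its)
 let ?P = "\<lambda>e. {\<tau>. \<tau> permutes {..<b e}}"
 have fin: "finite (?P e)" for e by (rule finite_permutations) simp
 have finS: "finite (PiE (set (slots its)) ?P)" using fin by (intro finite_PiE) auto
 obtain M where M: "itfits b N its M" "ifits b M it N'" using snoc.prems(2) by (auto simp: itfits_append)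
 have dist: "distinct (slots its)" using snoc.prems(1) by simp
 let ?S = "\<lambda>es. \<Sum>\<sigma>\<in>PiE (set (slots its)) ?P. (\<Prod>e\<in>set (slots its). wt (b e) (\<sigma> e)) * runs (concat (map (expand b \<sigma>) its)) v es"
 note IH = snoc.IH[OF dist M(1)]
 show ?case
 proof (cases it)
  case (Fix w)
  have w: "vword M w N'" using M(2) Fix by simp
  have "eqv N' (runs w ?S) (runs w (\<lambda>es. (\<Prod>e\<in>set (slots its). qfact (b e)) * fold (exec b) its v es))"
   by (rule runs_cong[OF IH w])
  then show ?thesis by (simp add: Fix runs_sum[OF finS] runs_scale eqv_def)
 next
  case (Slot e i)
  have i: "i + b e \<le> M" "N' = M" using M(2) Slot by auto
  have e: "e \<notin> set (slots its)" using snoc.prems(1) Slot by auto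
  let ?h = "\<lambda>(y, g). g(e := y) :: nat set => nat => nat"
  have T: "PiE (insert e (set (slots its))) ?P = ?h ` (?P e \<times> PiE (set (slots its)) ?P)"
   by (rule PiE_insert_eq)
  have inj: "inj_on ?h (?P e \<times> PiE (set (slots its)) ?P)"
   using e by (rule inj_combinator)
  have ins: "set (slots (its @ [it])) = insert e (set (slots its))" using Slot by auto
  show ?thesis
   unfolding eqv_def
  proof (intro allI impI)
   fix es :: "bool list" assume l: "length es = N'"
   have cs: "concat (map (expand b (g(e := y))) its) = concat (map (expand b g) its)" for y g
   proof -
    have "map (expand b (g(e := y))) its = map (expand b g) its"
     using e by (induction its rule: slots.induct) auto
    then show ?thesis by (simp only:)
   qed
   have "(\<Sum>\<sigma>\<in>PiE (set (slots (its @ [it]))) ?P. (\<Prod>e\<in>set (slots (its @ [it])). wt (b e) (\<sigma> e)) * runs (concat (map (expand b \<sigma>) (its @ [it]))) v es)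
    = (\<Sum>(y, g)\<in>?P e \<times> PiE (set (slots its)) ?P. (\<Prod>e\<in>set (slots its). wt (b e) (g e)) * (wt (b e) y * runs (perm_braid i (b e) y) (runs (concat (map (expand b g) its)) v) es))"
    unfolding ins T
   proof (subst sum.reindex[OF inj], rule sum.cong[OF refl], clarify)
    fix y g
    have "(\<Prod>e'\<in>insert e (set (slots its)). wt (b e') ((g(e := y)) e')) = wt (b e) y * (\<Prod>e'\<in>set (slots its). wt (b e') (g e'))"
     using e by (simp, intro disjI2 prod.cong) auto
    then show "((\<lambda>\<sigma>. (\<Prod>e\<in>insert e (set (slots its)). wt (b e) (\<sigma> e)) * runs (concat (map (expand b \<sigma>) (its @ [it]))) v es) \<circ> (\<lambda>(y, g). g(e := y))) (y, g)
     = (\<Prod>e\<in>set (slots its). wt (b e) (g e)) * (wt (b e) y * runs (perm_braid i (b e) y) (runs (concat (map (expand b g) its)) v) es)"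
     by (simp add: cs Slot mult_ac)
   qed
   also have "\<dots> = (\<Sum>g\<in>PiE (set (slots its)) ?P. (\<Prod>e\<in>set (slots its). wt (b e) (g e)) * (\<Sum>y\<in>?P e. wt (b e) y * runs (perm_braid i (b e) y) (runs (concat (map (expand b g) its)) v) es))"
    unfolding sum.cartesian_product[symmetric] sum_distrib_left by (rule sum.swap)
   also have "\<dots> = (\<Sum>g\<in>PiE (set (slots its)) ?P. (\<Prod>e\<in>set (slots its). wt (b e) (g e)) * (qfact (b e) * Pop i (b e) (runs (concat (map (expand b g) its)) v) es))"
    unfolding wt_def using perm_braid_sum[of i "b e" es] i l by simp
   also have "\<dots> = qfact (b e) * Pop i (b e) ?S es"
    unfolding Pop_sum[OF finS] by (simp add: sum_distrib_left mult_ac)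
   also have "Pop i (b e) ?S es = Pop i (b e) (\<lambda>es. (\<Prod>e\<in>set (slots its). qfact (b e)) * fold (exec b) its v es) es"
    using Pop_cong[OF IH i(1)] l i by (simp add: eqv_def)
   also have "qfact (b e) * \<dots> = (\<Prod>e\<in>set (slots (its @ [it])). qfact (b e)) * fold (exec b) (its @ [it]) v es"
    unfolding ins using e by (simp add: Pop_scale Slot)
   finally show "(\<Sum>\<sigma>\<in>PiE (set (slots (its @ [it]))) ?P. (\<Prod>e\<in>set (slots (its @ [it])). wt (b e) (\<sigma> e)) * runs (concat (map (expand b \<sigma>) (its @ [it]))) v es)
    = (\<Prod>e\<in>set (slots (its @ [it])). qfact (b e)) * fold (exec b) (its @ [it]) v es" .
  qed
 qed
qed

section \<open>Projections on the segments\<close>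

lemma Pop_commute:
 assumes "i + b \<le> j" "j + b' \<le> N"
 shows "eqv N (Pop j b' (Pop i b v)) (Pop i b (Pop j b' v))"
proof -
 obtain d where d: "j = i + b + d" using assms(1) le_Suc_ex by blast
 show ?thesis unfolding d
  by (rule local_op_commute[OF local_Pop local_Pop local_Pop]) (use assms d in simp)
qed

context
 fixes col :: "nat => nat"
begin

text \<open>\<open>T\<close> is the set of the segments that carry a projection where they begin.\<close>

definition mark :: "nat set => nat => nat => vec => vec" where
 "mark T s i v = (if s \<in> T then Pop i (col s) v else v)"

fun MK :: "nat set => nat => nat list => vec => vec" where
 "MK T i [] v = v"
| "MK T i (h # hs) v = MK T (i + col h) hs (mark T h i v)"

abbreviation wid :: "nat list => nat" where
 "wid hs \<equiv> sum_list (map col hs)"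

lemma mark_cong: "eqv N v u ==> i + col s \<le> N ==> eqv N (mark T s i v) (mark T s i u)"
 by (simp add: mark_def Pop_cong)

lemma MK_cong: "eqv N v u ==> i + wid hs \<le> N ==> eqv N (MK T i hs v) (MK T i hs u)"
proof (induction hs arbitrary: i v u)
 case (Cons h hs)
 then show ?case by (simp, intro Cons.IH mark_cong) auto
qed simp

lemma MK_UNIV: "MK UNIV i hs v = POPS i (map col hs) v"
 by (induction hs arbitrary: i v) (auto simp: mark_def)

lemma MK_subset: "T \<inter> set hs = T' \<inter> set hs ==> MK T i hs v = MK T' i hs v"
proof (induction hs arbitrary: i v)
 case (Cons h hs)
 have "h \<in> T \<longleftrightarrow> h \<in> T'" using Cons.prems by auto
 moreover have "T \<inter> set hs = T' \<inter> set hs" using Cons.prems by auto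
 ultimately show ?case using Cons.IH by (simp add: mark_def)
qed simp

lemma MK_Pop_left:
 "i' + b \<le> i ==> i + wid hs \<le> N ==> eqv N (Pop i' b (MK T i hs v)) (MK T i hs (Pop i' b v))"
proof (induction hs arbitrary: i v)
 case (Cons h hs)
 have "eqv N (Pop i' b (MK T (i + col h) hs (mark T h i v))) (MK T (i + col h) hs (Pop i' b (mark T h i v)))"
  using Cons by auto
 also have "eqv N \<dots> (MK T (i + col h) hs (mark T h i (Pop i' b v)))"
  using Cons.prems by (intro MK_cong) (auto simp: mark_def intro: eqv_sym[OF Pop_commute])
 finally show ?case by simp
qed simp

lemma MK_Pop_right:
 "i + wid hs \<le> i' ==> i' + b \<le> N ==> eqv N (Pop i' b (MK T i hs v)) (MK T i hs (Pop i' b v))"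
proof (induction hs arbitrary: i v)
 case (Cons h hs)
 have "eqv N (Pop i' b (MK T (i + col h) hs (mark T h i v))) (MK T (i + col h) hs (Pop i' b (mark T h i v)))"
  using Cons by auto
 also have "eqv N \<dots> (MK T (i + col h) hs (mark T h i (Pop i' b v)))"
  using Cons.prems by (intro MK_cong) (auto simp: mark_def intro: Pop_commute)
 finally show ?case by simp
qed simp

lemma MK_Pop:
 "k < length hs ==> distinct hs ==> i + wid hs \<le> N ==>
  eqv N (Pop (i + wid (take k hs)) (col (hs ! k)) (MK T i hs v)) (MK (insert (hs ! k) T) i hs v)"
proof (induction hs arbitrary: i v k)
 case (Cons h hs)
 show ?case
 proof (cases k)
  case 0
  have "eqv N (Pop i (col h) (MK T (i + col h) hs (mark T h i v))) (MK T (i + col h) hs (Pop i (col h) (mark T h i v)))"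
   using Cons.prems by (intro MK_Pop_left) auto
  also have "eqv N \<dots> (MK T (i + col h) hs (mark (insert h T) h i v))"
   using Cons.prems by (intro MK_cong) (auto simp: mark_def intro: Pop_idem)
  also have "MK T (i + col h) hs (mark (insert h T) h i v) = MK (insert h T) (i + col h) hs (mark (insert h T) h i v)"
   using Cons.prems by (intro MK_subset) auto
  finally show ?thesis using 0 by simp
 next
  case (Suc j)
  have j: "j < length hs" using Cons.prems Suc by simp
  then have "hs ! j \<noteq> h" using Cons.prems(2) by auto
  then have m: "mark (insert (hs ! j) T) h i v = mark T h i v" by (simp add: mark_def)
  have "eqv N (Pop (i + col h + wid (take j hs)) (col (hs ! j)) (MK T (i + col h) hs (mark T h i v))) (MK (insert (hs ! j) T) (i + col h) hs (mark T h i v))"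
   using Cons.prems by (intro Cons.IH[OF j]) auto
  then show ?thesis using Suc m by (simp add: add.assoc)
 qed
qed simp

end

lemma gridw_shift: "gridw (i + j) a b = map ((+) i) (gridw j a b)"
proof (induction j a b rule: gridw.induct)
 case (2 j a b)
 have "map ((+) i) [j..<j + b] = [i + j..<i + j + b]"
  by (rule nth_equalityI) auto
 then show ?case using 2 by simp
qed simp

lemma local_run:
 "local_op (\<lambda>ts ds. run z s (gridw 0 a b) (\<lambda>es. if es = ds then 1 else 0) ts) i (a + b) (a + b) (run z s (gridw i a b))"
 unfolding local_op_def
proof (intro allI impI)
 fix v :: vec and pre ts suf :: "bool list" assume l: "length pre = i" "length ts = a + b"
 have w: "\<forall>j\<in>set (gridw 0 a b). j + 2 \<le> a + b" using gridw_bound[of _ 0 a b] by auto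
 have "eqv (a + b) (\<lambda>es. v (pre @ es @ suf)) (\<lambda>es. \<Sum>ds\<in>words (a + b). v (pre @ ds @ suf) * (if es = ds then 1 else 0))"
  unfolding eqv_def
 proof (intro allI impI)
  fix es :: "bool list" assume "length es = a + b"
  then have "es \<in> words (a + b)" by (simp add: words_def)
  moreover have "(\<Sum>ds\<in>words (a + b). v (pre @ ds @ suf) * (if es = ds then 1 else 0)) = (\<Sum>ds\<in>words (a + b). if ds = es then v (pre @ es @ suf) else 0)"
   by (rule sum.cong) auto
  ultimately show "v (pre @ es @ suf) = (\<Sum>ds\<in>words (a + b). v (pre @ ds @ suf) * (if es = ds then 1 else 0))"
   by simp
 qed
 from run_cong[OF this w] l
 have "run z s (gridw 0 a b) (\<lambda>es. v (pre @ es @ suf)) ts = (\<Sum>ds\<in>words (a + b). v (pre @ ds @ suf) * run z s (gridw 0 a b) (\<lambda>es. if es = ds then 1 else 0) ts)"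
  by (simp add: eqv_def run_sum)
 moreover have "run z s (gridw i a b) v (pre @ ts @ suf) = run z s (gridw 0 a b) (\<lambda>es. v (pre @ es @ suf)) ts"
  using run_shift[OF l(1), of "gridw 0 a b" ts z s v suf] gridw_shift[of i 0 a b] w l(2) by simp
 ultimately show "run z s (gridw i a b) v (pre @ ts @ suf) = (\<Sum>ds\<in>words (a + b). run z s (gridw 0 a b) (\<lambda>es. if es = ds then 1 else 0) ts * v (pre @ ds @ suf))"
  by (simp add: mult.commute)
qed

lemma local_commute_left:
 assumes f: "local_op K i m m' f" and j: "j + b \<le> i" and N: "i + m' \<le> N"
 shows "eqv N (Pop j b (f v)) (f (Pop j b v))"
proof -
 obtain d where d: "i = j + b + d" using j le_Suc_ex by blast
 have f': "local_op K (j + b + d) m m' f" using f d by simp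
 show ?thesis
  by (rule eqv_sym, rule local_op_commute[OF local_Pop f' f']) (use N d in simp)
qed

lemma local_commute_right:
 assumes f: "local_op K i m m' f" and N: "i + m' + d + b \<le> N"
 shows "eqv N (Pop (i + m' + d) b (f v)) (f (Pop (i + m + d) b v))"
 by (rule local_op_commute[OF f local_Pop local_Pop N])

lemma CAP_cong: "eqv (2 * b + N) v u ==> i \<le> N ==> eqv N (CAP i b v) (CAP i b u)"
 unfolding eqv_def
proof (intro allI impI)
 fix es :: "bool list"
 assume v: "\<forall>es. length es = 2 * b + N \<longrightarrow> v es = u es" and i: "i \<le> N" and l: "length es = N"
 define pre suf where d: "pre = take i es" "suf = drop i es"
 have e: "es = pre @ suf" "length pre = i" using l i by (auto simp: d)
 show "CAP i b v es = CAP i b u es"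
  unfolding e(1) CAP_split[OF e(2)] by (rule sum.cong) (use v l e in \<open>auto simp: words_def\<close>)
qed

lemma act_Arcs_cong: "eqv N v u ==> i \<le> N ==> eqv (N + length ls) (act (Arcs i ls) v) (act (Arcs i ls) u)"
 unfolding eqv_def by auto

lemma CUP_cong: "eqv N v u ==> i \<le> N ==> eqv (N + 2 * b) (CUP i b v) (CUP i b u)"
 using act_Arcs_cong[of N v u i "cup_labels b"] by (simp add: CUP_def)

lemma local_CUP: "\<exists>K. local_op K i 0 (2 * b) (CUP i b)"
 unfolding CUP_def using local_Arcs[of "cup_labels b" i] by auto

section \<open>Rows and edges of a diagram\<close>

lemma state_0 [simp]: "state D 0 = (0, [])"
 by (simp add: state_def)

lemma row_0 [simp]: "row D 0 = []"
 by (simp add: row_def)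

lemma state_Suc: "p < length D ==> state D (Suc p) = step (D ! p) (state D p)"
 by (simp add: state_def take_Suc_conv_app_nth)

abbreviation nseg :: "diagram => nat => nat" where
 "nseg D p \<equiv> fst (state D p)"

lemma split_at:
 assumes "i \<le> length xs"
 obtains us vs where "xs = us @ vs" "length us = i"
 using assms by (metis append_take_drop_id length_take min.absorb2)

lemma split_at2:
 assumes "i + 2 \<le> length xs"
 obtains us x y vs where "xs = us @ [x, y] @ vs" "length us = i"
proof -
 have "xs = take i xs @ [xs ! i, xs ! (i + 1)] @ drop (i + 2) xs"
  using assms by (simp add: Cons_nth_drop_Suc)
 moreover have "length (take i xs) = i" using assms by simp
 ultimately show thesis using that by blast
qed

text \<open>For case distinctions by the piece, with the row split at the place of the piece.\<close>

lemma piece_cases [consumes 2, case_names Cup Cap Pos Neg Vertex]: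
 assumes D: "knotted_ribbon_graph D" and p: "p < length D"
 obtains (Cup) us vs where "D ! p = Cup (length us)" "row D p = us @ vs"
   "row D (Suc p) = us @ [nseg D p, nseg D p] @ vs" "nseg D (Suc p) = nseg D p + 1"
  | (Cap) us s t vs where "D ! p = Cap (length us)" "row D p = us @ [s, t] @ vs"
   "row D (Suc p) = us @ vs" "nseg D (Suc p) = nseg D p" "(s, t) \<in> joins D"
  | (Pos) us s t vs where "D ! p = Pos (length us)" "row D p = us @ [s, t] @ vs"
   "row D (Suc p) = us @ [t, s] @ vs" "nseg D (Suc p) = nseg D p"
  | (Neg) us s t vs where "D ! p = Neg (length us)" "row D p = us @ [s, t] @ vs"
   "row D (Suc p) = us @ [t, s] @ vs" "nseg D (Suc p) = nseg D p"
  | (Vertex) us d vs where "D ! p = Vertex (length us) d" "row D p = us @ vs"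
   "row D (Suc p) = us @ [nseg D p..<nseg D p + d] @ vs" "nseg D (Suc p) = nseg D p + d"
proof -
 have f: "fits (D ! p) (row D p)" using D p by (simp add: knotted_ribbon_graph_def)
 obtain n xs where st: "state D p = (n, xs)" by fastforce
 have r: "row D p = xs" "nseg D p = n" by (simp_all add: row_def st)
 have r': "row D (Suc p) = snd (step (D ! p) (n, xs))" "nseg D (Suc p) = fst (step (D ! p) (n, xs))"
  using p by (simp_all add: row_def state_Suc st)
 show thesis
 proof (cases "D ! p")
  case (Cup i)
  then obtain us vs where "xs = us @ vs" "length us = i" using f r split_at by (metis fits.simps(1))
  then show ?thesis using that(1)[of us vs] Cup r r' by simp
 next
  case (Cap i)
  then obtain us s t vs where x: "xs = us @ [s, t] @ vs" "length us = i" using f r split_at2 by (metis fits.simps(2))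
  then have "(s, t) = (row D p ! i, row D p ! (i + 1))" using r by (simp add: nth_append)
  then have "(s, t) \<in> joins D" unfolding joins_def using p Cap by blast
  then show ?thesis using that(2)[of us s t vs] Cap r r' x by simp
 next
  case (Pos i)
  then obtain us s t vs where "xs = us @ [s, t] @ vs" "length us = i" using f r split_at2 by (metis fits.simps(3))
  then show ?thesis using that(3)[of us s t vs] Pos r r' by (simp add: nth_append)
 next
  case (Neg i)
  then obtain us s t vs where "xs = us @ [s, t] @ vs" "length us = i" using f r split_at2 by (metis fits.simps(4))
  then show ?thesis using that(4)[of us s t vs] Neg r r' by (simp add: nth_append)
 next
  case (Vertex i d)
  then obtain us vs where "xs = us @ vs" "length us = i" using f r split_at by (metis fits.simps(5))
  then show ?thesis using that(5)[of us d vs] Vertex r r' by simp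
 qed
qed

lemma row_bound:
 assumes "knotted_ribbon_graph D" "p \<le> length D" "s \<in> set (row D p)"
 shows "s < nseg D p"
 using assms(2,3)
proof (induction p arbitrary: s)
 case (Suc p)
 then have p: "p < length D" and IH: "\<And>s. s \<in> set (row D p) ==> s < nseg D p" by auto
 from assms(1) p show ?case
  by (cases rule: piece_cases) (use IH Suc.prems in fastforce)+
qed simp

lemma nseg_mono:
 assumes "p \<le> p'" "p' \<le> length D"
 shows "nseg D p \<le> nseg D p'"
 using assms
proof (induction p' rule: dec_induct)
 case (step m)
 have "nseg D m \<le> nseg D (Suc m)"
  using step.prems by (cases "D ! m"; cases "state D m") (auto simp: state_Suc)
 then show ?case using step by simp
qed simp

lemma joins_segments:
 assumes "knotted_ribbon_graph D"
 shows "joins D \<subseteq> segments D \<times> segments D"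
proof
 fix st assume "st \<in> joins D"
 then obtain p i where p: "p < length D" "D ! p = Cap i" and st: "st = (row D p ! i, row D p ! (i + 1))"
  unfolding joins_def by blast
 from assms p(1) have "set [row D p ! i, row D p ! (i + 1)] \<subseteq> {..<nseg D p}"
 proof (cases rule: piece_cases)
  case (Cap us s t vs)
  have "s < nseg D p" "t < nseg D p"
   using row_bound[OF assms less_imp_le[OF p(1)], of s] row_bound[OF assms less_imp_le[OF p(1)], of t] Cap(2) by auto
  then show ?thesis using Cap(1,2) p(2) by (simp add: nth_append)
 qed (use p(2) in auto)
 moreover have "nseg D p \<le> nseg D (length D)" using p(1) by (intro nseg_mono) auto
 ultimately show "st \<in> segments D \<times> segments D" using st by (auto simp: segments_def)
qed

lemma edge_refl [simp]: "s \<in> edge D s"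
 by (simp add: edge_def)

lemma edge_eq: "t \<in> edge D s ==> edge D t = edge D s"
proof -
 let ?R = "joins D \<union> (joins D)\<inverse>"
 have sym: "(t, s) \<in> ?R\<^sup>*" if "(s, t) \<in> ?R\<^sup>*" for s t
  using that by (metis sym_Un_converse sym_rtrancl symD)
 assume "t \<in> edge D s"
 then have "(s, t) \<in> ?R\<^sup>*" by (simp add: edge_def)
 then show ?thesis using sym[of s t] unfolding edge_def by (auto intro: rtrancl_trans)
qed

lemma edge_join: "(s, t) \<in> joins D ==> edge D s = edge D t"
 using edge_eq[of t D s] by (auto simp: edge_def)

lemma edge_segments:
 assumes "knotted_ribbon_graph D" "s \<in> segments D"
 shows "edge D s \<subseteq> segments D"
proof
 fix t assume "t \<in> edge D s"
 then have "(s, t) \<in> (joins D \<union> (joins D)\<inverse>)\<^sup>*" by (simp add: edge_def)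
 then show "t \<in> segments D"
  by (induction rule: rtrancl_induct) (use assms joins_segments[OF assms(1)] in auto)
qed

lemma Min_edge:
 assumes "knotted_ribbon_graph D" "s \<in> segments D"
 shows "Min (edge D s) \<in> edge D s"
proof -
 have "finite (edge D s)"
  using edge_segments[OF assms] finite_subset by (auto simp: segments_def)
 then show ?thesis using edge_refl by (metis Min_in empty_iff)
qed

section \<open>One projection per edge or per segment\<close>

locale network =
 fixes D :: diagram and \<gamma> :: labels
 assumes graph: "knotted_ribbon_graph D"
  and net: "spin_network D \<gamma>"
  and adm: "admissible D \<gamma>"
begin

abbreviation "L \<equiv> length D"
abbreviation "n \<equiv> nseg D"
abbreviation "R \<equiv> row D"
abbreviation "col s \<equiv> ecol \<gamma> (edge D s)"
abbreviation "W p \<equiv> wid col (R p)"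
abbreviation "off p i \<equiv> wid col (take i (R p))"

definition pstep :: "nat set => nat => vec => vec" where
 "pstep T p v = (case D ! p of
   Cup i => mark col T (n p) (off p i) (CUP (off p i) (col (n p)) v)
  | Cap i => CAP (off p i) (col (R p ! i)) v
  | Pos i => run A True (gridw (off p i) (col (R p ! i)) (col (R p ! (i + 1)))) v
  | Neg i => run (inverse A) False (gridw (off p i) (col (R p ! i)) (col (R p ! (i + 1)))) v
  | Vertex i d => MK col T (off p i) [n p..<n p + d] (act (Arcs (off p i) (mlab (partner (vproj \<gamma> p)))) v))"

text \<open>The function on the row \<open>p\<close>, with projections on the segments in \<open>T\<close> and without any factors.\<close>

primrec V :: "nat set => nat => vec" where
 "V T 0 = (\<lambda>_. 1)"
| "V T (Suc p) = pstep T p (V T p)"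

lemma pstep_subset:
 assumes "p < L" "T \<inter> {n p..<n (Suc p)} = T' \<inter> {n p..<n (Suc p)}"
 shows "pstep T p v = pstep T' p v"
 using graph assms(1)
proof (cases rule: piece_cases)
 case (Cup us vs)
 then have "n p \<in> T \<longleftrightarrow> n p \<in> T'" using assms(2) by auto
 then show ?thesis using Cup by (simp add: pstep_def mark_def)
next
 case (Vertex us d vs)
 have "T \<inter> set [n p..<n p + d] = T' \<inter> set [n p..<n p + d]" using assms(2) Vertex(4) by simp
 from MK_subset[OF this] show ?thesis using Vertex by (simp add: pstep_def)
qed (auto simp: pstep_def)

lemma V_subset: "p \<le> L ==> T \<inter> {..<n p} = T' \<inter> {..<n p} ==> V T p = V T' p"
proof (induction p)
 case (Suc p)
 then have p: "p < L" by simp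
 have le: "n p \<le> n (Suc p)" using nseg_mono[of p "Suc p" D] p by linarith
 have iff: "x \<in> T \<longleftrightarrow> x \<in> T'" if "x < n (Suc p)" for x using Suc.prems(2) that by blast
 then have "T \<inter> {..<n p} = T' \<inter> {..<n p}" using le by (auto dest: less_le_trans)
 then have "V T p = V T' p" using Suc.IH p by (metis less_imp_le)
 moreover have "pstep T p (V T' p) = pstep T' p (V T' p)"
  by (intro pstep_subset p) (use iff in auto)
 ultimately show ?case by simp
qed simp

lemma partner_length:
 assumes "p < L" "D ! p = Vertex i d"
 shows "local_projector (vproj \<gamma> p)" "legs (vproj \<gamma> p) = map col [n p..<n p + d]"
  "length (partner (vproj \<gamma> p)) = wid col [n p..<n p + d]"
proof -
 have v: "p \<in> vertices D" using assms by (auto simp: vertices_def)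
 then show 1: "local_projector (vproj \<gamma> p)" using net by (auto simp: spin_network_def)
 show 2: "legs (vproj \<gamma> p) = map col [n p..<n p + d]"
  using adm v assms(2) by (auto simp: admissible_def half_edges_def)
 show "length (partner (vproj \<gamma> p)) = wid col [n p..<n p + d]"
  using 1 by (simp add: local_projector_def Let_def 2)
qed

lemma pstep_cong:
 assumes "p < L" "eqv (W p) v u"
 shows "eqv (W (Suc p)) (pstep T p v) (pstep T p u)"
 using graph assms(1)
proof (cases rule: piece_cases)
 case (Cup us vs)
 have "eqv (W p + 2 * col (n p)) (mark col T (n p) (off p (length us)) (CUP (off p (length us)) (col (n p)) v)) (mark col T (n p) (off p (length us)) (CUP (off p (length us)) (col (n p)) u))"
  using Cup assms(2) by (intro mark_cong CUP_cong) auto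
 moreover have "W (Suc p) = W p + 2 * col (n p)" using Cup by simp
 ultimately show ?thesis using Cup(1) by (simp add: pstep_def)
next
 case (Cap us s t vs)
 have "col s = col t" using Cap(5) edge_join by metis
 then have "W p = 2 * col s + W (Suc p)" using Cap(2,3) by simp
 then have "eqv (2 * col s + W (Suc p)) v u" using assms(2) by metis
 then show ?thesis using Cap by (simp add: pstep_def) (rule CAP_cong, auto)
next
 case (Pos us s t vs)
 have b: "\<forall>j\<in>set (gridw (wid col us) (col s) (col t)). j + 2 \<le> W p"
  using gridw_bound Pos by fastforce
 show ?thesis using run_cong[OF assms(2) b] Pos by (simp add: pstep_def nth_append ac_simps)
next
 case (Neg us s t vs)
 have b: "\<forall>j\<in>set (gridw (wid col us) (col s) (col t)). j + 2 \<le> W p"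
  using gridw_bound Neg by fastforce
 show ?thesis using run_cong[OF assms(2) b] Neg by (simp add: pstep_def nth_append ac_simps)
next
 case (Vertex us d vs)
 have l: "length (mlab (partner (vproj \<gamma> p))) = wid col [n p..<n p + d]"
  using partner_length(3)[OF assms(1) Vertex(1)] by (simp add: mlab_def)
 have "eqv (W p + wid col [n p..<n p + d]) (pstep T p v) (pstep T p u)"
  using Vertex act_Arcs_cong[OF assms(2), of "wid col us" "mlab (partner (vproj \<gamma> p))", unfolded l]
  by (simp add: pstep_def) (rule MK_cong, auto)
 then show ?thesis using Vertex by (simp add: ac_simps)
qed

lemma append3_cases:
 assumes "us @ [s] @ ws = xs @ ms @ ys"
 obtains (left) zs where "xs = us @ [s] @ zs" "ws = zs @ ms @ ys"
  | (middle) ms1 ms2 where "ms = ms1 @ [s] @ ms2" "us = xs @ ms1" "ws = ms2 @ ys"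
  | (right) zs where "ys = zs @ [s] @ ws" "us = xs @ ms @ zs"
proof -
 consider (1) zs where "xs = us @ zs" "zs @ ms @ ys = [s] @ ws" | (2) zs where "us = xs @ zs" "zs @ [s] @ ws = ms @ ys"
  using assms by (auto simp: append_eq_append_conv2)
 then show thesis
 proof cases
  case 1
  show thesis
  proof (cases zs)
   case Nil
   then have e: "ms @ ys = s # ws" and x: "xs = us" using 1 by simp_all
   show thesis
   proof (cases ms)
    case Nil
    then show thesis using right[of "[]"] e x by simp
   next
    case (Cons m ms2)
    then show thesis using middle[of "[]" ms2] e x by simp
   qed
  next
   case (Cons z zs')
   then show thesis using left[of zs'] 1 by simp
  qed
 next
  case 2
  consider (a) ts where "zs = ms @ ts" "ts @ [s] @ ws = ys" | (b) ts where "ms = zs @ ts" "ts @ ys = [s] @ ws"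
   using 2(2) by (auto simp: append_eq_append_conv2)
  then show thesis
  proof cases
   case a
   then show thesis using right[of ts] 2 by simp
  next
   case b
   show thesis
   proof (cases ts)
    case Nil
    then show thesis using right[of "[]"] b 2 by simp
   next
    case (Cons t ts')
    then show thesis using middle[of zs ts'] b 2 by simp
   qed
  qed
 qed
qed

text \<open>What is needed about a piece in \<open>V_Pop_step\<close>. Unlike \<open>local_op\<close> it is evidently
preserved when projections on the new segments follow.\<close>

definition pop_local :: "nat => nat => nat => (vec => vec) => bool" where
 "pop_local i m m' f \<longleftrightarrow>
   (\<forall>N j b v. j + b \<le> i \<longrightarrow> i + m' \<le> N \<longrightarrow> eqv N (Pop j b (f v)) (f (Pop j b v))) \<and>
   (\<forall>N d b v. i + m' + d + b \<le> N \<longrightarrow> eqv N (Pop (i + m' + d) b (f v)) (f (Pop (i + m + d) b v)))"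

lemma pop_local_op: "local_op K i m m' f ==> pop_local i m m' f"
 unfolding pop_local_def using local_commute_left local_commute_right by blast

lemma pop_local_MK:
 assumes f: "pop_local i m (wid col hs + m') f"
 shows "pop_local i m (wid col hs + m') (\<lambda>v. MK col T i hs (f v))"
 unfolding pop_local_def
proof (intro conjI allI impI)
 fix N j b v assume j: "j + b \<le> i" and N: "i + (wid col hs + m') \<le> N"
 have "eqv N (Pop j b (MK col T i hs (f v))) (MK col T i hs (Pop j b (f v)))"
  using j N by (intro MK_Pop_left) auto
 also have "eqv N \<dots> (MK col T i hs (f (Pop j b v)))"
  using f j N unfolding pop_local_def by (intro MK_cong) auto
 finally show "eqv N (Pop j b (MK col T i hs (f v))) (MK col T i hs (f (Pop j b v)))" .
next
 fix N d b v assume N: "i + (wid col hs + m') + d + b \<le> N"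
 have "eqv N (Pop (i + (wid col hs + m') + d) b (MK col T i hs (f v))) (MK col T i hs (Pop (i + (wid col hs + m') + d) b (f v)))"
  using N by (intro MK_Pop_right) auto
 also have "eqv N \<dots> (MK col T i hs (f (Pop (i + m + d) b v)))"
  using f N unfolding pop_local_def by (intro MK_cong) auto
 finally show "eqv N (Pop (i + (wid col hs + m') + d) b (MK col T i hs (f v))) (MK col T i hs (f (Pop (i + m + d) b v)))" .
qed

lemma pop_local_mark: "pop_local i m (col s + m') f ==> pop_local i m (col s + m') (\<lambda>v. mark col T s i (f v))"
 using pop_local_MK[of i m "[s]" m' f T] by simp

lemma W_Suc:
 assumes "R p = us @ ms @ vs" "R (Suc p) = us @ ms' @ vs"
 shows "W p = wid col us + wid col ms + wid col vs" "W (Suc p) = wid col us + wid col ms' + wid col vs"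
 using assms by simp_all

text \<open>A strand beside the piece \<open>p\<close> is followed one row down; only the strands produced by the piece, for which
\<open>mid\<close> is the hypothesis, depend on what the piece is.\<close>

lemma V_Pop_step:
 assumes p: "p < L" and R: "R p = us @ ms @ vs" "R (Suc p) = us @ ms' @ vs"
  and loc: "pop_local (wid col us) (wid col ms) (wid col ms') (pstep T p)"
  and IH: "\<And>xs s ys. R p = xs @ [s] @ ys ==> eqv (W p) (Pop (wid col xs) (col s) (V T p)) (V (insert s T) p)"
  and mid: "\<And>m1 s m2. ms' = m1 @ [s] @ m2 ==>
    eqv (W (Suc p)) (Pop (wid col us + wid col m1) (col s) (V T (Suc p))) (V (insert s T) (Suc p))"
  and xs: "R (Suc p) = xs @ [s] @ ys"
 shows "eqv (W (Suc p)) (Pop (wid col xs) (col s) (V T (Suc p))) (V (insert s T) (Suc p))"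
proof -
 have new: "pstep T p v = pstep (insert s T) p v" if "s \<in> set (R p)" for v
  using row_bound[OF graph _ that] p by (intro pstep_subset p) auto
 note W = W_Suc[OF R]
 from xs R have "xs @ [s] @ ys = us @ ms' @ vs" by simp
 then show ?thesis
 proof (cases rule: append3_cases)
  case (left zs)
  then have R': "R p = xs @ [s] @ (zs @ ms @ vs)" using R by simp
  have "eqv (W (Suc p)) (Pop (wid col xs) (col s) (pstep T p (V T p))) (pstep T p (Pop (wid col xs) (col s) (V T p)))"
   using loc left W unfolding pop_local_def by simp
  also have "eqv (W (Suc p)) \<dots> (pstep T p (V (insert s T) p))"
   by (intro pstep_cong p IH[OF R'])
  also have "\<dots> = pstep (insert s T) p (V (insert s T) p)" by (rule new) (simp add: R')
  finally show ?thesis by simp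
 next
  case (middle m1 m2)
  then show ?thesis using mid[of m1 s m2] by simp
 next
  case (right zs)
  then have R': "R p = (us @ ms @ zs) @ [s] @ ys" using R by simp
  have "eqv (W (Suc p)) (Pop (wid col us + wid col ms' + wid col zs) (col s) (pstep T p (V T p))) (pstep T p (Pop (wid col us + wid col ms + wid col zs) (col s) (V T p)))"
   using loc right(1) W unfolding pop_local_def by simp
  also have "eqv (W (Suc p)) \<dots> (pstep T p (V (insert s T) p))"
   by (intro pstep_cong p) (use IH[OF R'] in \<open>simp add: add.assoc\<close>)
  also have "\<dots> = pstep (insert s T) p (V (insert s T) p)" by (rule new) (simp add: R')
  finally show ?thesis using right(2) by (simp add: add.assoc)
 qed
qed

lemma two_split: "[a, b] = m1 @ [s] @ m2 ==> (m1 = [] \<and> s = a) \<or> (m1 = [a] \<and> s = b)"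
 by (cases m1) (auto simp: Cons_eq_append_conv)

lemma V_Pop_cross:
 assumes p: "p < L" and R: "R p = us @ [s, t] @ vs" "R (Suc p) = us @ [t, s] @ vs"
  and z: "signed z c" and step: "\<And>T. pstep T p = run z c (gridw (wid col us) (col s) (col t))"
  and IH: "\<And>xs s ys. R p = xs @ [s] @ ys ==> eqv (W p) (Pop (wid col xs) (col s) (V T p)) (V (insert s T) p)"
  and xs: "R (Suc p) = xs @ [r] @ ys"
 shows "eqv (W (Suc p)) (Pop (wid col xs) (col r) (V T (Suc p))) (V (insert r T) (Suc p))"
proof (rule V_Pop_step[OF p R _ IH _ xs])
 show "pop_local (wid col us) (wid col [s, t]) (wid col [t, s]) (pstep T p)"
  using pop_local_op[OF local_run, of "wid col us" "col s" "col t" z c] by (simp add: step add.commute)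
next
 fix m1 r m2 assume "[t, s] = m1 @ [r] @ m2"
 note W = W_Suc[OF R]
 let ?run = "run z c (gridw (wid col us) (col s) (col t))"
 have WW: "W (Suc p) = W p" using W by simp
 have cong: "eqv (W p) (?run v) (?run u)" if "eqv (W p) v u" for v u
  using pstep_cong[OF p that, of T] by (simp add: step WW)
 from two_split[OF \<open>[t, s] = m1 @ [r] @ m2\<close>]
 show "eqv (W (Suc p)) (Pop (wid col us + wid col m1) (col r) (V T (Suc p))) (V (insert r T) (Suc p))"
 proof
  assume *: "m1 = [] \<and> r = t"
  have "eqv (W p) (?run (Pop (wid col us + col s) (col t) (V T p))) (Pop (wid col us) (col t) (?run (V T p)))"
   by (rule grid_Pop_right[OF z]) (use W in simp)
  moreover have "eqv (W p) (?run (Pop (wid col us + col s) (col t) (V T p))) (?run (V (insert t T) p))"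
   using IH[of "us @ [s]" t vs] R by (intro cong) simp
  ultimately have "eqv (W p) (Pop (wid col us) (col t) (?run (V T p))) (?run (V (insert t T) p))"
   by (rule eqv_trans[OF eqv_sym])
  then show ?thesis using * by (simp add: step WW)
 next
  assume *: "m1 = [t] \<and> r = s"
  have "eqv (W p) (?run (Pop (wid col us) (col s) (V T p))) (Pop (wid col us + col t) (col s) (?run (V T p)))"
   by (rule grid_Pop_left[OF z]) (use W in simp)
  moreover have "eqv (W p) (?run (Pop (wid col us) (col s) (V T p))) (?run (V (insert s T) p))"
   using IH[of us s "t # vs"] R by (intro cong) simp
  ultimately have "eqv (W p) (Pop (wid col us + col t) (col s) (?run (V T p))) (?run (V (insert s T) p))"
   by (rule eqv_trans[OF eqv_sym])
  then show ?thesis using * by (simp add: step WW)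
 qed
qed

text \<open>A projection on a strand of any row can be moved down to the beginning of its segment. At a
minimum the projection may have to change the leg first (\<open>Pop_CUP\<close>).\<close>

lemma V_Pop:
 assumes "p \<le> L" "R p = xs @ [s] @ ys"
 shows "eqv (W p) (Pop (wid col xs) (col s) (V T p)) (V (insert s T) p)"
 using assms
proof (induction p arbitrary: xs s ys)
 case (Suc p)
 then have p: "p < L" by simp
 note IH = Suc.IH[OF less_imp_le[OF p]] and xs = Suc.prems(2)
 from graph p show ?case
 proof (cases rule: piece_cases)
  case (Cup us vs)
  let ?o = "wid col us" and ?c = "col (n p)"
  have R: "R p = us @ [] @ vs" "R (Suc p) = us @ [n p, n p] @ vs" using Cup by simp_all
  note W = W_Suc[OF R]
  have step: "pstep T p = (\<lambda>v. mark col T (n p) ?o (CUP ?o ?c v))" for T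
   using Cup by (intro ext) (simp add: pstep_def)
  show ?thesis
  proof (rule V_Pop_step[OF p R _ IH _ xs])
   obtain K where K: "local_op K ?o 0 (2 * ?c) (CUP ?o ?c)" using local_CUP by blast
   have "pop_local ?o 0 (?c + ?c) (\<lambda>v. mark col T (n p) ?o (CUP ?o ?c v))"
    by (rule pop_local_mark) (use pop_local_op[OF K] in \<open>simp add: mult_2\<close>)
   then show "pop_local (wid col us) (wid col []) (wid col [n p, n p]) (pstep T p)" by (simp add: step)
  next
   fix m1 r m2 assume m: "[n p, n p] = m1 @ [r] @ m2"
   have V': "V (insert (n p) T) p = V T p" using p by (intro V_subset) auto
   let ?v = "CUP ?o ?c (V T p)"
   have goal: "V (insert (n p) T) (Suc p) = Pop ?o ?c ?v" by (simp add: step V' mark_def)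
   have first: "eqv (W (Suc p)) (Pop ?o ?c (V T (Suc p))) (Pop ?o ?c ?v)"
    using W by (auto simp: step mark_def intro: Pop_idem)
   have cup: "eqv (W (Suc p)) (Pop (?o + ?c) ?c ?v) (Pop ?o ?c ?v)" by (rule Pop_CUP) (use W in simp)
   have "eqv (W (Suc p)) (Pop (?o + ?c) ?c (Pop ?o ?c ?v)) (Pop ?o ?c (Pop (?o + ?c) ?c ?v))"
    by (rule Pop_commute) (use W in auto)
   also have "eqv (W (Suc p)) \<dots> (Pop ?o ?c (Pop ?o ?c ?v))"
    by (rule Pop_cong[OF cup]) (use W in auto)
   also have "eqv (W (Suc p)) \<dots> (Pop ?o ?c ?v)"
    by (rule Pop_idem) (use W in auto)
   finally have second: "eqv (W (Suc p)) (Pop (?o + ?c) ?c (V T (Suc p))) (Pop ?o ?c ?v)"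
    using cup by (simp add: step mark_def)
   from two_split[OF m] show "eqv (W (Suc p)) (Pop (wid col us + wid col m1) (col r) (V T (Suc p))) (V (insert r T) (Suc p))"
   proof
    assume "m1 = [] \<and> r = n p"
    then show ?thesis using first goal by simp
   next
    assume "m1 = [n p] \<and> r = n p"
    then show ?thesis using second goal by simp
   qed
  qed
 next
  case (Cap us s t vs)
  have R: "R p = us @ [s, t] @ vs" "R (Suc p) = us @ [] @ vs" using Cap by simp_all
  obtain K where K: "local_op K (wid col us) (2 * col s) 0 (CAP (wid col us) (col s))"
   using local_CAP by blast
  have c: "col s = col t" using Cap(5) edge_join by metis
  have "pstep T p = CAP (wid col us) (col s)"
   using Cap by (intro ext) (simp add: pstep_def)
  then have "pop_local (wid col us) (wid col [s, t]) (wid col []) (pstep T p)"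
   using pop_local_op[OF K] c by (simp add: mult_2)
  then show ?thesis by (rule V_Pop_step[OF p R _ IH _ xs]) auto
 next
  case (Pos us s t vs)
  have step: "pstep T p = run A True (gridw (wid col us) (col s) (col t))" for T
   using Pos by (intro ext) (simp add: pstep_def nth_append)
  show ?thesis by (rule V_Pop_cross[OF p Pos(2,3) _ step IH xs]) (simp_all add: signed_def)
 next
  case (Neg us s t vs)
  have step: "pstep T p = run (inverse A) False (gridw (wid col us) (col s) (col t))" for T
   using Neg by (intro ext) (simp add: pstep_def nth_append)
  show ?thesis by (rule V_Pop_cross[OF p Neg(2,3) _ step IH xs]) (simp_all add: signed_def)
 next
  case (Vertex us d vs)
  let ?o = "wid col us" and ?hs = "[n p..<n p + d]" and ?m = "mlab (partner (vproj \<gamma> p))"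
  have R: "R p = us @ [] @ vs" "R (Suc p) = us @ ?hs @ vs" using Vertex by simp_all
  note W = W_Suc[OF R]
  have l: "length ?m = wid col ?hs"
   using partner_length(3)[OF p Vertex(1)] by (simp add: mlab_def)
  have step: "pstep T p = (\<lambda>v. MK col T ?o ?hs (act (Arcs ?o ?m) v))" for T
   using Vertex by (intro ext) (simp add: pstep_def)
  show ?thesis
  proof (rule V_Pop_step[OF p R _ IH _ xs])
   have "pop_local ?o 0 (wid col ?hs + 0) (\<lambda>v. MK col T ?o ?hs (act (Arcs ?o ?m) v))"
    by (rule pop_local_MK) (use pop_local_op[OF local_Arcs[of ?m]] in \<open>simp add: l del: act.simps\<close>)
   then show "pop_local (wid col us) (wid col []) (wid col ?hs) (pstep T p)" by (simp add: step del: act.simps)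
  next
   fix m1 r m2 assume m: "?hs = m1 @ [r] @ m2"
   have k: "length m1 < length ?hs" "take (length m1) ?hs = m1" "?hs ! length m1 = r"
    unfolding m by simp_all
   then have r: "r \<in> set ?hs" by (metis nth_mem)
   have V': "V (insert r T) p = V T p" using p r by (intro V_subset) auto
   have "eqv (W (Suc p)) (Pop (?o + wid col (take (length m1) ?hs)) (col (?hs ! length m1)) (MK col T ?o ?hs (act (Arcs ?o ?m) (V T p))))
     (MK col (insert (?hs ! length m1) T) ?o ?hs (act (Arcs ?o ?m) (V T p)))"
    by (rule MK_Pop[OF k(1)]) (use W in \<open>auto simp del: act.simps\<close>)
   then show "eqv (W (Suc p)) (Pop (wid col us + wid col m1) (col r) (V T (Suc p))) (V (insert r T) (Suc p))"
    unfolding k by (simp add: step V' del: act.simps)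
  qed
 qed
qed simp

end

context network
begin

lemma V_mono_eqv:
 assumes "p0 \<le> p" "p \<le> L" "eqv (W p0) (V T p0) (V T' p0)" "T \<inter> {n p0..} = T' \<inter> {n p0..}"
 shows "eqv (W p) (V T p) (V T' p)"
 using assms(1,2)
proof (induction p rule: dec_induct)
 case base
 then show ?case using assms by simp
next
 case (step m)
 then have m: "m < L" by simp
 have "n p0 \<le> n m" using nseg_mono[OF step.hyps(1), of D] m by simp
 then have "x \<in> T \<longleftrightarrow> x \<in> T'" if "n m \<le> x" for x
  using assms(4) that by (metis IntD1 IntI atLeast_iff le_trans)
 then have "pstep T m v = pstep T' m v" for v
  by (intro pstep_subset m) auto
 then show ?case using pstep_cong[OF m step.IH, of T'] m by simp
qed

lemma W_last: "W L = 0"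
 using graph by (simp add: knotted_ribbon_graph_def)

text \<open>At the maximum that joins the two segments, the projection passes from one leg to the other; then each
is moved down to the beginning of its own segment.\<close>

lemma V_join:
 assumes "(s, t) \<in> joins D"
 shows "V (insert s T) L [] = V (insert t T) L []"
proof -
 obtain p i where p: "p < L" "D ! p = Cap i" "(s, t) = (R p ! i, R p ! (i + 1))"
  using assms unfolding joins_def by blast
 from graph p(1) have H: "eqv (W (Suc p)) (V (insert s T) (Suc p)) (V (insert t T) (Suc p)) \<and> s < n (Suc p) \<and> t < n (Suc p)"
 proof (cases rule: piece_cases)
  case (Cap us s' t' vs)
  have st: "s' = s" "t' = t" using Cap(1,2) p(2,3) by (simp_all add: nth_append)
  note C = Cap[unfolded st]
  let ?o = "wid col us"
  have c: "col t = col s" using edge_join[OF assms] by simp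
  have W: "W p = ?o + 2 * col s + wid col vs" "W (Suc p) = ?o + wid col vs" using C(2,3) c by simp_all
  have step: "pstep T p v = CAP ?o (col s) v" for T v
   using C by (simp add: pstep_def)
  have cong: "eqv (W (Suc p)) (CAP ?o (col s) v) (CAP ?o (col s) u)" if "eqv (W p) v u" for v u
   using pstep_cong[OF p(1) that, of T] by (simp add: step)
  have 1: "eqv (W p) (Pop ?o (col s) (V T p)) (V (insert s T) p)"
   using V_Pop[of p us s "t # vs" T] p C by simp
  have 2: "eqv (W p) (Pop (?o + col s) (col s) (V T p)) (V (insert t T) p)"
   using V_Pop[of p "us @ [s]" t vs T] p C c by simp
  have "eqv (W (Suc p)) (CAP ?o (col s) (V (insert s T) p)) (CAP ?o (col s) (Pop ?o (col s) (V T p)))"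
   by (rule cong, rule eqv_sym, rule 1)
  also have "eqv (W (Suc p)) \<dots> (CAP ?o (col s) (Pop (?o + col s) (col s) (V T p)))"
   by (rule CAP_Pop) (simp add: W)
  also have "eqv (W (Suc p)) \<dots> (CAP ?o (col s) (V (insert t T) p))"
   by (rule cong, rule 2)
  finally have "eqv (W (Suc p)) (V (insert s T) (Suc p)) (V (insert t T) (Suc p))"
   by (simp add: step)
  moreover have "s < n p" "t < n p" using row_bound[OF graph, of p] p(1) C(2) by auto
  ultimately show ?thesis using C(4) by simp
 qed (simp_all add: p(2))
 have "eqv (W L) (V (insert s T) L) (V (insert t T) L)"
  by (rule V_mono_eqv[OF Suc_leI[OF p(1)] order_refl conjunct1[OF H]]) (use H in auto)
 then show ?thesis by (simp add: W_last eqv_def)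
qed

lemma V_edge: "t \<in> edge D s ==> V (insert s T) L [] = V (insert t T) L []"
proof -
 assume "t \<in> edge D s"
 then have "(s, t) \<in> (joins D \<union> (joins D)\<inverse>)\<^sup>*" by (simp add: edge_def)
 then show ?thesis
 proof (rule rtrancl_induct[where P = "\<lambda>t. V (insert s T) L [] = V (insert t T) L []"])
  fix y z assume "(y, z) \<in> joins D \<union> (joins D)\<inverse>" and IH: "V (insert s T) L [] = V (insert y T) L []"
  then consider "(y, z) \<in> joins D" | "(z, y) \<in> joins D" by blast
  then have "V (insert y T) L [] = V (insert z T) L []"
   by cases (rule V_join, assumption, rule V_join[symmetric], assumption)
  then show "V (insert s T) L [] = V (insert z T) L []" using IH by (simp only:)
 qed (rule refl)
qed

text \<open>The segments at which the permutation braids of the edges are inserted.\<close>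

definition reps :: "nat set" where
 "reps = {s. s = Min (edge D s)}"

lemma Min_edge_reps: "s \<in> segments D ==> Min (edge D s) \<in> reps"
 using edge_eq[OF Min_edge[OF graph]] by (simp add: reps_def)

text \<open>A projection may be added on any segment, because it can be moved within its edge to the representative, where it
is absorbed by the projection that is already there.\<close>

lemma V_reps: "V reps L [] = V UNIV L []"
proof -
 have "V (reps \<union> S) L [] = V reps L []" if "finite S" "S \<subseteq> segments D" for S
  using that
 proof (induction S rule: finite_induct)
  case (insert s S)
  have m: "Min (edge D s) \<in> reps" "Min (edge D s) \<in> edge D s"
   using insert.prems Min_edge_reps Min_edge[OF graph] by auto
  have "V (reps \<union> insert s S) L [] = V (insert s (reps \<union> S)) L []" by simp
  also have "\<dots> = V (insert (Min (edge D s)) (reps \<union> S)) L []" by (rule V_edge[OF m(2)])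
  also have "insert (Min (edge D s)) (reps \<union> S) = reps \<union> S" using m(1) by auto
  finally show ?case using insert by simp
 qed simp
 from this[of "segments D"] have "V (reps \<union> segments D) L [] = V reps L []" by (simp add: segments_def)
 moreover have "V (reps \<union> segments D) L = V UNIV L" by (rule V_subset) (auto simp: segments_def)
 ultimately show ?thesis by simp
qed

section \<open>The Penrose evaluation with projections\<close>

definition slot_of :: "nat => nat => citem list" where
 "slot_of s i = (if s = Min (edge D s) then [Slot (edge D s) i] else [])"

lemma edge_braid_slot: "edge_braid D \<gamma> \<sigma> s i = concat (map (expand (ecol \<gamma>) \<sigma>) (slot_of s i))"
 by (auto simp: edge_braid_def slot_of_def Let_def)

lemma exec_slot: "fold (exec (ecol \<gamma>)) (slot_of s i) v = mark col reps s i v"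
 by (auto simp: slot_of_def mark_def reps_def)

text \<open>The cable of the piece \<open>p\<close> with gaps for its permutation braids.\<close>

definition citems :: "nat => citem list" where
 "citems p = (case D ! p of
   Cup i => Fix [Arcs (off p i) (cup_labels (col (n p)))] # slot_of (n p) (off p i)
  | Cap i => [Fix (map (\<lambda>j. Join (off p i + j)) (rev [0..<col (R p ! i)]))]
  | Pos i => [Fix (map CrossPos (gridw (off p i) (col (R p ! i)) (col (R p ! (i + 1)))))]
  | Neg i => [Fix (map CrossNeg (gridw (off p i) (col (R p ! i)) (col (R p ! (i + 1)))))]
  | Vertex i d => Fix [Arcs (off p i) (mlab (partner (vproj \<gamma> p)))] #
    concat (map (\<lambda>h. slot_of h (off p i + wid col [n p..<h])) [n p..<n p + d]))"

lemma concat_map_concat: "concat (map f (concat (map g xs))) = concat (map (\<lambda>x. concat (map f (g x))) xs)"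
 by (induction xs) auto

lemma cable_slice_items: "cable_slice D \<gamma> \<sigma> p = concat (map (expand (ecol \<gamma>) \<sigma>) (citems p))"
proof (cases "D ! p")
 case (Cup i)
 show ?thesis unfolding cable_slice_def citems_def Cup Let_def width_def edge_braid_slot cup_labels_def by simp
next
 case (Cap i)
 show ?thesis unfolding cable_slice_def citems_def Cap Let_def width_def by simp
next
 case (Pos i)
 show ?thesis unfolding cable_slice_def citems_def Pos Let_def width_def piece.case gridw_cable[of CrossPos] by simp
next
 case (Neg i)
 show ?thesis unfolding cable_slice_def citems_def Neg Let_def width_def piece.case gridw_cable[of CrossNeg] by simp
next
 case (Vertex i d)
 show ?thesis unfolding cable_slice_def citems_def Vertex Let_def width_def edge_braid_slot mlab_def piece.case
  by (simp only: list.map concat.simps expand.simps concat_map_concat append.simps)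
qed

lemma fold_slots: "fold (exec (ecol \<gamma>)) (concat (map (\<lambda>h. slot_of h (i + wid col [k..<h])) [k..<k + d])) v
  = MK col reps i [k..<k + d] v"
proof (induction d)
 case (Suc d)
 have MK_snoc: "MK col T i (hs @ [h]) v = mark col T h (i + wid col hs) (MK col T i hs v)" for T i hs h v
  by (induction hs arbitrary: i v) (auto simp: add.assoc)
 show ?case using Suc by (simp add: exec_slot MK_snoc)
qed simp

lemma exec_items:
 assumes "p < L" "eqv (W p) v u"
 shows "eqv (W (Suc p)) (fold (exec (ecol \<gamma>)) (citems p) v) (pstep reps p u)"
proof -
 have "eqv (W (Suc p)) (fold (exec (ecol \<gamma>)) (citems p) v) (pstep reps p v)"
  using graph assms(1)
 proof (cases rule: piece_cases)
  case (Cup us vs)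
  then show ?thesis by (simp add: citems_def pstep_def exec_slot CUP_def del: act.simps)
 next
  case (Cap us s t vs)
  then show ?thesis by (simp add: citems_def pstep_def CAP_def)
 next
  case (Pos us s t vs)
  have b: "\<forall>j\<in>set (gridw (wid col us) (col s) (col t)). j + 2 \<le> W p"
   using gridw_bound Pos by fastforce
  have W: "W (Suc p) = W p" using Pos by simp
  show ?thesis using runs_CrossPos[OF b eqv_refl, of v] Pos unfolding W
   by (simp add: citems_def pstep_def nth_append)
 next
  case (Neg us s t vs)
  have b: "\<forall>j\<in>set (gridw (wid col us) (col s) (col t)). j + 2 \<le> W p"
   using gridw_bound Neg by fastforce
  have W: "W (Suc p) = W p" using Neg by simp
  show ?thesis using runs_CrossNeg[OF b eqv_refl, of v] Neg unfolding W
   by (simp add: citems_def pstep_def nth_append)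
 next
  case (Vertex us d vs)
  then show ?thesis by (simp add: citems_def pstep_def fold_slots del: act.simps)
 qed
 also have "eqv (W (Suc p)) \<dots> (pstep reps p u)" by (rule pstep_cong[OF assms])
 finally show ?thesis .
qed

definition items :: "nat => citem list" where
 "items p = concat (map citems [0..<p])"

lemma items_Suc: "items (Suc p) = items p @ citems p"
 by (simp add: items_def)

lemma exec_V: "p \<le> L ==> eqv (W p) (fold (exec (ecol \<gamma>)) (items p) (\<lambda>_. 1)) (V reps p)"
proof (induction p)
 case 0
 then show ?case by (simp add: items_def)
next
 case (Suc p)
 then show ?case using exec_items[of p] by (simp add: items_Suc)
qed

lemma slots_slot_of: "slots (slot_of s i) = map (edge D) (filter (\<lambda>s. s \<in> reps) [s])"
 by (simp add: slot_of_def reps_def)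

lemma slots_concat: "slots (concat xs) = concat (map slots xs)"
 by (induction xs) auto

lemma slots_citems:
 assumes "p < L"
 shows "slots (citems p) = map (edge D) (filter (\<lambda>s. s \<in> reps) [n p..<n (Suc p)])"
 using graph assms
proof (cases rule: piece_cases)
 case (Vertex us d vs)
 have *: "concat (map (\<lambda>h. slots (slot_of h (f h))) hs) = map (edge D) (filter (\<lambda>s. s \<in> reps) hs)" for f hs
  by (induction hs) (auto simp: slots_slot_of)
 show ?thesis using Vertex by (simp add: citems_def slots_concat comp_def *)
qed (simp_all add: citems_def slots_slot_of)

lemma slots_items: "p \<le> L ==> slots (items p) = map (edge D) (filter (\<lambda>s. s \<in> reps) [0..<n p])"
proof (induction p)
 case (Suc p)
 then have p: "p < L" by simp
 have "n p \<le> n (Suc p)" using nseg_mono[of p "Suc p" D] p by linarith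
 then obtain d where d: "n (Suc p) = n p + d" using le_Suc_ex by blast
 have "[0..<n (Suc p)] = [0..<n p] @ [n p..<n (Suc p)]"
  unfolding d by (rule upt_add_eq_append) simp
 then show ?case
  unfolding items_Suc slots_append Suc.IH[OF less_imp_le[OF p]] slots_citems[OF p] by (simp only: filter_append map_append)
qed (simp add: items_def)

lemma inj_reps: "inj_on (edge D) reps"
proof (rule inj_onI)
 fix s t assume "s \<in> reps" "t \<in> reps" and e: "edge D s = edge D t"
 then have s: "s = Min (edge D s)" and t: "t = Min (edge D t)" unfolding reps_def by (blast dest: CollectD)+
 show "s = t" using trans[OF trans[OF s arg_cong[OF e, of Min]] sym[OF t]] .
qed

lemma distinct_slots: "distinct (slots (items L))"
 by (simp add: slots_items distinct_map) (rule inj_on_subset[OF inj_reps], auto)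

lemma set_slots: "set (slots (items L)) = edges D"
proof -
 have "edges D \<subseteq> edge D ` (reps \<inter> segments D)"
 proof
  fix e assume "e \<in> edges D"
  then obtain s where s: "s \<in> segments D" "e = edge D s" by (auto simp: edges_def)
  let ?m = "Min (edge D s)"
  have m: "?m \<in> edge D s" using Min_edge[OF graph s(1)] .
  then have "edge D ?m = e" "?m \<in> segments D" using edge_eq edge_segments[OF graph s(1)] s by auto
  then show "e \<in> edge D ` (reps \<inter> segments D)" using Min_edge_reps[OF s(1)] by blast
 qed
 then have "edges D = edge D ` (reps \<inter> segments D)" by (auto simp: edges_def)
 also have "reps \<inter> segments D = {s. s < n L \<and> s \<in> reps}" by (auto simp: segments_def)
 finally show ?thesis by (simp add: slots_items)
qed

lemma itfits_slot: "i + col s \<le> N ==> itfits (ecol \<gamma>) N (slot_of s i) N"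
 by (simp add: slot_of_def)

lemma itfits_slots:
 "i + wid col [k..<k + d] \<le> N ==>
  itfits (ecol \<gamma>) N (concat (map (\<lambda>h. slot_of h (i + wid col [k..<h])) [k..<k + d])) N"
proof (induction d)
 case (Suc d)
 then show ?case by (auto simp: itfits_append intro!: exI[of _ N] itfits_slot)
qed simp

lemma itfits_citems:
 assumes "p < L"
 shows "itfits (ecol \<gamma>) (W p) (citems p) (W (Suc p))"
 using graph assms
proof (cases rule: piece_cases)
 case (Cup us vs)
 have W: "W (Suc p) = W p + 2 * col (n p)" "wid col us \<le> W p" using Cup by simp_all
 have "l < 2 * b" if "l \<in> set (cup_labels b)" for l b using that by (auto simp: cup_labels_def)
 then show ?thesis using W Cup(1,2) by (simp add: citems_def planar_cup_labels itfits_slot)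
next
 case (Cap us s t vs)
 have c: "col t = col s" using edge_join[OF Cap(5)] by simp
 have "vword (i + 2 * b + m) (map (\<lambda>j. Join (i + j)) (rev [0..<b])) (i + m)" for i b m
  by (induction b) auto
 from this[of "wid col us" "col s" "wid col vs"] show ?thesis using Cap(1-3) c by (simp add: citems_def add.assoc mult_2)
next
 case (Pos us s t vs)
 have b: "\<forall>j\<in>set (gridw (wid col us) (col s) (col t)). j + 2 \<le> W p"
  using gridw_bound Pos by fastforce
 have "vword N (map CrossPos w) N" if "\<forall>j\<in>set w. j + 2 \<le> N" for w N
  using that by (induction w) auto
 from this[OF b] show ?thesis using Pos by (simp add: citems_def nth_append ac_simps)
next
 case (Neg us s t vs)
 have b: "\<forall>j\<in>set (gridw (wid col us) (col s) (col t)). j + 2 \<le> W p"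
  using gridw_bound Neg by fastforce
 have "vword N (map CrossNeg w) N" if "\<forall>j\<in>set w. j + 2 \<le> N" for w N
  using that by (induction w) auto
 from this[OF b] show ?thesis using Neg by (simp add: citems_def nth_append ac_simps)
next
 case (Vertex us d vs)
 let ?m = "mlab (partner (vproj \<gamma> p))"
 have P: "projector_setup (vproj \<gamma> p)"
  using partner_length(1)[OF assms Vertex(1)] by (rule projector_setup.intro)
 have l: "length ?m = wid col [n p..<n p + d]"
  using partner_length(3)[OF assms Vertex(1)] by (simp add: mlab_def)
 have "planar ?m" by (rule planar_mlab[OF projector_setup.matching_p[OF P] projector_setup.noncross_p[OF P]])
 moreover have "\<forall>l\<in>set ?m. l < length ?m" by (auto simp: mlab_def)
 ultimately show ?thesis using Vertex l itfits_slots[of "wid col us" "n p" d "W (Suc p)"]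
  by (simp add: citems_def ac_simps)
qed

lemma itfits_items: "p \<le> L ==> itfits (ecol \<gamma>) 0 (items p) (W p)"
proof (induction p)
 case (Suc p)
 then show ?case using itfits_citems[of p] by (auto simp: items_Suc itfits_append)
qed (simp add: items_def)

lemma cable_items: "cable D \<gamma> \<sigma> = concat (map (expand (ecol \<gamma>) \<sigma>) (items L))"
 unfolding cable_def items_def concat_map_concat cable_slice_items[abs_def] by (simp only:)

lemma items_fit: "itfits (ecol \<gamma>) 0 (items L) 0"
 using itfits_items[of L] by (simp add: W_last)

theorem penrose_V: "penrose_eval D \<gamma> = (\<Prod>e\<in>edges D. qfact (ecol \<gamma> e)) * V UNIV L []"
proof -
 have "kauffman_bracket (cable D \<gamma> \<sigma>) = runs (concat (map (expand (ecol \<gamma>) \<sigma>) (items L))) (\<lambda>es. 1) []" for \<sigma>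
  unfolding cable_items by (rule kauffman_bracket_state_sum, rule vword_expand[OF items_fit])
 then have "penrose_eval D \<gamma> = (\<Sum>\<sigma>\<in>PiE (edges D) (\<lambda>e. {\<tau>. \<tau> permutes {..<ecol \<gamma> e}}).
    (\<Prod>e\<in>edges D. wt (ecol \<gamma> e) (\<sigma> e)) * runs (concat (map (expand (ecol \<gamma>) \<sigma>) (items L))) (\<lambda>es. 1) [])"
  using adm by (simp add: penrose_eval_def wt_def)
 also have "\<dots> = (\<Prod>e\<in>edges D. qfact (ecol \<gamma> e)) * fold (exec (ecol \<gamma>)) (items L) (\<lambda>_. 1) []"
  using sum_slots[OF distinct_slots items_fit, of "\<lambda>_. 1"] by (simp add: eqv_def set_slots)
 also have "fold (exec (ecol \<gamma>)) (items L) (\<lambda>_. 1) [] = V reps L []"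
  using exec_V[of L] by (simp add: W_last eqv_def)
 finally show ?thesis by (simp add: V_reps)
qed

end

section \<open>Half-edges of an edge\<close>

text \<open>The segments below \<open>p\<close> that are half-edges or begin at a minimum, and for each maximum one
of the two segments it joins, with repetitions.\<close>

definition hes :: "diagram => nat => nat list" where
 "hes D p = concat (map (half_edges D) [0..<p])"

definition cups :: "diagram => nat => nat list" where
 "cups D p = concat (map (\<lambda>q. case D ! q of Cup i => [nseg D q] | _ => []) [0..<p])"

definition caps :: "diagram => nat => nat list" where
 "caps D p = concat (map (\<lambda>q. case D ! q of Cap i => [row D q ! i] | _ => []) [0..<p])"

text \<open>The classes of segments connected through the maxima read so far, each named by one of its
members. In contrast to \<open>edge\<close> this can be followed piece by piece.\<close>

primrec lab :: "diagram => nat => nat => nat" where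
 "lab D 0 = (\<lambda>s. s)"
| "lab D (Suc p) = (case D ! p of
   Cap i => (\<lambda>s. if lab D p s = lab D p (row D p ! (i + 1)) then lab D p (row D p ! i) else lab D p s)
  | _ => lab D p)"

abbreviation cnt_edge :: "diagram => nat list => nat set => nat" where
 "cnt_edge D xs e \<equiv> count_list (map (edge D) xs) e"

context
 fixes D :: diagram
 assumes D: "knotted_ribbon_graph D"
begin

lemma lists_Suc:
 "hes D (Suc p) = hes D p @ half_edges D p"
 "cups D (Suc p) = cups D p @ (case D ! p of Cup i => [nseg D p] | _ => [])"
 "caps D (Suc p) = caps D p @ (case D ! p of Cap i => [row D p ! i] | _ => [])"
 by (simp_all add: hes_def cups_def caps_def)

lemma lists_bound:
 "p \<le> length D ==> set (hes D p) \<union> set (cups D p) \<union> set (caps D p) \<subseteq> {..<nseg D p}"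
proof (induction p)
 case (Suc p)
 then have p: "p < length D" by simp
 have IH: "set (hes D p) \<union> set (cups D p) \<union> set (caps D p) \<subseteq> {..<nseg D p}" using Suc by simp
 from D p show ?case
 proof (cases rule: piece_cases)
  case (Cap us s t vs)
  then have "s < nseg D p" using row_bound[OF D, of p s] p by simp
  then show ?thesis using Cap IH by (simp add: lists_Suc half_edges_def)
 qed (use IH in \<open>force simp: lists_Suc half_edges_def\<close>)+
qed (simp add: hes_def cups_def caps_def)

text \<open>Each minimum makes two strands, each half-edge one, and each maximum removes two.\<close>

lemma end_count:
 "p \<le> length D ==> 2 * cnt_edge D (cups D p) e + cnt_edge D (hes D p) e
   = cnt_edge D (row D p) e + 2 * cnt_edge D (caps D p) e"
proof (induction p)
 case (Suc p)
 then have p: "p < length D" by simp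
 have IH: "2 * cnt_edge D (cups D p) e + cnt_edge D (hes D p) e
   = cnt_edge D (row D p) e + 2 * cnt_edge D (caps D p) e" using Suc by simp
 from D p show ?case
 proof (cases rule: piece_cases)
  case (Cap us s t vs)
  then have "edge D s = edge D t" using edge_join by metis
  then show ?thesis using Cap IH by (simp add: lists_Suc half_edges_def)
 qed (use IH in \<open>simp_all add: lists_Suc half_edges_def\<close>)
qed (simp add: hes_def cups_def caps_def)

lemma lab_fresh: "p \<le> length D ==> (s < nseg D p \<longrightarrow> lab D p s < nseg D p) \<and> (nseg D p \<le> s \<longrightarrow> lab D p s = s)"
proof (induction p arbitrary: s)
 case (Suc p)
 then have p: "p < length D" by simp
 have IH: "s < nseg D p ==> lab D p s < nseg D p" "nseg D p \<le> s ==> lab D p s = s" for s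
  using Suc.IH[of s] p by auto
 from D p show ?case
 proof (cases rule: piece_cases)
  case (Cup us vs)
  then show ?thesis using IH[of s] by (cases "s < nseg D p") auto
 next
  case (Cap us s' t vs)
  then have "s' < nseg D p" "t < nseg D p" using row_bound[OF D, of p] p by auto
  then show ?thesis using Cap IH(1)[of s'] IH(1)[of t] IH[of s] by (cases "s < nseg D p") (auto simp: nth_append)
 next
  case (Vertex us d vs)
  then show ?thesis using IH[of s] by (cases "s < nseg D p") auto
 qed (use IH in auto)
qed simp

lemma count_relabel:
 "x \<noteq> y ==> count_list (map (\<lambda>s. if f s = y then x else f s) zs) w =
   (if w = y then 0 else if w = x then count_list (map f zs) x + count_list (map f zs) y else count_list (map f zs) w)"
 by (induction zs) auto

lemma count_map_id: "(\<And>s. s \<in> set zs ==> f s = s) ==> count_list (map f zs) w = count_list zs w"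
 by (induction zs) auto

lemma count_zero_bound: "(\<And>s. s \<in> set zs ==> f s < (k::nat)) ==> k \<le> w ==> count_list (map f zs) w = 0"
 by (fastforce simp: count_list_0_iff)

lemma count_distinct: "distinct zs ==> count_list zs w = (if w \<in> set zs then 1 else 0)"
 by (induction zs) auto

abbreviation ends :: "nat => nat => nat" where
 "ends p x \<equiv> count_list (map (lab D p) (hes D p)) x + count_list (map (lab D p) (row D p)) x"

text \<open>A class is a path or a circle: counting half-edges and strands in the current row together, it
has two ends or none. A maximum that joins two different classes uses up one end of each.\<close>

lemma ends_02: "p \<le> length D ==> ends p x \<in> {0, 2}"
proof (induction p arbitrary: x)
 case (Suc p)
 then have p: "p < length D" by simp
 have IH: "ends p x \<in> {0, 2}" for x using Suc.IH p by simp
 \<comment> \<open>a name that is not yet in use\<close>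
 have fresh: "ends p x = 0" if "nseg D p \<le> x" for x
  using count_zero_bound[of "hes D p" "lab D p" "nseg D p" x] count_zero_bound[of "row D p" "lab D p" "nseg D p" x]
   lab_fresh[of p] lists_bound[of p] row_bound[OF D, of p] p that by (simp add: subset_iff)
 from D p show ?case
 proof (cases rule: piece_cases)
  case (Cup us vs)
  have "lab D p (nseg D p) = nseg D p" using lab_fresh[of p "nseg D p"] p by simp
  then show ?thesis using Cup IH[of x] fresh[of x] by (auto simp: lists_Suc half_edges_def)
 next
  case (Cap us s t vs)
  let ?x = "lab D p s" and ?y = "lab D p t"
  have hes: "hes D (Suc p) = hes D p" using Cap by (simp add: lists_Suc half_edges_def)
  have r: "row D p ! length us = s" "row D p ! (length us + 1) = t"
   using Cap(2) by (simp_all add: nth_append)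
  have lab: "lab D (Suc p) = (\<lambda>z. if lab D p z = ?y then ?x else lab D p z)"
   by (simp only: lab.simps(2) Cap(1) piece.case r)
  have row: "count_list (map (lab D p) (row D p)) w = count_list (map (lab D p) (us @ vs)) w
   + (if ?x = w then 1 else 0) + (if ?y = w then 1 else 0)" for w
   using Cap(2) by simp
  show ?thesis
  proof (cases "?x = ?y")
   case True
   then have "lab D (Suc p) = lab D p" unfolding lab by auto
   then have "ends (Suc p) x = count_list (map (lab D p) (hes D p)) x + count_list (map (lab D p) (us @ vs)) x"
    unfolding hes Cap(3) by (simp only:)
   then show ?thesis using IH[of x] row[of x] True by (cases "?y = x") simp_all
  next
   case False
   show ?thesis
    unfolding hes Cap(3) lab count_relabel[OF False]
    using IH[of x] IH[of ?x] IH[of ?y] row[of x] row[of ?x] row[of ?y] False by auto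
  qed
 next
  case (Vertex us d vs)
  have id: "count_list (map (lab D p) [nseg D p..<nseg D p + d]) x = count_list [nseg D p..<nseg D p + d] x"
   using lab_fresh[of p] p by (intro count_map_id) auto
  have "count_list [nseg D p..<nseg D p + d] x = (if nseg D p \<le> x \<and> x < nseg D p + d then 1 else 0)"
   by (simp add: count_distinct)
  then show ?thesis using Vertex IH[of x] fresh[of x] id by (auto simp: lists_Suc half_edges_def)
 qed (use IH[of x] in \<open>auto simp: lists_Suc half_edges_def\<close>)
qed (simp add: hes_def)

lemma edge_lab: "p \<le> length D ==> edge D (lab D p s) = edge D s"
proof (induction p arbitrary: s)
 case (Suc p)
 then have p: "p < length D" and IH: "\<And>s. edge D (lab D p s) = edge D s" by auto
 from D p show ?case
 proof (cases rule: piece_cases)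
  case (Cap us s' t vs)
  have "edge D s' = edge D t" using edge_join[OF Cap(5)] .
  then have "edge D (lab D p s') = edge D s" if "lab D p s = lab D p t"
   using IH[of s] IH[of s'] IH[of t] that by simp
  then show ?thesis using Cap IH[of s] by (auto simp: nth_append)
 qed (use IH in auto)
qed simp

lemma lab_mono: "p \<le> p' ==> lab D p s = lab D p t ==> lab D p' s = lab D p' t"
 by (induction p' rule: dec_induct) (auto split: piece.splits)

lemma lab_edge:
 assumes "edge D s = edge D t"
 shows "lab D (length D) s = lab D (length D) t"
proof -
 have join: "lab D (length D) s = lab D (length D) t" if st: "(s, t) \<in> joins D" for s t
 proof -
  obtain p i where p: "p < length D" "D ! p = Cap i" "s = row D p ! i" "t = row D p ! (i + 1)"
   using st unfolding joins_def by blast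
  have "lab D (Suc p) s = lab D (Suc p) t" unfolding p(3,4) by (simp add: p(2))
  then show ?thesis by (rule lab_mono[OF Suc_leI[OF p(1)]])
 qed
 have "t \<in> edge D s" unfolding assms by simp
 then have "(s, t) \<in> (joins D \<union> (joins D)\<inverse>)\<^sup>*" by (simp add: edge_def)
 then show ?thesis
 proof (rule rtrancl_induct[where P = "\<lambda>t. lab D (length D) s = lab D (length D) t"])
  fix y z assume "(y, z) \<in> joins D \<union> (joins D)\<inverse>" and IH: "lab D (length D) s = lab D (length D) y"
  then consider "(y, z) \<in> joins D" | "(z, y) \<in> joins D" by blast
  then have "lab D (length D) y = lab D (length D) z"
   by cases (rule join, assumption, rule join[symmetric], assumption)
  then show "lab D (length D) s = lab D (length D) z" using IH by (simp only:)
 qed (rule refl)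
qed

lemma count_map_cong: "(\<And>h. f h = a \<longleftrightarrow> g h = b) ==> count_list (map f xs) a = count_list (map g xs) b"
 by (induction xs) auto

lemma edge_half_edges:
 assumes "e \<in> edges D"
 shows "cnt_edge D (hes D (length D)) e = (if e \<in> knot_components D then 0 else 2)"
proof -
 let ?L = "length D"
 obtain s where s: "e = edge D s" using assms by (auto simp: edges_def)
 have "cnt_edge D (hes D ?L) e = count_list (map (lab D ?L) (hes D ?L)) (lab D ?L s)"
 proof (rule count_map_cong)
  fix h
  show "edge D h = e \<longleftrightarrow> lab D ?L h = lab D ?L s"
   using lab_edge[of h s] edge_lab[OF order_refl, of h] edge_lab[OF order_refl, of s] s by auto
 qed
 then have 02: "cnt_edge D (hes D ?L) e \<in> {0, 2}"
  using ends_02[of ?L "lab D ?L s"] D by (simp add: knotted_ribbon_graph_def)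
 have in_e: "h \<in> e \<longleftrightarrow> e = edge D h" for h
 proof
  assume "h \<in> e"
  then show "e = edge D h" unfolding s by (rule edge_eq[symmetric])
 next
  assume "e = edge D h"
  then show "h \<in> e" by (metis edge_refl)
 qed
 have nil: "half_edges D v = []" if "v < ?L" "v \<notin> vertices D" for v
  using that by (auto simp: vertices_def half_edges_def split: piece.splits)
 have less: "v < ?L" if "v \<in> vertices D" for v using that by (simp add: vertices_def)
 have hes: "set (hes D ?L) = (\<Union>v<?L. set (half_edges D v))" by (auto simp: hes_def)
 have "e \<in> knot_components D \<longleftrightarrow> (\<forall>v\<in>vertices D. \<forall>h\<in>set (half_edges D v). e \<noteq> edge D h)"
  using assms in_e unfolding knot_components_def by blast
 also have "\<dots> \<longleftrightarrow> (\<forall>v<?L. \<forall>h\<in>set (half_edges D v). e \<noteq> edge D h)"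
  using nil less by (metis empty_iff empty_set)
 finally have "e \<in> knot_components D \<longleftrightarrow> e \<notin> edge D ` set (hes D ?L)"
  unfolding hes by blast
 then have "e \<in> knot_components D \<longleftrightarrow> cnt_edge D (hes D ?L) e = 0"
  by (simp add: count_list_0_iff)
 then show ?thesis using 02 by auto
qed

end

lemma prod_list_by_count:
 fixes F :: "'a => 'b :: comm_monoid_mult"
 assumes "finite S" "set xs \<subseteq> S"
 shows "prod_list (map F xs) = (\<Prod>x\<in>S. F x ^ count_list xs x)"
 using assms(2)
proof (induction xs)
 case (Cons y xs)
 have "(\<Prod>x\<in>S. F x ^ count_list (y # xs) x) = (\<Prod>x\<in>S. (if x = y then F x else 1) * F x ^ count_list xs x)"
  by (rule prod.cong) auto
 also have "\<dots> = F y * (\<Prod>x\<in>S. F x ^ count_list xs x)"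
  using Cons.prems assms(1) by (simp add: prod.distrib)
 finally show ?case using Cons by simp
qed simp

section \<open>Integrality of the standard evaluation\<close>

lemma projector_fact_nonzero: "projector_fact \<pi> \<noteq> 0"
proof -
 have "finite {(i, k). i < k \<and> k < length (legs \<pi>)}"
  by (rule finite_subset[of _ "{..<length (legs \<pi>)} \<times> {..<length (legs \<pi>)}"]) auto
 then show ?thesis by (auto simp: projector_fact_def qfact_nonzero)
qed

lemma POPS_scale: "POPS i cs (\<lambda>es. a * v es) = (\<lambda>es. a * POPS i cs v es)"
 by (induction cs arbitrary: i v) (auto simp: Pop_scale)

lemma act_scale: "act s (\<lambda>es. a * v es) = (\<lambda>es. a * act s v es)"
 using runs_scale[of "[s]" a v] by simp

context network
begin

text \<open>The factors that make the pieces preserve integrality.\<close>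

definition factor :: "nat => ratfun" where
 "factor p = (case D ! p of
   Cup i => qfact (col (n p))
  | Cap i => 1 / qfact (col (R p ! i))
  | Pos i => 1
  | Neg i => 1
  | Vertex i d => (\<Prod>h\<leftarrow>[n p..<n p + d]. qfact (col h)) / projector_fact (vproj \<gamma> p))"

lemma integral_vec_V: "p \<le> L ==> integral_vec (map col (R p)) (\<lambda>es. (\<Prod>j<p. factor j) * V UNIV p es)"
proof (induction p)
 case 0
 then show ?case by (simp add: integral_vec_Nil)
next
 case (Suc p)
 then have p: "p < L" by simp
 let ?c = "\<Prod>j<p. factor j"
 have IH: "integral_vec (map col (R p)) (\<lambda>es. ?c * V UNIV p es)" using Suc by simp
 have *: "(\<lambda>es. (\<Prod>j<Suc p. factor j) * V UNIV (Suc p) es) = (\<lambda>es. factor p * (?c * pstep UNIV p (V UNIV p) es))"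
  by (simp add: mult_ac)
 from graph p have "integral_vec (map col (R (Suc p))) (\<lambda>es. factor p * (?c * pstep UNIV p (V UNIV p) es))"
 proof (cases rule: piece_cases)
  case (Cup us vs)
  have "integral_vec (map col us @ [col (n p), col (n p)] @ map col vs)
   (\<lambda>es. qfact (col (n p)) * Pop (wid col us) (col (n p)) (CUP (wid col us) (col (n p)) (\<lambda>es. ?c * V UNIV p es)) es)"
   by (rule integral_vec_cup) (use IH Cup in simp_all)
  then show ?thesis
   using Cup by (simp add: factor_def pstep_def mark_def CUP_def act_scale Pop_scale del: act.simps)
 next
  case (Cap us s t vs)
  have c: "col t = col s" using edge_join[OF Cap(5)] by simp
  have "integral_vec (map col us @ map col vs) (\<lambda>es. CAP (wid col us) (col s) (\<lambda>es. ?c * V UNIV p es) es / qfact (col s))"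
   by (rule integral_vec_cap) (use IH Cap c in simp_all)
  then show ?thesis
   using Cap by (simp add: factor_def pstep_def CAP_def runs_scale nth_append)
 next
  case (Pos us s t vs)
  have "integral_vec (map col us @ [col t, col s] @ map col vs) (run A True (gridw (wid col us) (col s) (col t)) (\<lambda>es. ?c * V UNIV p es))"
   by (rule integral_vec_cross) (use IH Pos in \<open>simp_all add: signed_def\<close>)
  then show ?thesis
   using Pos by (simp add: factor_def pstep_def run_scale nth_append)
 next
  case (Neg us s t vs)
  have "integral_vec (map col us @ [col t, col s] @ map col vs) (run (inverse A) False (gridw (wid col us) (col s) (col t)) (\<lambda>es. ?c * V UNIV p es))"
   by (rule integral_vec_cross) (use IH Neg in \<open>simp_all add: signed_def\<close>)
  then show ?thesis
   using Neg by (simp add: factor_def pstep_def run_scale nth_append)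
 next
  case (Vertex us d vs)
  note pl = partner_length[OF p Vertex(1)]
  have "integral_vec (map col us @ legs (vproj \<gamma> p) @ map col vs)
   (\<lambda>es. (\<Prod>c\<leftarrow>legs (vproj \<gamma> p). qfact c) / projector_fact (vproj \<gamma> p) *
     POPS (wid col us) (legs (vproj \<gamma> p)) (act (Arcs (wid col us) (mlab (partner (vproj \<gamma> p)))) (\<lambda>es. ?c * V UNIV p es)) es)"
   by (rule integral_vec_vertex[OF pl(1)]) (use IH Vertex in simp_all)
  then show ?thesis
   using Vertex unfolding pl(2) by (simp add: factor_def pstep_def MK_UNIV act_scale POPS_scale comp_def del: act.simps)
 qed
 then show ?case unfolding * .
qed

abbreviation "Fq s \<equiv> qfact (col s)"

lemma prod_factor:
 "p \<le> L ==> (\<Prod>j<p. factor j) * (\<Prod>s\<leftarrow>caps D p. Fq s) * (\<Prod>v\<in>vertices D \<inter> {..<p}. projector_fact (vproj \<gamma> v))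
   = (\<Prod>s\<leftarrow>cups D p. Fq s) * (\<Prod>s\<leftarrow>hes D p. Fq s)"
proof (induction p)
 case (Suc p)
 then have p: "p < L" by simp
 let ?pf = "\<lambda>p. \<Prod>v\<in>vertices D \<inter> {..<p}. projector_fact (vproj \<gamma> v)"
 have IH: "(\<Prod>j<p. factor j) * (\<Prod>s\<leftarrow>caps D p. Fq s) * ?pf p = (\<Prod>s\<leftarrow>cups D p. Fq s) * (\<Prod>s\<leftarrow>hes D p. Fq s)"
  using Suc by simp
 have pf: "?pf (Suc p) = (if p \<in> vertices D then projector_fact (vproj \<gamma> p) * ?pf p else ?pf p)"
  by (simp add: lessThan_Suc Int_insert_right)
 note simps = lists_Suc[OF graph] half_edges_def factor_def qfact_nonzero projector_fact_nonzero
 from graph p show ?case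
 proof (cases rule: piece_cases)
  case (Cup us vs)
  have "?pf (Suc p) = ?pf p" unfolding pf using Cup by (simp add: vertices_def)
  then show ?thesis using Cup IH by (simp add: simps mult_ac)
 next
  case (Cap us s t vs)
  have "?pf (Suc p) = ?pf p" unfolding pf using Cap by (simp add: vertices_def)
  then show ?thesis using Cap IH by (simp add: simps mult_ac)
 next
  case (Pos us s t vs)
  have "?pf (Suc p) = ?pf p" unfolding pf using Pos by (simp add: vertices_def)
  then show ?thesis using Pos IH by (simp add: simps mult_ac)
 next
  case (Neg us s t vs)
  have "?pf (Suc p) = ?pf p" unfolding pf using Neg by (simp add: vertices_def)
  then show ?thesis using Neg IH by (simp add: simps mult_ac)
 next
  case (Vertex us d vs)
  have "?pf (Suc p) = projector_fact (vproj \<gamma> p) * ?pf p" unfolding pf using Vertex p by (auto simp: vertices_def)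
  then show ?thesis using Vertex IH by (simp add: simps mult_ac)
 qed
qed (simp add: hes_def cups_def caps_def)

lemma finite_edges: "finite (edges D)"
 by (simp add: edges_def segments_def)

lemma by_edges:
 assumes "set xs \<subseteq> segments D"
 shows "(\<Prod>s\<leftarrow>xs. Fq s) = (\<Prod>e\<in>edges D. qfact (ecol \<gamma> e) ^ cnt_edge D xs e)"
 using prod_list_by_count[OF finite_edges, of "map (edge D) xs" "\<lambda>e. qfact (ecol \<gamma> e)"] assms
 by (auto simp: edges_def comp_def)

text \<open>For an edge, let \<open>u\<close>, \<open>h\<close>, \<open>c\<close> be its numbers of minima, half-edges and maxima. Its
color enters with the exponent \<open>u + h - c = h/2\<close>, because \<open>2 u + h = 2 c\<close> by \<open>end_count\<close>.\<close>

lemma factor_total: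
 "(\<Prod>j<L. factor j) * total_fact D \<gamma> = (\<Prod>e\<in>edges D. qfact (ecol \<gamma> e))"
proof -
 let ?F = "\<lambda>e. qfact (ecol \<gamma> e)" and ?K = "knot_components D"
 have b: "set (hes D L) \<subseteq> segments D" "set (cups D L) \<subseteq> segments D" "set (caps D L) \<subseteq> segments D"
  using lists_bound[OF graph order_refl] by (auto simp: segments_def)
 have row: "R L = []" using graph by (simp add: knotted_ribbon_graph_def)
 have K: "?K \<subseteq> edges D" by (auto simp: knot_components_def)
 have v: "vertices D \<inter> {..<L} = vertices D" by (auto simp: vertices_def)
 have e: "?F e ^ cnt_edge D (cups D L) e * ?F e ^ cnt_edge D (hes D L) e * (if e \<in> ?K then ?F e else 1)
   = ?F e * ?F e ^ cnt_edge D (caps D L) e" if "e \<in> edges D" for e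
 proof (cases "e \<in> ?K")
  case True
  then have "cnt_edge D (hes D L) e = 0" "cnt_edge D (caps D L) e = cnt_edge D (cups D L) e"
   using end_count[OF graph order_refl, of e] edge_half_edges[OF graph that] unfolding row by simp_all
  then show ?thesis using True by (simp only: power_0 if_True mult_1_right mult.commute)
 next
  case False
  then have "cnt_edge D (hes D L) e = 2" "cnt_edge D (caps D L) e = Suc (cnt_edge D (cups D L) e)"
   using end_count[OF graph order_refl, of e] edge_half_edges[OF graph that] unfolding row by simp_all
  then show ?thesis using False by (simp only: power2_eq_square power_Suc if_False mult_1_right mult_ac)
 qed
 have "(\<Prod>s\<leftarrow>cups D L. Fq s) * (\<Prod>s\<leftarrow>hes D L. Fq s) * (\<Prod>e\<in>?K. ?F e)
   = (\<Prod>e\<in>edges D. ?F e) * (\<Prod>s\<leftarrow>caps D L. Fq s)"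
  unfolding by_edges[OF b(1)] by_edges[OF b(2)] by_edges[OF b(3)]
  using prod.inter_restrict[OF finite_edges, of ?F ?K] K e
  by (simp add: Int_absorb1 prod.distrib[symmetric])
 moreover have "(\<Prod>s\<leftarrow>caps D L. Fq s) \<noteq> 0" by (simp add: by_edges[OF b(3)] finite_edges qfact_nonzero)
 moreover note prod_factor[OF order_refl, unfolded v]
 moreover have "x * (k * l) = e" if "u * h * l = e * c" "c \<noteq> 0" "x * c * k = u * h" for x k l e u h c :: ratfun
 proof -
  have "(x * (k * l)) * c = (x * c * k) * l" by (simp only: mult_ac)
  also have "\<dots> = e * c" using that by simp
  finally show ?thesis using that(2) by simp
 qed
 ultimately show ?thesis unfolding total_fact_def by blast
qed

lemma total_fact_nonzero: "total_fact D \<gamma> \<noteq> 0"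
proof -
 have "finite (vertices D)" by (simp add: vertices_def)
 moreover have "finite (knot_components D)" using finite_edges by (simp add: knot_components_def)
 ultimately show ?thesis by (simp add: total_fact_def qfact_nonzero projector_fact_nonzero)
qed

theorem standard_eval_integral: "standard_eval D \<gamma> \<in> LA"
proof -
 have "standard_eval D \<gamma> = (\<Prod>j<L. factor j) * V UNIV L []"
  using total_fact_nonzero by (simp add: standard_eval_def penrose_V factor_total[symmetric])
 moreover have "integral_vec [] (\<lambda>es. (\<Prod>j<L. factor j) * V UNIV L es)"
  using integral_vec_V[OF order_refl] graph by (simp add: knotted_ribbon_graph_def)
 ultimately show ?thesis using integral_vec_Nil_D by fastforce
qed

end

section \<open>Homogeneity of the slices\<close>

lemma mod4I: "x = y + 4 * k ==> x mod 4 = y mod 4" for x y k :: int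
 by simp

lemma mod4E:
 fixes x y :: int
 assumes "x mod 4 = y mod 4"
 obtains k where "x = y + 4 * k"
proof -
 have "4 dvd x - y" using assms by (simp add: mod_eq_dvd_iff)
 then obtain k where "x - y = 4 * k" by (elim dvdE)
 then show thesis using that[of k] by simp
qed

text \<open>The degree of the word whose first sign is at position \<open>i\<close>.\<close>

fun dsum :: "nat => bool list => int" where
 "dsum i [] = 0"
| "dsum i (a # es) = (if a then 2 * int i else 0) + dsum (Suc i) es"

lemma dsum_append: "dsum i (pre @ suf) = dsum i pre + dsum (i + length pre) suf"
 by (induction pre arbitrary: i) auto

lemma dsum_shift: "dsum (i + 2) es mod 4 = dsum i es mod 4"
proof (induction es arbitrary: i)
 case (Cons a es)
 obtain k where "dsum (Suc i + 2) es = dsum (Suc i) es + 4 * k" using mod4E[OF Cons.IH] .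
 then show ?case by (intro mod4I[of _ _ "k + (if a then 1 else 0)"]) simp
qed simp

lemma dsum_shift_even: "even k ==> dsum (i + k) es mod 4 = dsum i es mod 4"
proof (elim evenE)
 fix m assume k: "k = 2 * m"
 have "dsum (i + 2 * m) es mod 4 = dsum i es mod 4"
 proof (induction m)
  case (Suc m)
  then show ?case using dsum_shift[of "i + 2 * m" es] by simp
 qed simp
 then show ?thesis by (simp add: k)
qed

text \<open>The degree of a system of arcs: an arc with left end \<open>j\<close> counts \<open>1 + 2 j\<close>, labels in
\<open>S\<close> having been met before.\<close>

fun lpos :: "nat => nat set => nat list => int" where
 "lpos i S [] = 0"
| "lpos i S (x # ls) = (if x \<in> S then 0 else 1 + 2 * int i) + lpos (Suc i) (insert x S) ls"

lemma lpos_append: "lpos i S (xs @ ys) = lpos i S xs + lpos (i + length xs) (S \<union> set xs) ys"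
 by (induction xs arbitrary: i S) auto

lemma lpos_cong: "S \<inter> set ls = T \<inter> set ls ==> lpos i S ls = lpos i T ls"
proof (induction ls arbitrary: i S T)
 case (Cons x ls)
 have "insert x S \<inter> set ls = insert x T \<inter> set ls" using Cons.prems by auto
 then have "lpos (Suc i) (insert x S) ls = lpos (Suc i) (insert x T) ls" by (rule Cons.IH)
 moreover have "x \<in> S \<longleftrightarrow> x \<in> T" using Cons.prems by auto
 ultimately show ?case by simp
qed simp

lemma lpos_shift: "lpos (i + 2) S ls mod 4 = lpos i S ls mod 4"
proof (induction ls arbitrary: i S)
 case (Cons x ls)
 obtain k where "lpos (Suc i + 2) (insert x S) ls = lpos (Suc i) (insert x S) ls + 4 * k" using mod4E[OF Cons.IH] .
 then show ?case by (intro mod4I[of _ _ "k + (if x \<in> S then 0 else 1)"]) simp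
qed simp

lemma A_in_hom: "A \<in> hom 1"
 using hom_powi[of 1] by simp

lemma inverse_A_in_hom: "inverse A \<in> hom (- 1)"
 using hom_powi[of "- 1"] by (simp add: power_int_minus)

lemma cupM_hom: "cupM a b \<in> hom (if a then 1 else - 1)"
 by (auto simp: cupM_def A_in_hom inverse_A_in_hom intro: hom_minus)

text \<open>Inserting an innermost arc shifts the arcs to its right by two positions, which changes the degree
by a multiple of 4. The arc itself has weight \<open>A\<close> or \<open>-1/A\<close>, and its ends are at positions of different
parity, so both choices have the same degree.\<close>

lemma arcw_hom:
 "planar ls ==> length ds = length ls ==> arcw ls ds \<in> hom (lpos i {} ls - dsum i ds) \<and> even (length ls)"
proof (induction arbitrary: ds rule: planar.induct)
 case planar_Nil
 then show ?case by (simp add: hom_1)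
next
 case (planar_insert as bs x)
 define pre a b suf where d: "pre = take (length as) ds" "a = ds ! length as" "b = ds ! (length as + 1)" "suf = drop (length as + 2) ds"
 have ds: "ds = pre @ a # b # suf" "length pre = length as" "length suf = length bs"
  using planar_insert.prems by (simp_all add: d Cons_nth_drop_Suc)
 have IH: "arcw (as @ bs) (pre @ suf) \<in> hom (lpos i {} (as @ bs) - dsum i (pre @ suf))" "even (length (as @ bs))"
  using planar_insert.IH[of "pre @ suf"] ds by auto
 have arcw: "arcw (as @ [x, x] @ bs) ds = cupM a b * arcw (as @ bs) (pre @ suf)"
  using arcw_insert[OF planar_insert.hyps(2) ds(2,3)] ds(1) by simp
 let ?k = "i + length as"
 have x: "x \<notin> set as" "x \<notin> set bs" using planar_insert.hyps(2) by auto
 have "lpos (?k + 2) (insert x (set as)) bs = lpos (?k + 2) (set as) bs" by (rule lpos_cong) (use x in auto)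
 then have "lpos (?k + 2) (insert x (set as)) bs mod 4 = lpos ?k (set as) bs mod 4"
  using lpos_shift[of ?k "set as" bs] by (simp only:)
 then obtain k1 where k1: "lpos (?k + 2) (insert x (set as)) bs = lpos ?k (set as) bs + 4 * k1" by (rule mod4E)
 obtain k2 where k2: "dsum (?k + 2) suf = dsum ?k suf + 4 * k2" using dsum_shift by (rule mod4E)
 have "arcw (as @ [x, x] @ bs) ds \<in> hom (lpos i {} (as @ [x, x] @ bs) - dsum i ds)"
 proof (cases "a = b")
  case True
  then show ?thesis unfolding arcw by (simp add: cupM_def)
 next
  case False
  have "arcw (as @ [x, x] @ bs) ds \<in> hom ((if a then 1 else - 1) + (lpos i {} (as @ bs) - dsum i (pre @ suf)))"
   unfolding arcw by (rule hom_mult[OF cupM_hom IH(1)])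
  moreover have "((if a then 1 else - 1) + (lpos i {} (as @ bs) - dsum i (pre @ suf))) mod 4
    = (lpos i {} (as @ [x, x] @ bs) - dsum i ds) mod 4"
  proof -
   have 1: "lpos i {} (as @ [x, x] @ bs) = lpos i {} as + (1 + 2 * int ?k) + lpos (?k + 2) (insert x (set as)) bs"
    using x by (simp add: lpos_append)
   have 2: "dsum i ds = dsum i pre + (if a then 2 * int ?k else 2 * int ?k + 2) + dsum (?k + 2) suf"
    using False by (simp add: ds dsum_append)
   have 3: "lpos i {} (as @ bs) = lpos i {} as + lpos ?k (set as) bs" "dsum i (pre @ suf) = dsum i pre + dsum ?k suf"
    by (simp_all add: lpos_append dsum_append ds)
   show ?thesis unfolding 1 2 3 k1 k2 by (intro mod4I[of _ _ "k2 - k1"]) (cases a; simp)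
  qed
  ultimately show ?thesis by (rule hom_cong)
 qed
 then show ?case using IH(2) by simp
qed

definition homog :: "nat => int => vec => bool" where
 "homog N g v \<longleftrightarrow> (\<forall>es. length es = N \<longrightarrow> v es \<in> hom (g - dsum 0 es))"

lemma homog_cong: "homog N g v ==> g mod 4 = h mod 4 ==> homog N h v"
 unfolding homog_def using hom_cong mod_diff_cong by blast

lemma homog_arcs:
 assumes "homog N g v" "i \<le> N" "planar ls"
 shows "homog (N + length ls) (g + lpos i {} ls) (act (Arcs i ls) v)"
 unfolding homog_def
proof (intro allI impI)
 fix es :: "bool list" assume l: "length es = N + length ls"
 define pre ds suf where d: "pre = take i es" "ds = take (length ls) (drop i es)" "suf = drop (i + length ls) es"
 have e: "es = pre @ ds @ suf" "length pre = i" "length ds = length ls" "length (pre @ suf) = N"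
  using l assms(2) by (simp_all add: d) (metis add.commute append_take_drop_id drop_drop)
 have w: "arcw ls ds \<in> hom (lpos i {} ls - dsum i ds)" "even (length ls)"
  using arcw_hom[OF assms(3) e(3)] by auto
 have "v (pre @ suf) \<in> hom (g - dsum 0 (pre @ suf))" using assms(1) e(4) by (simp add: homog_def)
 then have "act (Arcs i ls) v es \<in> hom ((lpos i {} ls - dsum i ds) + (g - dsum 0 (pre @ suf)))"
  unfolding e(1) act_Arcs_split[OF e(2,3)] by (rule hom_mult[OF w(1)])
 moreover have "((lpos i {} ls - dsum i ds) + (g - dsum 0 (pre @ suf))) mod 4 = (g + lpos i {} ls - dsum 0 es) mod 4"
 proof -
  obtain k where "dsum (i + length ls) suf = dsum i suf + 4 * k" using dsum_shift_even[OF w(2)] by (rule mod4E)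
  then show ?thesis by (intro mod4I[of _ _ k]) (simp add: e dsum_append)
 qed
 ultimately show "act (Arcs i ls) v es \<in> hom (g + lpos i {} ls - dsum 0 es)" by (rule hom_cong)
qed

lemma homog_join:
 assumes "homog (N + 2) g v" "i \<le> N"
 shows "homog N (g + (1 + 2 * int i)) (act (Join i) v)"
 unfolding homog_def
proof (intro allI impI)
 fix es :: "bool list" assume l: "length es = N"
 define pre suf where d: "pre = take i es" "suf = drop i es"
 have e: "es = pre @ suf" "length pre = i" using l assms(2) by (simp_all add: d)
 have v: "v (pre @ [a, b] @ suf) \<in> hom (g - dsum 0 (pre @ [a, b] @ suf))" for a b
  using assms(1) l by (simp add: homog_def e)
 obtain k where k: "dsum (i + 2) suf = dsum i suf + 4 * k" using dsum_shift by (rule mod4E)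
 have "- A * v (pre @ [True, False] @ suf) \<in> hom (1 + (g - dsum 0 (pre @ [True, False] @ suf)))"
  using hom_mult[OF hom_minus[OF A_in_hom] v] by simp
 then have "- A * v (pre @ [True, False] @ suf) \<in> hom (g + (1 + 2 * int i) - dsum 0 es)"
  by (rule hom_cong, intro mod4I[of _ _ "- int i - k"]) (use k in \<open>simp add: e dsum_append\<close>)
 moreover have "inverse A * v (pre @ [False, True] @ suf) \<in> hom (- 1 + (g - dsum 0 (pre @ [False, True] @ suf)))"
  by (rule hom_mult[OF inverse_A_in_hom v])
 then have "inverse A * v (pre @ [False, True] @ suf) \<in> hom (g + (1 + 2 * int i) - dsum 0 es)"
  by (rule hom_cong, intro mod4I[of _ _ "- int i - k - 1"]) (use k in \<open>simp add: e dsum_append\<close>)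
 ultimately have "- A * v (pre @ [True, False] @ suf) + inverse A * v (pre @ [False, True] @ suf) \<in> hom (g + (1 + 2 * int i) - dsum 0 es)"
  by (rule hom_add)
 then show "act (Join i) v es \<in> hom (g + (1 + 2 * int i) - dsum 0 es)"
  by (simp add: cap_at_def capsum_def d)
qed

fun sdeg :: "slice => int" where
 "sdeg (Arcs i ls) = lpos i {} ls"
| "sdeg (Join i) = 1 + 2 * int i"
| "sdeg (CrossPos i) = 1"
| "sdeg (CrossNeg i) = - 1"

text \<open>The smoothing with a maximum and a minimum has degree \<open>2 (1 + 2 i)\<close>, that is 2 modulo 4.\<close>

lemma homog_turn:
 assumes "homog N g v" "i + 2 \<le> N"
 shows "homog N (g + 2) (cup_at i (cap_at i v))"
proof -
 have "N - 2 + 2 = N" using assms(2) by simp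
 then have 1: "homog (N - 2) (g + (1 + 2 * int i)) (cap_at i v)"
  using homog_join[of "N - 2" g v i] assms by simp
 have "planar [0, 0]" using planar_insert[of "[]" "[]" 0] planar_Nil by simp
 from homog_arcs[OF 1 _ this, of i] have 2: "homog N (g + (1 + 2 * int i) + (1 + 2 * int i)) (act (Arcs i [0, 0]) (cap_at i v))"
  using assms(2) \<open>N - 2 + 2 = N\<close> by (simp del: act.simps)
 have "homog N (g + 2) (act (Arcs i [0, 0]) (cap_at i v))" by (rule homog_cong[OF 2]) presburger
 moreover have "act (Arcs i [0, 0]) (cap_at i v) es = cup_at i (cap_at i v) es" if "length es = N" for es
 proof -
  have "take 2 (drop i es) = [es ! i, es ! (i + 1)]"
   using that assms(2) by (simp add: numeral_2_eq_2 take_Suc_conv_app_nth)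
  then show ?thesis by (simp add: cup_at_def numeral_2_eq_2)
 qed
 ultimately show ?thesis by (simp add: homog_def del: act.simps)
qed

lemma homog_act:
 assumes "homog N g v" "sfit s N"
 shows "homog (swd s N) (g + sdeg s) (act s v)"
proof (cases s)
 case (Arcs i ls)
 then show ?thesis using homog_arcs[OF assms(1)] assms(2) by (simp del: act.simps)
next
 case (Join i)
 have "N - 2 + 2 = N" "i \<le> N - 2" using assms(2) Join by auto
 then show ?thesis using homog_join[of "N - 2" g v i] assms Join by (simp del: act.simps)
next
 case (CrossPos i)
 then have i: "i + 2 \<le> N" using assms by simp
 show ?thesis
  unfolding homog_def
 proof (intro allI impI)
  fix es :: "bool list" assume l: "length es = swd s N"
  have "A * v es \<in> hom (1 + (g - dsum 0 es))"
   using assms l CrossPos by (intro hom_mult[OF A_in_hom]) (simp add: homog_def)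
  then have 1: "A * v es \<in> hom (g + 1 - dsum 0 es)" by (rule hom_cong) (simp add: algebra_simps)
  have "inverse A * cup_at i (cap_at i v) es \<in> hom (- 1 + (g + 2 - dsum 0 es))"
   using homog_turn[OF assms(1) i] l CrossPos by (intro hom_mult[OF inverse_A_in_hom]) (simp add: homog_def)
  then have 2: "inverse A * cup_at i (cap_at i v) es \<in> hom (g + 1 - dsum 0 es)" by (rule hom_cong) (simp add: algebra_simps)
  show "act s v es \<in> hom (g + sdeg s - dsum 0 es)"
   using hom_add[OF 1 2] CrossPos by simp
 qed
next
 case (CrossNeg i)
 then have i: "i + 2 \<le> N" using assms by simp
 show ?thesis
  unfolding homog_def
 proof (intro allI impI)
  fix es :: "bool list" assume l: "length es = swd s N"
  have "inverse A * v es \<in> hom (- 1 + (g - dsum 0 es))"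
   using assms l CrossNeg by (intro hom_mult[OF inverse_A_in_hom]) (simp add: homog_def)
  then have 1: "inverse A * v es \<in> hom (g - 1 - dsum 0 es)" by (rule hom_cong) (simp add: algebra_simps)
  have "A * cup_at i (cap_at i v) es \<in> hom (1 + (g + 2 - dsum 0 es))"
   using homog_turn[OF assms(1) i] l CrossNeg by (intro hom_mult[OF A_in_hom]) (simp add: homog_def)
  then have 2: "A * cup_at i (cap_at i v) es \<in> hom (g - 1 - dsum 0 es)" by (rule hom_cong, intro mod4I[of _ _ 1]) simp
  show "act s v es \<in> hom (g + sdeg s - dsum 0 es)"
   using hom_add[OF 2 1] CrossNeg by simp
 qed
qed

definition wdeg :: "slice list => int" where
 "wdeg w = sum_list (map sdeg w)"

lemma wdeg_simps [simp]: "wdeg [] = 0" "wdeg (s # w) = sdeg s + wdeg w" "wdeg (w @ w') = wdeg w + wdeg w'"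
 by (simp_all add: wdeg_def)

lemma homog_runs: "vword N w N' ==> homog N g v ==> homog N' (g + wdeg w) (runs w v)"
proof (induction w arbitrary: N g v)
 case (Cons s w)
 then show ?case using Cons.IH[OF _ homog_act[OF Cons.prems(2)], of s] by (simp add: add.assoc)
qed simp

lemma kauffman_bracket_hom: "vword 0 w 0 ==> kauffman_bracket w \<in> hom (wdeg w)"
 using homog_runs[of 0 w 0 0 "\<lambda>_. 1"] kauffman_bracket_state_sum[of w] by (simp add: homog_def hom_1)

lemma wdeg_braid: "wdeg (perm_braid i b \<sigma>) = - int (inversions b \<sigma>)"
proof -
 have 1: "wdeg (map (\<lambda>j. CrossNeg (i + j)) ks) = - int (length ks)" for ks
  by (induction ks) auto
 have 2: "card {j. j < k \<and> P j} \<le> k" for k :: nat and P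
  using card_mono[of "{..<k}" "{j. j < k \<and> P j}"] by auto
 have "length (reduced_word b \<sigma>) = (\<Sum>k<b. card {j. j < k \<and> \<sigma> j > \<sigma> k})"
  by (induction b) (simp_all add: reduced_word_def 2)
 moreover have "inversions b \<sigma> = (\<Sum>k<b. card {j. j < k \<and> \<sigma> j > \<sigma> k})"
  unfolding inversions_itab by (rule sum.cong) (auto simp: itab_def)
 ultimately show ?thesis by (simp add: perm_braid_def 1)
qed

section \<open>The degree of a vertex\<close>

lemma lpos_nth: "lpos i {} ls = (\<Sum>j<length ls. if ls ! j \<in> set (take j ls) then 0 else 1 + 2 * int (i + j))"
proof (induction ls rule: rev_induct)
 case (snoc x ls)
 have "(\<Sum>j<length ls. if (ls @ [x]) ! j \<in> set (take j (ls @ [x])) then 0 else 1 + 2 * int (i + j))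
   = (\<Sum>j<length ls. if ls ! j \<in> set (take j ls) then 0 else 1 + 2 * int (i + j))"
  by (rule sum.cong) (auto simp: nth_append)
 then show ?case using snoc by (simp add: lpos_append)
qed simp

lemma lpos_cup_labels: "lpos i {} (cup_labels b) = int b * int b + 2 * int i * int b"
proof -
 have 1: "lpos i S [0..<b] = int b * int b + 2 * int i * int b" if "S = {}" for S
  unfolding that
 proof (induction b)
  case (Suc b)
  then show ?case by (simp add: lpos_append algebra_simps)
 qed simp
 have 2: "lpos k S ls = 0" if "set ls \<subseteq> S" for k S ls
  using that by (induction ls arbitrary: k S) (auto simp: insert_absorb)
 show ?thesis by (simp add: cup_labels_def lpos_append 1 2)
qed

lemma card_ordered_pairs:
 fixes S :: "nat set"
 assumes "finite S"
 shows "2 * int (card {(a, b) \<in> S \<times> S. a < b}) = int (card S) * (int (card S) - 1)"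
 using assms
proof (induction S rule: finite_linorder_max_induct)
 case (insert m S)
 have fin: "finite {(a, b) \<in> S \<times> S. a < b}"
  by (rule finite_subset[of _ "S \<times> S"]) (use insert.hyps(1) in auto)
 have "{(a, b) \<in> insert m S \<times> insert m S. a < b} = {(a, b) \<in> S \<times> S. a < b} \<union> S \<times> {m}"
  using insert.hyps(2) by auto
 moreover have "{(a, b) \<in> S \<times> S. a < b} \<inter> S \<times> {m} = {}" using insert.hyps(2) by auto
 ultimately have "card {(a, b) \<in> insert m S \<times> insert m S. a < b} = card {(a, b) \<in> S \<times> S. a < b} + card S"
  using card_Un_disjoint[OF fin, of "S \<times> {m}"] insert.hyps(1) by (simp add: card_cartesian_product)
 moreover have "m \<notin> S" using insert.hyps(2) by auto
 ultimately show ?case using insert.IH insert.hyps(1) by (simp add: algebra_simps)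
qed simp

text \<open>Pairs of different bundles, the arcs of the first enclosing those of the second; this
depends on the legs only.\<close>

definition nested :: "nat => ((nat \<times> nat) \<times> (nat \<times> nat)) set" where
 "nested d = {((i, k), (i', k')) | i k i' k'. i < k \<and> k < d \<and> i' < k' \<and> k' < d \<and> (i, k) \<noteq> (i', k') \<and> i \<le> i' \<and> k' \<le> k}"

context projector_setup
begin

lemma arcs_double:
 assumes X: "X \<subseteq> {..<n}" and inv: "\<And>x. x \<in> X ==> p ! x \<in> X"
 shows "card X = 2 * card (X \<inter> arcs)"
proof -
 have fin: "finite X" using X finite_subset by blast
 have X_eq: "X = (X \<inter> arcs) \<union> (!) p ` (X \<inter> arcs)"
 proof (intro set_eqI iffI)
  fix x assume x: "x \<in> X"
  then have xn: "x < n" using X by auto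
  show "x \<in> (X \<inter> arcs) \<union> (!) p ` (X \<inter> arcs)"
  proof (cases "x < p ! x")
   case True
   then show ?thesis using x xn by (simp add: arcs_def)
  next
   case False
   then have "p ! x < x" using p_neq[OF xn] by simp
   then have "p ! x \<in> X \<inter> arcs" using inv[OF x] p_less[OF xn] p_p[OF xn] by (simp add: arcs_def)
   moreover have "x = p ! (p ! x)" using p_p[OF xn] by simp
   ultimately show ?thesis by blast
  qed
 next
  fix x assume "x \<in> (X \<inter> arcs) \<union> (!) p ` (X \<inter> arcs)"
  then show "x \<in> X" using inv by auto
 qed
 have dis: "(X \<inter> arcs) \<inter> (!) p ` (X \<inter> arcs) = {}"
 proof -
  have "p ! x \<notin> arcs" if "x \<in> arcs" for x using that p_p[of x] by (auto simp: arcs_def)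
  then show ?thesis by auto
 qed
 have img: "card ((!) p ` (X \<inter> arcs)) = card (X \<inter> arcs)"
 proof (rule card_image, rule inj_onI)
  fix x y assume "x \<in> X \<inter> arcs" "y \<in> X \<inter> arcs" and e: "p ! x = p ! y"
  then have n: "x < n" "y < n" using X by auto
  have "p ! (p ! x) = p ! (p ! y)" using e by (rule arg_cong)
  then show "x = y" unfolding p_p[OF n(1)] p_p[OF n(2)] .
 qed
 have "finite (X \<inter> arcs)" using fin by simp
 note card_Un_disjoint[OF this finite_imageI[OF this] dis]
 then have "card X = card (X \<inter> arcs) + card (X \<inter> arcs)" unfolding img by (rule trans[OF arg_cong[OF X_eq]])
 then show ?thesis by (simp only: mult_2)
qed

lemma card_arcs: "2 * card arcs = n"
proof -
 have "arcs \<subseteq> {..<n}" by (auto simp: arcs_def)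
 then have "{..<n} \<inter> arcs = arcs" by blast
 then show ?thesis using arcs_double[of "{..<n}"] p_less by simp
qed

lemma card_arcs_bund: "card arcs = (\<Sum>B\<in>prs. card (bund B))"
 unfolding arcs_Union by (rule card_UN_disjoint) (simp, simp, intro ballI impI bund_disj)

text \<open>Before the left end \<open>j\<close> of an arc there are both ends of some arcs and one end of each arc that encloses
\<open>j\<close>. So \<open>j\<close> has the parity of its depth.\<close>

lemma arc_parity:
 assumes j: "j \<in> arcs"
 shows "even (j + card {x \<in> arcs. x < j \<and> j < p ! x})"
proof -
 have jn: "j < n" "j < p ! j" using j by (auto simp: arcs_def)
 let ?X = "{x. x < j \<and> p ! x < j}" and ?Y = "{x \<in> arcs. x < j \<and> j < p ! x}"
 have neq: "p ! x \<noteq> j" if "x < j" for x using that p_p[of x] jn by auto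
 have "{..<j} = ?X \<union> ?Y"
 proof (intro set_eqI)
  fix x
  show "x \<in> {..<j} \<longleftrightarrow> x \<in> ?X \<union> ?Y" using neq[of x] jn by (auto simp: arcs_def)
 qed
 moreover have "finite ?X" "finite ?Y" "?X \<inter> ?Y = {}" by auto
 ultimately have "card {..<j} = card ?X + card ?Y" using card_Un_disjoint[of ?X ?Y] by (simp only:)
 then have "j = card ?X + card ?Y" by simp
 moreover have "card ?X = 2 * card (?X \<inter> arcs)"
  by (rule arcs_double) (use jn p_p in auto)
 moreover have "even (j' + y)" if "j' = x + y" "x = 2 * z" for j' x y z :: nat using that by simp
 ultimately show ?thesis by blast
qed

text \<open>If \<open>i = i'\<close> or \<open>k = k'\<close>, the order of the ends within the common leg is forced, since arcs do
not cross.\<close>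

lemma nesting:
 assumes B: "(i, k) \<in> prs" "(i', k') \<in> prs" "(i, k) \<noteq> (i', k')" and x: "x \<in> bund (i, k)" and y: "y \<in> bund (i', k')"
 shows "x < y \<and> y < p ! x \<longleftrightarrow> i \<le> i' \<and> k' \<le> k"
proof -
 have xn: "x < n" "L x = i" "L (p ! x) = k" and yn: "y < n" "L y = i'" "L (p ! y) = k'"
  using x y by (auto simp: bund_def)
 have ik: "i < k" "i' < k'" using B by (auto simp: prs_def)
 note pn = p_less[OF xn(1)] p_less[OF yn(1)]
 show ?thesis
 proof
  assume *: "x < y \<and> y < p ! x"
  then have "\<not> p ! x < p ! y" using no_cross[OF xn(1) yn(1)] by blast
  then have "p ! y \<le> p ! x" by simp
  then show "i \<le> i' \<and> k' \<le> k" using L_mono[of x y] L_mono[of "p ! y" "p ! x"] * xn yn pn by simp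
 next
  assume *: "i \<le> i' \<and> k' \<le> k"
  have ypx: "y < p ! x" using L_less_imp[OF yn(1), of "p ! x"] yn xn ik * by simp
  have "x < y"
  proof (rule ccontr)
   assume "\<not> x < y"
   moreover have "x \<noteq> y" using B(3) xn yn by auto
   ultimately have yx: "y < x" by simp
   then have "i' \<le> i" using L_mono[of y x] xn yn by simp
   then have ii: "i = i'" using * by simp
   then have "k' < k" using * B(3) by (metis le_neq_implies_less)
   then have "p ! y < p ! x" using L_less_imp[OF pn(2), of "p ! x"] xn yn by simp
   moreover have "x < p ! y" using L_less_imp[OF xn(1), of "p ! y"] xn yn ik ii by simp
   ultimately show False using no_cross[OF yn(1) xn(1) yx] by blast
  qed
  then show "x < y \<and> y < p ! x" using ypx by blast
 qed
qed

lemma nesting_self: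
 assumes B: "B \<in> prs" and x: "x \<in> bund B" and y: "y \<in> bund B"
 shows "y < p ! x"
proof -
 have "L y < L (p ! x)" "y < n" using assms by (auto simp: bund_def prs_def)
 then show ?thesis using L_less_imp by blast
qed

text \<open>By \<open>arc_parity\<close> the sum of the left ends is modulo 2 the number of pairs of an arc and an arc enclosing
it. In a bundle of \<open>m\<close> arcs there are \<open>m (m - 1)/2\<close> such pairs, between two bundles all or none.\<close>

lemma sum_arcs:
 "2 * (\<Sum>j\<in>arcs. int j) mod 4 = ((\<Sum>B\<in>prs. int (card (bund B)) * (int (card (bund B)) - 1))
   + 2 * (\<Sum>(B, B')\<in>nested d. int (card (bund B)) * int (card (bund B')))) mod 4"
proof -
 let ?dep = "\<lambda>y. {x \<in> arcs. x < y \<and> y < p ! x}"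
 let ?N = "\<lambda>B B'. {(x, y) \<in> bund B \<times> bund B'. x < y \<and> y < p ! x}"
 have "\<forall>y\<in>arcs. \<exists>k. int y = int (card (?dep y)) + 2 * k"
 proof
  fix y assume "y \<in> arcs"
  then have "even (int y - int (card (?dep y)))" using arc_parity[of y] by simp
  then obtain k where "int y - int (card (?dep y)) = 2 * k" by (elim evenE)
  then have "int y = int (card (?dep y)) + 2 * k" by simp
  then show "\<exists>k. int y = int (card (?dep y)) + 2 * k" ..
 qed
 then obtain k where k: "\<And>y. y \<in> arcs ==> int y = int (card (?dep y)) + 2 * k y" by metis
 have "(\<Sum>j\<in>arcs. int j) = (\<Sum>y\<in>arcs. int (card (?dep y)) + 2 * k y)" by (rule sum.cong[OF refl k])
 also have "\<dots> = (\<Sum>y\<in>arcs. int (card (?dep y))) + 2 * (\<Sum>y\<in>arcs. k y)"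
  by (simp only: sum.distrib sum_distrib_left)
 finally have 1: "2 * (\<Sum>j\<in>arcs. int j) = 2 * (\<Sum>y\<in>arcs. int (card (?dep y))) + 4 * (\<Sum>y\<in>arcs. k y)"
  by simp
 have part: "(\<Sum>y\<in>arcs. f y) = (\<Sum>B\<in>prs. \<Sum>y\<in>bund B. f y)" for f :: "nat => int"
  unfolding arcs_Union by (rule sum.UNION_disjoint) (simp, simp, intro ballI impI bund_disj)
 \<comment> \<open>the depth of an arc, split according to the bundle of the enclosing arc\<close>
 have dep: "int (card (?dep y)) = (\<Sum>B\<in>prs. int (card {x \<in> bund B. x < y \<and> y < p ! x}))" for y
 proof -
  have "?dep y = (\<Union>B\<in>prs. {x \<in> bund B. x < y \<and> y < p ! x})" unfolding arcs_Union by auto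
  moreover have "card \<dots> = (\<Sum>B\<in>prs. card {x \<in> bund B. x < y \<and> y < p ! x})"
   by (rule card_UN_disjoint) (simp, simp, use bund_disj in blast)
  ultimately show ?thesis by simp
 qed
 have N: "int (card (?N B B')) = (\<Sum>y\<in>bund B'. int (card {x \<in> bund B. x < y \<and> y < p ! x}))" for B B'
 proof -
  have "?N B B' = (\<lambda>(y, x). (x, y)) ` (SIGMA y:bund B'. {x \<in> bund B. x < y \<and> y < p ! x})"
   by (auto simp: image_iff)
  moreover have "card \<dots> = card (SIGMA y:bund B'. {x \<in> bund B. x < y \<and> y < p ! x})"
   by (rule card_image) (auto simp: inj_on_def)
  ultimately have "card (?N B B') = card (SIGMA y:bund B'. {x \<in> bund B. x < y \<and> y < p ! x})" by (rule trans[OF arg_cong])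
  then show ?thesis by simp
 qed
 have "(\<Sum>y\<in>arcs. int (card (?dep y))) = (\<Sum>B'\<in>prs. \<Sum>B\<in>prs. int (card (?N B B')))"
  unfolding part dep N by (intro sum.cong refl sum.swap)
 also have "\<dots> = (\<Sum>B\<in>prs. \<Sum>B'\<in>prs. int (card (?N B B')))" by (rule sum.swap)
 also have "\<dots> = (\<Sum>B\<in>prs. int (card (?N B B)) + (\<Sum>B'\<in>prs. if (B, B') \<in> nested d then int (card (bund B)) * int (card (bund B')) else 0))"
 proof (rule sum.cong[OF refl])
  fix B assume B: "B \<in> prs"
  have "int (card (?N B B')) = (if (B, B') \<in> nested d then int (card (bund B)) * int (card (bund B')) else 0)"
   if B': "B' \<in> prs" "B' \<noteq> B" for B'
  proof -
   obtain i k i' k' where e: "B = (i, k)" "B' = (i', k')" by (cases B, cases B') auto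
   have nest: "(x < y \<and> y < p ! x) \<longleftrightarrow> (B, B') \<in> nested d" if "x \<in> bund B" "y \<in> bund B'" for x y
    using nesting[of i k i' k' x y] that B B' e by (auto simp: nested_def prs_def)
   show ?thesis
   proof (cases "(B, B') \<in> nested d")
    case True
    then have "?N B B' = bund B \<times> bund B'" using nest by auto
    then show ?thesis using True by (simp add: card_cartesian_product)
   next
    case False
    then have "?N B B' = {}" using nest by auto
    then show ?thesis using False by (simp only: card.empty if_False of_nat_0)
   qed
  qed
  moreover have "(B, B) \<notin> nested d" by (auto simp: nested_def)
  ultimately show "(\<Sum>B'\<in>prs. int (card (?N B B'))) =
    int (card (?N B B)) + (\<Sum>B'\<in>prs. if (B, B') \<in> nested d then int (card (bund B)) * int (card (bund B')) else 0)"
   using B by (simp add: sum.remove[of prs B])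
 qed
 also have "\<dots> = (\<Sum>B\<in>prs. int (card (?N B B))) + (\<Sum>(B, B')\<in>nested d. int (card (bund B)) * int (card (bund B')))"
 proof -
  have "nested d \<subseteq> prs \<times> prs" by (auto simp: nested_def prs_def)
  then have "(\<Sum>(B, B')\<in>nested d. int (card (bund B)) * int (card (bund B')))
    = (\<Sum>(B, B')\<in>prs \<times> prs. if (B, B') \<in> nested d then int (card (bund B)) * int (card (bund B')) else 0)"
   by (intro sum.mono_neutral_cong_left) auto
  then show ?thesis by (simp add: sum.distrib sum.cartesian_product)
 qed
 finally have 2: "2 * (\<Sum>y\<in>arcs. int (card (?dep y))) = (\<Sum>B\<in>prs. 2 * int (card (?N B B))) + 2 * (\<Sum>(B, B')\<in>nested d. int (card (bund B)) * int (card (bund B')))"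
  by (simp add: sum_distrib_left)
 have "2 * int (card (?N B B)) = int (card (bund B)) * (int (card (bund B)) - 1)" if "B \<in> prs" for B
 proof -
  have "?N B B = {(x, y) \<in> bund B \<times> bund B. x < y}" using nesting_self[OF that] by auto
  then show ?thesis using card_ordered_pairs[of "bund B"] by simp
 qed
 then show ?thesis unfolding 1 2 by simp
qed

lemma lpos_mlab: "lpos i {} (mlab p) = (\<Sum>j\<in>arcs. 1 + 2 * int (i + j))"
proof -
 have new: "mlab p ! j \<in> set (take j (mlab p)) \<longleftrightarrow> j \<notin> arcs" if j: "j < n" for j
 proof -
  have nth: "mlab p ! x = min x (p ! x)" if "x < n" for x using that by (simp add: mlab_def len_p)
  have "mlab p ! j \<in> set (take j (mlab p)) \<longleftrightarrow> (\<exists>x<j. min x (p ! x) = min j (p ! j))"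
   using j nth by (auto simp: in_set_conv_nth mlab_def len_p)
  also have "\<dots> \<longleftrightarrow> (\<exists>x<j. x = p ! j)"
  proof -
   have "min x (p ! x) = min j (p ! j) \<longleftrightarrow> x = p ! j" if x: "x < j" for x
   proof -
    have "min j (p ! j) = min x (p ! x) \<longleftrightarrow> x = j \<or> x = p ! j"
     by (rule mlab_eq_iff[OF matching_p]) (use j x in \<open>simp_all add: len_p\<close>)
    then show ?thesis using x by auto
   qed
   then show ?thesis by auto
  qed
  also have "\<dots> \<longleftrightarrow> j \<notin> arcs" using j p_neq[OF j] by (auto simp: arcs_def)
  finally show ?thesis .
 qed
 have "lpos i {} (mlab p) = (\<Sum>j<n. if j \<notin> arcs then 0 else 1 + 2 * int (i + j))"
  unfolding lpos_nth using new by (intro sum.cong) (auto simp: mlab_def len_p)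
 also have "\<dots> = (\<Sum>j\<in>arcs. 1 + 2 * int (i + j))"
  by (rule sum.mono_neutral_cong_right) (auto simp: arcs_def)
 finally show ?thesis .
qed

lemma lpos_vertex:
 "lpos i {} (mlab p) mod 4 = ((\<Sum>B\<in>prs. int (card (bund B))) + 2 * int i * (\<Sum>B\<in>prs. int (card (bund B)))
   + (\<Sum>B\<in>prs. int (card (bund B)) * (int (card (bund B)) - 1))
   + 2 * (\<Sum>(B, B')\<in>nested d. int (card (bund B)) * int (card (bund B')))) mod 4"
proof -
 have "lpos i {} (mlab p) = int (card arcs) + 2 * int i * int (card arcs) + 2 * (\<Sum>j\<in>arcs. int j)"
  unfolding lpos_mlab by (simp add: sum.distrib sum_distrib_left algebra_simps)
 then show ?thesis unfolding card_arcs_bund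
  using mod_add_cong[OF refl sum_arcs, of "int (card arcs) + 2 * int i * int (card arcs)"]
  by (simp add: card_arcs_bund algebra_simps)
qed

end

section \<open>Quadratic forms\<close>

definition linear_form :: "'i set => (('i => int) => int) => bool" where
 "linear_form I f \<longleftrightarrow> (\<exists>a. \<forall>x. f x = (\<Sum>i\<in>I. a i * x i))"

lemma linear_form_0: "linear_form I (\<lambda>x. 0)"
 unfolding linear_form_def by (intro exI[of _ "\<lambda>_. 0"]) simp

lemma linear_form_add: "linear_form I f ==> linear_form I g ==> linear_form I (\<lambda>x. f x + g x)"
 unfolding linear_form_def
proof clarify
 fix a b assume "\<forall>x. f x = (\<Sum>i\<in>I. a i * x i)" "\<forall>x. g x = (\<Sum>i\<in>I. b i * x i)"
 then show "\<exists>c. \<forall>x. f x + g x = (\<Sum>i\<in>I. c i * x i)"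
  by (intro exI[of _ "\<lambda>i. a i + b i"]) (simp add: sum.distrib distrib_right)
qed

lemma linear_form_coord: "finite I ==> i \<in> I ==> linear_form I (\<lambda>x. x i)"
 unfolding linear_form_def
 by (intro exI[of _ "\<lambda>j. if j = i then 1 else 0"]) (simp add: if_distrib[of "\<lambda>a. a * _"] cong: if_cong)

lemma linear_form_sum: "(\<And>j. j \<in> J ==> linear_form I (f j)) ==> linear_form I (\<lambda>x. \<Sum>j\<in>J. f j x)"
 by (induction J rule: infinite_finite_induct) (simp_all add: linear_form_0 linear_form_add)

lemma linear_form_sum_list: "(\<And>j. j \<in> set js ==> linear_form I (f j)) ==> linear_form I (\<lambda>x. \<Sum>j\<leftarrow>js. f j x)"
 by (induction js) (simp_all add: linear_form_0 linear_form_add)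

lemma quadratic_form_0: "quadratic_form I (\<lambda>x. 0 :: int)"
 unfolding quadratic_form_def by (intro exI[of _ "\<lambda>_ _. 0"]) simp

lemma quadratic_form_add:
 "quadratic_form I F ==> quadratic_form I G ==> quadratic_form I (\<lambda>x. F x + G x :: int)"
 unfolding quadratic_form_def
proof clarify
 fix a b :: "'a => 'a => int"
 assume "\<forall>x. F x = (\<Sum>i\<in>I. \<Sum>j\<in>I. a i j * of_int (x i) * of_int (x j))"
  "\<forall>x. G x = (\<Sum>i\<in>I. \<Sum>j\<in>I. b i j * of_int (x i) * of_int (x j))"
 then show "\<exists>c. \<forall>x. F x + G x = (\<Sum>i\<in>I. \<Sum>j\<in>I. c i j * of_int (x i) * of_int (x j))"
  by (intro exI[of _ "\<lambda>i j. a i j + b i j"]) (simp add: sum.distrib distrib_right)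
qed

lemma quadratic_form_mult:
 "linear_form I f ==> linear_form I g ==> quadratic_form I (\<lambda>x. k * (f x * g x) :: int)"
 unfolding quadratic_form_def linear_form_def
proof clarify
 fix a b assume "\<forall>x. f x = (\<Sum>i\<in>I. a i * x i)" "\<forall>x. g x = (\<Sum>i\<in>I. b i * x i)"
 then show "\<exists>c. \<forall>x. k * (f x * g x) = (\<Sum>i\<in>I. \<Sum>j\<in>I. c i j * of_int (x i) * of_int (x j))"
  by (intro exI[of _ "\<lambda>i j. k * (b i * a j)"]) (simp add: sum_product sum_distrib_left mult_ac)
qed

lemma quadratic_form_sum:
 "(\<And>j. j \<in> J ==> quadratic_form I (F j)) ==> quadratic_form I (\<lambda>x. (\<Sum>j\<in>J. F j x) :: int)"
 by (induction J rule: infinite_finite_induct) (simp_all add: quadratic_form_0 quadratic_form_add)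

lemma quadratic_form_of_int:
 "quadratic_form I F ==> quadratic_form I (\<lambda>x. of_int (F x :: int) :: 'r :: comm_ring_1)"
 unfolding quadratic_form_def
proof clarify
 fix c :: "'a => 'a => int" assume "\<forall>x. F x = (\<Sum>i\<in>I. \<Sum>j\<in>I. c i j * of_int (x i) * of_int (x j))"
 then show "\<exists>c. \<forall>x. (of_int (F x) :: 'r) = (\<Sum>i\<in>I. \<Sum>j\<in>I. c i j * of_int (x i) * of_int (x j))"
  by (intro exI[of _ "\<lambda>i j. of_int (c i j)"]) simp
qed

lemma residue_of_int: "residue (of_int k) = k mod 4"
proof -
 have "Rep_bit0 (Abs_bit0 (k mod int CARD(4)) :: 4) = k mod int CARD(4)" by (rule bit0.Rep_Abs_mod)
 then show ?thesis by (simp add: residue_def bit0.of_int_eq)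
qed

section \<open>The quadratic form of a diagram\<close>

abbreviation ec :: "diagram => (label => int) => nat => int" where
 "ec D x s \<equiv> x (Edge_color (edge D s))"

abbreviation eoff :: "diagram => (label => int) => nat => nat => int" where
 "eoff D x p i \<equiv> (\<Sum>s\<leftarrow>take i (row D p). ec D x s)"

definition leg_pairs :: "nat => (nat \<times> nat) set" where
 "leg_pairs d = {(i, k). i < k \<and> k < d}"

abbreviation arcn :: "(label => int) => nat => nat \<times> nat => int" where
 "arcn x p B \<equiv> x (Arc_number p (fst B) (snd B))"

text \<open>The degree modulo 4 of the piece \<open>p\<close>, up to the linear term and the degree of the projector
of a vertex, as a function of the labels. Factors \<open>1\<close> only unify the shape of the terms.\<close>

definition pform :: "diagram => nat => (label => int) => int" where
 "pform D p = (case D ! p of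
   Cup i => (\<lambda>x. 1 * (ec D x (nseg D p) * ec D x (nseg D p)) + 2 * (eoff D x p i * ec D x (nseg D p)))
  | Cap i => (\<lambda>x. 1 * (ec D x (row D p ! i) * ec D x (row D p ! i)) + 2 * (eoff D x p i * ec D x (row D p ! i)))
  | Pos i => (\<lambda>x. 1 * (ec D x (row D p ! i) * ec D x (row D p ! (i + 1))))
  | Neg i => (\<lambda>x. (- 1) * (ec D x (row D p ! i) * ec D x (row D p ! (i + 1))))
  | Vertex i d => (\<lambda>x. 2 * (eoff D x p i * (\<Sum>B\<in>leg_pairs d. arcn x p B))
    + (\<Sum>P\<in>nested d. 2 * (arcn x p (fst P) * arcn x p (snd P)))))"

definition qform :: "diagram => (label => int) => int" where
 "qform D = (\<lambda>x. (\<Sum>p<length D. pform D p x)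
   + (\<Sum>e\<in>edges D - knot_components D. 1 * (x (Edge_color e) * x (Edge_color e))))"

lemma finite_label_set: "finite (label_set D)"
proof -
 have "finite (edges D)" by (simp add: edges_def segments_def)
 moreover have "{Arc_number v i k | v i k. v \<in> vertices D \<and> i < k \<and> k < valency D v} \<subseteq>
   (\<lambda>(v, i, k). Arc_number v i k) ` (SIGMA v:vertices D. {..<valency D v} \<times> {..<valency D v})"
  by force
 moreover have "finite (SIGMA v:vertices D. {..<valency D v} \<times> {..<valency D v})"
  by (intro finite_SigmaI) (auto simp: vertices_def)
 ultimately show ?thesis unfolding label_set_def
  by (intro finite_UnI[OF finite_imageI finite_subset[OF _ finite_imageI]])
qed

lemma quadratic_form_qform:
 assumes D: "knotted_ribbon_graph D"
 shows "quadratic_form (label_set D) (qform D)"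
proof -
 let ?I = "label_set D"
 have edge: "linear_form ?I (\<lambda>x. x (Edge_color e))" if "e \<in> edges D" for e
  using that by (intro linear_form_coord[OF finite_label_set]) (simp add: label_set_def)
 have seg: "linear_form ?I (\<lambda>x. ec D x s)" if "s < nseg D (length D)" for s
  using that by (intro edge) (simp add: edges_def segments_def)
 have "quadratic_form ?I (pform D p)" if p: "p < length D" for p
 proof -
  have le: "nseg D (Suc p) \<le> nseg D (length D)" "nseg D p \<le> nseg D (length D)"
   using nseg_mono[of "Suc p" "length D" D] nseg_mono[of p "length D" D] p by simp_all
  have row: "linear_form ?I (\<lambda>x. ec D x s)" if "s \<in> set (row D p)" for s
   using row_bound[OF D less_imp_le[OF p] that] le by (intro seg) simp
  have off: "linear_form ?I (\<lambda>x. eoff D x p i)" for i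
   by (intro linear_form_sum_list row) (auto dest: in_set_takeD)
  from D p show ?thesis
  proof (cases rule: piece_cases)
   case (Cup us vs)
   have c: "linear_form ?I (\<lambda>x. ec D x (nseg D p))" using le Cup(4) by (intro seg) simp
   show ?thesis unfolding pform_def Cup(1) piece.case
    by (rule quadratic_form_add[OF quadratic_form_mult[OF c c] quadratic_form_mult[OF off[of "length us"] c]])
  next
   case (Cap us s t vs)
   have c: "linear_form ?I (\<lambda>x. ec D x (row D p ! length us))" by (rule row) (simp add: Cap(2))
   show ?thesis unfolding pform_def Cap(1) piece.case
    by (rule quadratic_form_add[OF quadratic_form_mult[OF c c] quadratic_form_mult[OF off[of "length us"] c]])
  next
   case (Pos us s t vs)
   have c: "linear_form ?I (\<lambda>x. ec D x (row D p ! length us))" by (rule row) (simp add: Pos(2))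
   have c': "linear_form ?I (\<lambda>x. ec D x (row D p ! (length us + 1)))" by (rule row) (simp add: Pos(2) nth_append)
   show ?thesis unfolding pform_def Pos(1) piece.case by (rule quadratic_form_mult[OF c c'])
  next
   case (Neg us s t vs)
   have c: "linear_form ?I (\<lambda>x. ec D x (row D p ! length us))" by (rule row) (simp add: Neg(2))
   have c': "linear_form ?I (\<lambda>x. ec D x (row D p ! (length us + 1)))" by (rule row) (simp add: Neg(2) nth_append)
   show ?thesis unfolding pform_def Neg(1) piece.case by (rule quadratic_form_mult[OF c c'])
  next
   case (Vertex us d vs)
   have "p \<in> vertices D" "valency D p = d" using p Vertex(1) by (auto simp: vertices_def valency_def half_edges_def)
   then have arc: "linear_form ?I (\<lambda>x. arcn x p B)" if "B \<in> leg_pairs d" for B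
    using that by (intro linear_form_coord[OF finite_label_set]) (auto simp: label_set_def leg_pairs_def)
   have m: "linear_form ?I (\<lambda>x. \<Sum>B\<in>leg_pairs d. arcn x p B)" by (rule linear_form_sum[OF arc])
   have "quadratic_form ?I (\<lambda>x. 2 * (arcn x p (fst P) * arcn x p (snd P)))" if "P \<in> nested d" for P
    by (rule quadratic_form_mult[OF arc arc]) (use that in \<open>auto simp: nested_def leg_pairs_def\<close>)
   from quadratic_form_sum[OF this] show ?thesis unfolding pform_def Vertex(1) piece.case
    by (intro quadratic_form_add[OF quadratic_form_mult[OF off[of "length us"] m]])
  qed
 qed
 then have 1: "quadratic_form ?I (\<lambda>x. \<Sum>p<length D. pform D p x)" by (rule quadratic_form_sum) simp
 have "quadratic_form ?I (\<lambda>x. 1 * (x (Edge_color e) * x (Edge_color e)))" if "e \<in> edges D - knot_components D" for e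
  by (rule quadratic_form_mult[OF edge edge]) (use that in auto)
 from quadratic_form_add[OF 1 quadratic_form_sum[OF this]] show ?thesis unfolding qform_def .
qed

section \<open>The degree of the standard evaluation\<close>

fun fdeg :: "citem list => int" where
 "fdeg [] = 0"
| "fdeg (Fix w # its) = wdeg w + fdeg its"
| "fdeg (Slot e i # its) = fdeg its"

lemma fdeg_append [simp]: "fdeg (its @ its') = fdeg its + fdeg its'"
 by (induction its rule: fdeg.induct) auto

lemma wdeg_expand:
 "wdeg (concat (map (expand b \<sigma>) its)) = fdeg its - (\<Sum>e\<leftarrow>slots its. int (inversions (b e) (\<sigma> e)))"
 by (induction its rule: fdeg.induct) (auto simp: wdeg_braid)

text \<open>Together with the degree \<open>-1\<close> of each crossing of the braid, the exponent \<open>-3\<close> per inversion makes the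
degree independent of the permutation.\<close>

lemma wt_hom: "wt b \<tau> \<in> hom (int b * (int b - 1) - 3 * int (inversions b \<tau>))"
proof -
 have "A ^ (b * (b - 1)) = A powi (int b * (int b - 1))"
  by (cases b) (simp_all add: power_int_of_nat[symmetric] algebra_simps del: power_int_of_nat)
 then have "wt b \<tau> \<in> hom (int b * (int b - 1) + (- 3 * int (inversions b \<tau>)))"
  unfolding wt_def by (intro hom_mult) (simp_all only: hom_powi)
 then show ?thesis by simp
qed

context network
begin

lemma penrose_hom:
 "penrose_eval D \<gamma> \<in> hom ((\<Sum>p<L. fdeg (citems p)) + (\<Sum>e\<in>edges D. int (ecol \<gamma> e) * (int (ecol \<gamma> e) - 1)))"
 (is "_ \<in> hom (?F + ?E)")
proof -
 have F: "fdeg (items p) = (\<Sum>q<p. fdeg (citems q))" for p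
  by (induction p) (simp_all add: items_Suc, simp add: items_def)
 have summand: "(\<Prod>e\<in>edges D. wt (ecol \<gamma> e) (\<sigma> e)) * kauffman_bracket (cable D \<gamma> \<sigma>) \<in> hom (?F + ?E)" for \<sigma>
 proof -
  let ?inv = "\<Sum>e\<in>edges D. int (inversions (ecol \<gamma> e) (\<sigma> e))"
  have "kauffman_bracket (cable D \<gamma> \<sigma>) \<in> hom (wdeg (cable D \<gamma> \<sigma>))"
   unfolding cable_items by (rule kauffman_bracket_hom, rule vword_expand[OF items_fit])
  moreover have "wdeg (cable D \<gamma> \<sigma>) = ?F - ?inv"
   unfolding cable_items wdeg_expand F set_slots[symmetric] by (simp add: sum_list_distinct_conv_sum_set distinct_slots)
  moreover have "(\<Prod>e\<in>edges D. wt (ecol \<gamma> e) (\<sigma> e)) \<in> hom (\<Sum>e\<in>edges D. int (ecol \<gamma> e) * (int (ecol \<gamma> e) - 1) - 3 * int (inversions (ecol \<gamma> e) (\<sigma> e)))"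
   by (intro hom_prod wt_hom)
  then have "(\<Prod>e\<in>edges D. wt (ecol \<gamma> e) (\<sigma> e)) \<in> hom (?E - 3 * ?inv)"
   by (simp only: sum_subtractf sum_distrib_left)
  \<comment> \<open>the inversions enter with the total coefficient \<open>-4\<close>\<close>
  ultimately have "(\<Prod>e\<in>edges D. wt (ecol \<gamma> e) (\<sigma> e)) * kauffman_bracket (cable D \<gamma> \<sigma>) \<in> hom ((?E - 3 * ?inv) + (?F - ?inv))"
   by (intro hom_mult) (simp_all only:)
  then show ?thesis by (rule hom_cong) (rule mod4I[of _ _ "- ?inv"], simp)
 qed
 show ?thesis using adm hom_sum[OF summand] by (simp add: penrose_eval_def wt_def)
qed

abbreviation "x \<equiv> label_value \<gamma>"

text \<open>The linear term at a vertex: its number of arcs.\<close>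

definition vlin :: "nat => int" where
 "vlin p = (case D ! p of Vertex i d => \<Sum>B\<in>leg_pairs d. arcn x p B | _ => 0)"

text \<open>The degree of the factorial of the projector at a vertex.\<close>

definition vden :: "nat => int" where
 "vden p = (case D ! p of Vertex i d => \<Sum>B\<in>leg_pairs d. arcn x p B * (arcn x p B - 1) | _ => 0)"

lemma fdeg_slot_of: "fdeg (slot_of s i) = 0"
 by (simp add: slot_of_def)

lemma projector_at:
 assumes "p < L" "D ! p = Vertex i d"
 shows "projector_setup (vproj \<gamma> p)" "length (legs (vproj \<gamma> p)) = d"
  "projector_setup.prs (vproj \<gamma> p) = leg_pairs d"
  "int (card (projector_setup.bund (vproj \<gamma> p) B)) = arcn x p B"
proof -
 show P: "projector_setup (vproj \<gamma> p)"
  using partner_length(1)[OF assms] by (rule projector_setup.intro)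
 show d: "length (legs (vproj \<gamma> p)) = d" using partner_length(2)[OF assms] by simp
 show "projector_setup.prs (vproj \<gamma> p) = leg_pairs d"
  unfolding projector_setup.prs_def[OF P] leg_pairs_def d ..
 show "int (card (projector_setup.bund (vproj \<gamma> p) B)) = arcn x p B"
  using projector_setup.card_bund[OF P, of "fst B" "snd B"] by simp
qed

lemma int_wid: "int (wid col ss) = (\<Sum>s\<leftarrow>ss. ec D x s)"
 by (induction ss) auto

lemma fdeg_citems:
 assumes p: "p < L"
 shows "fdeg (citems p) mod 4 = (pform D p x + vlin p + vden p) mod 4"
 using graph p
proof (cases rule: piece_cases)
 case (Cup us vs)
 then show ?thesis
  by (simp add: citems_def fdeg_slot_of lpos_cup_labels pform_def vlin_def vden_def int_wid mult.assoc)
next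
 case (Cap us s t vs)
 have "wdeg (map (\<lambda>j. Join (i + j)) (rev [0..<b])) = int b * int b + 2 * int i * int b" for i b
  by (induction b) (simp_all add: algebra_simps)
 then show ?thesis using Cap
  by (simp add: citems_def pform_def vlin_def vden_def int_wid mult.assoc)
next
 case (Pos us s t vs)
 have "wdeg (map CrossPos (gridw i a b)) = int a * int b" for i a b
 proof -
  have "wdeg (map CrossPos w) = int (length w)" for w by (induction w) auto
  moreover have "length (gridw i a b) = a * b" by (induction i a b rule: gridw.induct) auto
  ultimately show ?thesis by simp
 qed
 then show ?thesis using Pos by (simp add: citems_def pform_def vlin_def vden_def nth_append)
next
 case (Neg us s t vs)
 have "wdeg (map CrossNeg (gridw i a b)) = - (int a * int b)" for i a b
 proof -
  have "wdeg (map CrossNeg w) = - int (length w)" for w by (induction w) auto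
  moreover have "length (gridw i a b) = a * b" by (induction i a b rule: gridw.induct) auto
  ultimately show ?thesis by simp
 qed
 then show ?thesis using Neg by (simp add: citems_def pform_def vlin_def vden_def nth_append)
next
 case (Vertex us d vs)
 note P = projector_at[OF p Vertex(1)]
 have slots: "fdeg (concat (map (\<lambda>h. slot_of h (f h)) hs)) = 0" for f hs
  by (induction hs) (simp_all add: fdeg_slot_of)
 have 1: "fdeg (citems p) = lpos (wid col us) {} (mlab (partner (vproj \<gamma> p)))"
  unfolding citems_def Vertex(1) piece.case by (simp add: slots Vertex(2))
 have 2: "lpos (wid col us) {} (mlab (partner (vproj \<gamma> p))) mod 4 = ((\<Sum>B\<in>leg_pairs d. arcn x p B) + 2 * int (wid col us) * (\<Sum>B\<in>leg_pairs d. arcn x p B)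
   + (\<Sum>B\<in>leg_pairs d. arcn x p B * (arcn x p B - 1))
   + 2 * (\<Sum>(B, B')\<in>nested d. arcn x p B * arcn x p B')) mod 4"
  using projector_setup.lpos_vertex[OF P(1), of "wid col us"] unfolding P(2-4) .
 have 3: "(\<Sum>B\<in>leg_pairs d. arcn x p B) + 2 * int (wid col us) * (\<Sum>B\<in>leg_pairs d. arcn x p B)
   + (\<Sum>B\<in>leg_pairs d. arcn x p B * (arcn x p B - 1))
   + 2 * (\<Sum>(B, B')\<in>nested d. arcn x p B * arcn x p B') = pform D p x + vlin p + vden p"
 proof -
  have "2 * (\<Sum>(B, B')\<in>nested d. arcn x p B * arcn x p B') = (\<Sum>P\<in>nested d. 2 * (arcn x p (fst P) * arcn x p (snd P)))"
   by (simp add: sum_distrib_left case_prod_beta)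
  moreover have "int (wid col us) = eoff D x p (length us)" by (simp add: int_wid Vertex(2))
  ultimately show ?thesis unfolding pform_def vlin_def vden_def Vertex(1) piece.case by (simp only: mult.assoc add_ac)
 qed
 show ?thesis unfolding 1 2 3 ..
qed

lemma total_fact_hom:
 "total_fact D \<gamma> \<in> hom ((\<Sum>p<L. vden p) + (\<Sum>e\<in>knot_components D. int (ecol \<gamma> e) * (int (ecol \<gamma> e) - 1)))"
proof -
 have pf: "projector_fact (vproj \<gamma> v) \<in> hom (vden v)" if v: "v \<in> vertices D" for v
 proof -
  obtain i d where p: "v < L" "D ! v = Vertex i d" using v by (auto simp: vertices_def)
  note P = projector_at[OF p]
  have "projector_fact (vproj \<gamma> v) \<in> hom (\<Sum>B\<in>leg_pairs d. int (card (projector_setup.bund (vproj \<gamma> v) B)) * (int (card (projector_setup.bund (vproj \<gamma> v) B)) - 1))"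
   unfolding projector_setup.projector_fact_prs[OF P(1)] P(3) by (intro hom_prod qfact_hom)
  then show ?thesis unfolding P(4) vden_def p(2) piece.case .
 qed
 have "(\<Sum>p<L. vden p) = (\<Sum>v\<in>vertices D. vden v)"
  by (rule sum.mono_neutral_right) (auto simp: vertices_def vden_def split: piece.splits)
 then show ?thesis unfolding total_fact_def by (auto intro!: hom_mult hom_prod pf qfact_hom)
qed

text \<open>Twice the number of arcs at a vertex is the sum of the colors of its half-edges, and every
edge has two half-edges or none.\<close>

lemma sum_vlin: "(\<Sum>p<L. vlin p) = (\<Sum>e\<in>edges D - knot_components D. int (ecol \<gamma> e))"
proof -
 have v: "2 * vlin p = int (wid col (half_edges D p))" if p: "p < L" for p
 proof (cases "D ! p")
  case (Vertex i d)
  note P = projector_at[OF p Vertex]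
  have "int (wid col (half_edges D p)) = int (sum_list (legs (vproj \<gamma> p)))"
   using partner_length(2)[OF p Vertex] Vertex by (simp add: half_edges_def)
  also have "\<dots> = 2 * int (card (projector_setup.arcs (vproj \<gamma> p)))"
   using projector_setup.card_arcs[OF P(1)] by linarith
  also have "int (card (projector_setup.arcs (vproj \<gamma> p))) = (\<Sum>B\<in>leg_pairs d. arcn x p B)"
   unfolding projector_setup.card_arcs_bund[OF P(1)] P(3) of_nat_sum P(4) ..
  finally show ?thesis by (simp add: vlin_def Vertex)
 qed (simp_all add: vlin_def half_edges_def)
 have "2 * (\<Sum>p<m. vlin p) = int (wid col (hes D m))" if "m \<le> L" for m
  using that
 proof (induction m)
  case (Suc m)
  then show ?case using v[of m] by (simp add: lists_Suc[OF graph] distrib_left)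
 qed (simp add: hes_def)
 then have "2 * (\<Sum>p<L. vlin p) = int (wid col (hes D L))" by simp
 also have "wid col (hes D L) = sum_list (map (ecol \<gamma>) (map (edge D) (hes D L)))" by (simp add: comp_def)
 also have "\<dots> = (\<Sum>e\<in>edges D. cnt_edge D (hes D L) e * ecol \<gamma> e)"
 proof (rule sum_list_map_eq_sum_count2[OF _ finite_edges])
  show "set (map (edge D) (hes D L)) \<subseteq> edges D"
   using lists_bound[OF graph order_refl] by (auto simp: edges_def segments_def)
 qed
 also have "\<dots> = (\<Sum>e\<in>edges D - knot_components D. 2 * ecol \<gamma> e)"
  by (rule sum.mono_neutral_cong_right) (auto simp: edge_half_edges[OF graph] finite_edges)
 finally show ?thesis by (simp add: sum_distrib_left[symmetric])
qed

theorem standard_eval_hom: "standard_eval D \<gamma> \<in> hom (qform D x)"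
proof -
 let ?b = "\<lambda>e. int (ecol \<gamma> e) * (int (ecol \<gamma> e) - 1)" and ?K = "knot_components D"
 have K: "?K \<subseteq> edges D" by (auto simp: knot_components_def)
 have "standard_eval D \<gamma> * total_fact D \<gamma> = penrose_eval D \<gamma>"
  using total_fact_nonzero by (simp add: standard_eval_def)
 then have st: "standard_eval D \<gamma> \<in> hom ((\<Sum>p<L. fdeg (citems p)) + sum ?b (edges D) - ((\<Sum>p<L. vden p) + sum ?b ?K))"
  using hom_divide[OF standard_eval_integral total_fact_hom total_fact_nonzero] penrose_hom by (simp only:)
 have "\<forall>p. \<exists>k. p < L \<longrightarrow> fdeg (citems p) = pform D p x + vlin p + vden p + 4 * k"
  using mod4E[OF fdeg_citems] by metis
 then obtain k where k: "\<And>p. p < L ==> fdeg (citems p) = pform D p x + vlin p + vden p + 4 * k p" by metis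
 have "(\<Sum>p<L. fdeg (citems p)) = (\<Sum>p<L. pform D p x + vlin p + vden p + 4 * k p)"
  by (rule sum.cong) (simp_all add: k)
 also have "\<dots> = (\<Sum>p<L. pform D p x) + (\<Sum>p<L. vlin p) + (\<Sum>p<L. vden p) + 4 * (\<Sum>p<L. k p)"
  by (simp add: sum.distrib sum_distrib_left)
 finally have 1: "(\<Sum>p<L. fdeg (citems p)) = (\<Sum>p<L. pform D p x) + (\<Sum>p<L. vlin p) + (\<Sum>p<L. vden p) + 4 * (\<Sum>p<L. k p)" .
 have 2: "sum ?b (edges D) = sum ?b (edges D - ?K) + sum ?b ?K"
  by (rule sum.subset_diff[OF K finite_edges])
 have 3: "sum ?b (edges D - ?K) = (\<Sum>e\<in>edges D - ?K. 1 * (x (Edge_color e) * x (Edge_color e))) - (\<Sum>e\<in>edges D - ?K. int (ecol \<gamma> e))"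
  by (simp add: sum_subtractf[symmetric] algebra_simps)
 show ?thesis
  by (rule hom_cong[OF st], rule mod4I[of _ _ "\<Sum>p<L. k p"]) (unfold 1 2 3 sum_vlin qform_def, simp)
qed

end

theorem proposition1p1:
  fixes \<Gamma> :: diagram
  assumes "knotted_ribbon_graph \<Gamma>"
  shows "\<exists>Q :: (label \<Rightarrow> int) \<Rightarrow> 4. quadratic_form (label_set \<Gamma>) Q \<and>
    (\<forall>\<gamma> :: labels. spin_network \<Gamma> \<gamma> \<longrightarrow>
       (\<exists>P \<in> laurent_polys q.
          standard_eval \<Gamma> \<gamma> = A powi residue (Q (label_value \<gamma>)) * P))"
proof (intro exI conjI allI impI)
 show "quadratic_form (label_set \<Gamma>) (\<lambda>x. of_int (qform \<Gamma> x) :: 4)"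
  by (intro quadratic_form_of_int quadratic_form_qform assms)
next
 fix \<gamma> :: labels assume net: "spin_network \<Gamma> \<gamma>"
 let ?k = "qform \<Gamma> (label_value \<gamma>)"
 have "standard_eval \<Gamma> \<gamma> \<in> hom ?k"
 proof (cases "admissible \<Gamma> \<gamma>")
  case True
  interpret network \<Gamma> \<gamma> by unfold_locales (fact assms, fact net, fact True)
  show ?thesis by (rule standard_eval_hom)
 next
  case False
  then show ?thesis by (simp add: standard_eval_def penrose_eval_def)
 qed
 then have "standard_eval \<Gamma> \<gamma> \<in> hom (residue (of_int ?k))"
  by (rule hom_cong) (simp add: residue_of_int)
 then show "\<exists>P\<in>laurent_polys q. standard_eval \<Gamma> \<gamma> = A powi residue (of_int ?k) * P"
  unfolding hom_def by blast
qed

end
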